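(* Let $d\ge 0$ be an integer and let $n,m,p,q$ be positive integers. Then: (a) $h_d(GL(n,\mathbb R))=h_d(Sp(m,\mathbb R))$ provided $d\le\min(n,m)$; (b) $h_d(GL(n,\mathbb H))=h_d(SO^*(2m))$ provided $d\le\min(n,m)$; (c) $h_d(O(n,\mathbb C))=h_d(Sp(p,q))$ provided $d\le\min(\tfrac n2,p,q)$; (d) $h_d(Sp(m,\mathbb C))=h_d(O(p,q))$ provided $d\le\min(m,\tfrac p2,\tfrac q2)$; (e) $h_d(GL(n,\mathbb C))=h_d(U(p,q))$ provided $d\le\min(n,p,q)$.
   Context: For each real form $G_0$ let $(G,K)$ be the following symmetric pair of complex linear algebraic groups, $\mathfrak g=\mathrm{Lie}(G)$. $K$ acts on $\mathfrak g$ by restriction of the adjoint representation of $G$, hence on the symmetric power $\mathcal S^d(\mathfrak g)$, and $h_d(G_0):=\dim[\mathcal S^d(\mathfrak g)]^K$ (dimension over $\mathbb C$ of the $K$-invariants). Let $J_m=\begin{pmatrix}0&I_m\\ -I_m&0\end{pmatrix}$, $D_m=\begin{pmatrix}0&I_m\\ I_m&0\end{pmatrix}$. The group $Sp_{2m}(\mathbb C)$ has defining representation of dimension $2m$. - $U(p,q)$: $G=GL_{p+q}(\mathbb C)$, $K=GL_p(\mathbb C)\times GL_q(\mathbb C)$ embedded block diagonally. - $GL(n,\mathbb R)$: $G=GL_n(\mathbb C)$, $K=O_n(\mathbb C)=\{g: g^{-1}=g^t\}$. - $GL(n,\mathbb H)$: $G=GL_{2n}(\mathbb C)$, $K=Sp_{2n}(\mathbb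 C)$, the fixed points of $g\mapsto -J_n(g^{-1})^tJ_n$. - $SO^*(2m)$: $G=SO_{2m}(\mathbb C)$ for the symmetric form $(x,y)=xD_my^t$, $K=\{\mathrm{diag}(g,(g^{-1})^t): g\in GL_m(\mathbb C)\}\cong GL_m(\mathbb C)$. - $Sp(m,\mathbb R)$: $G=Sp_{2m}(\mathbb C)$ for the form $(x,y)=xJ_my^t$, $K=\{\mathrm{diag}(g,(g^{-1})^t): g\in GL_m(\mathbb C)\}\cong GL_m(\mathbb C)$. - $O(p,q)$: $G=O_{p+q}(\mathbb C)$ for the form $(x,y)=xy^t$, $K=O_p(\mathbb C)\times O_q(\mathbb C)$ embedded block diagonally. - $Sp(p,q)$: $G=Sp_{2(p+q)}(\mathbb C)$ for the form $(x,y)=xC_{p+q}y^t$, where $C_{p+q}$ is block diagonal with $p+q$ copies of $J_1=\begin{pmatrix}0&1\\-1&0\end{pmatrix}$, and $K=Sp_{2p}(\mathbb C)\times Sp_{2q}(\mathbb C)$ embedded block diagonally (the factors preserving the forms $C_p$ and $C_q$). - $GL(n,\mathbb C)$, $O(n,\mathbb C)$, $Sp(m,\mathbb C)$: $G=K\times K$ with $K=GL_n(\mathbb C)$, $O_n(\mathbb C)$, $Sp_{2m}(\mathbb C)$ respectively, $K$ embedded diagonally in $G$. *)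

theory Defs
  imports
    "HOL-Analysis.Complex_Analysis_Basics"
    "HOL-Library.Poly_Mapping"
    "HOL-Library.Multiset"
    "Jordan_Normal_Form.Determinant"
    "Jordan_Normal_Form.Gauss_Jordan_Elimination"
begin

section \<open>Matrix groups and their Lie algebras\<close>

definition minv :: "complex mat \<Rightarrow> complex mat" where
  "minv g = the (mat_inverse g)"

definition GL_grp :: "nat \<Rightarrow> complex mat set" where
  "GL_grp N = {g \<in> carrier_mat N N. invertible_mat g}"

text \<open>The isometry group of the form \<open>(x, y) = x B y\<^sup>t\<close> on row vectors, on which \<open>g\<close> acts by
  \<open>x \<mapsto> x g\<close>. For all the forms used below, \<open>B\<close> is its own inverse up to sign, so that the
  column convention \<open>g\<^sup>t B g = B\<close> describes the same group.\<close>

definition isom_grp :: "nat \<Rightarrow> complex mat \<Rightarrow> complex mat set" where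
  "isom_grp N B = {g \<in> GL_grp N. g * B * transpose_mat g = B}"

definition J_mat :: "nat \<Rightarrow> complex mat" where
  "J_mat m = four_block_mat (0\<^sub>m m m) (1\<^sub>m m) (- 1\<^sub>m m) (0\<^sub>m m m)"

definition D_mat :: "nat \<Rightarrow> complex mat" where
  "D_mat m = four_block_mat (0\<^sub>m m m) (1\<^sub>m m) (1\<^sub>m m) (0\<^sub>m m m)"

definition C_mat :: "nat \<Rightarrow> complex mat" where
  "C_mat r = diag_block_mat (replicate r (J_mat 1))"

definition O_grp :: "nat \<Rightarrow> complex mat set" where
  "O_grp n = isom_grp n (1\<^sub>m n)"

definition Sp_grp :: "nat \<Rightarrow> complex mat set" where
  "Sp_grp m = isom_grp (2 * m) (J_mat m)"

definition SO_D_grp :: "nat \<Rightarrow> complex mat set" where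
  "SO_D_grp m = {g \<in> isom_grp (2 * m) (D_mat m). Determinant.det g = 1}"

definition Sp_C_grp :: "nat \<Rightarrow> complex mat set" where
  "Sp_C_grp r = isom_grp (2 * r) (C_mat r)"

definition block_prod :: "complex mat set \<Rightarrow> complex mat set \<Rightarrow> complex mat set" where
  "block_prod A B = {diag_block_mat [a, b] | a b. a \<in> A \<and> b \<in> B}"

definition block_diagonal :: "complex mat set \<Rightarrow> complex mat set" where
  "block_diagonal A = {diag_block_mat [a, a] | a. a \<in> A}"

definition GL_Levi :: "nat \<Rightarrow> complex mat set" where
  "GL_Levi m = {diag_block_mat [g, transpose_mat (minv g)] | g. g \<in> GL_grp m}"

text \<open>A complex linear algebraic group \<open>G\<close> is smooth, so its Lie algebra, the tangent space at the
  identity, consists of the velocities at \<open>0\<close> of germs of holomorphic curves in \<open>G\<close>.\<close>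

definition Lie_alg :: "nat \<Rightarrow> complex mat set \<Rightarrow> complex mat set" where
  "Lie_alg N G = {X \<in> carrier_mat N N. \<exists>\<gamma> :: complex \<Rightarrow> complex mat.
     \<gamma> 0 = 1\<^sub>m N \<and> (\<forall>\<^sub>F z in nhds 0. \<gamma> z \<in> G) \<and>
     (\<forall>i<N. \<forall>j<N. (\<lambda>z. \<gamma> z $$ (i, j)) analytic_on {0} \<and>
        ((\<lambda>z. \<gamma> z $$ (i, j)) has_field_derivative X $$ (i, j)) (at 0))}"

definition Ad :: "complex mat \<Rightarrow> complex mat \<Rightarrow> complex mat" where
  "Ad k X = k * X * minv k"


section \<open>Symmetric powers and their invariants\<close>

definition scl :: "complex \<Rightarrow> ('b \<Rightarrow>\<^sub>0 complex) \<Rightarrow> ('b \<Rightarrow>\<^sub>0 complex)" where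
  "scl c f = Poly_Mapping.map ((*) c) f"

lemma lookup_scl: "Poly_Mapping.lookup (scl c f) b = c * Poly_Mapping.lookup f b"
  by (simp add: scl_def Poly_Mapping.map.rep_eq when_def)

lemma vector_space_scl: "vector_space (scl :: complex \<Rightarrow> ('b \<Rightarrow>\<^sub>0 complex) \<Rightarrow> _)"
  by unfold_locales
    (auto intro!: poly_mapping_eqI simp: lookup_scl lookup_add algebra_simps)

text \<open>For a subspace \<open>V\<close> of square matrices, the symmetric power \<open>S\<^sup>d(V)\<close> is the quotient
  of the free vector space \<open>sym_free d V\<close> on the formal commutative products \<open>X\<^sub>1 \<cdots> X\<^sub>d\<close>
  (multisets of size \<open>d\<close> of elements of \<open>V\<close>) by the subspace \<open>sym_rel d V\<close> generated by the
  relations that make these products linear in each factor.\<close>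

definition sym_free :: "nat \<Rightarrow> complex mat set \<Rightarrow> (complex mat multiset \<Rightarrow>\<^sub>0 complex) set" where
  "sym_free d V = {f. \<forall>M \<in> Poly_Mapping.keys f. size M = d \<and> set_mset M \<subseteq> V}"

abbreviation formal_prod :: "complex mat multiset \<Rightarrow> (complex mat multiset \<Rightarrow>\<^sub>0 complex)" where
  "formal_prod M \<equiv> Poly_Mapping.single M 1"

definition sym_rel :: "nat \<Rightarrow> complex mat set \<Rightarrow> (complex mat multiset \<Rightarrow>\<^sub>0 complex) set" where
  "sym_rel d V = module.span scl
     ({formal_prod (add_mset (X + Y) M) - formal_prod (add_mset X M) - formal_prod (add_mset Y M)
        | X Y M. X \<in> V \<and> Y \<in> V \<and> set_mset M \<subseteq> V \<and> Suc (size M) = d} \<union>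
      {formal_prod (add_mset (c \<cdot>\<^sub>m X) M) - scl c (formal_prod (add_mset X M))
        | c X M. X \<in> V \<and> set_mset M \<subseteq> V \<and> Suc (size M) = d})"

text \<open>The linear extension of \<open>X\<^sub>1 \<cdots> X\<^sub>d \<mapsto> (Ad k X\<^sub>1) \<cdots> (Ad k X\<^sub>d)\<close>.\<close>

definition sym_act :: "complex mat \<Rightarrow> (complex mat multiset \<Rightarrow>\<^sub>0 complex) \<Rightarrow>
    (complex mat multiset \<Rightarrow>\<^sub>0 complex)" where
  "sym_act k f = (\<Sum>M \<in> Poly_Mapping.keys f.
     scl (Poly_Mapping.lookup f M) (formal_prod (image_mset (Ad k) M)))"

text \<open>The preimage in \<open>sym_free d V\<close> of the space of \<open>K\<close>-invariants of the quotient \<open>S\<^sup>d(V)\<close>.\<close>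

definition sym_inv :: "nat \<Rightarrow> complex mat set \<Rightarrow> complex mat set \<Rightarrow>
    (complex mat multiset \<Rightarrow>\<^sub>0 complex) set" where
  "sym_inv d V K = {f \<in> sym_free d V. \<forall>k \<in> K. sym_act k f - f \<in> sym_rel d V}"

text \<open>The dimension of the quotient \<open>W / R\<close>: \<open>B \<subseteq> W\<close> represents a basis of it if
  every \<open>w \<in> W\<close> is, modulo \<open>R\<close>, a linear combination of \<open>B\<close> with unique coefficients.\<close>

definition quot_basis :: "('b \<Rightarrow>\<^sub>0 complex) set \<Rightarrow> ('b \<Rightarrow>\<^sub>0 complex) set \<Rightarrow>
    ('b \<Rightarrow>\<^sub>0 complex) set \<Rightarrow> bool" where
  "quot_basis W R B \<longleftrightarrow> finite B \<and> B \<subseteq> W \<and>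
     (\<forall>w \<in> W. \<exists>!c. (\<forall>b. b \<notin> B \<longrightarrow> c b = 0) \<and> w - (\<Sum>b \<in> B. scl (c b) b) \<in> R)"

definition quot_dim :: "('b \<Rightarrow>\<^sub>0 complex) set \<Rightarrow> ('b \<Rightarrow>\<^sub>0 complex) set \<Rightarrow> nat" where
  "quot_dim W R = (THE r. \<exists>B. quot_basis W R B \<and> card B = r)"

text \<open>\<open>dim [S\<^sup>d(Lie G)]\<^sup>K\<close> for groups \<open>K \<subseteq> G\<close> of \<open>N \<times> N\<close> matrices\<close>

definition inv_dim :: "nat \<Rightarrow> nat \<Rightarrow> complex mat set \<Rightarrow> complex mat set \<Rightarrow> nat" where
  "inv_dim d N G K = quot_dim (sym_inv d (Lie_alg N G) K) (sym_rel d (Lie_alg N G))"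


section \<open>The symmetric pairs\<close>

definition h_U :: "nat \<Rightarrow> nat \<Rightarrow> nat \<Rightarrow> nat" where
  "h_U d p q = inv_dim d (p + q) (GL_grp (p + q)) (block_prod (GL_grp p) (GL_grp q))"

definition h_GL_R :: "nat \<Rightarrow> nat \<Rightarrow> nat" where
  "h_GL_R d n = inv_dim d n (GL_grp n) {g \<in> GL_grp n. minv g = transpose_mat g}"

definition h_GL_H :: "nat \<Rightarrow> nat \<Rightarrow> nat" where
  "h_GL_H d n = inv_dim d (2 * n) (GL_grp (2 * n))
     {g \<in> GL_grp (2 * n). g = - (J_mat n * transpose_mat (minv g) * J_mat n)}"

definition h_SO_star :: "nat \<Rightarrow> nat \<Rightarrow> nat" where
  "h_SO_star d m = inv_dim d (2 * m) (SO_D_grp m) (GL_Levi m)"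

definition h_Sp_R :: "nat \<Rightarrow> nat \<Rightarrow> nat" where
  "h_Sp_R d m = inv_dim d (2 * m) (Sp_grp m) (GL_Levi m)"

definition h_O_pq :: "nat \<Rightarrow> nat \<Rightarrow> nat \<Rightarrow> nat" where
  "h_O_pq d p q = inv_dim d (p + q) (O_grp (p + q)) (block_prod (O_grp p) (O_grp q))"

definition h_Sp_pq :: "nat \<Rightarrow> nat \<Rightarrow> nat \<Rightarrow> nat" where
  "h_Sp_pq d p q =
     inv_dim d (2 * (p + q)) (Sp_C_grp (p + q)) (block_prod (Sp_C_grp p) (Sp_C_grp q))"

text \<open>For the complex groups, \<open>G = K \<times> K\<close> is realised by block diagonal matrices of twice the size.\<close>

definition h_GL_C :: "nat \<Rightarrow> nat \<Rightarrow> nat" where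
  "h_GL_C d n = inv_dim d (2 * n) (block_prod (GL_grp n) (GL_grp n)) (block_diagonal (GL_grp n))"

definition h_O_C :: "nat \<Rightarrow> nat \<Rightarrow> nat" where
  "h_O_C d n = inv_dim d (2 * n) (block_prod (O_grp n) (O_grp n)) (block_diagonal (O_grp n))"

definition h_Sp_C :: "nat \<Rightarrow> nat \<Rightarrow> nat" where
  "h_Sp_C d m = inv_dim d (4 * m) (block_prod (Sp_grp m) (Sp_grp m)) (block_diagonal (Sp_grp m))"

end

theory Submission
  imports Defs
begin

text \<open>In all ten cases suitable coordinates identify Lie(\<open>G\<close>) with the tensors \<open>X\<^sub>a\<^sub>b = \<epsilon>\<^sub>0 X\<^sub>b\<^sub>a\<close>, where the indices
  carry colours and \<open>X\<^sub>a\<^sub>b\<close> is supported on pairs of colours related by \<open>R\<^sub>0\<close>; the group \<open>K\<close> acts by \<open>g \<otimes> g\<close>, where \<open>g\<close>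
  runs through a product of orthogonal, symplectic or general linear groups.  By the first and second fundamental theorems
  of invariant theory, for small \<open>d\<close> the \<open>K\<close>-invariants in the symmetric power correspond to functions of a pair of
  perfect matchings on \<open>2d\<close> coloured points: the first matching joins the two indices of each of the \<open>d\<close> tensors (colours
  related by \<open>R\<^sub>0\<close>, sign \<open>\<epsilon>\<^sub>0\<close> under a flip of an edge), the second one the indices contracted by the invariant form of
  \<open>K\<close> (colours related by \<open>R\<^sub>1\<close>, sign \<open>\<epsilon>\<^sub>1\<close>).  The two symmetric pairs in each of (a)--(e) have the same data with the
  roles of the two matchings exchanged.

  The form of the second fundamental theorem needed here, that an invariant is determined by its coefficients on words
  in which each label occurs in exactly two positions, is proved by differentiating along curves in \<open>K\<close>: as long as a
  word repeats a label too often, some label is still unused, and moving occurrences to it gives a linear relation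
  with coefficients on words with more labels.\<close>

section \<open>Dimensions of quotients\<close>

text \<open>No dimension is ever computed. \<open>quot_dim\<close> is a definite description, and a
  linear map on \<open>W\<close> with kernel \<open>R\<close> turns it into the same kind of
  description over its image, a space of functions. It then suffices that the images for the two
  pairs correspond under \<open>(\<sigma>, c)\<close> to
  \<open>(pinv \<sigma>, c \<circ> \<sigma>)\<close>.

  The bound on d enters as \<open>d \<le> N \<kappa>\<close>, in two ways. It leaves room for d
  different labels, so that every matching has a word whose labels pair up the positions along it.
  Moving occurrences to the free label strictly increases the number of labels, so the reduction is
  a terminating induction. The derivative at the identity changes one letter at a time; curves with
  only two nontrivial rows keep the list of possible changes short.\<close>

interpretation scl: vector_space "scl :: complex \<Rightarrow> ('b \<Rightarrow>\<^sub>0 complex) \<Rightarrow> _"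
  by (rule vector_space_scl)

text \<open>The analogue of \<open>quot_basis\<close> with equality of functions in place of
  congruence modulo \<open>R\<close>, so that quotients of unrelated spaces can be compared through
  their images.\<close>

definition fun_basis :: "('x \<Rightarrow> complex) set \<Rightarrow> ('x \<Rightarrow> complex) set \<Rightarrow> bool" where
  "fun_basis F C \<longleftrightarrow> finite C \<and> C \<subseteq> F \<and>
     (\<forall>y \<in> F. \<exists>!c. (\<forall>b. b \<notin> C \<longrightarrow> c b = 0) \<and> y = (\<lambda>x. \<Sum>b \<in> C. c b * b x))"

context
  fixes \<Psi> :: "('b \<Rightarrow>\<^sub>0 complex) \<Rightarrow> 'x \<Rightarrow> complex" and W R :: "('b \<Rightarrow>\<^sub>0 complex) set"
  assumes add: "\<And>f g. \<Psi> (f + g) = (\<lambda>x. \<Psi> f x + \<Psi> g x)"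
    and scl: "\<And>c f. \<Psi> (scl c f) = (\<lambda>x. c * \<Psi> f x)"
    and W: "scl.subspace W"
    and ker: "\<And>w. w \<in> W \<Longrightarrow> w \<in> R \<longleftrightarrow> \<Psi> w = (\<lambda>_. 0)"
begin

lemma map_zero: "\<Psi> 0 = (\<lambda>_. 0)"
  using scl[of 0 0] by simp

lemma map_sum: "finite B \<Longrightarrow> \<Psi> (\<Sum>b\<in>B. f b) = (\<lambda>x. \<Sum>b\<in>B. \<Psi> (f b) x)"
  by (induction B rule: finite_induct) (simp_all add: map_zero add)

lemma map_diff: "\<Psi> (f - g) = (\<lambda>x. \<Psi> f x - \<Psi> g x)"
proof -
  have "\<Psi> (f - g) = \<Psi> (f + scl (-1) g)"
    by simp
  then show ?thesis
    unfolding add scl by simp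
qed

lemma diff_comb_in_kernel_iff:
  assumes "finite B" "B \<subseteq> W" "w \<in> W"
  shows "w - (\<Sum>b\<in>B. scl (c b) b) \<in> R \<longleftrightarrow> \<Psi> w = (\<lambda>x. \<Sum>b\<in>B. c b * \<Psi> b x)"
proof -
  have "w - (\<Sum>b\<in>B. scl (c b) b) \<in> W"
    using assms by (intro scl.subspace_diff[OF W] scl.subspace_sum[OF W] scl.subspace_scale[OF W]) auto
  then show ?thesis
    using ker assms by (auto simp: map_diff map_sum scl fun_eq_iff)
qed

lemma quot_basis_iff_fun_basis_image:
  assumes B: "finite B" "B \<subseteq> W" and inj: "inj_on \<Psi> B"
  shows "quot_basis W R B \<longleftrightarrow> fun_basis (\<Psi> ` W) (\<Psi> ` B)"
proof -
  have sum: "(\<Sum>z\<in>\<Psi> ` B. c z * z x) = (\<Sum>b\<in>B. c (\<Psi> b) * \<Psi> b x)" for c x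
    using inj by (simp add: sum.reindex)
  have "(\<exists>!c. (\<forall>b. b \<notin> B \<longrightarrow> c b = 0) \<and> w - (\<Sum>b\<in>B. scl (c b) b) \<in> R) \<longleftrightarrow>
    (\<exists>!c. (\<forall>b. b \<notin> \<Psi> ` B \<longrightarrow> c b = 0) \<and> \<Psi> w = (\<lambda>x. \<Sum>b\<in>\<Psi> ` B. c b * b x))"
    (is "(\<exists>!c. ?P c) \<longleftrightarrow> (\<exists>!c. ?Q c)") if w: "w \<in> W" for w
  proof -
    \<comment> \<open>\<open>u\<close> pulls coefficients back along \<open>\<Psi>\<close> and
      \<open>v\<close> pushes them forward; on families supported in \<open>B\<close> and in its
      image they are mutually inverse because \<open>\<Psi>\<close> is injective on
      \<open>B\<close>.\<close>
    define u :: "(('x \<Rightarrow> complex) \<Rightarrow> complex) \<Rightarrow> _" where "u c = (\<lambda>b. if b \<in> B then c (\<Psi> b) else 0)" for c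
    define v :: "_ \<Rightarrow> ('x \<Rightarrow> complex) \<Rightarrow> complex" where "v c = (\<lambda>z. if z \<in> \<Psi> ` B then c (inv_into B \<Psi> z) else 0)" for c
    have P: "?P c \<longleftrightarrow> (\<forall>b. b \<notin> B \<longrightarrow> c b = 0) \<and> \<Psi> w = (\<lambda>x. \<Sum>b\<in>B. c b * \<Psi> b x)" for c
      using diff_comb_in_kernel_iff[OF B w] by simp
    have 1: "?P (u c)" if "?Q c" for c
      using that unfolding P u_def sum by (auto simp: fun_eq_iff intro!: sum.cong)
    have 2: "?Q (v c)" if "?P c" for c
      using that unfolding P v_def sum by (auto simp: fun_eq_iff inj intro!: sum.cong)
    have 3: "v (u c) = c" if "?Q c" for c
      using that inj unfolding u_def v_def by (auto simp: fun_eq_iff)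
    have 4: "u (v c) = c" if "?P c" for c
      using that inj unfolding u_def v_def by (auto simp: fun_eq_iff)
    show ?thesis
    proof
      assume "\<exists>!c. ?P c"
      then obtain c where c: "?P c" "\<And>c'. ?P c' \<Longrightarrow> c' = c" by (elim ex1E) blast
      show "\<exists>!c. ?Q c"
      proof (rule ex1I[of _ "v c"])
        show "?Q (v c)" by (rule 2[OF c(1)])
        show "c' = v c" if "?Q c'" for c' using c(2)[OF 1[OF that]] 3[OF that] by simp
      qed
    next
      assume "\<exists>!c. ?Q c"
      then obtain c where c: "?Q c" "\<And>c'. ?Q c' \<Longrightarrow> c' = c" by (elim ex1E) blast
      show "\<exists>!c. ?P c"
      proof (rule ex1I[of _ "u c"])
        show "?P (u c)" by (rule 1[OF c(1)])
        show "c' = u c" if "?P c'" for c' using c(2)[OF 2[OF that]] 4[OF that] by simp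
      qed
    qed
  qed
  from ball_cong[OF refl this] show ?thesis
    using B unfolding quot_basis_def fun_basis_def ball_simps(9) by (simp only: finite_imageI image_mono simp_thms)
qed

text \<open>If two basis elements had the same image, the first would have two coordinate families,
  the indicators of both elements, against uniqueness.\<close>

lemma quot_basis_inj:
  assumes "quot_basis W R B"
  shows "inj_on \<Psi> B"
proof (rule inj_onI, rule ccontr)
  fix x y assume xy: "x \<in> B" "y \<in> B" "\<Psi> x = \<Psi> y" "x \<noteq> y"
  have B: "finite B" "B \<subseteq> W" using assms by (auto simp: quot_basis_def)
  then have xW: "x \<in> W" using xy by auto
  have u0: "\<exists>!c. (\<forall>b. b \<notin> B \<longrightarrow> c b = 0) \<and> x - (\<Sum>b\<in>B. scl (c b) b) \<in> R"
    using assms xW unfolding quot_basis_def by blast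
  define P where "P c \<longleftrightarrow> (\<forall>b. b \<notin> B \<longrightarrow> c b = 0) \<and> \<Psi> x = (\<lambda>t. \<Sum>b\<in>B. c b * \<Psi> b t)" for c
  from u0 have u: "\<exists>!c. P c"
    unfolding diff_comb_in_kernel_iff[OF B xW] P_def .
  have z: "P (\<lambda>b. if b = z then 1 else 0)" if "z \<in> {x, y}" for z
    using that xy B unfolding P_def by (auto simp: if_distrib[of "\<lambda>u. u * _"] cong: if_cong)
  have "(\<lambda>b. if b = x then 1 else 0 :: complex) = (\<lambda>b. if b = y then 1 else 0)"
    using u z[of x] z[of y] by blast
  then have "(if x = x then 1 else 0 :: complex) = (if x = y then 1 else 0)"
    by (rule fun_cong)
  then show False using xy by simp
qed

text \<open>The two predicates of \<open>r\<close> coincide, by mapping a basis forward or choosing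
  one preimage of each basis function, so the descriptions agree whatever the dimension is.\<close>

lemma quot_dim_eq_fun_basis:
  "quot_dim W R = (THE r. \<exists>C. fun_basis (\<Psi> ` W) C \<and> card C = r)"
proof -
  have "(\<exists>B. quot_basis W R B \<and> card B = r) \<longleftrightarrow> (\<exists>C. fun_basis (\<Psi> ` W) C \<and> card C = r)" for r
  proof
    assume "\<exists>B. quot_basis W R B \<and> card B = r"
    then obtain B where B: "quot_basis W R B" "card B = r" by blast
    then have "finite B" "B \<subseteq> W" "inj_on \<Psi> B" using quot_basis_inj by (auto simp: quot_basis_def)
    then show "\<exists>C. fun_basis (\<Psi> ` W) C \<and> card C = r"
      using B quot_basis_iff_fun_basis_image by (intro exI[of _ "\<Psi> ` B"]) (auto simp: card_image)
  next
    assume "\<exists>C. fun_basis (\<Psi> ` W) C \<and> card C = r"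
    then obtain C where C: "fun_basis (\<Psi> ` W) C" "card C = r" by blast
    define B where "B = inv_into W \<Psi> ` C"
    have sub: "C \<subseteq> \<Psi> ` W" and fin: "finite C" using C by (auto simp: fun_basis_def)
    have im: "\<Psi> ` B = C" unfolding B_def image_image using sub by (force simp: f_inv_into_f)
    have inj: "inj_on \<Psi> B" unfolding B_def
      by (intro inj_on_imageI inj_onI) (use subsetD[OF sub] in \<open>simp add: f_inv_into_f\<close>)
    have B: "finite B" "B \<subseteq> W" unfolding B_def using fin sub by (auto intro: inv_into_into)
    show "\<exists>B. quot_basis W R B \<and> card B = r"
      using quot_basis_iff_fun_basis_image[OF B inj] C inj im card_image[OF inj] by auto
  qed
  then show ?thesis unfolding quot_dim_def by simp
qed

end

section \<open>The hyperoctahedral group and the combinatorial model\<close>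

abbreviation pinv :: "('a \<Rightarrow> 'a) \<Rightarrow> 'a \<Rightarrow> 'a" where
  "pinv f \<equiv> inv_into UNIV f"

text \<open>The point \<open>(k, s)\<close> stands for the first (\<open>False\<close>) or second
  (\<open>True\<close>) index of the \<open>k\<close>-th tensor factor.\<close>

definition pts :: "nat \<Rightarrow> (nat \<times> bool) set" where
  "pts d = {..<d} \<times> UNIV"

definition flip :: "nat \<times> bool \<Rightarrow> nat \<times> bool" where
  "flip x = (fst x, \<not> snd x)"

text \<open>The stabiliser of the standard matching in the symmetric group on the 2d points.\<close>

definition hyperoct :: "nat \<Rightarrow> (nat \<times> bool \<Rightarrow> nat \<times> bool) set" where
  "hyperoct d = {\<eta>. \<eta> permutes pts d \<and> (\<forall>x. \<eta> (flip x) = flip (\<eta> x))}"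

text \<open>\<open>\<epsilon>\<close> to the number of edges whose orientation \<open>\<eta>\<close>
  reverses.\<close>

definition flip_sign :: "nat \<Rightarrow> complex \<Rightarrow> (nat \<times> bool \<Rightarrow> nat \<times> bool) \<Rightarrow> complex" where
  "flip_sign d \<epsilon> \<eta> = (\<Prod>k<d. if snd (\<eta> (k, False)) then \<epsilon> else 1)"

lemma finite_pts [simp]: "finite (pts d)"
  by (simp add: pts_def)

lemma mem_pts [simp]: "(k, s) \<in> pts d \<longleftrightarrow> k < d"
  by (simp add: pts_def)

lemma hyperoct_flip: "\<eta> \<in> hyperoct d \<Longrightarrow> \<eta> (flip x) = flip (\<eta> x)"
  unfolding hyperoct_def by blast

lemma hyperoct_fst:
  assumes "\<eta> \<in> hyperoct d"
  shows "fst (\<eta> (k, s)) = fst (\<eta> (k, False))" "snd (\<eta> (k, True)) \<longleftrightarrow> \<not> snd (\<eta> (k, False))"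
proof -
  have *: "\<eta> (k, True) = flip (\<eta> (k, False))"
    using hyperoct_flip[OF assms, of "(k, False)"] by (simp add: flip_def)
  show "fst (\<eta> (k, s)) = fst (\<eta> (k, False))" by (cases s) (simp_all add: * flip_def)
  show "snd (\<eta> (k, True)) \<longleftrightarrow> \<not> snd (\<eta> (k, False))" by (simp add: * flip_def)
qed

lemma hyperoct_lt: "\<eta> \<in> hyperoct d \<Longrightarrow> fst (\<eta> (k, s)) < d \<longleftrightarrow> k < d"
  using permutes_in_image[of \<eta> "pts d" "(k, s)"] by (cases "\<eta> (k, s)") (simp add: hyperoct_def)

text \<open>Two edges sent to the same edge would have to share a point, because
  \<open>\<eta>\<close> maps edges onto edges and is injective.\<close>

lemma hyperoct_fst_permutes:
  assumes \<eta>: "\<eta> \<in> hyperoct d"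
  shows "(\<lambda>k. fst (\<eta> (k, False))) permutes {..<d}"
proof (rule bij_imp_permutes)
  have "inj_on (\<lambda>k. fst (\<eta> (k, False))) {..<d}"
  proof (rule inj_onI)
    fix k j assume kj: "fst (\<eta> (k, False)) = fst (\<eta> (j, False))"
    have "\<eta> (k, False) = \<eta> (j, False) \<or> \<eta> (k, False) = \<eta> (j, True)"
      using kj hyperoct_fst(1)[OF \<eta>, of j True] hyperoct_fst(2)[OF \<eta>, of j] by (auto simp: prod_eq_iff)
    moreover have "inj \<eta>" using \<eta> permutes_inj by (auto simp: hyperoct_def)
    ultimately show "k = j" by (auto dest: injD)
  qed
  moreover have "(\<lambda>k. fst (\<eta> (k, False))) ` {..<d} \<subseteq> {..<d}"
    using hyperoct_lt[OF \<eta>] by auto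
  ultimately show "bij_betw (\<lambda>k. fst (\<eta> (k, False))) {..<d} {..<d}"
    using endo_inj_surj[of "{..<d}"] by (auto simp: bij_betw_def)
  show "fst (\<eta> (x, False)) = x" if "x \<notin> {..<d}" for x
    using \<eta> that permutes_not_in[of \<eta> "pts d" "(x, False)"] by (simp add: hyperoct_def)
qed

lemma hyperoct_inv:
  assumes "\<eta> \<in> hyperoct d"
  shows "pinv \<eta> \<in> hyperoct d"
proof -
  have p: "\<eta> permutes pts d" and f: "\<And>x. \<eta> (flip x) = flip (\<eta> x)" using assms by (auto simp: hyperoct_def)
  have "pinv \<eta> (flip x) = flip (pinv \<eta> x)" for x
    using f[of "pinv \<eta> x"] p by (metis permutes_inverses)
  then show ?thesis using p by (auto simp: hyperoct_def permutes_inv)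
qed

lemma hyperoct_id: "id \<in> hyperoct d"
  by (auto simp: hyperoct_def permutes_id)

text \<open>The inverse reverses the image of an edge exactly when \<open>\<eta>\<close> reverses
  the edge; reindexing the product by the induced permutation of edges gives the equality for any
  value of \<open>\<epsilon>\<close>.\<close>

lemma flip_sign_inv:
  assumes \<eta>: "\<eta> \<in> hyperoct d"
  shows "flip_sign d \<epsilon> (pinv \<eta>) = flip_sign d \<epsilon> \<eta>"
proof -
  let ?f = "\<lambda>k. fst (\<eta> (k, False))"
  have p: "\<eta> permutes pts d" using \<eta> by (simp add: hyperoct_def)
  have s: "snd (pinv \<eta> (?f k, False)) \<longleftrightarrow> snd (\<eta> (k, False))" for k
  proof (cases "snd (\<eta> (k, False))")
    case True
    then have "(?f k, False) = \<eta> (k, True)"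
      using hyperoct_fst(1)[OF \<eta>, of k True] hyperoct_fst(2)[OF \<eta>, of k] by (auto simp: prod_eq_iff)
    then show ?thesis using True p by (simp add: permutes_inverses)
  next
    case False
    then have "(?f k, False) = \<eta> (k, False)" by (auto simp: prod_eq_iff)
    then show ?thesis using False p by (simp add: permutes_inverses)
  qed
  have "flip_sign d \<epsilon> (pinv \<eta>) = (\<Prod>k<d. if snd (pinv \<eta> (?f k, False)) then \<epsilon> else 1)"
    unfolding flip_sign_def by (rule prod.permute[OF hyperoct_fst_permutes[OF \<eta>], unfolded o_def])
  then show ?thesis unfolding s flip_sign_def .
qed

text \<open>The matching meant is the image of the standard one under \<open>\<sigma>\<close>;
  taking \<open>id\<close> constrains the standard matching itself.\<close>

definition edge_compat :: "nat \<Rightarrow> ('c \<Rightarrow> 'c \<Rightarrow> bool) \<Rightarrow> (nat \<times> bool \<Rightarrow> nat \<times> bool) \<Rightarrow> (nat \<times> bool \<Rightarrow> 'c) \<Rightarrow> bool" where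
  "edge_compat d R \<sigma> c \<longleftrightarrow> (\<forall>k<d. R (c (\<sigma> (k, False))) (c (\<sigma> (k, True))))"

text \<open>A pair \<open>(\<sigma>, c)\<close> encodes a colouring \<open>c\<close> of the \<open>2d\<close> points together with two perfect matchings of
  them: the standard one, pairing \<open>(k, False)\<close> with \<open>(k, True)\<close>, and its image under \<open>\<sigma>\<close>.\<close>

definition match_space :: "nat \<Rightarrow> ('c \<Rightarrow> 'c \<Rightarrow> bool) \<Rightarrow> complex \<Rightarrow> ('c \<Rightarrow> 'c \<Rightarrow> bool) \<Rightarrow> complex \<Rightarrow>
    ((nat \<times> bool \<Rightarrow> nat \<times> bool) \<times> (nat \<times> bool \<Rightarrow> 'c) \<Rightarrow> complex) set" where
  "match_space d R0 \<epsilon>0 R1 \<epsilon>1 = {\<psi>.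
     (\<forall>\<sigma> c. \<not> (\<sigma> permutes pts d \<and> c \<in> extensional (pts d) \<and> edge_compat d R0 id c \<and> edge_compat d R1 \<sigma> c) \<longrightarrow> \<psi> (\<sigma>, c) = 0) \<and>
     (\<forall>\<sigma> c. \<forall>\<eta>\<in>hyperoct d. \<sigma> permutes pts d \<longrightarrow> c \<in> extensional (pts d) \<longrightarrow>
        \<psi> (\<eta> \<circ> \<sigma>, c \<circ> pinv \<eta>) = flip_sign d \<epsilon>0 \<eta> * \<psi> (\<sigma>, c) \<and>
        \<psi> (\<sigma> \<circ> \<eta>, c) = flip_sign d \<epsilon>1 \<eta> * \<psi> (\<sigma>, c))}"

text \<open>Relabelling the points by the inverse of \<open>\<sigma>\<close> makes the second
  matching standard and sends the first to the one encoded by \<open>pinv \<sigma>\<close>. The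
  default 0 agrees with the vanishing imposed by \<open>match_space\<close>, which makes the
  operation an involution there.\<close>

definition swap_match :: "((nat \<times> bool \<Rightarrow> nat \<times> bool) \<times> (nat \<times> bool \<Rightarrow> 'c) \<Rightarrow> complex) \<Rightarrow> nat \<Rightarrow>
    (nat \<times> bool \<Rightarrow> nat \<times> bool) \<times> (nat \<times> bool \<Rightarrow> 'c) \<Rightarrow> complex" where
  "swap_match \<psi> d x = (if fst x permutes pts d then \<psi> (pinv (fst x), snd x \<circ> fst x) else 0)"

lemma extensional_comp_permutes:
  "\<sigma> permutes A \<Longrightarrow> c \<circ> \<sigma> \<in> extensional A \<longleftrightarrow> c \<in> extensional A"
  by (simp add: extensional_def permutes_not_in cong: imp_cong)

text \<open>Inversion turns left into right multiplication, so the two equivariance laws trade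
  places; their signs survive because \<open>flip_sign\<close> takes the same value on an element
  and its inverse.\<close>

lemma swap_match_in:
  fixes \<psi> :: "(nat \<times> bool \<Rightarrow> nat \<times> bool) \<times> (nat \<times> bool \<Rightarrow> 'c) \<Rightarrow> complex"
  assumes "\<psi> \<in> match_space d R0 \<epsilon>0 R1 \<epsilon>1"
  shows "swap_match \<psi> d \<in> match_space d R1 \<epsilon>1 R0 \<epsilon>0"
proof -
  have z: "\<not> (\<sigma> permutes pts d \<and> c \<in> extensional (pts d) \<and> edge_compat d R0 id c \<and> edge_compat d R1 \<sigma> c) \<Longrightarrow> \<psi> (\<sigma>, c) = 0" for \<sigma> c
    using assms unfolding match_space_def by blast
  have e: "\<psi> (\<eta> \<circ> \<sigma>, c \<circ> pinv \<eta>) = flip_sign d \<epsilon>0 \<eta> * \<psi> (\<sigma>, c)"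
     "\<psi> (\<sigma> \<circ> \<eta>, c) = flip_sign d \<epsilon>1 \<eta> * \<psi> (\<sigma>, c)"
    if "\<eta> \<in> hyperoct d" "\<sigma> permutes pts d" "c \<in> extensional (pts d)" for \<sigma> c \<eta>
    using assms that unfolding match_space_def by blast+
  show ?thesis unfolding match_space_def
  proof (intro CollectI conjI allI ballI impI)
    fix \<sigma> and c :: "nat \<times> bool \<Rightarrow> 'c" assume n: "\<not> (\<sigma> permutes pts d \<and> c \<in> extensional (pts d) \<and> edge_compat d R1 id c \<and> edge_compat d R0 \<sigma> c)"
    show "swap_match \<psi> d (\<sigma>, c) = 0"
    proof (cases "\<sigma> permutes pts d")
      case True
      have "edge_compat d R0 id (c \<circ> \<sigma>) \<longleftrightarrow> edge_compat d R0 \<sigma> c" by (simp add: edge_compat_def)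
      moreover have "edge_compat d R1 (pinv \<sigma>) (c \<circ> \<sigma>) \<longleftrightarrow> edge_compat d R1 id c"
        using True by (simp add: edge_compat_def permutes_inverses)
      ultimately show ?thesis
        using n z True by (auto simp: swap_match_def extensional_comp_permutes)
    qed (simp add: swap_match_def)
  next
    fix \<sigma> \<eta> and c :: "nat \<times> bool \<Rightarrow> 'c" assume \<eta>: "\<eta> \<in> hyperoct d" and \<sigma>: "\<sigma> permutes pts d" and c: "c \<in> extensional (pts d)"
    have p: "\<eta> permutes pts d" using \<eta> by (simp add: hyperoct_def)
    have "pinv (\<eta> \<circ> \<sigma>) = pinv \<sigma> \<circ> pinv \<eta>" "c \<circ> pinv \<eta> \<circ> (\<eta> \<circ> \<sigma>) = c \<circ> \<sigma>"
      using p \<sigma> by (auto simp: permutes_inverses permutes_inv_o fun_eq_iff o_inv_distrib permutes_bij)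
    then show "swap_match \<psi> d (\<eta> \<circ> \<sigma>, c \<circ> pinv \<eta>) = flip_sign d \<epsilon>1 \<eta> * swap_match \<psi> d (\<sigma>, c)"
      using e(2)[OF hyperoct_inv[OF \<eta>] permutes_inv[OF \<sigma>], of "c \<circ> \<sigma>"] p \<sigma> c
      by (simp add: swap_match_def permutes_compose extensional_comp_permutes flip_sign_inv[OF \<eta>])
    have "pinv (\<sigma> \<circ> \<eta>) = pinv \<eta> \<circ> pinv \<sigma>" "c \<circ> (\<sigma> \<circ> \<eta>) = (c \<circ> \<sigma>) \<circ> pinv (pinv \<eta>)"
      using p \<sigma> by (auto simp: o_inv_distrib permutes_bij permutes_inv_inv)
    then show "swap_match \<psi> d (\<sigma> \<circ> \<eta>, c) = flip_sign d \<epsilon>0 \<eta> * swap_match \<psi> d (\<sigma>, c)"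
      using e(1)[OF hyperoct_inv[OF \<eta>] permutes_inv[OF \<sigma>], of "c \<circ> \<sigma>"] p \<sigma> c
      by (simp add: swap_match_def permutes_compose extensional_comp_permutes flip_sign_inv[OF \<eta>])
  qed
qed

lemma swap_match_swap:
  fixes \<psi> :: "(nat \<times> bool \<Rightarrow> nat \<times> bool) \<times> (nat \<times> bool \<Rightarrow> 'c) \<Rightarrow> complex"
  assumes "\<psi> \<in> match_space d R0 \<epsilon>0 R1 \<epsilon>1"
  shows "swap_match (swap_match \<psi> d) d = \<psi>"
proof
  fix x show "swap_match (swap_match \<psi> d) d x = \<psi> x"
  proof (cases "fst x permutes pts d")
    case True
    then have "pinv (pinv (fst x)) = fst x" "pinv (fst x) permutes pts d" "snd x \<circ> fst x \<circ> pinv (fst x) = snd x"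
      by (auto simp: permutes_inv_inv permutes_inv fun_eq_iff permutes_inverses)
    then show ?thesis using True by (simp add: swap_match_def)
  next
    case False
    then have "\<psi> (fst x, snd x) = 0"
      using assms unfolding match_space_def by blast
    then show ?thesis using False by (simp add: swap_match_def)
  qed
qed

lemma swap_match_image:
  "(\<lambda>\<psi>. swap_match \<psi> d) ` match_space d R0 \<epsilon>0 R1 \<epsilon>1 = match_space d R1 \<epsilon>1 R0 \<epsilon>0"
proof -
  have "\<psi> \<in> (\<lambda>\<psi>. swap_match \<psi> d) ` match_space d R0 \<epsilon>0 R1 \<epsilon>1" if "\<psi> \<in> match_space d R1 \<epsilon>1 R0 \<epsilon>0" for \<psi>
    using swap_match_swap[OF that] swap_match_in[OF that] by (intro image_eqI[of _ _ "swap_match \<psi> d"]) simp_all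
  then show ?thesis using swap_match_in by auto
qed

text \<open>Says that \<open>W\<close> modulo \<open>R\<close> is isomorphic to the function space
  \<open>F\<close>. The map is linear on the whole ambient space, so that sums carry no side
  conditions.\<close>

definition models :: "('b \<Rightarrow>\<^sub>0 complex) set \<Rightarrow> ('b \<Rightarrow>\<^sub>0 complex) set \<Rightarrow> ('x \<Rightarrow> complex) set \<Rightarrow> bool" where
  "models W R F \<longleftrightarrow> scl.subspace W \<and> (\<exists>\<Psi>. (\<forall>f g. \<Psi> (f + g) = (\<lambda>x. \<Psi> f x + \<Psi> g x)) \<and>
     (\<forall>c f. \<Psi> (scl c f) = (\<lambda>x. c * \<Psi> f x)) \<and> (\<forall>w\<in>W. w \<in> R \<longleftrightarrow> \<Psi> w = (\<lambda>_. 0)) \<and> \<Psi> ` W = F)"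

lemma models_quot_dim:
  assumes "models W R F"
  shows "quot_dim W R = (THE r. \<exists>C. fun_basis F C \<and> card C = r)"
proof -
  obtain \<Psi> where P: "\<And>f g. \<Psi> (f + g) = (\<lambda>x. \<Psi> f x + \<Psi> g x)" "\<And>c f. \<Psi> (scl c f) = (\<lambda>x. c * \<Psi> f x)"
    "\<And>w. w \<in> W \<Longrightarrow> w \<in> R \<longleftrightarrow> \<Psi> w = (\<lambda>_. 0)" "\<Psi> ` W = F" and W: "scl.subspace W"
    using assms unfolding models_def by blast
  show ?thesis using quot_dim_eq_fun_basis[OF P(1) P(2) W P(3)] P(4) by simp
qed

lemma models_swap:
  assumes "models W R (match_space d R0 \<epsilon>0 R1 \<epsilon>1)"
  shows "models W R (match_space d R1 \<epsilon>1 R0 \<epsilon>0)"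
proof -
  obtain \<Psi> where P: "\<And>f g. \<Psi> (f + g) = (\<lambda>x. \<Psi> f x + \<Psi> g x)" "\<And>c f. \<Psi> (scl c f) = (\<lambda>x. c * \<Psi> f x)"
    "\<And>w. w \<in> W \<Longrightarrow> w \<in> R \<longleftrightarrow> \<Psi> w = (\<lambda>_. 0)" "\<Psi> ` W = match_space d R0 \<epsilon>0 R1 \<epsilon>1" and W: "scl.subspace W"
    using assms unfolding models_def by blast
  have "swap_match (\<Psi> w) d = (\<lambda>_. 0) \<longleftrightarrow> \<Psi> w = (\<lambda>_. 0)" if "w \<in> W" for w
  proof -
    have "\<Psi> w \<in> match_space d R0 \<epsilon>0 R1 \<epsilon>1" using P(4) that by blast
    from swap_match_swap[OF this] have "\<Psi> w = swap_match (swap_match (\<Psi> w) d) d" ..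
    moreover have "swap_match (\<lambda>_. 0) d = (\<lambda>_. 0)" by (simp add: swap_match_def fun_eq_iff)
    ultimately show ?thesis by metis
  qed
  then show ?thesis unfolding models_def
    using P(1-3) swap_match_image[of d R0 \<epsilon>0 R1 \<epsilon>1, folded P(4), unfolded image_image] W
    by (intro conjI exI[of _ "\<lambda>w. swap_match (\<Psi> w) d"]) (auto simp: swap_match_def fun_eq_iff)
qed

lemma quot_dim_eq_by_swap:
  assumes "models W R (match_space d R0 \<epsilon>0 R1 \<epsilon>1)" "models W' R' (match_space d R1 \<epsilon>1 R0 \<epsilon>0)"
  shows "quot_dim W R = quot_dim W' R'"
  using models_quot_dim[OF models_swap[OF assms(1)]] models_quot_dim[OF assms(2)] by simp

section \<open>Symmetric powers as symmetric tensors\<close>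

text \<open>Distributivity: a choice of one pair per \<open>k\<close> is recoded as a word on the 2d
  points.\<close>

lemma prod_sum_pairs:
  fixes u :: "nat \<Rightarrow> 'h \<Rightarrow> 'h \<Rightarrow> complex"
  assumes H: "finite H"
  shows "(\<Prod>k<d. \<Sum>a\<in>H. \<Sum>b\<in>H. u k a b) =
    (\<Sum>J\<in>PiE (pts d) (\<lambda>_. H). \<Prod>k<d. u k (J (k, False)) (J (k, True)))"
proof -
  have "(\<Prod>k<d. \<Sum>a\<in>H. \<Sum>b\<in>H. u k a b) = (\<Prod>k<d. \<Sum>ab\<in>H \<times> H. u k (fst ab) (snd ab))"
    by (simp add: sum.cartesian_product split_def)
  also have "\<dots> = (\<Sum>J\<in>PiE {..<d} (\<lambda>_. H \<times> H). \<Prod>k<d. u k (fst (J k)) (snd (J k)))"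
    by (rule prod_sum_PiE) (use H in auto)
  also have "\<dots> = (\<Sum>J\<in>PiE (pts d) (\<lambda>_. H). \<Prod>k<d. u k (J (k, False)) (J (k, True)))"
    by (rule sum.reindex_bij_witness[where
          i = "\<lambda>J. restrict (\<lambda>k. (J (k, False), J (k, True))) {..<d}" and
          j = "\<lambda>J. restrict (\<lambda>(k, s). if s then snd (J k) else fst (J k)) (pts d)"])
       (auto simp: PiE_iff extensional_def restrict_def pts_def mem_Times_iff fun_eq_iff split: if_splits)
  finally show ?thesis .
qed

lemma prod_pts: "(\<Prod>p\<in>pts d. f p) = (\<Prod>k<d. f (k, False) * f (k, True))"
proof -
  have "(\<Prod>p\<in>pts d. f p) = (\<Prod>k<d. \<Prod>s\<in>UNIV. f (k, s))"
    unfolding pts_def by (subst prod.cartesian_product) (simp add: case_prod_unfold)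
  then show ?thesis by (simp add: UNIV_bool)
qed

definition pair_word :: "(nat \<Rightarrow> 'h \<times> 'h) \<Rightarrow> nat \<times> bool \<Rightarrow> 'h" where
  "pair_word J x = (if snd x then snd (J (fst x)) else fst (J (fst x)))"

lemma pair_word_Pi:
  assumes "J \<in> PiE {..<d} (\<lambda>_. H \<times> H)"
  shows "pair_word J \<in> pts d \<rightarrow> H"
proof
  fix x assume "x \<in> pts d"
  then have "J (fst x) \<in> H \<times> H" using PiE_mem[OF assms, of "fst x"] by (auto simp: pts_def)
  then show "pair_word J x \<in> H" by (auto simp: pair_word_def)
qed

section \<open>Particular elements of the hyperoctahedral group\<close>

lemma involution_permutes:
  assumes "\<And>x. f (f x) = x" "\<And>x. x \<notin> A \<Longrightarrow> f x = x"
  shows "f permutes A"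
  unfolding permutes_def using assms by metis

text \<open>Inequality of truth values acts as exclusive or: the edges selected by \<open>S\<close>
  are reversed in place.\<close>

definition flip_at :: "nat \<Rightarrow> (nat \<Rightarrow> bool) \<Rightarrow> nat \<times> bool \<Rightarrow> nat \<times> bool" where
  "flip_at d S x = (fst x, if fst x < d then snd x \<noteq> S (fst x) else snd x)"

lemma flip_at_hyperoct: "flip_at d S \<in> hyperoct d"
  unfolding hyperoct_def
proof (intro CollectI conjI allI)
  show "flip_at d S permutes pts d"
    by (rule involution_permutes) (auto simp: flip_at_def pts_def)
  show "flip_at d S (flip x) = flip (flip_at d S x)" for x
    by (auto simp: flip_at_def flip_def)
qed

lemma flip_sign_flip_at: "flip_sign d \<epsilon> (flip_at d S) = (\<Prod>k<d. if S k then \<epsilon> else 1)"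
  unfolding flip_sign_def by (rule prod.cong) (auto simp: flip_at_def)

definition perm_pairs :: "(nat \<Rightarrow> nat) \<Rightarrow> nat \<times> bool \<Rightarrow> nat \<times> bool" where
  "perm_pairs \<pi> x = (\<pi> (fst x), snd x)"

lemma perm_pairs_hyperoct:
  assumes "\<pi> permutes {..<d}"
  shows "perm_pairs \<pi> \<in> hyperoct d"
  unfolding hyperoct_def
proof (intro CollectI conjI allI)
  have lt: "k < d \<Longrightarrow> \<pi> k < d" "k < d \<Longrightarrow> pinv \<pi> k < d" for k
    using permutes_in_image[OF assms, of k] permutes_in_image[OF permutes_inv[OF assms], of k] by simp_all
  have bij: "bij_betw (perm_pairs \<pi>) (pts d) (pts d)"
    by (rule bij_betw_byWitness[where f' = "perm_pairs (pinv \<pi>)"])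
       (auto simp: perm_pairs_def permutes_inverses[OF assms] pts_def lt)
  show "perm_pairs \<pi> permutes pts d"
    by (rule bij_imp_permutes[OF bij]) (use permutes_not_in[OF assms] in \<open>auto simp: perm_pairs_def pts_def\<close>)
  show "perm_pairs \<pi> (flip x) = flip (perm_pairs \<pi> x)" for x
    by (simp add: perm_pairs_def flip_def)
qed

lemma flip_sign_perm_pairs: "flip_sign d \<epsilon> (perm_pairs \<pi>) = 1"
  by (simp add: flip_sign_def perm_pairs_def)

section \<open>The free space of formal products and its relations\<close>

lemma sym_rel_subspace: "scl.subspace (sym_rel d V)"
  unfolding sym_rel_def by (rule scl.subspace_span)

lemma sym_rel_add: "X \<in> V \<Longrightarrow> Y \<in> V \<Longrightarrow> set_mset M \<subseteq> V \<Longrightarrow> Suc (size M) = d \<Longrightarrow>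
    formal_prod (add_mset (X + Y) M) - formal_prod (add_mset X M) - formal_prod (add_mset Y M) \<in> sym_rel d V"
  unfolding sym_rel_def by (rule scl.span_base) blast

lemma sym_rel_smult: "X \<in> V \<Longrightarrow> set_mset M \<subseteq> V \<Longrightarrow> Suc (size M) = d \<Longrightarrow>
    formal_prod (add_mset (c \<cdot>\<^sub>m X) M) - scl c (formal_prod (add_mset X M)) \<in> sym_rel d V"
  unfolding sym_rel_def by (rule scl.span_base) blast

lemma sum_single_keys: "f = (\<Sum>M\<in>Poly_Mapping.keys f. scl (Poly_Mapping.lookup f M) (formal_prod M))"
proof (rule poly_mapping_eqI)
  fix k
  have "Poly_Mapping.lookup (\<Sum>M\<in>Poly_Mapping.keys f. scl (Poly_Mapping.lookup f M) (formal_prod M)) k =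
    (\<Sum>M\<in>Poly_Mapping.keys f. if M = k then Poly_Mapping.lookup f M else 0)"
    unfolding lookup_sum by (intro sum.cong) (auto simp: lookup_scl lookup_single when_def)
  then show "Poly_Mapping.lookup f k =
    Poly_Mapping.lookup (\<Sum>M\<in>Poly_Mapping.keys f. scl (Poly_Mapping.lookup f M) (formal_prod M)) k"
    by (simp add: in_keys_iff)
qed

lemma sym_free_subspace: "scl.subspace (sym_free d V)"
proof (rule scl.subspaceI)
  show "0 \<in> sym_free d V" by (simp add: sym_free_def)
  show "f + g \<in> sym_free d V" if "f \<in> sym_free d V" "g \<in> sym_free d V" for f g
    using that Poly_Mapping.keys_add[of f g] unfolding sym_free_def by blast
  show "scl c f \<in> sym_free d V" if "f \<in> sym_free d V" for c f
  proof -
    have "Poly_Mapping.keys (scl c f) \<subseteq> Poly_Mapping.keys f"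
      by (auto simp: in_keys_iff lookup_scl)
    then show ?thesis using that unfolding sym_free_def by blast
  qed
qed

lemma formal_prod_sym_free: "formal_prod M \<in> sym_free d V \<longleftrightarrow> size M = d \<and> set_mset M \<subseteq> V"
  by (simp add: sym_free_def)

lemma sum_PiE_Suc:
  "(\<Sum>J\<in>PiE {..<Suc m} (\<lambda>_. A). F J) = (\<Sum>(a, J)\<in>A \<times> PiE {..<m} (\<lambda>_. A). F (J(m := a)))"
proof (rule sum.reindex_bij_witness[where i = "\<lambda>(a, J). J(m := a)" and j = "\<lambda>J. (J m, restrict J {..<m})"])
  fix J assume J: "J \<in> PiE {..<Suc m} (\<lambda>_. A)"
  show eq: "(case (J m, restrict J {..<m}) of (a, J) \<Rightarrow> J(m := a)) = J"
    using J by (auto simp: fun_eq_iff PiE_iff extensional_def)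
  show "(J m, restrict J {..<m}) \<in> A \<times> PiE {..<m} (\<lambda>_. A)"
    using PiE_mem[OF J] by (simp add: restrict_PiE_iff)
  show "(case (J m, restrict J {..<m}) of (a, J) \<Rightarrow> F (J(m := a))) = F J"
    using eq by simp
next
  fix aJ assume aJ: "aJ \<in> A \<times> PiE {..<m} (\<lambda>_. A)"
  then obtain a J where [simp]: "aJ = (a, J)" and "a \<in> A" "J \<in> PiE {..<m} (\<lambda>_. A)" by blast
  then show "(case aJ of (a, J) \<Rightarrow> J(m := a)) \<in> PiE {..<Suc m} (\<lambda>_. A)"
    by (auto simp: PiE_iff extensional_def less_Suc_eq)
  show "((case aJ of (a, J) \<Rightarrow> J(m := a)) m, restrict (case aJ of (a, J) \<Rightarrow> J(m := a)) {..<m}) = aJ"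
    using \<open>J \<in> PiE {..<m} (\<lambda>_. A)\<close> by (auto simp: fun_eq_iff PiE_iff extensional_def)
qed

text \<open>The tensor \<open>t\<close> of order 2d is fixed by the 2d-th tensor power of
  \<open>r\<close>. Only words with letters in \<open>H\<close> are tested, since coordinates mean
  nothing outside \<open>H\<close>.\<close>

definition tensor_invariant :: "nat \<Rightarrow> 'h set \<Rightarrow> ('h \<Rightarrow> 'h \<Rightarrow> complex) \<Rightarrow> ((nat \<times> bool \<Rightarrow> 'h) \<Rightarrow> complex) \<Rightarrow> bool" where
  "tensor_invariant d H r t \<longleftrightarrow>
     (\<forall>h\<in>pts d \<rightarrow> H. (\<Sum>J\<in>PiE (pts d) (\<lambda>_. H). (\<Prod>x\<in>pts d. r (h x) (J x)) * t J) = t h)"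

definition half :: complex where "half = 1 / 2"

lemma half_add_half: "half + half = 1"
  by (simp add: half_def)

lemma sum_UNIV_bool: "(\<Sum>s\<in>UNIV. F s) = F False + F True"
  by (simp add: UNIV_bool add.commute)

text \<open>\<open>L\<close> is a linear bijection from \<open>V\<close> onto the arrays on
  \<open>H\<close> with symmetry \<open>eps\<close> and support in \<open>R0\<close>; the symmetric
  power of \<open>V\<close> is then studied as a space of tensors of order 2d.\<close>

locale sym_model =
  fixes d :: nat and V :: "complex mat set" and H :: "'h set"
    and L :: "complex mat \<Rightarrow> 'h \<Rightarrow> 'h \<Rightarrow> complex" and eps :: complex and R0 :: "'h \<Rightarrow> 'h \<Rightarrow> bool"
  assumes finite_H: "finite H" and eps: "eps * eps = 1"
    and R0_sym: "\<And>a b. R0 a b \<Longrightarrow> R0 b a"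
    and V_add: "\<And>X Y. X \<in> V \<Longrightarrow> Y \<in> V \<Longrightarrow> X + Y \<in> V"
    and V_smult: "\<And>c X. X \<in> V \<Longrightarrow> c \<cdot>\<^sub>m X \<in> V"
    and L_add: "\<And>X Y a b. X \<in> V \<Longrightarrow> Y \<in> V \<Longrightarrow> a \<in> H \<Longrightarrow> b \<in> H \<Longrightarrow> L (X + Y) a b = L X a b + L Y a b"
    and L_smult: "\<And>c X a b. X \<in> V \<Longrightarrow> a \<in> H \<Longrightarrow> b \<in> H \<Longrightarrow> L (c \<cdot>\<^sub>m X) a b = c * L X a b"
    and L_sym: "\<And>X a b. X \<in> V \<Longrightarrow> a \<in> H \<Longrightarrow> b \<in> H \<Longrightarrow> L X b a = eps * L X a b"
    and L_supp: "\<And>X a b. X \<in> V \<Longrightarrow> a \<in> H \<Longrightarrow> b \<in> H \<Longrightarrow> \<not> R0 a b \<Longrightarrow> L X a b = 0"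
    and L_inj: "\<And>X Y. X \<in> V \<Longrightarrow> Y \<in> V \<Longrightarrow> (\<And>a b. a \<in> H \<Longrightarrow> b \<in> H \<Longrightarrow> L X a b = L Y a b) \<Longrightarrow> X = Y"
    and L_surj: "\<And>x. (\<And>a b. a \<in> H \<Longrightarrow> b \<in> H \<Longrightarrow> x b a = eps * x a b) \<Longrightarrow>
       (\<And>a b. a \<in> H \<Longrightarrow> b \<in> H \<Longrightarrow> \<not> R0 a b \<Longrightarrow> x a b = 0) \<Longrightarrow>
       \<exists>X\<in>V. \<forall>a\<in>H. \<forall>b\<in>H. L X a b = x a b"
begin

text \<open>The symmetrisation of the tensor product of the listed matrices, without the factor
  1/d!; hence the factors \<open>fact d\<close> below.\<close>

definition tens :: "complex mat list \<Rightarrow> (nat \<times> bool \<Rightarrow> 'h) \<Rightarrow> complex" where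
  "tens xs h = (\<Sum>\<pi> | \<pi> permutes {..<length xs}. \<Prod>k<length xs. L (xs ! \<pi> k) (h (k, False)) (h (k, True)))"

text \<open>The linear extension of \<open>tens\<close>; \<open>SOME\<close> orders the multiset,
  and \<open>tens_mset_cong\<close> makes the choice immaterial.\<close>

definition T :: "(complex mat multiset \<Rightarrow>\<^sub>0 complex) \<Rightarrow> (nat \<times> bool \<Rightarrow> 'h) \<Rightarrow> complex" where
  "T f h = (\<Sum>M\<in>Poly_Mapping.keys f. Poly_Mapping.lookup f M * tens (SOME xs. mset xs = M) h)"

text \<open>Two orderings differ by a permutation, which composes with \<open>\<pi>\<close> and
  disappears in the sum over all permutations.\<close>

lemma tens_mset_cong:
  assumes "mset xs = mset ys"
  shows "tens xs h = tens ys h"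
proof -
  obtain p where p: "p permutes {..<length ys}" "permute_list p ys = xs"
    using mset_eq_permutation[OF assms] by blast
  have len: "length xs = length ys" using assms by (rule mset_eq_length)
  have "tens ys h = (\<Sum>\<pi> | \<pi> permutes {..<length ys}. \<Prod>k<length ys. L (ys ! (p \<circ> \<pi>) k) (h (k, False)) (h (k, True)))"
    unfolding tens_def by (rule setum_permutations_compose_left[OF p(1)])
  also have "\<dots> = tens xs h"
    unfolding tens_def len
  proof (intro sum.cong prod.cong refl)
    fix \<pi> k assume "\<pi> \<in> {\<pi>. \<pi> permutes {..<length ys}}" "k \<in> {..<length ys}"
    then have "\<pi> k < length ys" using permutes_in_image[of \<pi> "{..<length ys}" k] by auto
    then have "xs ! \<pi> k = ys ! p (\<pi> k)"
      using p by (metis permute_list_nth)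
    then show "L (ys ! (p \<circ> \<pi>) k) (h (k, False)) (h (k, True)) = L (xs ! \<pi> k) (h (k, False)) (h (k, True))"
      by simp
  qed
  finally show ?thesis ..
qed

lemma tens_some: "tens (SOME ys. mset ys = mset xs) h = tens xs h"
  by (rule tens_mset_cong) (rule someI[of "\<lambda>ys. mset ys = mset xs"], simp)

section \<open>Linearity of the symmetrisation and its vanishing on relations\<close>

lemma T_superset:
  assumes "finite S" "Poly_Mapping.keys f \<subseteq> S"
  shows "T f h = (\<Sum>M\<in>S. Poly_Mapping.lookup f M * tens (SOME xs. mset xs = M) h)"
  unfolding T_def by (rule sum.mono_neutral_left) (use assms in \<open>auto simp: in_keys_iff\<close>)

lemma T_add: "T (f + g) h = T f h + T g h"
proof -
  let ?S = "Poly_Mapping.keys f \<union> Poly_Mapping.keys g"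
  have "Poly_Mapping.keys (f + g) \<subseteq> ?S" by (rule Poly_Mapping.keys_add)
  then show ?thesis
    by (simp add: T_superset[of ?S] lookup_add distrib_right sum.distrib)
qed

lemma T_scl: "T (scl c f) h = c * T f h"
proof -
  have "Poly_Mapping.keys (scl c f) \<subseteq> Poly_Mapping.keys f"
    by (auto simp: in_keys_iff lookup_scl)
  then show ?thesis
    by (simp add: T_superset[of "Poly_Mapping.keys f"] lookup_scl sum_distrib_left mult.assoc)
qed

lemma T_zero [simp]: "T 0 h = 0"
  by (simp add: T_def)

lemma T_diff: "T (f - g) h = T f h - T g h"
  using T_add[of "f - g" g h] by simp

lemma T_sum: "T (\<Sum>a\<in>A. f a) h = (\<Sum>a\<in>A. T (f a) h)"
  by (induction A rule: infinite_finite_induct) (simp_all add: T_add)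

lemma T_formal [simp]: "T (formal_prod (mset xs)) h = tens xs h"
  by (simp add: T_def tens_some)

text \<open>Isolates the one factor that contains \<open>X\<close>, in slot
  \<open>pinv \<pi> 0\<close>; the remaining product does not involve \<open>X\<close>, which makes
  linearity in the head visible.\<close>

lemma tens_Cons:
  "tens (X # xs) h = (\<Sum>\<pi> | \<pi> permutes {..<Suc (length xs)}.
     L X (h (pinv \<pi> 0, False)) (h (pinv \<pi> 0, True)) *
     (\<Prod>k\<in>{..<Suc (length xs)} - {pinv \<pi> 0}. L (xs ! (\<pi> k - 1)) (h (k, False)) (h (k, True))))"
  unfolding tens_def length_Cons
proof (rule sum.cong[OF refl])
  fix \<pi> assume "\<pi> \<in> {\<pi>. \<pi> permutes {..<Suc (length xs)}}"
  then have p: "\<pi> permutes {..<Suc (length xs)}" by simp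
  have k0: "pinv \<pi> 0 \<in> {..<Suc (length xs)}"
    using permutes_in_image[OF permutes_inv[OF p], of 0] by simp
  have "(X # xs) ! \<pi> (pinv \<pi> 0) = X" using p by (simp add: permutes_inverses)
  moreover have "(X # xs) ! \<pi> k = xs ! (\<pi> k - 1)" if "k \<noteq> pinv \<pi> 0" for k
    using that p by (metis nth_Cons' permutes_inverses(2))
  ultimately show "(\<Prod>k<Suc (length xs). L ((X # xs) ! \<pi> k) (h (k, False)) (h (k, True))) =
     L X (h (pinv \<pi> 0, False)) (h (pinv \<pi> 0, True)) *
     (\<Prod>k\<in>{..<Suc (length xs)} - {pinv \<pi> 0}. L (xs ! (\<pi> k - 1)) (h (k, False)) (h (k, True)))"
    using k0 by (subst prod.remove[OF _ k0]) (auto intro!: prod.cong)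
qed

lemma pinv_zero_lt: "\<pi> permutes {..<Suc n} \<Longrightarrow> pinv \<pi> 0 < Suc n"
  using permutes_in_image[OF permutes_inv, of \<pi> "{..<Suc n}" 0] by simp

text \<open>By linearity of \<open>T\<close> it suffices to check the generating relations, which
  follow from linearity of \<open>tens\<close> in the head of the list. The word must take values in
  \<open>H\<close> because \<open>L\<close> is linear only there.\<close>

lemma T_sym_rel:
  assumes f: "f \<in> sym_rel d V" and h: "h \<in> pts d \<rightarrow> H"
  shows "T f h = 0"
proof -
  have sub: "scl.subspace {f. T f h = 0}"
    by (rule scl.subspaceI) (simp_all add: T_add T_scl)
  have 1: "formal_prod (add_mset (X + Y) M) - formal_prod (add_mset X M) - formal_prod (add_mset Y M)
        \<in> {f. T f h = 0}"
    if XY: "X \<in> V" "Y \<in> V" "set_mset M \<subseteq> V" "Suc (size M) = d" for X Y M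
  proof -
    obtain xs where xs: "mset xs = M" using ex_mset by blast
    have "tens ((X + Y) # xs) h = tens (X # xs) h + tens (Y # xs) h"
      unfolding tens_Cons sum.distrib[symmetric]
    proof (rule sum.cong[OF refl])
      fix \<pi> assume "\<pi> \<in> {\<pi>. \<pi> permutes {..<Suc (length xs)}}"
      then have "pinv \<pi> 0 < d" using pinv_zero_lt XY xs by auto
      then have "L (X + Y) (h (pinv \<pi> 0, False)) (h (pinv \<pi> 0, True)) =
        L X (h (pinv \<pi> 0, False)) (h (pinv \<pi> 0, True)) + L Y (h (pinv \<pi> 0, False)) (h (pinv \<pi> 0, True))"
        using XY h by (intro L_add) auto
      then show "L (X + Y) (h (pinv \<pi> 0, False)) (h (pinv \<pi> 0, True)) *
         (\<Prod>k\<in>{..<Suc (length xs)} - {pinv \<pi> 0}. L (xs ! (\<pi> k - 1)) (h (k, False)) (h (k, True))) =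
         L X (h (pinv \<pi> 0, False)) (h (pinv \<pi> 0, True)) *
         (\<Prod>k\<in>{..<Suc (length xs)} - {pinv \<pi> 0}. L (xs ! (\<pi> k - 1)) (h (k, False)) (h (k, True))) +
         L Y (h (pinv \<pi> 0, False)) (h (pinv \<pi> 0, True)) *
         (\<Prod>k\<in>{..<Suc (length xs)} - {pinv \<pi> 0}. L (xs ! (\<pi> k - 1)) (h (k, False)) (h (k, True)))"
        by (simp add: distrib_right)
    qed
    then show ?thesis
      using T_formal[of "_ # xs" h] xs by (simp add: T_diff)
  qed
  have 2: "formal_prod (add_mset (c \<cdot>\<^sub>m X) M) - scl c (formal_prod (add_mset X M)) \<in> {f. T f h = 0}"
    if X: "X \<in> V" "set_mset M \<subseteq> V" "Suc (size M) = d" for c X M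
  proof -
    obtain xs where xs: "mset xs = M" using ex_mset by blast
    have "tens ((c \<cdot>\<^sub>m X) # xs) h = c * tens (X # xs) h"
      unfolding tens_Cons sum_distrib_left
    proof (rule sum.cong[OF refl])
      fix \<pi> assume "\<pi> \<in> {\<pi>. \<pi> permutes {..<Suc (length xs)}}"
      then have "pinv \<pi> 0 < d" using pinv_zero_lt X xs by auto
      then have "L (c \<cdot>\<^sub>m X) (h (pinv \<pi> 0, False)) (h (pinv \<pi> 0, True)) =
        c * L X (h (pinv \<pi> 0, False)) (h (pinv \<pi> 0, True))"
        using X h by (intro L_smult) auto
      then show "L (c \<cdot>\<^sub>m X) (h (pinv \<pi> 0, False)) (h (pinv \<pi> 0, True)) *
         (\<Prod>k\<in>{..<Suc (length xs)} - {pinv \<pi> 0}. L (xs ! (\<pi> k - 1)) (h (k, False)) (h (k, True))) =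
         c * (L X (h (pinv \<pi> 0, False)) (h (pinv \<pi> 0, True)) *
         (\<Prod>k\<in>{..<Suc (length xs)} - {pinv \<pi> 0}. L (xs ! (\<pi> k - 1)) (h (k, False)) (h (k, True))))"
        by simp
    qed
    then show ?thesis
      using T_formal[of "_ # xs" h] xs by (simp add: T_diff T_scl)
  qed
  have "sym_rel d V \<subseteq> {f. T f h = 0}"
    unfolding sym_rel_def by (rule scl.span_minimal[OF _ sub]) (use 1 2 in blast)
  then show ?thesis using f by blast
qed

text \<open>Induction on the index set: subtracting the term of one index from \<open>X\<close>
  leaves a matrix of \<open>V\<close> with a shorter expansion, and injectivity of \<open>L\<close>
  identifies the sums.\<close>

lemma formal_prod_linear_comb:
  assumes A: "finite A" "\<And>a. a \<in> A \<Longrightarrow> E a \<in> V" and M: "set_mset M \<subseteq> V" "Suc (size M) = d"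
    and X: "X \<in> V" "\<And>u v. u \<in> H \<Longrightarrow> v \<in> H \<Longrightarrow> L X u v = (\<Sum>a\<in>A. x a * L (E a) u v)"
  shows "formal_prod (add_mset X M) - (\<Sum>a\<in>A. scl (x a) (formal_prod (add_mset (E a) M))) \<in> sym_rel d V"
  using A X
proof (induction A arbitrary: X rule: finite_induct)
  case empty
  \<comment> \<open>All coordinates vanish, so \<open>L\<close> cannot distinguish \<open>X\<close>
    from its zero multiple, and the homogeneity relation with scalar 0 applies.\<close>
  have "X = 0 \<cdot>\<^sub>m X"
    using empty by (intro L_inj V_smult) (auto simp: L_smult)
  then show ?case
    using sym_rel_smult[OF empty(2) M, of 0] by simp
next
  case (insert a A)
  define X' where "X' = X + (- x a) \<cdot>\<^sub>m E a"
  have Ea: "E a \<in> V" using insert.prems by simp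
  have X': "X' \<in> V" unfolding X'_def using insert.prems Ea by (intro V_add V_smult)
  have LX': "L X' u v = (\<Sum>a\<in>A. x a * L (E a) u v)" if "u \<in> H" "v \<in> H" for u v
    using that insert Ea unfolding X'_def by (subst L_add) (simp_all add: V_smult L_smult)
  have "X = X' + x a \<cdot>\<^sub>m E a"
    using X' Ea insert.prems insert.hyps LX'
    by (intro L_inj V_add V_smult) (auto simp: L_add L_smult V_smult)
  then have 1: "formal_prod (add_mset X M) - formal_prod (add_mset X' M) - formal_prod (add_mset (x a \<cdot>\<^sub>m E a) M)
      \<in> sym_rel d V"
    using sym_rel_add[OF X' V_smult[OF Ea] M] by simp
  have 2: "formal_prod (add_mset (x a \<cdot>\<^sub>m E a) M) - scl (x a) (formal_prod (add_mset (E a) M)) \<in> sym_rel d V"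
    by (rule sym_rel_smult[OF Ea M])
  have 3: "formal_prod (add_mset X' M) - (\<Sum>a\<in>A. scl (x a) (formal_prod (add_mset (E a) M))) \<in> sym_rel d V"
    using insert.IH[OF _ X' LX'] insert.prems by simp
  show ?case
    using scl.subspace_add[OF sym_rel_subspace scl.subspace_add[OF sym_rel_subspace 1 2] 3] insert.hyps
    by (simp add: algebra_simps)
qed

text \<open>The factors are expanded one at a time. \<open>M\<close> must be arbitrary in the
  induction: the last factor is parked there while the first \<open>m\<close> are expanded.\<close>

lemma formal_prod_expand:
  assumes A: "finite A" "\<And>a. a \<in> A \<Longrightarrow> E a \<in> V"
    and X: "\<And>k. k < m \<Longrightarrow> X k \<in> V"
      "\<And>k u v. k < m \<Longrightarrow> u \<in> H \<Longrightarrow> v \<in> H \<Longrightarrow> L (X k) u v = (\<Sum>a\<in>A. x k a * L (E a) u v)"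
    and M: "set_mset M \<subseteq> V" "size M + m = d"
  shows "formal_prod (mset (map X [0..<m]) + M) - (\<Sum>J\<in>PiE {..<m} (\<lambda>_. A).
     scl (\<Prod>k<m. x k (J k)) (formal_prod (mset (map (\<lambda>k. E (J k)) [0..<m]) + M))) \<in> sym_rel d V"
  using X M
proof (induction m arbitrary: M)
  case 0
  show ?case using scl.subspace_0[OF sym_rel_subspace[of d V]] by simp
next
  case (Suc m)
  let ?E = "\<lambda>J. mset (map (\<lambda>k. E (J k)) [0..<m])"
  have 1: "formal_prod (mset (map X [0..<m]) + add_mset (X m) M) - (\<Sum>J\<in>PiE {..<m} (\<lambda>_. A).
     scl (\<Prod>k<m. x k (J k)) (formal_prod (?E J + add_mset (X m) M))) \<in> sym_rel d V"
    using Suc.prems by (intro Suc.IH) auto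
  have 2: "(\<Sum>J\<in>PiE {..<m} (\<lambda>_. A). scl (\<Prod>k<m. x k (J k))
     (formal_prod (?E J + add_mset (X m) M) - (\<Sum>a\<in>A. scl (x m a) (formal_prod (?E J + add_mset (E a) M))))) \<in> sym_rel d V"
  proof (intro scl.subspace_sum[OF sym_rel_subspace] scl.subspace_scale[OF sym_rel_subspace])
    fix J assume J: "J \<in> PiE {..<m} (\<lambda>_. A)"
    have "formal_prod (add_mset (X m) (?E J + M)) - (\<Sum>a\<in>A. scl (x m a) (formal_prod (add_mset (E a) (?E J + M)))) \<in> sym_rel d V"
      using Suc.prems A J by (intro formal_prod_linear_comb) (auto simp: PiE_iff)
    then show "formal_prod (?E J + add_mset (X m) M) - (\<Sum>a\<in>A. scl (x m a) (formal_prod (?E J + add_mset (E a) M))) \<in> sym_rel d V"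
      by simp
  qed
  have "(\<Sum>J\<in>PiE {..<Suc m} (\<lambda>_. A). scl (\<Prod>k<Suc m. x k (J k)) (formal_prod (mset (map (\<lambda>k. E (J k)) [0..<Suc m]) + M))) =
    (\<Sum>(a, J)\<in>A \<times> PiE {..<m} (\<lambda>_. A). scl ((\<Prod>k<m. x k (J k)) * x m a) (formal_prod (?E J + add_mset (E a) M)))"
  proof -
    have p: "(\<Prod>k<Suc m. x k ((J(m := a)) k)) = (\<Prod>k<m. x k (J k)) * x m a" for J a
    proof -
      have "(\<Prod>k<m. x k ((J(m := a)) k)) = (\<Prod>k<m. x k (J k))"
        by (rule prod.cong) auto
      then show ?thesis by (simp only: prod.lessThan_Suc fun_upd_same)
    qed
    have e: "mset (map (\<lambda>k. E ((J(m := a)) k)) [0..<Suc m]) + M = ?E J + add_mset (E a) M" for J a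
    proof -
      have "map (\<lambda>k. E ((J(m := a)) k)) [0..<m] = map (\<lambda>k. E (J k)) [0..<m]"
        by (rule map_cong) auto
      moreover have "[0..<Suc m] = [0..<m] @ [m]" by simp
      ultimately show ?thesis by (simp only: map_append mset_append list.map mset.simps fun_upd_same) simp
    qed
    show ?thesis unfolding sum_PiE_Suc p e ..
  qed
  also have "\<dots> = (\<Sum>J\<in>PiE {..<m} (\<lambda>_. A). \<Sum>a\<in>A. scl ((\<Prod>k<m. x k (J k)) * x m a) (formal_prod (?E J + add_mset (E a) M)))"
    unfolding sum.cartesian_product[symmetric] by (rule sum.swap)
  also have "\<dots> = (\<Sum>J\<in>PiE {..<m} (\<lambda>_. A). scl (\<Prod>k<m. x k (J k)) (\<Sum>a\<in>A. scl (x m a) (formal_prod (?E J + add_mset (E a) M))))"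
    by (simp only: scl.scale_sum_right scl.scale_scale)
  finally have eq: "(\<Sum>J\<in>PiE {..<Suc m} (\<lambda>_. A). scl (\<Prod>k<Suc m. x k (J k)) (formal_prod (mset (map (\<lambda>k. E (J k)) [0..<Suc m]) + M))) = \<dots>" .
  have "mset (map X [0..<Suc m]) + M = mset (map X [0..<m]) + add_mset (X m) M" by simp
  then show ?case
    using scl.subspace_add[OF sym_rel_subspace 1 2] unfolding eq scl.scale_right_diff_distrib sum_subtractf
    by (simp only: diff_add_eq diff_add_cancel add_diff_eq add_diff_cancel_right')
qed

text \<open>Coordinates of the unit tensor at \<open>ab\<close> after the projection (id + eps
  flip)/2 onto tensors of symmetry \<open>eps\<close>, cut down to the support
  \<open>R0\<close>.\<close>

definition proj :: "'h \<times> 'h \<Rightarrow> 'h \<Rightarrow> 'h \<Rightarrow> complex" where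
  "proj ab u v = (if R0 u v then of_bool (ab = (u, v)) * half + of_bool (ab = (v, u)) * (eps * half) else 0)"

lemma R0_comm: "R0 b a \<longleftrightarrow> R0 a b"
  by (rule iffI) (erule R0_sym)+

lemma proj_commute: "proj ab v u = eps * proj ab u v"
proof -
  have "eps * (x * half + y * (eps * half)) = y * ((eps * eps) * half) + x * (eps * half)" for x y
    by (simp only: distrib_left mult.assoc mult.left_commute add.commute)
  then show ?thesis
    unfolding proj_def R0_comm[of v u] eps by (cases "R0 u v") (simp_all only: if_True if_False mult_1_left mult_zero_right)
qed

text \<open>A spanning family of \<open>V\<close> rather than a basis: \<open>E (b, a)\<close> is
  \<open>eps\<close> times \<open>E (a, b)\<close> for letters in \<open>H\<close>.\<close>

definition E :: "'h \<times> 'h \<Rightarrow> complex mat" where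
  "E ab = (SOME X. X \<in> V \<and> (\<forall>u\<in>H. \<forall>v\<in>H. L X u v = proj ab u v))"

lemma E: "E ab \<in> V" "u \<in> H \<Longrightarrow> v \<in> H \<Longrightarrow> L (E ab) u v = proj ab u v"
proof -
  have "\<exists>X\<in>V. \<forall>u\<in>H. \<forall>v\<in>H. L X u v = proj ab u v"
    by (rule L_surj[OF proj_commute]) (simp add: proj_def)
  then have "E ab \<in> V \<and> (\<forall>u\<in>H. \<forall>v\<in>H. L (E ab) u v = proj ab u v)"
    unfolding E_def using someI_ex[of "\<lambda>X. X \<in> V \<and> (\<forall>u\<in>H. \<forall>v\<in>H. L X u v = proj ab u v)"] by blast
  then show "E ab \<in> V" "u \<in> H \<Longrightarrow> v \<in> H \<Longrightarrow> L (E ab) u v = proj ab u v" by auto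
qed

text \<open>\<open>X\<close> already has the symmetry and the support, so the projector fixes it:
  half comes from the index \<open>(u, v)\<close> and half, by \<open>L_sym\<close>, from
  \<open>(v, u)\<close>.\<close>

lemma L_expand:
  assumes X: "X \<in> V" and uv: "u \<in> H" "v \<in> H"
  shows "L X u v = (\<Sum>ab\<in>H \<times> H. L X (fst ab) (snd ab) * L (E ab) u v)"
proof (cases "R0 u v")
  case False
  then show ?thesis using assms by (simp add: E proj_def L_supp)
next
  case True
  have *: "(\<Sum>ab\<in>H \<times> H. g ab * of_bool (ab = z)) = g z" if "z \<in> H \<times> H" for z and g :: "'h \<times> 'h \<Rightarrow> complex"
    using that finite_H by (simp add: of_bool_def if_distrib sum.delta cong: if_cong)
  have "(\<Sum>ab\<in>H \<times> H. L X (fst ab) (snd ab) * L (E ab) u v) =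
     (\<Sum>ab\<in>H \<times> H. L X (fst ab) (snd ab) * of_bool (ab = (u, v))) * half +
     (\<Sum>ab\<in>H \<times> H. L X (fst ab) (snd ab) * of_bool (ab = (v, u))) * (eps * half)"
    unfolding sum_distrib_right sum.distrib[symmetric] E(2)[OF uv] proj_def if_P[OF True]
    by (simp only: distrib_left mult.assoc)
  also have "\<dots> = L X u v * half + L X v u * (eps * half)"
    using uv by (simp only: * SigmaI fst_conv snd_conv)
  also have "\<dots> = L X u v * half + (eps * eps) * (L X u v * half)"
    unfolding L_sym[OF X uv] by (simp only: mult.assoc mult.left_commute)
  also have "\<dots> = L X u v * (half + half)"
    unfolding eps by (simp only: distrib_left mult_1_left)
  finally show ?thesis unfolding half_add_half by simp
qed

text \<open>Writes a tensor in the matrices \<open>E\<close>; on symmetric tensors this inverts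
  \<open>T\<close> up to the factor d!.\<close>

definition section_map :: "((nat \<times> bool \<Rightarrow> 'h) \<Rightarrow> complex) \<Rightarrow> complex mat multiset \<Rightarrow>\<^sub>0 complex" where
  "section_map t = (\<Sum>J\<in>PiE {..<d} (\<lambda>_. H \<times> H).
     scl (t (pair_word J)) (formal_prod (mset (map (\<lambda>k. E (J k)) [0..<d]))))"

lemma section_map_sym_free: "section_map t \<in> sym_free d V"
proof -
  have "formal_prod (mset (map (\<lambda>k. E (J k)) [0..<d])) \<in> sym_free d V" for J
    unfolding formal_prod_sym_free using E(1) by (simp add: image_subset_iff)
  then show ?thesis unfolding section_map_def
    by (intro scl.subspace_sum[OF sym_free_subspace] scl.subspace_scale[OF sym_free_subspace])
qed

lemma section_map_add: "section_map (\<lambda>h. t h + t' h) = section_map t + section_map t'"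
  by (simp add: section_map_def scl.scale_left_distrib sum.distrib)

lemma section_map_scale: "section_map (\<lambda>h. c * t h) = scl c (section_map t)"
  by (simp add: section_map_def scl.scale_sum_right)

lemma section_map_sum: "section_map (\<lambda>h. \<Sum>a\<in>A. t a h) = (\<Sum>a\<in>A. section_map (t a))"
  by (induction A rule: infinite_finite_induct) (simp_all add: section_map_add, simp_all add: section_map_def)

text \<open>Each permutation in \<open>tens xs\<close> expands the same commutative product, so
  modulo the relations the d! summands give d! copies of it.\<close>

lemma section_map_tens:
  assumes xs: "set xs \<subseteq> V" "length xs = d"
  shows "scl (fact d) (formal_prod (mset xs)) - section_map (tens xs) \<in> sym_rel d V"
proof -
  let ?P = "{\<pi>. \<pi> permutes {..<d}}"
  have *: "formal_prod (mset xs) - section_map (\<lambda>h. \<Prod>k<d. L (xs ! \<pi> k) (h (k, False)) (h (k, True))) \<in> sym_rel d V"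
    if \<pi>: "\<pi> permutes {..<d}" for \<pi>
  proof -
    have lt: "\<pi> k < d" if "k < d" for k using that permutes_in_image[OF \<pi>, of k] by simp
    have "formal_prod (mset (map (\<lambda>k. xs ! \<pi> k) [0..<d]) + {#}) - (\<Sum>J\<in>PiE {..<d} (\<lambda>_. H \<times> H).
     scl (\<Prod>k<d. L (xs ! \<pi> k) (fst (J k)) (snd (J k))) (formal_prod (mset (map (\<lambda>k. E (J k)) [0..<d]) + {#}))) \<in> sym_rel d V"
    proof (rule formal_prod_expand)
      show "finite (H \<times> H)" using finite_H by simp
      show "E a \<in> V" for a by (rule E)
      show V: "xs ! \<pi> k \<in> V" if "k < d" for k
        using lt[OF that] xs by (metis nth_mem subsetD)
      show "L (xs ! \<pi> k) u v = (\<Sum>a\<in>H \<times> H. L (xs ! \<pi> k) (fst a) (snd a) * L (E a) u v)"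
        if "k < d" "u \<in> H" "v \<in> H" for k u v
        by (rule L_expand[OF V[OF that(1)] that(2,3)])
    qed simp_all
    moreover have "mset (map (\<lambda>k. xs ! \<pi> k) [0..<d]) = mset xs"
    proof -
      have "map (\<lambda>k. xs ! \<pi> k) [0..<d] = permute_list \<pi> xs" by (simp add: permute_list_def xs)
      then show ?thesis using \<pi> xs by (metis mset_permute_list)
    qed
    ultimately show ?thesis by (simp add: section_map_def pair_word_def)
  qed
  have "(\<Sum>\<pi>\<in>?P. formal_prod (mset xs) - section_map (\<lambda>h. \<Prod>k<d. L (xs ! \<pi> k) (h (k, False)) (h (k, True)))) \<in> sym_rel d V"
    by (rule scl.subspace_sum[OF sym_rel_subspace]) (use * in auto)
  moreover have "(\<Sum>\<pi>\<in>?P. formal_prod (mset xs)) = scl (fact d) (formal_prod (mset xs))"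
  proof -
    have "(\<Sum>\<pi>\<in>?P. formal_prod (mset xs)) = (\<Sum>\<pi>\<in>?P. scl 1 (formal_prod (mset xs)))" by simp
    also have "\<dots> = scl (\<Sum>\<pi>\<in>?P. 1) (formal_prod (mset xs))" by (rule scl.scale_sum_left[symmetric])
    also have "(\<Sum>\<pi>\<in>?P. 1) = (fact d :: complex)" by (simp add: card_permutations)
    finally show ?thesis .
  qed
  ultimately show ?thesis
    unfolding tens_def xs(2) by (simp add: section_map_sum sum_subtractf)
qed

lemma section_map_T:
  assumes f: "f \<in> sym_free d V"
  shows "scl (fact d) f - section_map (T f) \<in> sym_rel d V"
proof -
  let ?xs = "\<lambda>M. SOME xs. mset xs = M"
  have xs: "mset (?xs M) = M" for M :: "complex mat multiset" by (rule someI_ex) (rule ex_mset)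
  have "(\<Sum>M\<in>Poly_Mapping.keys f. scl (Poly_Mapping.lookup f M)
     (scl (fact d) (formal_prod (mset (?xs M))) - section_map (tens (?xs M)))) \<in> sym_rel d V"
  proof (intro scl.subspace_sum[OF sym_rel_subspace] scl.subspace_scale[OF sym_rel_subspace] section_map_tens)
    fix M assume "M \<in> Poly_Mapping.keys f"
    then have "size M = d \<and> set_mset M \<subseteq> V" using f by (auto simp: sym_free_def)
    then show "set (?xs M) \<subseteq> V" "length (?xs M) = d"
      using xs[of M] by (metis set_mset_mset, metis size_mset)
  qed
  also have "(\<Sum>M\<in>Poly_Mapping.keys f. scl (Poly_Mapping.lookup f M)
     (scl (fact d) (formal_prod (mset (?xs M))) - section_map (tens (?xs M)))) =
     scl (fact d) (\<Sum>M\<in>Poly_Mapping.keys f. scl (Poly_Mapping.lookup f M) (formal_prod M)) -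
     section_map (\<lambda>h. \<Sum>M\<in>Poly_Mapping.keys f. Poly_Mapping.lookup f M * tens (?xs M) h)"
    by (simp add: xs section_map_sum section_map_scale scl.scale_right_diff_distrib sum_subtractf scl.scale_sum_right mult.commute)
  also have "\<dots> = scl (fact d) f - section_map (T f)"
    unfolding sum_single_keys[symmetric] T_def ..
  finally show ?thesis .
qed

text \<open>If \<open>T f\<close> vanishes on words in \<open>H\<close>, its section is 0, and
  \<open>section_map_T\<close> puts d! times \<open>f\<close> among the relations; over the complex
  numbers d! can be divided out.\<close>

lemma kernel_T:
  assumes f: "f \<in> sym_free d V" and z: "\<And>h. h \<in> pts d \<rightarrow> H \<Longrightarrow> T f h = 0"
  shows "f \<in> sym_rel d V"
proof -
  have "section_map (T f) = 0"
    unfolding section_map_def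
    by (rule sum.neutral) (simp add: z[OF pair_word_Pi])
  then have "scl (fact d) f \<in> sym_rel d V"
    using section_map_T[OF f] by simp
  from scl.subspace_scale[OF sym_rel_subspace this, of "1 / fact d"] show ?thesis by simp
qed

text \<open>Hides the choice of orderings, so that statements about \<open>tens\<close> carry over
  to \<open>T\<close> by linearity.\<close>

lemma T_in_terms_of_lists:
  assumes "f \<in> sym_free d V"
  shows "\<exists>c xs. (\<forall>M\<in>Poly_Mapping.keys f. set (xs M) \<subseteq> V \<and> length (xs M) = d) \<and>
    (\<forall>h. T f h = (\<Sum>M\<in>Poly_Mapping.keys f. c M * tens (xs M) h))"
proof (intro exI conjI ballI allI)
  let ?xs = "\<lambda>M. SOME xs. mset xs = M"
  fix M assume that: "M \<in> Poly_Mapping.keys f"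
  show "set (?xs M) \<subseteq> V" "length (?xs M) = d"
  proof -
    have "mset (?xs M) = M" by (rule someI_ex) (rule ex_mset)
    moreover have "size M = d \<and> set_mset M \<subseteq> V" using assms that by (auto simp: sym_free_def)
    ultimately show "set (?xs M) \<subseteq> V" "length (?xs M) = d"
      by (metis set_mset_mset, metis size_mset)
  qed
next
  let ?xs = "\<lambda>M. SOME xs. mset xs = M"
  show "T f h = (\<Sum>M\<in>Poly_Mapping.keys f. Poly_Mapping.lookup f M * tens (?xs M) h)" for h
    by (simp add: T_def)
qed

section \<open>Symmetry and support of the symmetrised tensors\<close>

lemma nth_perm_in_V:
  assumes "set xs \<subseteq> V" "length xs = d" "\<pi> permutes {..<d}" "k < d"
  shows "xs ! \<pi> k \<in> V"
  using assms permutes_in_image[of \<pi> "{..<d}" k] by (metis lessThan_iff nth_mem subsetD)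

text \<open>Composing with \<open>\<eta>\<close> permutes the edges and reverses some of them. The
  permutation is absorbed in the sum over \<open>\<pi>\<close>, and each reversal costs one factor
  \<open>eps\<close> by \<open>L_sym\<close>.\<close>

lemma tens_hyperoct:
  assumes xs: "set xs \<subseteq> V" "length xs = d" and h: "h \<in> pts d \<rightarrow> H" and \<eta>: "\<eta> \<in> hyperoct d"
  shows "tens xs (h \<circ> \<eta>) = flip_sign d eps \<eta> * tens xs h"
proof -
  define \<kappa> where "\<kappa> k = fst (\<eta> (k, False))" for k
  have \<kappa>: "\<kappa> permutes {..<d}" unfolding \<kappa>_def by (rule hyperoct_fst_permutes[OF \<eta>])
  have hH: "h (k, s) \<in> H" if "k < d" for k s using h that by (auto simp: Pi_iff)
  have \<kappa>lt: "\<kappa> k < d" if "k < d" for k using that permutes_in_image[OF \<kappa>, of k] by simp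
  have 1: "L X ((h \<circ> \<eta>) (k, False)) ((h \<circ> \<eta>) (k, True)) =
     (if snd (\<eta> (k, False)) then eps else 1) * L X (h (\<kappa> k, False)) (h (\<kappa> k, True))"
    if "X \<in> V" "k < d" for X k
  proof (cases "snd (\<eta> (k, False))")
    case True
    then have "\<eta> (k, False) = (\<kappa> k, True)" "\<eta> (k, True) = (\<kappa> k, False)"
      using hyperoct_fst(1)[OF \<eta>, of k True] hyperoct_fst(2)[OF \<eta>, of k] by (simp_all add: \<kappa>_def prod_eq_iff)
    moreover have "L X (h (\<kappa> k, True)) (h (\<kappa> k, False)) = eps * L X (h (\<kappa> k, False)) (h (\<kappa> k, True))"
      by (rule L_sym[OF that(1) hH[OF \<kappa>lt[OF that(2)]] hH[OF \<kappa>lt[OF that(2)]]])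
    ultimately show ?thesis using True by simp
  next
    case False
    then have "\<eta> (k, False) = (\<kappa> k, False)" "\<eta> (k, True) = (\<kappa> k, True)"
      using hyperoct_fst(1)[OF \<eta>, of k True] hyperoct_fst(2)[OF \<eta>, of k] by (simp_all add: \<kappa>_def prod_eq_iff)
    then show ?thesis using False by simp
  qed
  have 2: "(\<Prod>k<d. L (xs ! \<pi> k) ((h \<circ> \<eta>) (k, False)) ((h \<circ> \<eta>) (k, True))) =
     flip_sign d eps \<eta> * (\<Prod>k<d. L (xs ! \<pi> k) (h (\<kappa> k, False)) (h (\<kappa> k, True)))" if "\<pi> permutes {..<d}" for \<pi>
    unfolding flip_sign_def prod.distrib[symmetric]
  proof (rule prod.cong[OF refl])
    fix k assume "k \<in> {..<d}"
    then have "k < d" by simp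
    from 1[OF nth_perm_in_V[OF xs that this] this]
    show "L (xs ! \<pi> k) ((h \<circ> \<eta>) (k, False)) ((h \<circ> \<eta>) (k, True)) =
      (if snd (\<eta> (k, False)) then eps else 1) * L (xs ! \<pi> k) (h (\<kappa> k, False)) (h (\<kappa> k, True))" .
  qed
  have "tens xs (h \<circ> \<eta>) = flip_sign d eps \<eta> *
     (\<Sum>\<pi> | \<pi> permutes {..<d}. \<Prod>k<d. L (xs ! \<pi> k) (h (\<kappa> k, False)) (h (\<kappa> k, True)))"
    unfolding tens_def xs(2) sum_distrib_left by (rule sum.cong) (use 2 in auto)
  also have "(\<Sum>\<pi> | \<pi> permutes {..<d}. \<Prod>k<d. L (xs ! \<pi> k) (h (\<kappa> k, False)) (h (\<kappa> k, True))) =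
    (\<Sum>\<pi> | \<pi> permutes {..<d}. \<Prod>k<d. L (xs ! (\<pi> \<circ> \<kappa>) k) (h (\<kappa> k, False)) (h (\<kappa> k, True)))"
    by (rule sum_permutations_compose_right[OF \<kappa>])
  also have "\<dots> = tens xs h"
    unfolding tens_def xs(2)
  proof (rule sum.cong[OF refl])
    fix \<pi>
    show "(\<Prod>k<d. L (xs ! (\<pi> \<circ> \<kappa>) k) (h (\<kappa> k, False)) (h (\<kappa> k, True))) =
      (\<Prod>k<d. L (xs ! \<pi> k) (h (k, False)) (h (k, True)))"
      using prod.permute[OF \<kappa>, of "\<lambda>k. L (xs ! \<pi> k) (h (k, False)) (h (k, True))"] by (simp add: o_def)
  qed
  finally show ?thesis .
qed

lemma T_hyperoct:
  assumes "f \<in> sym_free d V" "h \<in> pts d \<rightarrow> H" "\<eta> \<in> hyperoct d"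
  shows "T f (h \<circ> \<eta>) = flip_sign d eps \<eta> * T f h"
proof -
  obtain c xs where cxs: "(\<forall>M\<in>Poly_Mapping.keys f. set (xs M) \<subseteq> V \<and> length (xs M) = d) \<and>
    (\<forall>h. T f h = (\<Sum>M\<in>Poly_Mapping.keys f. c M * tens (xs M) h))"
    using T_in_terms_of_lists[OF assms(1)] by (elim exE) (rule that)
  note xs = conjunct1[OF cxs, rule_format] and T = conjunct2[OF cxs, rule_format]
  show ?thesis unfolding T sum_distrib_left
  proof (rule sum.cong[OF refl])
    fix M assume "M \<in> Poly_Mapping.keys f"
    from xs[OF this] have M: "set (xs M) \<subseteq> V" "length (xs M) = d" by simp_all
    show "c M * tens (xs M) (h \<circ> \<eta>) = flip_sign d eps \<eta> * (c M * tens (xs M) h)"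
      unfolding tens_hyperoct[OF M assms(2,3)] by simp
  qed
qed

lemma T_cong:
  assumes "f \<in> sym_free d V" "\<And>x. x \<in> pts d \<Longrightarrow> h x = h' x"
  shows "T f h = T f h'"
proof -
  obtain c xs where cxs: "(\<forall>M\<in>Poly_Mapping.keys f. set (xs M) \<subseteq> V \<and> length (xs M) = d) \<and>
    (\<forall>h. T f h = (\<Sum>M\<in>Poly_Mapping.keys f. c M * tens (xs M) h))"
    using T_in_terms_of_lists[OF assms(1)] by (elim exE) (rule that)
  note xs = conjunct1[OF cxs, rule_format] and T = conjunct2[OF cxs, rule_format]
  show ?thesis unfolding T
  proof (rule sum.cong[OF refl])
    fix M assume "M \<in> Poly_Mapping.keys f"
    from xs[OF this] have "length (xs M) = d" by simp
    then show "c M * tens (xs M) h = c M * tens (xs M) h'"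
      using assms(2) by (simp add: tens_def)
  qed
qed

lemma T_supp:
  assumes f: "f \<in> sym_free d V" and h: "h \<in> pts d \<rightarrow> H" and k: "k < d" "\<not> R0 (h (k, False)) (h (k, True))"
  shows "T f h = 0"
proof -
  obtain c xs where cxs: "(\<forall>M\<in>Poly_Mapping.keys f. set (xs M) \<subseteq> V \<and> length (xs M) = d) \<and>
    (\<forall>h. T f h = (\<Sum>M\<in>Poly_Mapping.keys f. c M * tens (xs M) h))"
    using T_in_terms_of_lists[OF f] by (elim exE) (rule that)
  note xs = conjunct1[OF cxs, rule_format] and T = conjunct2[OF cxs, rule_format]
  show ?thesis unfolding T
  proof (rule sum.neutral, rule ballI)
    fix M assume "M \<in> Poly_Mapping.keys f"
    from xs[OF this] have M: "set (xs M) \<subseteq> V" "length (xs M) = d" by simp_all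
    have hH: "h (k, s) \<in> H" for s using h k(1) by (auto simp: Pi_iff)
    have "(\<Prod>k<d. L (xs M ! \<pi> k) (h (k, False)) (h (k, True))) = 0" if "\<pi> permutes {..<d}" for \<pi>
      by (rule prod_zero) (use k L_supp[OF nth_perm_in_V[OF M that k(1)] hH hH] in auto)
    then show "c M * tens (xs M) h = 0"
      unfolding tens_def M(2) by (simp add: sum.neutral)
  qed
qed

text \<open>The product of the projectors averages over the 2^d ways of reversing edges. A reversal
  contributes \<open>eps\<close> from the projector and \<open>eps\<close> from \<open>t\<close>, so
  every term equals \<open>t h\<close> divided by 2^d.\<close>

lemma sum_proj:
  assumes h: "h \<in> pts d \<rightarrow> H"
    and sym: "\<And>\<eta>. \<eta> \<in> hyperoct d \<Longrightarrow> t (h \<circ> \<eta>) = flip_sign d eps \<eta> * t h"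
    and supp: "\<And>k. k < d \<Longrightarrow> \<not> R0 (h (k, False)) (h (k, True)) \<Longrightarrow> t h = 0"
    and cong: "\<And>h h'. (\<And>x. x \<in> pts d \<Longrightarrow> h x = h' x) \<Longrightarrow> t h = t h'"
  shows "(\<Sum>J\<in>PiE {..<d} (\<lambda>_. H \<times> H). t (pair_word J) * (\<Prod>k<d. proj (J k) (h (k, False)) (h (k, True)))) = t h"
proof (cases "\<forall>k<d. R0 (h (k, False)) (h (k, True))")
  case False
  then obtain k where k: "k < d" "\<not> R0 (h (k, False)) (h (k, True))" by blast
  have *: "(\<Prod>k<d. proj (J k) (h (k, False)) (h (k, True))) = 0" for J
    by (rule prod_zero[OF finite_lessThan bexI[of _ k]]) (simp_all add: k proj_def)
  show ?thesis unfolding supp[OF k] * by (simp only: mult_zero_right sum.neutral_const)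
next
  case True
  \<comment> \<open>\<open>fl k s\<close> is the pair of letters on edge \<open>k\<close>, read
    backwards if \<open>s\<close>; \<open>w s\<close> is its weight in the projector, and
    \<open>JS S\<close> the choice of pairs that results from reversing the edges in
    \<open>S\<close>.\<close>
  define fl where "fl k s = (h (k, s), h (k, \<not> s))" for k s
  define w where "w s = (if s then eps * half else half)" for s
  define JS where "JS S = restrict (\<lambda>k. fl k (S k)) {..<d}" for S
  let ?P = "PiE {..<d} (\<lambda>_. H \<times> H)" and ?S = "PiE {..<d} (\<lambda>_. UNIV :: bool set)"
  have finS: "finite ?S" by (rule finite_PiE) auto
  have finP: "finite ?P" by (rule finite_PiE) (use finite_H in auto)
  have proj: "proj ab (h (k, False)) (h (k, True)) = (\<Sum>s\<in>UNIV. of_bool (ab = fl k s) * w s)" if "k < d" for ab k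
  proof -
    have "R0 (h (k, False)) (h (k, True))" using True that by blast
    then show ?thesis
      unfolding proj_def fl_def w_def
      by (simp only: sum_UNIV_bool if_True if_False not_False_eq_True not_True_eq_False)
  qed
  have JS_mem: "JS S \<in> ?P" for S
    unfolding JS_def restrict_PiE_iff fl_def using h by (auto simp: Pi_iff)
  have "(\<Prod>k<d. proj (J k) (h (k, False)) (h (k, True))) = (\<Sum>S\<in>?S. of_bool (J = JS S) * (\<Prod>k<d. w (S k)))"
    if J: "J \<in> ?P" for J
  proof -
    have "(\<Prod>k<d. proj (J k) (h (k, False)) (h (k, True))) = (\<Prod>k<d. \<Sum>s\<in>UNIV. of_bool (J k = fl k s) * w s)"
      by (rule prod.cong) (auto simp: proj)
    also have "\<dots> = (\<Sum>S\<in>?S. \<Prod>k<d. of_bool (J k = fl k (S k)) * w (S k))"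
      by (rule prod_sum_PiE) auto
    also have "\<dots> = (\<Sum>S\<in>?S. of_bool (J = JS S) * (\<Prod>k<d. w (S k)))"
    proof (rule sum.cong[OF refl])
      fix S
      have "J = JS S \<longleftrightarrow> (\<forall>k<d. J k = fl k (S k))"
        using J by (auto simp: JS_def fun_eq_iff PiE_iff extensional_def)
      moreover have "(\<Prod>k<d. of_bool (J k = fl k (S k))) = (of_bool (\<forall>k<d. J k = fl k (S k)) :: complex)"
      proof (cases "\<forall>k<d. J k = fl k (S k)")
        case False
        then show ?thesis by (auto intro!: prod_zero)
      qed simp
      ultimately show "(\<Prod>k<d. of_bool (J k = fl k (S k)) * w (S k)) = of_bool (J = JS S) * (\<Prod>k<d. w (S k))"
        by (simp add: prod.distrib)
    qed
    finally show ?thesis .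
  qed
  then have "(\<Sum>J\<in>?P. t (pair_word J) * (\<Prod>k<d. proj (J k) (h (k, False)) (h (k, True)))) =
     (\<Sum>J\<in>?P. \<Sum>S\<in>?S. t (pair_word J) * (of_bool (J = JS S) * (\<Prod>k<d. w (S k))))"
    by (simp add: sum_distrib_left)
  also have "\<dots> = (\<Sum>S\<in>?S. \<Sum>J\<in>?P. t (pair_word J) * (of_bool (J = JS S) * (\<Prod>k<d. w (S k))))"
    by (rule sum.swap)
  also have "\<dots> = (\<Sum>S\<in>?S. t (pair_word (JS S)) * (\<Prod>k<d. w (S k)))"
  proof (rule sum.cong[OF refl])
    fix S
    have "(\<Sum>J\<in>?P. t (pair_word J) * (of_bool (J = JS S) * (\<Prod>k<d. w (S k)))) =
      (\<Sum>J\<in>?P. if J = JS S then t (pair_word J) * (\<Prod>k<d. w (S k)) else 0)"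
      by (rule sum.cong) auto
    then show "(\<Sum>J\<in>?P. t (pair_word J) * (of_bool (J = JS S) * (\<Prod>k<d. w (S k)))) =
      t (pair_word (JS S)) * (\<Prod>k<d. w (S k))"
      using JS_mem finP by simp
  qed
  also have "\<dots> = (\<Sum>S\<in>?S. (\<Prod>k<d. half) * t h)"
  proof (rule sum.cong[OF refl])
    fix S
    have "t (pair_word (JS S)) = t (h \<circ> flip_at d S)"
      by (rule cong) (auto simp: pair_word_def JS_def fl_def flip_at_def pts_def)
    also have "\<dots> = (\<Prod>k<d. if S k then eps else 1) * t h"
      using sym[OF flip_at_hyperoct] by (simp only: flip_sign_flip_at)
    finally have "t (pair_word (JS S)) * (\<Prod>k<d. w (S k)) = (\<Prod>k<d. (if S k then eps else 1) * w (S k)) * t h"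
      by (simp add: prod.distrib)
    also have "(\<Prod>k<d. (if S k then eps else 1) * w (S k)) = (\<Prod>k<d. half)"
    proof (rule prod.cong[OF refl])
      fix k
      have "eps * (eps * half) = (eps * eps) * half" by (simp only: mult.assoc)
      then show "(if S k then eps else 1) * w (S k) = half"
        unfolding w_def eps by simp
    qed
    finally show "t (pair_word (JS S)) * (\<Prod>k<d. w (S k)) = (\<Prod>k<d. half) * t h" .
  qed
  also have "\<dots> = (\<Prod>k<d. \<Sum>s\<in>(UNIV :: bool set). half) * t h"
    unfolding sum_distrib_right[symmetric] by (subst prod_sum_PiE) auto
  also have "\<dots> = t h"
    by (simp only: sum_UNIV_bool half_add_half prod.neutral_const mult_1_left)
  finally show ?thesis .
qed

text \<open>Every one of the d! orderings in \<open>tens\<close> reproduces \<open>t h\<close>, by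
  \<open>sum_proj\<close> after undoing the permutation of edges; a pure permutation of edges
  carries no sign.\<close>

lemma T_section_map:
  assumes h: "h \<in> pts d \<rightarrow> H"
    and sym: "\<And>\<eta> h. \<eta> \<in> hyperoct d \<Longrightarrow> h \<in> pts d \<rightarrow> H \<Longrightarrow> t (h \<circ> \<eta>) = flip_sign d eps \<eta> * t h"
    and supp: "\<And>k h. h \<in> pts d \<rightarrow> H \<Longrightarrow> k < d \<Longrightarrow> \<not> R0 (h (k, False)) (h (k, True)) \<Longrightarrow> t h = 0"
    and cong: "\<And>h h'. (\<And>x. x \<in> pts d \<Longrightarrow> h x = h' x) \<Longrightarrow> t h = t h'"
  shows "T (section_map t) h = fact d * t h"
proof -
  let ?P = "PiE {..<d} (\<lambda>_. H \<times> H)"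
  have hH: "h (k, s) \<in> H" if "k < d" for k s using h that by (auto simp: Pi_iff)
  have *: "(\<Sum>J\<in>?P. t (pair_word J) * (\<Prod>k<d. proj (J (\<pi> k)) (h (k, False)) (h (k, True)))) = t h"
    if \<pi>: "\<pi> permutes {..<d}" for \<pi>
  proof -
    let ?h = "h \<circ> perm_pairs (pinv \<pi>)"
    note hyp = perm_pairs_hyperoct[OF permutes_inv[OF \<pi>]]
    have h': "?h \<in> pts d \<rightarrow> H"
      using h hyp by (auto simp: hyperoct_def Pi_iff permutes_in_image)
    have "(\<Prod>k<d. proj (J (\<pi> k)) (h (k, False)) (h (k, True))) = (\<Prod>k<d. proj (J k) (?h (k, False)) (?h (k, True)))" for J
      using prod.permute[OF \<pi>, of "\<lambda>k. proj (J k) (?h (k, False)) (?h (k, True))"]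
      by (simp add: o_def perm_pairs_def permutes_inverses[OF \<pi>])
    then have "(\<Sum>J\<in>?P. t (pair_word J) * (\<Prod>k<d. proj (J (\<pi> k)) (h (k, False)) (h (k, True)))) =
      (\<Sum>J\<in>?P. t (pair_word J) * (\<Prod>k<d. proj (J k) (?h (k, False)) (?h (k, True))))" by (simp only:)
    also have "\<dots> = t ?h"
      by (rule sum_proj[OF h' sym[OF _ h'] supp[OF h'] cong])
    also have "\<dots> = t h"
      using sym[OF hyp h] by (simp add: flip_sign_perm_pairs)
    finally show ?thesis .
  qed
  have tens: "tens (map (\<lambda>k. E (J k)) [0..<d]) h = (\<Sum>\<pi> | \<pi> permutes {..<d}. \<Prod>k<d. proj (J (\<pi> k)) (h (k, False)) (h (k, True)))" for J
    unfolding tens_def length_map length_upt minus_nat.diff_0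
  proof (intro sum.cong prod.cong refl)
    fix \<pi> k assume "\<pi> \<in> {\<pi>. \<pi> permutes {..<d}}" "k \<in> {..<d}"
    then have "\<pi> k < d" "k < d" using permutes_in_image[of \<pi> "{..<d}" k] by auto
    then show "L (map (\<lambda>k. E (J k)) [0..<d] ! \<pi> k) (h (k, False)) (h (k, True)) = proj (J (\<pi> k)) (h (k, False)) (h (k, True))"
      by (simp add: E(2) hH)
  qed
  have "T (section_map t) h = (\<Sum>J\<in>?P. t (pair_word J) * tens (map (\<lambda>k. E (J k)) [0..<d]) h)"
    unfolding section_map_def T_sum T_scl T_formal ..
  also have "\<dots> = (\<Sum>\<pi> | \<pi> permutes {..<d}. \<Sum>J\<in>?P. t (pair_word J) * (\<Prod>k<d. proj (J (\<pi> k)) (h (k, False)) (h (k, True))))"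
    unfolding tens sum_distrib_left by (rule sum.swap)
  also have "\<dots> = (\<Sum>\<pi> | \<pi> permutes {..<d}. t h)"
    by (rule sum.cong[OF refl]) (simp only: mem_Collect_eq *)
  also have "\<dots> = fact d * t h"
    by (simp add: card_permutations)
  finally show ?thesis .
qed

section \<open>The action of the group on tensors\<close>

definition acts :: "complex mat \<Rightarrow> ('h \<Rightarrow> 'h \<Rightarrow> complex) \<Rightarrow> bool" where
  "acts k r \<longleftrightarrow> (\<forall>X\<in>V. Ad k X \<in> V \<and>
     (\<forall>a\<in>H. \<forall>b\<in>H. L (Ad k X) a b = (\<Sum>a'\<in>H. \<Sum>b'\<in>H. r a a' * r b b' * L X a' b')))"

lemma tens_act:
  assumes xs: "set xs \<subseteq> V" "length xs = d" and k: "acts k r" and h: "h \<in> pts d \<rightarrow> H"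
  shows "tens (map (Ad k) xs) h = (\<Sum>J\<in>PiE (pts d) (\<lambda>_. H). (\<Prod>x\<in>pts d. r (h x) (J x)) * tens xs J)"
proof -
  have hH: "h (k, s) \<in> H" if "k < d" for k s using h that by (auto simp: Pi_iff)
  have *: "(\<Prod>j<d. L (map (Ad k) xs ! \<pi> j) (h (j, False)) (h (j, True))) =
    (\<Sum>J\<in>PiE (pts d) (\<lambda>_. H). (\<Prod>x\<in>pts d. r (h x) (J x)) * (\<Prod>j<d. L (xs ! \<pi> j) (J (j, False)) (J (j, True))))"
    if \<pi>: "\<pi> permutes {..<d}" for \<pi>
  proof -
    have "(\<Prod>j<d. L (map (Ad k) xs ! \<pi> j) (h (j, False)) (h (j, True))) =
      (\<Prod>j<d. \<Sum>a\<in>H. \<Sum>b\<in>H. r (h (j, False)) a * r (h (j, True)) b * L (xs ! \<pi> j) a b)"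
    proof (rule prod.cong[OF refl])
      fix j assume "j \<in> {..<d}"
      then have j: "j < d" by simp
      have "\<pi> j < d" using j permutes_in_image[OF \<pi>, of j] by simp
      then have "map (Ad k) xs ! \<pi> j = Ad k (xs ! \<pi> j)" using xs by simp
      then show "L (map (Ad k) xs ! \<pi> j) (h (j, False)) (h (j, True)) =
        (\<Sum>a\<in>H. \<Sum>b\<in>H. r (h (j, False)) a * r (h (j, True)) b * L (xs ! \<pi> j) a b)"
        using k nth_perm_in_V[OF xs \<pi> j] hH[OF j] unfolding acts_def by simp
    qed
    also have "\<dots> = (\<Sum>J\<in>PiE (pts d) (\<lambda>_. H). \<Prod>j<d. r (h (j, False)) (J (j, False)) * r (h (j, True)) (J (j, True)) * L (xs ! \<pi> j) (J (j, False)) (J (j, True)))"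
      by (rule prod_sum_pairs[OF finite_H])
    also have "\<dots> = (\<Sum>J\<in>PiE (pts d) (\<lambda>_. H). (\<Prod>x\<in>pts d. r (h x) (J x)) * (\<Prod>j<d. L (xs ! \<pi> j) (J (j, False)) (J (j, True))))"
      unfolding prod_pts by (simp only: prod.distrib)
    finally show ?thesis .
  qed
  have "tens (map (Ad k) xs) h = (\<Sum>\<pi> | \<pi> permutes {..<d}. \<Sum>J\<in>PiE (pts d) (\<lambda>_. H). (\<Prod>x\<in>pts d. r (h x) (J x)) * (\<Prod>j<d. L (xs ! \<pi> j) (J (j, False)) (J (j, True))))"
    unfolding tens_def length_map xs(2) by (rule sum.cong[OF refl]) (simp only: mem_Collect_eq *)
  also have "\<dots> = (\<Sum>J\<in>PiE (pts d) (\<lambda>_. H). (\<Prod>x\<in>pts d. r (h x) (J x)) * tens xs J)"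
    unfolding tens_def xs(2) sum_distrib_left by (rule sum.swap)
  finally show ?thesis .
qed

lemma T_sym_act:
  assumes f: "f \<in> sym_free d V" and k: "acts k r" and h: "h \<in> pts d \<rightarrow> H"
  shows "T (sym_act k f) h = (\<Sum>J\<in>PiE (pts d) (\<lambda>_. H). (\<Prod>x\<in>pts d. r (h x) (J x)) * T f J)"
proof -
  let ?xs = "\<lambda>M. SOME xs. mset xs = M"
  have xs: "set (?xs M) \<subseteq> V" "length (?xs M) = d" "mset (?xs M) = M" if "M \<in> Poly_Mapping.keys f" for M
  proof -
    show e: "mset (?xs M) = M" by (rule someI_ex) (rule ex_mset)
    have "size M = d \<and> set_mset M \<subseteq> V" using f that by (auto simp: sym_free_def)
    then show "set (?xs M) \<subseteq> V" "length (?xs M) = d" using e by (metis set_mset_mset, metis size_mset)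
  qed
  have "T (sym_act k f) h = (\<Sum>M\<in>Poly_Mapping.keys f. Poly_Mapping.lookup f M * tens (map (Ad k) (?xs M)) h)"
    unfolding sym_act_def T_sum T_scl
  proof (rule sum.cong[OF refl])
    fix M assume "M \<in> Poly_Mapping.keys f"
    from xs(3)[OF this] have "image_mset (Ad k) M = mset (map (Ad k) (?xs M))" by simp
    then show "Poly_Mapping.lookup f M * T (formal_prod (image_mset (Ad k) M)) h =
      Poly_Mapping.lookup f M * tens (map (Ad k) (?xs M)) h" by (simp only: T_formal)
  qed
  also have "\<dots> = (\<Sum>M\<in>Poly_Mapping.keys f. \<Sum>J\<in>PiE (pts d) (\<lambda>_. H). (\<Prod>x\<in>pts d. r (h x) (J x)) * (Poly_Mapping.lookup f M * tens (?xs M) J))"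
    by (rule sum.cong[OF refl]) (simp only: tens_act[OF xs(1,2) k h] sum_distrib_left mult.left_commute)
  also have "\<dots> = (\<Sum>J\<in>PiE (pts d) (\<lambda>_. H). (\<Prod>x\<in>pts d. r (h x) (J x)) * T f J)"
    unfolding T_def sum_distrib_left by (rule sum.swap)
  finally show ?thesis .
qed

lemma sym_act_sym_free:
  assumes f: "f \<in> sym_free d V" and k: "acts k r"
  shows "sym_act k f \<in> sym_free d V"
  unfolding sym_act_def
proof (intro scl.subspace_sum[OF sym_free_subspace] scl.subspace_scale[OF sym_free_subspace])
  fix M assume "M \<in> Poly_Mapping.keys f"
  then have "size M = d \<and> set_mset M \<subseteq> V" using f by (auto simp: sym_free_def)
  then show "formal_prod (image_mset (Ad k) M) \<in> sym_free d V"
    using k unfolding formal_prod_sym_free acts_def by auto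
qed

text \<open>The difference lies in the free space, where \<open>T\<close> detects the relations
  exactly, so invariance modulo relations becomes an equation between tensors.\<close>

lemma sym_act_diff_iff:
  assumes f: "f \<in> sym_free d V" and k: "acts k r"
  shows "sym_act k f - f \<in> sym_rel d V \<longleftrightarrow> tensor_invariant d H r (T f)"
proof -
  have mem: "sym_act k f - f \<in> sym_free d V"
    by (rule scl.subspace_diff[OF sym_free_subspace sym_act_sym_free[OF f k] f])
  have "sym_act k f - f \<in> sym_rel d V \<longleftrightarrow> (\<forall>h\<in>pts d \<rightarrow> H. T (sym_act k f - f) h = 0)"
    using kernel_T[OF mem] T_sym_rel by blast
  then show ?thesis
    unfolding tensor_invariant_def T_diff using T_sym_act[OF f k] by simp
qed

lemma sym_inv_subspace: "scl.subspace (sym_inv d V K)"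
  if acts: "\<And>k. k \<in> K \<Longrightarrow> \<exists>r. acts k r"
proof -
  have lin: "tensor_invariant d H r (T (f + g))" if "tensor_invariant d H r (T f)" "tensor_invariant d H r (T g)" for r f g
    using that unfolding tensor_invariant_def by (simp add: T_add distrib_left sum.distrib)
  have sc: "tensor_invariant d H r (T (scl c f))" if "tensor_invariant d H r (T f)" for r f c
    using that unfolding tensor_invariant_def T_scl
    by (simp only: mult.left_commute[of _ c] sum_distrib_left[symmetric]) simp
  have z: "tensor_invariant d H r (T 0)" for r
    unfolding tensor_invariant_def by simp
  have iff: "f \<in> sym_inv d V K \<longleftrightarrow> f \<in> sym_free d V \<and> (\<forall>k\<in>K. tensor_invariant d H (SOME r. acts k r) (T f))" for f
  proof -
    have "acts k (SOME r. acts k r)" if "k \<in> K" for k using acts[OF that] by (rule someI_ex)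
    then show ?thesis unfolding sym_inv_def using sym_act_diff_iff by blast
  qed
  show ?thesis
  proof (rule scl.subspaceI)
    show "0 \<in> sym_inv d V K"
      unfolding iff using z scl.subspace_0[OF sym_free_subspace] by blast
    show "f + g \<in> sym_inv d V K" if "f \<in> sym_inv d V K" "g \<in> sym_inv d V K" for f g
      using that lin scl.subspace_add[OF sym_free_subspace] unfolding iff by blast
    show "scl c f \<in> sym_inv d V K" if "f \<in> sym_inv d V K" for c f
      using that sc scl.subspace_scale[OF sym_free_subspace] unfolding iff by blast
  qed
qed

end

section \<open>The base groups\<close>

datatype gtype = Orth | Symp | Lin

definition form_sign :: "gtype \<Rightarrow> bool \<Rightarrow> bool \<Rightarrow> complex" where
  "form_sign ty s s' = (case ty of Orth \<Rightarrow> 1 | Symp \<Rightarrow> (if s = s' then 0 else if s then -1 else 1)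
     | Lin \<Rightarrow> (if s = s' then 0 else 1))"

definition form :: "gtype \<Rightarrow> nat \<times> bool \<Rightarrow> nat \<times> bool \<Rightarrow> complex" where
  "form ty a b = (if fst a = fst b then form_sign ty (snd a) (snd b) else 0)"

text \<open>In an index \<open>(i, s)\<close> the truth value separates the two members of a dual
  pair of basis vectors; an orthonormal basis needs only one value.\<close>

definition idx :: "gtype \<Rightarrow> nat \<Rightarrow> (nat \<times> bool) set" where
  "idx ty n = {..<n} \<times> (if ty = Orth then {False} else UNIV)"

text \<open>Matrices on \<open>idx ty n\<close> preserving the form: \<open>O\<^sub>n\<close>, \<open>Sp\<^sub>2\<^sub>n\<close>, and \<open>GL\<^sub>n\<close> acting on
  \<open>V \<oplus> V\<^sup>*\<close>, which is cut out in the isometry group of the duality pairing by block diagonality.\<close>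

definition base_group :: "gtype \<Rightarrow> nat \<Rightarrow> (nat \<times> bool \<Rightarrow> nat \<times> bool \<Rightarrow> complex) set" where
  "base_group ty n = {g. (\<forall>a\<in>idx ty n. \<forall>b\<in>idx ty n.
       (\<Sum>x\<in>idx ty n. \<Sum>y\<in>idx ty n. g a x * g b y * form ty x y) = form ty a b) \<and>
     (ty = Lin \<longrightarrow> (\<forall>a\<in>idx ty n. \<forall>b\<in>idx ty n. snd a \<noteq> snd b \<longrightarrow> g a b = 0))}"

lemma finite_idx [simp]: "finite (idx ty n)"
  by (simp add: idx_def)

lemma mem_idx: "(i, s) \<in> idx ty n \<longleftrightarrow> i < n \<and> (ty = Orth \<longrightarrow> \<not> s)"
  by (auto simp: idx_def)

text \<open>Serves both monomial matrices and the curves below: when each row has at most two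
  nonzero entries, invariance of the form is a four-term identity.\<close>

lemma two_term_base_group:
  assumes f: "\<And>a. a \<in> idx ty n \<Longrightarrow> f a \<in> idx ty n" and m: "\<And>a. a \<in> idx ty n \<Longrightarrow> m a \<in> idx ty n"
    and form: "\<And>a b. a \<in> idx ty n \<Longrightarrow> b \<in> idx ty n \<Longrightarrow>
      c a * c b * form ty (f a) (f b) + c a * e b * form ty (f a) (m b) +
      (e a * c b * form ty (m a) (f b) + e a * e b * form ty (m a) (m b)) = form ty a b"
    and lin: "\<And>a. ty = Lin \<Longrightarrow> a \<in> idx ty n \<Longrightarrow> snd (f a) = snd a \<and> snd (m a) = snd a"
  shows "(\<lambda>a x. of_bool (x = f a) * c a + of_bool (x = m a) * e a) \<in> base_group ty n"
proof -
  have delta: "(\<Sum>x\<in>idx ty n. of_bool (x = z) * u x) = u z" if "z \<in> idx ty n" for z and u :: "_ \<Rightarrow> complex"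
  proof -
    have "(\<Sum>x\<in>idx ty n. of_bool (x = z) * u x) = (\<Sum>x\<in>idx ty n. if x = z then u x else 0)"
      by (rule sum.cong) auto
    then show ?thesis using that by simp
  qed
  have row: "(\<Sum>x\<in>idx ty n. (of_bool (x = f a) * c a + of_bool (x = m a) * e a) * u x) = c a * u (f a) + e a * u (m a)"
    if a: "a \<in> idx ty n" for a and u :: "_ \<Rightarrow> complex"
  proof -
    have "(\<Sum>x\<in>idx ty n. (of_bool (x = f a) * c a + of_bool (x = m a) * e a) * u x) =
      (\<Sum>x\<in>idx ty n. of_bool (x = f a) * (c a * u x)) + (\<Sum>x\<in>idx ty n. of_bool (x = m a) * (e a * u x))"
      by (simp only: sum.distrib distrib_right mult.assoc)
    then show ?thesis by (simp only: delta[OF f[OF a]] delta[OF m[OF a]])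
  qed
  have "(\<Sum>x\<in>idx ty n. \<Sum>y\<in>idx ty n. (of_bool (x = f a) * c a + of_bool (x = m a) * e a) *
      (of_bool (y = f b) * c b + of_bool (y = m b) * e b) * form ty x y) = form ty a b"
    if a: "a \<in> idx ty n" and b: "b \<in> idx ty n" for a b
    unfolding mult.assoc sum_distrib_left[symmetric]
    unfolding row[OF b] row[OF a] form[OF a b, symmetric] by (simp only: distrib_left mult.assoc)
  moreover have "of_bool (b = f a) * c a + of_bool (b = m a) * e a = 0"
    if "ty = Lin" "a \<in> idx ty n" "snd a \<noteq> snd b" for a b
    using lin[OF that(1,2)] that(3) by auto
  ultimately show ?thesis unfolding base_group_def by blast
qed

lemma monomial_base_group:
  assumes f: "\<And>a. a \<in> idx ty n \<Longrightarrow> f a \<in> idx ty n"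
    and form: "\<And>a b. a \<in> idx ty n \<Longrightarrow> b \<in> idx ty n \<Longrightarrow> c a * c b * form ty (f a) (f b) = form ty a b"
    and lin: "\<And>a. ty = Lin \<Longrightarrow> a \<in> idx ty n \<Longrightarrow> snd (f a) = snd a"
  shows "(\<lambda>a x. of_bool (x = f a) * c a) \<in> base_group ty n"
  using two_term_base_group[of ty n f f c "\<lambda>_. 0", OF f f] form lin by simp

lemma id_base_group: "(\<lambda>a x. of_bool (x = a)) \<in> base_group ty n"
  using monomial_base_group[of ty n "\<lambda>a. a" "\<lambda>_. 1"] by simp

text \<open>The form pairs the basis vector \<open>(i, False)\<close> with
  \<open>(i, neg_sign ty)\<close>.\<close>

definition neg_sign :: "gtype \<Rightarrow> bool" where
  "neg_sign ty \<longleftrightarrow> ty \<noteq> Orth"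

text \<open>A holomorphic curve through the identity with velocity \<open>E\<^sub>(\<^sub>i\<^sub>,\<^sub>F\<^sub>)\<^sub>,\<^sub>(\<^sub>j\<^sub>,\<^sub>F\<^sub>) - E\<^sub>(\<^sub>j\<^sub>,\<^sub>s\<^sub>)\<^sub>,\<^sub>(\<^sub>i\<^sub>,\<^sub>s\<^sub>)\<close> for
  \<open>s = neg_sign ty\<close>: a rotation in the orthogonal case, a unipotent otherwise.\<close>

definition curve :: "gtype \<Rightarrow> nat \<Rightarrow> nat \<Rightarrow> complex \<Rightarrow> nat \<times> bool \<Rightarrow> nat \<times> bool \<Rightarrow> complex" where
  "curve ty i j z = (\<lambda>a x. of_bool (x = a) *
       (if ty = Orth \<and> (a = (i, False) \<or> a = (j, False)) then cos z else 1) +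
     of_bool (x = (if a = (i, False) then (j, False) else if a = (j, neg_sign ty) then (i, neg_sign ty) else a)) *
       (if a = (i, False) then (if ty = Orth then sin z else z)
        else if a = (j, neg_sign ty) then - (if ty = Orth then sin z else z) else 0))"

definition velocity :: "gtype \<Rightarrow> nat \<Rightarrow> nat \<Rightarrow> nat \<times> bool \<Rightarrow> nat \<times> bool \<Rightarrow> complex" where
  "velocity ty i j a x = of_bool (a = (i, False) \<and> x = (j, False)) -
     of_bool (a = (j, neg_sign ty) \<and> x = (i, neg_sign ty))"

text \<open>The off-diagonal entries of the rows \<open>(i, False)\<close> and
  \<open>(j, neg_sign ty)\<close> have opposite signs, so their contributions to the pairing of
  these two rows cancel. In the orthogonal case both rows keep norm 1 by \<open>sc\<close>.\<close>

lemma curve_base_group: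
  assumes "i < n" "j < n" "i \<noteq> j"
  shows "curve ty i j z \<in> base_group ty n"
  unfolding curve_def
proof (rule two_term_base_group)
  fix a assume "a \<in> idx ty n"
  then show "(if a = (i, False) then (j, False) else if a = (j, neg_sign ty) then (i, neg_sign ty) else a) \<in> idx ty n"
    using assms by (cases a) (auto simp: mem_idx neg_sign_def)
next
  fix a b assume a: "a \<in> idx ty n" and b: "b \<in> idx ty n"
  obtain k s l t where ab: "a = (k, s)" "b = (l, t)" by (cases a, cases b) blast
  have sc: "cos z * cos z + sin z * sin z = 1"
    using sin_cos_squared_add2[of z] by (simp add: power2_eq_square)
  show "(if ty = Orth \<and> (a = (i, False) \<or> a = (j, False)) then cos z else 1) *
       (if ty = Orth \<and> (b = (i, False) \<or> b = (j, False)) then cos z else 1) * form ty a b +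
       (if ty = Orth \<and> (a = (i, False) \<or> a = (j, False)) then cos z else 1) *
       (if b = (i, False) then if ty = Orth then sin z else z
        else if b = (j, neg_sign ty) then - (if ty = Orth then sin z else z) else 0) *
       form ty a (if b = (i, False) then (j, False) else if b = (j, neg_sign ty) then (i, neg_sign ty) else b) +
       ((if a = (i, False) then if ty = Orth then sin z else z
         else if a = (j, neg_sign ty) then - (if ty = Orth then sin z else z) else 0) *
        (if ty = Orth \<and> (b = (i, False) \<or> b = (j, False)) then cos z else 1) *
        form ty (if a = (i, False) then (j, False) else if a = (j, neg_sign ty) then (i, neg_sign ty) else a) b +
        (if a = (i, False) then if ty = Orth then sin z else z
         else if a = (j, neg_sign ty) then - (if ty = Orth then sin z else z) else 0) *
        (if b = (i, False) then if ty = Orth then sin z else z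
         else if b = (j, neg_sign ty) then - (if ty = Orth then sin z else z) else 0) *
        form ty (if a = (i, False) then (j, False) else if a = (j, neg_sign ty) then (i, neg_sign ty) else a)
         (if b = (i, False) then (j, False) else if b = (j, neg_sign ty) then (i, neg_sign ty) else b)) =
       form ty a b"
  proof (cases "ty = Orth")
    case True
    then have st: "\<not> s" "\<not> t" using a b ab by (auto simp: mem_idx)
    have form: "form Orth (x, False) (y, False) = of_bool (x = y)" for x y
      by (simp add: form_def form_sign_def)
    consider "k = i" "l = i" | "k = i" "l = j" | "k = i" "l \<noteq> i" "l \<noteq> j" | "k = j" "l = i" | "k = j" "l = j"
      | "k = j" "l \<noteq> i" "l \<noteq> j" | "k \<noteq> i" "k \<noteq> j" "l = i" | "k \<noteq> i" "k \<noteq> j" "l = j"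
      | "k \<noteq> i" "k \<noteq> j" "l \<noteq> i" "l \<noteq> j" by blast
    then show ?thesis
      using assms(3) sc st True unfolding ab neg_sign_def by cases (simp_all add: form)
  next
    case False
    then have ns: "neg_sign ty = True" by (simp add: neg_sign_def)
    have form1: "form ty (x, u) b = (if b = (x, \<not> u) then form_sign ty u (\<not> u) else 0)" for x u b
      using False by (cases ty; cases b) (auto simp: form_def form_sign_def)
    have form2: "form ty b (x, u) = (if b = (x, \<not> u) then form_sign ty (\<not> u) u else 0)" for x u b
      using False by (cases ty; cases b) (auto simp: form_def form_sign_def)
    consider "a = (i, False)" | "a = (j, True)" | "a \<noteq> (i, False)" "a \<noteq> (j, True)" by blast
    then show ?thesis
    proof cases
      case 1
      consider "b = (i, False)" | "b = (j, True)" | "b \<noteq> (i, False)" "b \<noteq> (j, True)" by blast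
      then show ?thesis using 1 assms(3) False unfolding ns by cases (simp_all add: form1)
    next
      case 2
      consider "b = (i, False)" | "b = (j, True)" | "b \<noteq> (i, False)" "b \<noteq> (j, True)" by blast
      then show ?thesis using 2 assms(3) False unfolding ns by cases (simp_all add: form1)
    next
      case 3
      consider "b = (i, False)" | "b = (j, True)" | "b \<noteq> (i, False)" "b \<noteq> (j, True)" by blast
      then show ?thesis using 3 assms(3) False unfolding ns by cases (simp_all add: form2)
    qed
  qed
qed auto

lemma curve_0: "i \<noteq> j \<Longrightarrow> curve ty i j 0 a x = of_bool (x = a)"
  by (simp add: curve_def)

lemma curve_deriv:
  assumes "i \<noteq> j"
  shows "((\<lambda>z. curve ty i j z a x) has_field_derivative velocity ty i j a x) (at 0)"
proof -
  define u where "u = (\<lambda>z::complex. if ty = Orth then sin z else z)"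
  define v where "v = (\<lambda>z::complex. if ty = Orth \<and> (a = (i, False) \<or> a = (j, False)) then cos z else 1)"
  have u: "(u has_field_derivative 1) (at 0)"
    unfolding u_def by (cases "ty = Orth") (auto intro!: derivative_eq_intros)
  have v: "(v has_field_derivative 0) (at 0)"
    unfolding v_def by (cases "ty = Orth \<and> (a = (i, False) \<or> a = (j, False))") (auto intro!: derivative_eq_intros)
  consider "a = (i, False)" | "a \<noteq> (i, False)" "a = (j, neg_sign ty)" | "a \<noteq> (i, False)" "a \<noteq> (j, neg_sign ty)" by blast
  then show ?thesis
  proof cases
    case 1
    have e: "(\<lambda>z. curve ty i j z a x) = (\<lambda>z. of_bool (x = a) * v z + of_bool (x = (j, False)) * u z)"
      unfolding curve_def u_def v_def using 1 by auto
    have "velocity ty i j a x = of_bool (x = a) * 0 + of_bool (x = (j, False)) * 1"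
      using 1 assms by (simp add: velocity_def)
    then show ?thesis unfolding e using DERIV_add[OF DERIV_cmult[OF v] DERIV_cmult[OF u]] by metis
  next
    case 2
    have e: "(\<lambda>z. curve ty i j z a x) = (\<lambda>z. of_bool (x = a) * v z + (- of_bool (x = (i, neg_sign ty))) * u z)"
      unfolding curve_def u_def v_def using 2 by auto
    have "velocity ty i j a x = of_bool (x = a) * 0 + (- of_bool (x = (i, neg_sign ty))) * 1"
      using 2 assms by (simp add: velocity_def)
    then show ?thesis unfolding e using DERIV_add[OF DERIV_cmult[OF v] DERIV_cmult[OF u]] by metis
  next
    case 3
    have e: "(\<lambda>z. curve ty i j z a x) = (\<lambda>z. of_bool (x = a) * v z)"
      unfolding curve_def u_def v_def using 3 by auto
    have "velocity ty i j a x = of_bool (x = a) * 0"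
      using 3 by (simp add: velocity_def)
    then show ?thesis unfolding e using DERIV_cmult[OF v] by metis
  qed
qed

text \<open>The complements of \<open>A\<close> and of its image have the same size, so the inverse
  of \<open>f\<close> extends by any bijection between them. It is used to rename labels.\<close>

lemma permutation_extending:
  assumes "finite S" "A \<subseteq> S" "inj_on f A" "f ` A \<subseteq> S"
  shows "\<exists>\<pi>. \<pi> permutes S \<and> (\<forall>a\<in>A. \<pi> (f a) = a)"
proof -
  have fin: "finite A" "finite (f ` A)" using assms finite_subset by auto
  have "card (S - f ` A) = card (S - A)"
    using assms fin by (simp add: card_Diff_subset card_image)
  then obtain g where g: "bij_betw g (S - f ` A) (S - A)"
    using finite_same_card_bij[of "S - f ` A" "S - A"] assms(1) by auto
  have h: "bij_betw (inv_into A f) (f ` A) A"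
    by (rule bij_betw_inv_into[OF inj_on_imp_bij_betw[OF assms(3)]])
  define \<pi> where "\<pi> x = (if x \<in> f ` A then inv_into A f x else if x \<in> S then g x else x)" for x
  have 1: "bij_betw \<pi> (f ` A) A"
    using h by (subst bij_betw_cong[of _ _ "inv_into A f"]) (auto simp: \<pi>_def)
  have 2: "bij_betw \<pi> (S - f ` A) (S - A)"
    using g by (subst bij_betw_cong[of _ _ g]) (auto simp: \<pi>_def)
  have "bij_betw \<pi> (f ` A \<union> (S - f ` A)) (A \<union> (S - A))"
    by (rule bij_betw_combine[OF 1 2]) auto
  moreover have "f ` A \<union> (S - f ` A) = S" "A \<union> (S - A) = S" using assms by auto
  ultimately have "\<pi> permutes S"
    by (intro bij_imp_permutes) (use assms in \<open>auto simp: \<pi>_def\<close>)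
  moreover have "\<pi> (f a) = a" if "a \<in> A" for a
    using that assms(3) by (simp add: \<pi>_def)
  ultimately show ?thesis by blast
qed

section \<open>Words\<close>

text \<open>A colour \<open>\<gamma>\<close> is acted on by the base group with index
  \<open>kc \<gamma>\<close>; for \<open>Lin\<close>, \<open>sg \<gamma>\<close> tells whether it
  carries the defining representation or its dual. \<open>stable\<close> provides d distinct labels
  in each group.\<close>

locale words =
  fixes d :: nat and ty :: gtype and N :: "'k \<Rightarrow> nat" and kc :: "'c::finite \<Rightarrow> 'k" and sg :: "'c \<Rightarrow> bool"
  assumes stable: "\<And>\<kappa>. d \<le> N \<kappa>"
begin

definition H :: "((nat \<times> bool) \<times> 'c) set" where
  "H = {a. fst a \<in> idx ty (N (kc (snd a))) \<and> (ty = Lin \<longrightarrow> snd (fst a) = sg (snd a))}"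

definition fam :: "('k \<Rightarrow> nat \<times> bool \<Rightarrow> nat \<times> bool \<Rightarrow> complex) \<Rightarrow>
    (nat \<times> bool) \<times> 'c \<Rightarrow> (nat \<times> bool) \<times> 'c \<Rightarrow> complex" where
  "fam g a b = (if snd a = snd b then g (kc (snd a)) (fst a) (fst b) else 0)"

definition family :: "('k \<Rightarrow> nat \<times> bool \<Rightarrow> nat \<times> bool \<Rightarrow> complex) \<Rightarrow> bool" where
  "family g \<longleftrightarrow> (\<forall>\<kappa>. g \<kappa> \<in> base_group ty (N \<kappa>))"

definition R1 :: "'c \<Rightarrow> 'c \<Rightarrow> bool" where
  "R1 \<gamma> \<gamma>' \<longleftrightarrow> kc \<gamma> = kc \<gamma>' \<and> (ty = Lin \<longrightarrow> sg \<gamma> \<noteq> sg \<gamma>')"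

definition eps1 :: complex where
  "eps1 = (if ty = Symp then -1 else 1)"

definition beta :: "(nat \<times> bool) \<times> 'c \<Rightarrow> (nat \<times> bool) \<times> 'c \<Rightarrow> complex" where
  "beta a b = (if kc (snd a) = kc (snd b) then form ty (fst a) (fst b) else 0)"

text \<open>Both ends of an edge share the number. The side is read from the end of the edge for
  \<open>Symp\<close>, where it is free, and from the colour for \<open>Lin\<close>, where
  membership in \<open>H\<close> forces it.\<close>

definition label :: "nat \<times> bool \<Rightarrow> 'c \<Rightarrow> nat \<times> bool" where
  "label x \<gamma> = (fst x, case ty of Orth \<Rightarrow> False | Symp \<Rightarrow> snd x | Lin \<Rightarrow> sg \<gamma>)"

text \<open>Numbers the points by the edges of the matching encoded by \<open>\<sigma>\<close>:
  \<open>pinv \<sigma> x\<close> is the edge through \<open>x\<close> together with the end at which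
  \<open>x\<close> lies. Invariant tensors will be determined by their values on these
  words.\<close>

definition regular_word :: "(nat \<times> bool \<Rightarrow> nat \<times> bool) \<Rightarrow> (nat \<times> bool \<Rightarrow> 'c) \<Rightarrow> nat \<times> bool \<Rightarrow> (nat \<times> bool) \<times> 'c" where
  "regular_word \<sigma> c x = (label (pinv \<sigma> x) (c x), c x)"

lemma finite_H: "finite H"
proof -
  have fin: "finite (\<Union>\<gamma>. idx ty (N (kc \<gamma>)) \<times> {\<gamma>})"
    by (rule finite_UN_I[OF finite]) simp
  have "H \<subseteq> (\<Union>\<gamma>. idx ty (N (kc \<gamma>)) \<times> {\<gamma>})"
    unfolding H_def by auto
  then show ?thesis by (rule finite_subset[OF _ fin])
qed

lemma regular_word_in_H:
  assumes "\<sigma> permutes pts d"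
  shows "regular_word \<sigma> c \<in> pts d \<rightarrow> H"
proof
  fix x assume "x \<in> pts d"
  then have "pinv \<sigma> x \<in> pts d" using permutes_in_image[OF permutes_inv[OF assms]] by blast
  then have "fst (pinv \<sigma> x) < N (kc (c x))" using stable[of "kc (c x)"] by (cases "pinv \<sigma> x") auto
  then show "regular_word \<sigma> c x \<in> H"
    unfolding regular_word_def H_def label_def by (cases ty; cases "pinv \<sigma> x") (auto simp: mem_idx)
qed

text \<open>For \<open>Lin\<close>, \<open>H\<close> keeps only the side that belongs to the colour;
  the missing terms vanish since the group elements are block diagonal.\<close>

lemma sum_fam:
  assumes "a \<in> H" "family g"
  shows "(\<Sum>x\<in>H. fam g a x * F x) = (\<Sum>x\<in>idx ty (N (kc (snd a))). g (kc (snd a)) (fst a) x * F (x, snd a))"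
proof -
  let ?I = "idx ty (N (kc (snd a)))"
  let ?H = "{x \<in> ?I. ty = Lin \<longrightarrow> snd x = sg (snd a)}"
  have lin: "g (kc (snd a)) (fst a) x = 0" if "ty = Lin" "x \<in> ?I" "snd x \<noteq> sg (snd a)" for x
    using assms that unfolding family_def base_group_def H_def by auto
  have "(\<Sum>x\<in>H. fam g a x * F x) = (\<Sum>x\<in>(\<lambda>x. (x, snd a)) ` ?H. fam g a x * F x)"
    by (rule sum.mono_neutral_right[OF finite_H]) (auto simp: H_def fam_def image_iff)
  also have "\<dots> = (\<Sum>x\<in>?H. g (kc (snd a)) (fst a) x * F (x, snd a))"
    by (subst sum.reindex) (auto simp: inj_on_def fam_def)
  also have "\<dots> = (\<Sum>x\<in>?I. g (kc (snd a)) (fst a) x * F (x, snd a))"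
    by (rule sum.mono_neutral_left) (auto simp: lin)
  finally show ?thesis .
qed

lemma beta_invariant:
  assumes "a \<in> H" "b \<in> H" "family g"
  shows "(\<Sum>x\<in>H. \<Sum>y\<in>H. fam g a x * fam g b y * beta x y) = beta a b"
proof -
  have "(\<Sum>x\<in>H. \<Sum>y\<in>H. fam g a x * fam g b y * beta x y) = (\<Sum>x\<in>H. fam g a x * (\<Sum>y\<in>H. fam g b y * beta x y))"
    by (simp only: mult.assoc sum_distrib_left)
  also have "\<dots> = (\<Sum>x\<in>idx ty (N (kc (snd a))). g (kc (snd a)) (fst a) x *
      (\<Sum>y\<in>idx ty (N (kc (snd b))). g (kc (snd b)) (fst b) y * beta (x, snd a) (y, snd b)))"
    by (simp only: sum_fam[OF assms(1,3)] sum_fam[OF assms(2,3)])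
  also have "\<dots> = beta a b"
  proof (cases "kc (snd a) = kc (snd b)")
    case True
    let ?I = "idx ty (N (kc (snd b)))" and ?g = "g (kc (snd b))"
    have "(\<Sum>x\<in>?I. \<Sum>y\<in>?I. ?g (fst a) x * ?g (fst b) y * form ty x y) = form ty (fst a) (fst b)"
      using assms True unfolding family_def base_group_def H_def by auto
    then show ?thesis using True by (simp add: beta_def sum_distrib_left mult.assoc)
  qed (simp add: beta_def)
  finally show ?thesis .
qed

definition monomial_family :: "('k \<Rightarrow> nat \<times> bool \<Rightarrow> nat \<times> bool) \<Rightarrow> ('k \<Rightarrow> nat \<times> bool \<Rightarrow> complex) \<Rightarrow>
    'k \<Rightarrow> nat \<times> bool \<Rightarrow> nat \<times> bool \<Rightarrow> complex" where
  "monomial_family f c \<kappa> a x = of_bool (x = f \<kappa> a) * c \<kappa> a"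

lemma monomial_family:
  assumes "\<And>\<kappa> a. a \<in> idx ty (N \<kappa>) \<Longrightarrow> f \<kappa> a \<in> idx ty (N \<kappa>)"
    and "\<And>\<kappa> a b. a \<in> idx ty (N \<kappa>) \<Longrightarrow> b \<in> idx ty (N \<kappa>) \<Longrightarrow> c \<kappa> a * c \<kappa> b * form ty (f \<kappa> a) (f \<kappa> b) = form ty a b"
    and "\<And>\<kappa> a. ty = Lin \<Longrightarrow> a \<in> idx ty (N \<kappa>) \<Longrightarrow> snd (f \<kappa> a) = snd a"
  shows "family (monomial_family f c)"
  unfolding family_def monomial_family_def using monomial_base_group[of ty _ "f _" "c _"] assms by blast

context
  fixes t :: "(nat \<times> bool \<Rightarrow> (nat \<times> bool) \<times> 'c) \<Rightarrow> complex"
  assumes inv: "\<And>g. family g \<Longrightarrow> tensor_invariant d H (fam g) t"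
    and cong: "\<And>h h'. (\<And>x. x \<in> pts d \<Longrightarrow> h x = h' x) \<Longrightarrow> t h = t h'"
begin

text \<open>Each row has a single nonzero entry, so the sum in the invariance equation reduces to
  one word.\<close>

lemma monomial_invariant:
  assumes fam: "family (monomial_family f c)" and h: "h \<in> pts d \<rightarrow> H"
    and fH: "\<And>x. x \<in> pts d \<Longrightarrow> (f (kc (snd (h x))) (fst (h x)), snd (h x)) \<in> H"
  shows "t h = (\<Prod>x\<in>pts d. c (kc (snd (h x))) (fst (h x))) * t (\<lambda>x. (f (kc (snd (h x))) (fst (h x)), snd (h x)))"
proof -
  define h' where "h' = restrict (\<lambda>x. (f (kc (snd (h x))) (fst (h x)), snd (h x))) (pts d)"
  define C where "C = (\<Prod>x\<in>pts d. c (kc (snd (h x))) (fst (h x)))"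
  let ?P = "PiE (pts d) (\<lambda>_. H)"
  have h': "h' \<in> ?P" using fH by (auto simp: h'_def)
  have fin: "finite ?P" by (rule finite_PiE) (auto simp: finite_H)
  have "(\<Prod>x\<in>pts d. fam (monomial_family f c) (h x) (J x)) * t J = (if J = h' then C * t J else 0)" if J: "J \<in> ?P" for J
  proof (cases "J = h'")
    case True
    have "(\<Prod>x\<in>pts d. fam (monomial_family f c) (h x) (J x)) = C"
      unfolding C_def True by (rule prod.cong) (auto simp: fam_def monomial_family_def h'_def)
    then show ?thesis using True by simp
  next
    case False
    then obtain x where x: "x \<in> pts d" "J x \<noteq> h' x"
      using PiE_ext[OF J h'] by blast
    then have "fam (monomial_family f c) (h x) (J x) = 0"
      by (auto simp: fam_def monomial_family_def h'_def prod_eq_iff)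
    then have "(\<Prod>x\<in>pts d. fam (monomial_family f c) (h x) (J x)) = 0"
      using x(1) by (intro prod_zero[OF finite_pts] bexI[of _ x])
    then show ?thesis using False by simp
  qed
  then have "(\<Sum>J\<in>?P. (\<Prod>x\<in>pts d. fam (monomial_family f c) (h x) (J x)) * t J) = (\<Sum>J\<in>?P. if J = h' then C * t J else 0)"
    by (rule sum.cong[OF refl])
  also have "\<dots> = C * t h'" using h' fin by simp
  also have "t h' = t (\<lambda>x. (f (kc (snd (h x))) (fst (h x)), snd (h x)))"
    by (rule cong) (simp add: h'_def)
  finally show ?thesis
    using inv[OF fam] h unfolding tensor_invariant_def C_def by simp
qed

text \<open>The infinitesimal form of invariance: after differentiating at the identity along the
  curve in the group of index \<open>\<kappa>\<close>, the product rule leaves only words that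
  differ from \<open>h\<close> in at most one position.\<close>

lemma curve_relation:
  assumes ij: "i < N \<kappa>" "j < N \<kappa>" "i \<noteq> j" and h: "h \<in> pts d \<rightarrow> H"
  shows "(\<Sum>p\<in>pts d. \<Sum>b\<in>{b\<in>H. snd b = snd (h p)}. if kc (snd (h p)) = \<kappa> then
     velocity ty i j (fst (h p)) (fst b) * t (h(p := b)) else 0) = 0"
proof -
  let ?P = "PiE (pts d) (\<lambda>_. H)"
  have fin: "finite ?P" by (rule finite_PiE) (auto simp: finite_H)
  define G where "G z = (\<lambda>\<kappa>'. if \<kappa>' = \<kappa> then curve ty i j z else (\<lambda>a x. of_bool (x = a)))" for z
  have famG: "family (G z)" for z
    unfolding family_def G_def using curve_base_group[OF ij] id_base_group by simp
  define X where "X a b = (if snd b = snd a \<and> kc (snd a) = \<kappa> then velocity ty i j (fst a) (fst b) else 0)"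
    for a b :: "(nat \<times> bool) \<times> 'c"
  have G0: "fam (G 0) a b = of_bool (b = a)" for a b
    unfolding fam_def G_def by (auto simp: curve_0[OF ij(3)] prod_eq_iff)
  have dG: "((\<lambda>z. fam (G z) a b) has_field_derivative X a b) (at 0)" for a b
  proof (cases "snd a = snd b \<and> kc (snd a) = \<kappa>")
    case True
    then have "(\<lambda>z. fam (G z) a b) = (\<lambda>z. curve ty i j z (fst a) (fst b))" "X a b = velocity ty i j (fst a) (fst b)"
      by (auto simp: fam_def G_def X_def)
    then show ?thesis using curve_deriv[OF ij(3)] by simp
  next
    case False
    then have "(\<lambda>z. fam (G z) a b) = (\<lambda>z. fam (G 0) a b)" "X a b = 0"
      by (auto simp: fam_def G_def X_def fun_eq_iff)
    then show ?thesis by (metis DERIV_const)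
  qed
  define \<Phi> where "\<Phi> z = (\<Sum>J\<in>?P. t J * (\<Prod>x\<in>pts d. fam (G z) (h x) (J x)))" for z
  \<comment> \<open>By invariance the sum is constant along the curve, so its derivative is 0 and
    must equal the one given by the product rule.\<close>
  have "\<Phi> = (\<lambda>_. t h)"
  proof
    fix z
    have "(\<Sum>J\<in>?P. (\<Prod>x\<in>pts d. fam (G z) (h x) (J x)) * t J) = t h"
      using inv[OF famG] h unfolding tensor_invariant_def by blast
    then show "\<Phi> z = t h" unfolding \<Phi>_def by (subst mult.commute)
  qed
  then have "(\<Phi> has_field_derivative 0) (at 0)"
    by (simp only: DERIV_const)
  moreover have "(\<Phi> has_field_derivative (\<Sum>J\<in>?P. t J *
      (\<Sum>p\<in>pts d. X (h p) (J p) * (\<Prod>x\<in>pts d - {p}. fam (G 0) (h x) (J x))))) (at 0)"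
    unfolding \<Phi>_def by (rule DERIV_sum, rule DERIV_cmult, rule has_field_derivative_prod, rule dG)
  ultimately have zero: "0 = (\<Sum>J\<in>?P. t J * (\<Sum>p\<in>pts d. X (h p) (J p) * (\<Prod>x\<in>pts d - {p}. fam (G 0) (h x) (J x))))"
    by (rule DERIV_unique)
  note zero
  also have "(\<Sum>J\<in>?P. t J * (\<Sum>p\<in>pts d. X (h p) (J p) * (\<Prod>x\<in>pts d - {p}. fam (G 0) (h x) (J x)))) =
    (\<Sum>J\<in>?P. \<Sum>p\<in>pts d. X (h p) (J p) * (\<Prod>x\<in>pts d - {p}. of_bool (J x = h x)) * t J)"
    by (intro sum.cong refl) (simp add: G0 sum_distrib_left mult.commute)
  also have "\<dots> = (\<Sum>p\<in>pts d. \<Sum>J\<in>?P. X (h p) (J p) * (\<Prod>x\<in>pts d - {p}. of_bool (J x = h x)) * t J)"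
    by (rule sum.swap)
  also have "(\<Sum>p\<in>pts d. \<Sum>J\<in>?P. X (h p) (J p) * (\<Prod>x\<in>pts d - {p}. of_bool (J x = h x)) * t J) =
    (\<Sum>p\<in>pts d. \<Sum>b\<in>{b\<in>H. snd b = snd (h p)}. if kc (snd (h p)) = \<kappa> then
     velocity ty i j (fst (h p)) (fst b) * t (h(p := b)) else 0)"
  proof (rule sum.cong[OF refl])
    fix p assume p: "p \<in> pts d"
    \<comment> \<open>The word \<open>h\<close> with letter \<open>b\<close> at \<open>p\<close>,
      restricted so that it lies among the extensional words summed over.\<close>
    let ?u = "\<lambda>b. restrict (h(p := b)) (pts d)"
    have one: "(\<Prod>x\<in>pts d - {p}. of_bool (J x = h x)) = (of_bool (\<forall>x\<in>pts d - {p}. J x = h x) :: complex)" for J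
    proof (cases "\<forall>x\<in>pts d - {p}. J x = h x")
      case False
      then obtain x where "x \<in> pts d - {p}" "J x \<noteq> h x" by blast
      then have "(\<Prod>x\<in>pts d - {p}. of_bool (J x = h x)) = (0 :: complex)"
        by (intro prod_zero bexI[of _ x]) auto
      then show ?thesis using False by simp
    qed simp
    have inj: "inj_on ?u H"
    proof (rule inj_onI)
      fix b b' assume "?u b = ?u b'"
      then have "?u b p = ?u b' p" by simp
      then show "b = b'" using p by simp
    qed
    have im: "?u ` H = {J \<in> ?P. \<forall>x\<in>pts d - {p}. J x = h x}"
    proof (intro equalityI subsetI)
      fix J assume "J \<in> ?u ` H"
      then obtain b where b: "b \<in> H" "J = ?u b" by blast
      have "\<forall>x\<in>pts d. (h(p := b)) x \<in> H" using h b by (simp add: Pi_iff)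
      then have "?u b \<in> ?P" unfolding restrict_PiE_iff .
      then show "J \<in> {J \<in> ?P. \<forall>x\<in>pts d - {p}. J x = h x}" using b by simp
    next
      fix J assume "J \<in> {J \<in> ?P. \<forall>x\<in>pts d - {p}. J x = h x}"
      then have J: "J \<in> ?P" and Jh: "\<And>x. x \<in> pts d \<Longrightarrow> x \<noteq> p \<Longrightarrow> J x = h x"
        by (simp_all del: PiE_iff)
      have "J = ?u (J p)"
      proof
        fix x
        consider "x \<notin> pts d" | "x = p" | "x \<in> pts d" "x \<noteq> p" by blast
        then show "J x = ?u (J p) x"
          by cases (simp_all add: PiE_arb[OF J(1)] p Jh)
      qed
      then show "J \<in> ?u ` H" using PiE_mem[OF J(1) p] by blast
    qed
    have "(\<Sum>J\<in>?P. X (h p) (J p) * (\<Prod>x\<in>pts d - {p}. of_bool (J x = h x)) * t J) =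
      (\<Sum>J\<in>{J \<in> ?P. \<forall>x\<in>pts d - {p}. J x = h x}. X (h p) (J p) * t J)"
      unfolding one
    proof (rule sum.mono_neutral_cong_right[OF fin])
      show "\<forall>J\<in>?P - {J \<in> ?P. \<forall>x\<in>pts d - {p}. J x = h x}.
        X (h p) (J p) * of_bool (\<forall>x\<in>pts d - {p}. J x = h x) * t J = 0" by simp
    qed (blast, simp)
    also have "\<dots> = (\<Sum>b\<in>H. X (h p) (?u b p) * t (?u b))"
      unfolding im[symmetric] by (simp only: sum.reindex[OF inj] o_def)
    also have "\<dots> = (\<Sum>b\<in>H. X (h p) b * t (h(p := b)))"
    proof (rule sum.cong[OF refl])
      fix b
      have "t (?u b) = t (h(p := b))" by (rule cong) simp
      then show "X (h p) (?u b p) * t (?u b) = X (h p) b * t (h(p := b))" using p by simp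
    qed
    also have "\<dots> = (\<Sum>b\<in>{b\<in>H. snd b = snd (h p)}. if kc (snd (h p)) = \<kappa> then
       velocity ty i j (fst (h p)) (fst b) * t (h(p := b)) else 0)"
      by (rule sum.mono_neutral_cong_right) (auto simp: finite_H X_def)
    finally show "(\<Sum>J\<in>?P. X (h p) (J p) * (\<Prod>x\<in>pts d - {p}. of_bool (J x = h x)) * t J) =
      (\<Sum>b\<in>{b\<in>H. snd b = snd (h p)}. if kc (snd (h p)) = \<kappa> then
       velocity ty i j (fst (h p)) (fst b) * t (h(p := b)) else 0)" .
  qed
  finally show ?thesis by simp
qed

text \<open>The unit moved by a one-parameter torus: letters of one group with the same number,
  whatever their side and colour.\<close>

definition site :: "(nat \<times> bool) \<times> 'c \<Rightarrow> 'k \<times> nat" where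
  "site a = (kc (snd a), fst (fst a))"

definition fiber :: "(nat \<times> bool \<Rightarrow> (nat \<times> bool) \<times> 'c) \<Rightarrow> 'k \<times> nat \<Rightarrow> bool \<Rightarrow> (nat \<times> bool) set" where
  "fiber h u s = {x \<in> pts d. site (h x) = u \<and> snd (fst (h x)) = s}"

lemma finite_fiber [simp]: "finite (fiber h u s)"
  by (simp add: fiber_def)

lemma fiber_disjoint: "fiber h u False \<inter> fiber h u True = {}"
  by (auto simp: fiber_def)

lemma Orth_sign: "ty = Orth \<Longrightarrow> a \<in> H \<Longrightarrow> \<not> snd (fst a)"
  unfolding H_def by (cases "fst a") (simp add: mem_idx)

lemma fiber_Orth: "ty = Orth \<Longrightarrow> h \<in> pts d \<rightarrow> H \<Longrightarrow> fiber h u True = {}"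
proof (rule equals0I)
  fix x assume ty: "ty = Orth" and h: "h \<in> pts d \<rightarrow> H" and x: "x \<in> fiber h u True"
  have "x \<in> pts d" "snd (fst (h x))" using x by (simp_all add: fiber_def)
  then show False using Orth_sign[OF ty Pi_mem[OF h]] by blast
qed

text \<open>A diagonal group element acts on a word by a scalar, which must be 1 when the
  coefficient is nonzero. Changing one sign in the orthogonal group gives parity; scaling a dual
  pair by inverse factors gives equal counts on the two sides.\<close>

lemma balanced:
  assumes h: "h \<in> pts d \<rightarrow> H" and nz: "t h \<noteq> 0"
  shows "if ty = Orth then even (card (fiber h u False)) else card (fiber h u False) = card (fiber h u True)"
proof -
  obtain \<kappa> i where u: "u = (\<kappa>, i)" by (cases u)
  \<comment> \<open>Any nonzero number that is not a root of unity would do in place of 2: equal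
    powers must have equal exponents. Orthogonal diagonal entries can only be signs.\<close>
  define c :: "'k \<Rightarrow> nat \<times> bool \<Rightarrow> complex" where "c \<kappa>' a = (if \<kappa>' = \<kappa> \<and> fst a = i then (if ty = Orth then -1 else if snd a then 1 / 2 else 2) else 1)"
    for \<kappa>' a
  have "family (monomial_family (\<lambda>_ a. a) c)"
    by (rule monomial_family) (auto simp: c_def form_def form_sign_def split: gtype.splits)
  from monomial_invariant[OF this h] have "t h = (\<Prod>x\<in>pts d. c (kc (snd (h x))) (fst (h x))) * t h"
    using h by (simp add: Pi_iff)
  then have 1: "(\<Prod>x\<in>pts d. c (kc (snd (h x))) (fst (h x))) = 1"
    using nz by simp
  have "(\<Prod>x\<in>pts d. c (kc (snd (h x))) (fst (h x))) =
    (\<Prod>x\<in>fiber h u True \<union> fiber h u False. c (kc (snd (h x))) (fst (h x)))"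
    by (rule prod.mono_neutral_right) (auto simp: fiber_def c_def u site_def)
  also have "\<dots> = (\<Prod>x\<in>fiber h u True. c (kc (snd (h x))) (fst (h x))) * (\<Prod>x\<in>fiber h u False. c (kc (snd (h x))) (fst (h x)))"
    by (rule prod.union_disjoint) (auto simp: fiber_def)
  also have "\<dots> = (if ty = Orth then -1 else 1 / 2) ^ card (fiber h u True) * (if ty = Orth then -1 else 2) ^ card (fiber h u False)"
  proof -
    have "(\<Prod>x\<in>fiber h u s. c (kc (snd (h x))) (fst (h x))) =
      (\<Prod>x\<in>fiber h u s. if ty = Orth then -1 else if s then 1 / 2 else 2)" for s
      by (rule prod.cong) (auto simp: fiber_def c_def u site_def)
    then show ?thesis by simp
  qed
  finally have 2: "(if ty = Orth then -1 else 1 / 2) ^ card (fiber h u True) * (if ty = Orth then -1 else 2) ^ card (fiber h u False) = (1 :: complex)"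
    using 1 by simp
  show ?thesis
  proof (cases "ty = Orth")
    case True
    then have "(-1) ^ card (fiber h u False) = (1 :: complex)"
      using 2 fiber_Orth[OF True h] by simp
    then show ?thesis using True by (simp add: minus_one_power_iff split: if_splits)
  next
    case False
    then have "(2 :: complex) ^ card (fiber h u False) = 2 ^ card (fiber h u True)"
      using 2 by (simp add: power_divide field_simps)
    then have "(of_nat (2 ^ card (fiber h u False)) :: complex) = of_nat (2 ^ card (fiber h u True))"
      by simp
    then have "(2 :: nat) ^ card (fiber h u False) = 2 ^ card (fiber h u True)"
      by (simp only: of_nat_eq_iff)
    then show ?thesis using False by simp
  qed
qed

section \<open>Counting how often sites are used\<close>

lemma card_site_fiber: "card {x \<in> pts d. site (h x) = u} = card (fiber h u False) + card (fiber h u True)"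
proof -
  have "{x \<in> pts d. site (h x) = u} = fiber h u False \<union> fiber h u True" by (auto simp: fiber_def)
  then show ?thesis by (simp only: card_Un_disjoint[OF finite_fiber finite_fiber fiber_disjoint])
qed

lemma sum_card_fibers:
  "(\<Sum>u\<in>(\<lambda>x. site (h x)) ` pts d. card (fiber h u False) + card (fiber h u True)) = 2 * d"
proof -
  have "(\<Sum>x\<in>pts d. 1 :: nat) = (\<Sum>u\<in>(\<lambda>x. site (h x)) ` pts d. \<Sum>x\<in>{x \<in> pts d. site (h x) = u}. 1)"
    by (rule sum.image_gen) simp
  moreover have "card (pts d) = 2 * d" by (simp add: pts_def card_cartesian_product)
  ultimately show ?thesis by (simp add: card_site_fiber)
qed

text \<open>\<open>balanced\<close> excludes a single use: an even number, or a sum of two equal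
  numbers, is at least 2 when positive.\<close>

lemma used_site_card:
  assumes h: "h \<in> pts d \<rightarrow> H" and nz: "t h \<noteq> 0" and u: "u \<in> (\<lambda>x. site (h x)) ` pts d"
  shows "2 \<le> card (fiber h u False) + card (fiber h u True)"
proof -
  have "{x \<in> pts d. site (h x) = u} \<noteq> {}" using u by blast
  then have "card {x \<in> pts d. site (h x) = u} \<noteq> 0" by (simp add: card_eq_0_iff)
  then have pos: "card (fiber h u False) + card (fiber h u True) \<noteq> 0" unfolding card_site_fiber .
  show ?thesis
  proof (cases "ty = Orth")
    case True
    then have "even (card (fiber h u False))" "card (fiber h u True) = 0"
      using balanced[OF h nz, of u] fiber_Orth[OF _ h] by simp_all
    moreover have "2 \<le> a + b" if "even a" "b = 0" "a + b \<noteq> 0" for a b :: nat using that by presburger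
    ultimately show ?thesis using pos by blast
  next
    case False
    then have "card (fiber h u False) = card (fiber h u True)"
      using balanced[OF h nz, of u] by simp
    moreover have "2 \<le> a + b" if "a = b" "a + b \<noteq> 0" for a b :: nat using that by presburger
    ultimately show ?thesis using pos by blast
  qed
qed

lemma crowded_site_vanishes:
  assumes h: "h \<in> pts d \<rightarrow> H" and crowded: "3 \<le> card (fiber h u False) + card (fiber h u True)"
    and IH: "\<And>h'. h' \<in> pts d \<rightarrow> H \<Longrightarrow>
      card ((\<lambda>x. site (h x)) ` pts d) < card ((\<lambda>x. site (h' x)) ` pts d) \<Longrightarrow> t h' = 0"
  shows "t h = 0"
proof (rule ccontr)
  assume nz: "t h \<noteq> 0"
  define U where "U = (\<lambda>x. site (h x)) ` pts d"
  have finU: "finite U" by (simp add: U_def)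
  obtain \<kappa> i where u: "u = (\<kappa>, i)" by (cases u)
  have cardu: "3 \<le> card {x \<in> pts d. site (h x) = u}" unfolding card_site_fiber by (rule crowded)
  have uU: "u \<in> U"
  proof (rule ccontr)
    assume "u \<notin> U"
    then have e: "{x \<in> pts d. site (h x) = u} = {}" unfolding U_def by blast
    show False using cardu unfolding e by simp
  qed
  \<comment> \<open>Every used site takes at least two of the 2d positions and \<open>u\<close>
    takes three, so fewer than d sites are used and some number below \<open>N \<kappa>\<close> is
    free in the group of \<open>u\<close>.\<close>
  have "(\<Sum>v\<in>U. 2) < (\<Sum>v\<in>U. card (fiber h v False) + card (fiber h v True))"
  proof (rule sum_strict_mono_ex1[OF finU])
    show "\<forall>v\<in>U. 2 \<le> card (fiber h v False) + card (fiber h v True)"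
      using used_site_card[OF h nz] unfolding U_def by blast
    show "\<exists>v\<in>U. 2 < card (fiber h v False) + card (fiber h v True)"
      using crowded uU by (intro bexI[of _ u]) simp_all
  qed
  then have "card U < d" using sum_card_fibers[of h] by (simp add: U_def)
  have "\<exists>j<N \<kappa>. (\<kappa>, j) \<notin> U"
  proof (rule ccontr)
    assume "\<not> ?thesis"
    then have "Pair \<kappa> ` {..<N \<kappa>} \<subseteq> U" by auto
    then have "card (Pair \<kappa> ` {..<N \<kappa>}) \<le> card U" by (rule card_mono[OF finU])
    then show False using \<open>card U < d\<close> stable[of \<kappa>] by (simp add: card_image inj_on_def)
  qed
  then obtain j where j: "j < N \<kappa>" "(\<kappa>, j) \<notin> U" by blast
  have ij: "i \<noteq> j" using j(2) uU u by auto
  \<comment> \<open>The velocity entry that leads back from \<open>j\<close> to \<open>i\<close>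
    sits on the side \<open>neg_sign ty\<close>, so the occurrence to be moved must lie on that
    side; balance guarantees one.\<close>
  have "fiber h u (neg_sign ty) \<noteq> {}"
  proof (cases "ty = Orth")
    case True
    then show ?thesis using crowded fiber_Orth[OF True h, of u] by (auto simp: neg_sign_def)
  next
    case False
    then have "card (fiber h u False) = card (fiber h u True)" using balanced[OF h nz, of u] by simp
    then have "card (fiber h u True) \<noteq> 0" using crowded by linarith
    then have "fiber h u True \<noteq> {}" by (metis card.empty)
    then show ?thesis using False by (simp add: neg_sign_def)
  qed
  then obtain p0 where p0: "p0 \<in> pts d" "site (h p0) = u" "snd (fst (h p0)) = neg_sign ty"
    by (auto simp: fiber_def simp del: split_paired_Ex)
  define \<gamma> where "\<gamma> = snd (h p0)"
  have hp0: "h p0 = ((i, neg_sign ty), \<gamma>)" and kc: "kc \<gamma> = \<kappa>"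
    using p0 u by (auto simp: site_def \<gamma>_def prod_eq_iff)
  have hp0H: "h p0 \<in> H" using h p0(1) by blast
  then have i: "i < N \<kappa>" unfolding hp0 H_def by (simp add: mem_idx kc)
  have lin: "ty = Lin \<Longrightarrow> neg_sign ty = sg \<gamma>" using hp0H unfolding hp0 H_def by simp
  define h' where "h' = h(p0 := ((j, neg_sign ty), \<gamma>))"
  have "((j, neg_sign ty), \<gamma>) \<in> H"
    using j(1) lin unfolding H_def by (auto simp: mem_idx kc neg_sign_def)
  then have h': "h' \<in> pts d \<rightarrow> H" using h by (auto simp: h'_def Pi_iff simp del: split_paired_All)
  let ?S = "\<lambda>p. \<Sum>b\<in>{b\<in>H. snd b = snd (h' p)}. if kc (snd (h' p)) = \<kappa> then
     velocity ty i j (fst (h' p)) (fst b) * t (h'(p := b)) else 0"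
  \<comment> \<open>The only nonzero summand restores the original letter, with velocity entry
    -1.\<close>
  have "?S p0 = (\<Sum>b\<in>{b\<in>H. snd b = snd (h' p0)}. if b = h p0 then - t h else 0)"
  proof (rule sum.cong[OF refl])
    fix b assume b: "b \<in> {b\<in>H. snd b = snd (h' p0)}"
    have "h'(p0 := h p0) = h" by (simp add: h'_def fun_eq_iff)
    moreover have "b = h p0 \<longleftrightarrow> fst b = (i, neg_sign ty)"
      using b unfolding hp0 by (auto simp: h'_def prod_eq_iff)
    ultimately show "(if kc (snd (h' p0)) = \<kappa> then velocity ty i j (fst (h' p0)) (fst b) * t (h'(p0 := b)) else 0) =
        (if b = h p0 then - t h else 0)"
      using kc ij by (auto simp: h'_def velocity_def)
  qed
  also have "\<dots> = - t h"
    using finite_H hp0H by (simp add: h'_def \<gamma>_def)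
  finally have S0: "?S p0 = - t h" .
  have "?S p = 0" if p: "p \<in> pts d" "p \<noteq> p0" for p
  proof (rule sum.neutral, rule ballI)
    fix b assume b: "b \<in> {b\<in>H. snd b = snd (h' p)}"
    have h'p: "h' p = h p" using p by (simp add: h'_def)
    show "(if kc (snd (h' p)) = \<kappa> then velocity ty i j (fst (h' p)) (fst b) * t (h'(p := b)) else 0) = 0"
    proof (cases "kc (snd (h p)) = \<kappa> \<and> fst (h p) = (i, False) \<and> fst b = (j, False)")
      case True
      define h'' where "h'' = h'(p := b)"
      have h'': "h'' \<in> pts d \<rightarrow> H" using h' b by (auto simp: h''_def Pi_iff simp del: split_paired_All)
      have sp: "site (h p) = u" using True u by (simp add: site_def)
      have keep: "h'' x = h x" if "x \<noteq> p" "x \<noteq> p0" for x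
        using that by (simp add: h''_def h'_def)
      have "insert (\<kappa>, j) U \<subseteq> (\<lambda>x. site (h'' x)) ` pts d"
      proof (rule subsetI)
        fix v assume v: "v \<in> insert (\<kappa>, j) U"
        have "\<exists>x\<in>pts d. site (h'' x) = v"
        proof (cases "v = (\<kappa>, j)")
          case True
          then have "site (h'' p0) = v" using p(2) kc by (simp add: h''_def h'_def site_def)
          then show ?thesis using p0(1) by blast
        next
          case False
          then obtain y where y: "y \<in> pts d" "site (h y) = v" using v by (auto simp: U_def simp del: split_paired_Ex)
          show ?thesis
          proof (cases "v = u")
            case True
            \<comment> \<open>A third position on \<open>u\<close>, distinct from \<open>p\<close>
              and \<open>p0\<close>, is left untouched.\<close>
            have "\<not> {x \<in> pts d. site (h x) = u} \<subseteq> {p, p0}"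
            proof
              assume "{x \<in> pts d. site (h x) = u} \<subseteq> {p, p0}"
              then have "card {x \<in> pts d. site (h x) = u} \<le> card {p, p0}" by (rule card_mono[rotated]) simp
              then show False using cardu p(2) by simp
            qed
            then obtain x where "x \<in> pts d" "site (h x) = u" "x \<noteq> p" "x \<noteq> p0" by blast
            then show ?thesis using keep True by metis
          next
            case False
            then have "y \<noteq> p" "y \<noteq> p0" using y sp p0(2) by auto
            then show ?thesis using keep y by metis
          qed
        qed
        then show "v \<in> (\<lambda>x. site (h'' x)) ` pts d" by blast
      qed
      then have "card (insert (\<kappa>, j) U) \<le> card ((\<lambda>x. site (h'' x)) ` pts d)"
        by (rule card_mono[rotated]) simp
      then have "t h'' = 0"
        using j(2) finU by (intro IH[OF h'']) (simp add: U_def)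
      then show ?thesis by (simp add: h''_def)
    next
      case False
      have "fst (h p) \<noteq> (j, neg_sign ty)" if "kc (snd (h p)) = \<kappa>"
      proof
        assume "fst (h p) = (j, neg_sign ty)"
        then have "site (h p) = (\<kappa>, j)" using that by (simp add: site_def)
        then show False using j(2) p(1) unfolding U_def by (metis imageI)
      qed
      then show ?thesis using False by (auto simp: h'p velocity_def)
    qed
  qed
  note Sp = this
  have "(\<Sum>p\<in>pts d. ?S p) = (\<Sum>p\<in>pts d. if p = p0 then - t h else 0)"
  proof (rule sum.cong[OF refl])
    fix p assume p: "p \<in> pts d"
    show "?S p = (if p = p0 then - t h else 0)"
    proof (cases "p = p0")
      case True
      show ?thesis unfolding True using S0 by (simp only: if_True simp_thms)
    next
      case False
      show ?thesis using Sp[OF p False] False by (simp only: if_False)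
    qed
  qed
  also have "\<dots> = - t h" using p0(1) by simp
  finally show False
    using curve_relation[OF i j(1) ij h'] nz by simp
qed

text \<open>When every used site holds exactly two positions, the sites themselves form a matching
  of the positions. Renaming the numbers inside each group then turns the word into the regular word
  of that matching without changing the coefficient.\<close>

lemma regular_reduction:
  assumes h: "h \<in> pts d \<rightarrow> H" and nz: "t h \<noteq> 0"
    and two: "\<And>u. u \<in> (\<lambda>x. site (h x)) ` pts d \<Longrightarrow> card (fiber h u False) + card (fiber h u True) = 2"
  shows "\<exists>\<sigma> c. \<sigma> permutes pts d \<and> c \<in> extensional (pts d) \<and> edge_compat d R1 \<sigma> c \<and> t h = t (regular_word \<sigma> c)"
proof -
  define U where "U = (\<lambda>x. site (h x)) ` pts d"
  have finU: "finite U" by (simp add: U_def)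
  have hH: "h x \<in> H" if "x \<in> pts d" for x using h that by blast
  have "card U = d" using sum_card_fibers[of h] two by (simp add: U_def)
  \<comment> \<open>There are exactly d used sites, because they cover the 2d positions two at a
    time; \<open>e\<close> numbers them as edges.\<close>
  then obtain e where e: "bij_betw e {..<d} U"
    using ex_bij_betw_nat_finite[OF finU] by (auto simp: atLeast0LessThan)
  \<comment> \<open>Orders the two positions of a site. Outside the orthogonal case balance puts one
    on each side, and the order follows the side so that the labels agree with those of
    \<open>regular_word\<close>.\<close>
  have "\<exists>q :: bool \<Rightarrow> nat \<times> bool. q False \<noteq> q True \<and> {x \<in> pts d. site (h x) = u} = {q False, q True} \<and>
      (ty \<noteq> Orth \<longrightarrow> (\<forall>s. snd (fst (h (q s))) = s))" if u: "u \<in> U" for u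
  proof (cases "ty = Orth")
    case True
    have "card {x \<in> pts d. site (h x) = u} = 2" using two u unfolding card_site_fiber U_def by blast
    then obtain a b where "{x \<in> pts d. site (h x) = u} = {a, b}" "a \<noteq> b" by (meson card_2_iff)
    then show ?thesis using True by (intro exI[of _ "\<lambda>s. if s then b else a"]) auto
  next
    case False
    have "card (fiber h u False) = 1" "card (fiber h u True) = 1"
      using balanced[OF h nz, of u] two[of u] u False by (auto simp: U_def)
    then obtain a b where ab: "fiber h u False = {a}" "fiber h u True = {b}"
      by (auto simp: card_1_singleton_iff simp del: split_paired_Ex)
    have "{x \<in> pts d. site (h x) = u} = fiber h u False \<union> fiber h u True" by (auto simp: fiber_def)
    moreover have "snd (fst (h a)) = False" "snd (fst (h b)) = True"
      using ab by (auto simp: fiber_def simp del: split_paired_All)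
    ultimately show ?thesis using ab
      by (intro exI[of _ "\<lambda>s. if s then b else a"]) auto
  qed
  from bchoice[OF ballI[OF this]] obtain q :: "'k \<times> nat \<Rightarrow> bool \<Rightarrow> nat \<times> bool" where
    "\<forall>u\<in>U. q u False \<noteq> q u True \<and> {x \<in> pts d. site (h x) = u} = {q u False, q u True} \<and>
      (ty \<noteq> Orth \<longrightarrow> (\<forall>s. snd (fst (h (q u s))) = s))" ..
  then have q: "\<And>u. u \<in> U \<Longrightarrow> q u False \<noteq> q u True"
    "\<And>u. u \<in> U \<Longrightarrow> {x \<in> pts d. site (h x) = u} = {q u False, q u True}"
    "\<And>u s. u \<in> U \<Longrightarrow> ty \<noteq> Orth \<Longrightarrow> snd (fst (h (q u s))) = s" by blast+
  have eU: "e k \<in> U" if "k < d" for k using e that by (auto simp: bij_betw_def)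
  define \<sigma> where "\<sigma> x = (if fst x < d then q (e (fst x)) (snd x) else x)" for x
  have \<sigma>_in: "\<sigma> x \<in> pts d" "site (h (\<sigma> x)) = e (fst x)" if x: "x \<in> pts d" for x
  proof -
    have lt: "fst x < d" using x by (auto simp: pts_def)
    then have "\<sigma> x \<in> {q (e (fst x)) False, q (e (fst x)) True}"
      unfolding \<sigma>_def by (cases "snd x") simp_all
    then have "\<sigma> x \<in> {y \<in> pts d. site (h y) = e (fst x)}" unfolding q(2)[OF eU[OF lt]] .
    then show "\<sigma> x \<in> pts d" "site (h (\<sigma> x)) = e (fst x)" by blast+
  qed
  have inj: "inj_on \<sigma> (pts d)"
  proof (rule inj_onI)
    fix x y assume xy: "x \<in> pts d" "y \<in> pts d" "\<sigma> x = \<sigma> y"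
    have lt: "fst x < d" "fst y < d" using xy by (auto simp: pts_def)
    have "e (fst x) = e (fst y)" using \<sigma>_in(2)[OF xy(1)] \<sigma>_in(2)[OF xy(2)] xy(3) by simp
    then have "fst x = fst y" using e lt by (auto simp: bij_betw_def dest: inj_onD)
    moreover have "snd x = snd y"
      using xy(3) lt q(1)[OF eU[OF lt(2)]] \<open>fst x = fst y\<close> unfolding \<sigma>_def by (cases "snd x"; cases "snd y") auto
    ultimately show "x = y" by (simp add: prod_eq_iff)
  qed
  have "\<sigma> ` pts d = pts d"
    by (rule endo_inj_surj[OF finite_pts _ inj]) (use \<sigma>_in(1) in blast)
  then have \<sigma>: "\<sigma> permutes pts d"
    by (intro bij_imp_permutes) (use inj in \<open>auto simp: bij_betw_def \<sigma>_def\<close>)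
  define c where "c = restrict (\<lambda>x. snd (h x)) (pts d)"
  have h\<sigma>: "site (h (\<sigma> (k, s))) = e k" "\<sigma> (k, s) \<in> pts d" if "k < d" for k s
    using \<sigma>_in[of "(k, s)"] that by simp_all
  have sign: "ty \<noteq> Orth \<Longrightarrow> snd (fst (h (\<sigma> (k, s)))) = s" if "k < d" for k s
    using q(3)[OF eU[OF that]] that by (simp add: \<sigma>_def)
  have linsg: "ty = Lin \<Longrightarrow> snd (fst (h x)) = sg (snd (h x))" if "x \<in> pts d" for x
    using hH[OF that] unfolding H_def by blast
  have "edge_compat d R1 \<sigma> c"
    unfolding edge_compat_def
  proof (intro allI impI)
    fix k assume k: "k < d"
    have "kc (c (\<sigma> (k, False))) = kc (c (\<sigma> (k, True)))"
      using h\<sigma>[OF k] by (simp add: c_def site_def prod_eq_iff)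
    moreover have "sg (c (\<sigma> (k, False))) \<noteq> sg (c (\<sigma> (k, True)))" if "ty = Lin"
      using sign[OF k, of False] sign[OF k, of True] linsg[OF h\<sigma>(2)[OF k]] that h\<sigma>(2)[OF k] by (simp add: c_def)
    ultimately show "R1 (c (\<sigma> (k, False))) (c (\<sigma> (k, True)))" by (simp add: R1_def)
  qed
  \<comment> \<open>In each group the numbers of its used sites are sent to the edge indices; these
    are below d and hence admissible by \<open>stable\<close>.\<close>
  have "\<exists>\<pi>. \<pi> permutes {..<N \<kappa>} \<and> (\<forall>k\<in>{k. k < d \<and> fst (e k) = \<kappa>}. \<pi> (snd (e k)) = k)" for \<kappa>
  proof (rule permutation_extending)
    show "finite {..<N \<kappa>}" by simp
    show "{k. k < d \<and> fst (e k) = \<kappa>} \<subseteq> {..<N \<kappa>}" using stable[of \<kappa>] by auto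
    show "inj_on (\<lambda>k. snd (e k)) {k. k < d \<and> fst (e k) = \<kappa>}"
      using e by (auto simp: bij_betw_def inj_on_def prod_eq_iff)
    show "(\<lambda>k. snd (e k)) ` {k. k < d \<and> fst (e k) = \<kappa>} \<subseteq> {..<N \<kappa>}"
    proof (intro image_subsetI, elim CollectE conjE)
      fix k assume k: "k < d" "fst (e k) = \<kappa>"
      have "h (\<sigma> (k, False)) \<in> H" using hH h\<sigma>(2)[OF k(1)] by blast
      then show "snd (e k) \<in> {..<N \<kappa>}"
        using h\<sigma>(1)[OF k(1), of False] k(2) by (auto simp: H_def site_def idx_def prod_eq_iff mem_Times_iff)
    qed
  qed
  from choice[OF allI[OF this]] obtain \<pi> where
    "\<forall>\<kappa>. \<pi> \<kappa> permutes {..<N \<kappa>} \<and> (\<forall>k\<in>{k. k < d \<and> fst (e k) = \<kappa>}. \<pi> \<kappa> (snd (e k)) = k)" ..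
  then have \<pi>: "\<And>\<kappa>. \<pi> \<kappa> permutes {..<N \<kappa>}" "\<And>k. k < d \<Longrightarrow> \<pi> (fst (e k)) (snd (e k)) = k"
    by blast+
  define f where "f \<kappa> a = (\<pi> \<kappa> (fst a), snd a)" for \<kappa> and a :: "nat \<times> bool"
  have f_idx: "f \<kappa> a \<in> idx ty (N \<kappa>)" if "a \<in> idx ty (N \<kappa>)" for \<kappa> a
    using that permutes_in_image[OF \<pi>(1)[of \<kappa>], of "fst a"] by (auto simp: f_def idx_def)
  have fam: "family (monomial_family f (\<lambda>_ _. 1))"
  proof (rule monomial_family)
    show "f \<kappa> a \<in> idx ty (N \<kappa>)" if "a \<in> idx ty (N \<kappa>)" for \<kappa> a by (rule f_idx[OF that])
    show "1 * 1 * form ty (f \<kappa> a) (f \<kappa> b) = form ty a b" for \<kappa> a b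
      using injD[OF permutes_inj[OF \<pi>(1)]] by (auto simp: form_def f_def)
  qed (simp add: f_def)
  have "t h = t (\<lambda>x. (f (kc (snd (h x))) (fst (h x)), snd (h x)))"
  proof -
    have "(f (kc (snd (h x))) (fst (h x)), snd (h x)) \<in> H" if "x \<in> pts d" for x
      using hH[OF that] f_idx by (auto simp: H_def f_def)
    from monomial_invariant[OF fam h this] show ?thesis by simp
  qed
  also have "\<dots> = t (regular_word \<sigma> c)"
  proof (rule cong)
    fix x assume x: "x \<in> pts d"
    obtain k s where ks: "pinv \<sigma> x = (k, s)" by (cases "pinv \<sigma> x")
    have x': "x = \<sigma> (k, s)" using ks permutes_inverses(1)[OF \<sigma>, of x] by simp
    have "(k, s) \<in> pts d" using ks permutes_in_image[OF permutes_inv[OF \<sigma>], of x] x by simp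
    then have k: "k < d" by simp
    have st: "kc (snd (h x)) = fst (e k)" "fst (fst (h x)) = snd (e k)"
      using h\<sigma>(1)[OF k, of s] unfolding x' site_def by (auto simp: prod_eq_iff)
    have "snd (fst (h x)) = snd (label (k, s) (snd (h x)))"
      using sign[OF k, of s] linsg[OF x] Orth_sign[OF _ hH[OF x]] unfolding x' label_def by (cases ty) auto
    then show "(f (kc (snd (h x))) (fst (h x)), snd (h x)) = regular_word \<sigma> c x"
      using x \<pi>(2)[OF k] st unfolding regular_word_def ks by (simp add: f_def c_def label_def)
  qed
  finally have "t h = t (regular_word \<sigma> c)" .
  moreover have "c \<in> extensional (pts d)" by (simp add: c_def)
  ultimately show ?thesis using \<sigma> \<open>edge_compat d R1 \<sigma> c\<close> by blast
qed

text \<open>Downward induction on the number of used sites, which is at most 2d: a crowded site is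
  resolved by words with more sites, and a word without crowded sites reduces to a regular
  one.\<close>

lemma vanishes_if_regular_vanishes:
  assumes zero: "\<And>\<sigma> c. \<sigma> permutes pts d \<Longrightarrow> c \<in> extensional (pts d) \<Longrightarrow> edge_compat d R1 \<sigma> c \<Longrightarrow> t (regular_word \<sigma> c) = 0"
    and "h \<in> pts d \<rightarrow> H"
  shows "t h = 0"
  using assms(2)
proof (induction "2 * d - card ((\<lambda>x. site (h x)) ` pts d)" arbitrary: h rule: less_induct)
  case less
  have bound: "card ((\<lambda>x. site (h' x)) ` pts d) \<le> 2 * d" for h'
    using card_image_le[OF finite_pts, of "\<lambda>x. site (h' x)" d] by (simp add: pts_def card_cartesian_product)
  have IH: "t h' = 0" if "h' \<in> pts d \<rightarrow> H" "card ((\<lambda>x. site (h x)) ` pts d) < card ((\<lambda>x. site (h' x)) ` pts d)" for h'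
    using that bound[of h'] by (intro less.hyps) auto
  show ?case
  proof (rule ccontr)
    assume nz: "t h \<noteq> 0"
    have "card (fiber h u False) + card (fiber h u True) = 2" if "u \<in> (\<lambda>x. site (h x)) ` pts d" for u
    proof (rule ccontr)
      assume "card (fiber h u False) + card (fiber h u True) \<noteq> 2"
      then have "3 \<le> card (fiber h u False) + card (fiber h u True)"
        using used_site_card[OF less.prems nz that] by simp
      from crowded_site_vanishes[OF less.prems this IH] nz show False by simp
    qed
    from regular_reduction[OF less.prems nz this] zero nz show False by auto
  qed
qed

text \<open>A symmetry of the second matching is undone by a monomial group element that renames the
  numbers. For \<open>Symp\<close> the side records the orientation of the edge, so a reversed edge
  requires exchanging a dual pair, which costs the sign.\<close>

lemma regular_word_hyperoct:
  assumes \<sigma>: "\<sigma> permutes pts d" and \<eta>: "\<eta> \<in> hyperoct d"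
  shows "t (regular_word (\<sigma> \<circ> \<eta>) c) = flip_sign d eps1 \<eta> * t (regular_word \<sigma> c)"
proof -
  have p: "\<eta> permutes pts d" using \<eta> by (simp add: hyperoct_def)
  define f where "f a = (if ty = Symp then \<eta> a else (fst (\<eta> (fst a, False)), snd a))" for a
  \<comment> \<open>Exchanging the vectors of a symplectic pair preserves the form only with a minus
    sign on one of them.\<close>
  define s where "s a = (if ty = Symp \<and> snd a \<and> \<not> snd (\<eta> a) then -1 else 1 :: complex)" for a
  have fst_lt: "fst (\<eta> (k, b)) < n \<longleftrightarrow> k < n" if "d \<le> n" for k b n
  proof (cases "k < d")
    case False
    then show ?thesis using permutes_not_in[OF p, of "(k, b)"] by simp
  qed (use hyperoct_lt[OF \<eta>, of k b] that in auto)
  have fst_inj: "fst (\<eta> (k, False)) = fst (\<eta> (l, False)) \<longleftrightarrow> k = l" for k l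
    using permutes_inj[OF hyperoct_fst_permutes[OF \<eta>]] by (auto dest: injD)
  have snd_eta: "snd (\<eta> (k, b)) = (b \<noteq> snd (\<eta> (k, False)))" for k b
    using hyperoct_fst(2)[OF \<eta>, of k] by (cases b) auto
  have fam: "family (monomial_family (\<lambda>_. f) (\<lambda>_. s))"
  proof (rule monomial_family)
    fix \<kappa> a assume "a \<in> idx ty (N \<kappa>)"
    then have a: "fst a < N \<kappa>" "ty = Orth \<longrightarrow> \<not> snd a" by (cases a; simp add: mem_idx)+
    have "fst (f a) < N \<kappa>"
      using fst_lt[OF stable[of \<kappa>], of "fst a"] a(1) by (cases a) (simp add: f_def)
    moreover have "ty = Orth \<longrightarrow> \<not> snd (f a)" using a(2) by (simp add: f_def)
    ultimately show "f a \<in> idx ty (N \<kappa>)" by (cases "f a") (simp add: mem_idx)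
  next
    fix \<kappa> a b assume ab: "a \<in> idx ty (N \<kappa>)" "b \<in> idx ty (N \<kappa>)"
    obtain k x where a: "a = (k, x)" by (cases a)
    obtain l y where b: "b = (l, y)" by (cases b)
    show "s a * s b * form ty (f a) (f b) = form ty a b"
    proof (cases "ty = Symp")
      case True
      have "form ty (\<eta> a) (\<eta> b) = (if k = l then form_sign ty (x \<noteq> snd (\<eta> (k, False))) (y \<noteq> snd (\<eta> (l, False))) else 0)"
        unfolding a b form_def hyperoct_fst(1)[OF \<eta>, of k x] hyperoct_fst(1)[OF \<eta>, of l y] fst_inj
          snd_eta[of k x] snd_eta[of l y] by simp
      then show ?thesis
        using True unfolding f_def s_def a b snd_conv snd_eta[of k x] snd_eta[of l y]
        by (cases x; cases y; cases "snd (\<eta> (k, False))") (auto simp: form_def form_sign_def)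
    next
      case False
      then show ?thesis by (simp add: f_def s_def a b form_def fst_inj)
    qed
  next
    show "snd (f a) = snd a" if "ty = Lin" for a using that by (simp add: f_def)
  qed
  let ?h = "regular_word (\<sigma> \<circ> \<eta>) c"
  have h: "?h \<in> pts d \<rightarrow> H"
    by (rule regular_word_in_H[OF permutes_compose[OF p \<sigma>]])
  have inv_eq: "\<eta> (pinv (\<sigma> \<circ> \<eta>) x) = pinv \<sigma> x" for x
  proof -
    have "\<sigma> (\<eta> (pinv (\<sigma> \<circ> \<eta>) x)) = x"
      using permutes_inverses(1)[OF permutes_compose[OF p \<sigma>], of x] by simp
    then show ?thesis using permutes_inverses(2)[OF \<sigma>] by metis
  qed
  have moved: "(f (fst (?h x)), snd (?h x)) = regular_word \<sigma> c x" for x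
  proof -
    obtain k b where kb: "pinv (\<sigma> \<circ> \<eta>) x = (k, b)" by (cases "pinv (\<sigma> \<circ> \<eta>) x")
    have "pinv \<sigma> x = \<eta> (k, b)" using inv_eq[of x] kb by simp
    then show ?thesis
      unfolding regular_word_def kb f_def label_def using hyperoct_fst(1)[OF \<eta>, of k b]
      by (cases ty) (auto simp: prod_eq_iff)
  qed
  have "t ?h = (\<Prod>x\<in>pts d. s (fst (?h x))) * t (\<lambda>x. (f (fst (?h x)), snd (?h x)))"
    by (rule monomial_invariant[OF fam h]) (use moved regular_word_in_H[OF \<sigma>, of c] in \<open>auto simp: Pi_iff simp del: split_paired_All\<close>)
  also have "(\<lambda>x. (f (fst (?h x)), snd (?h x))) = regular_word \<sigma> c"
    using moved by blast
  also have "(\<Prod>x\<in>pts d. s (fst (?h x))) = flip_sign d eps1 \<eta>"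
  proof -
    have "s (label y \<gamma>) = s y" for y \<gamma>
    proof (cases "ty = Symp")
      case True
      then have "label y \<gamma> = y" unfolding label_def by simp
      then show ?thesis by simp
    qed (simp add: s_def)
    then have "s (fst (?h x)) = s (pinv (\<sigma> \<circ> \<eta>) x)" for x
      by (simp add: regular_word_def)
    then have "(\<Prod>x\<in>pts d. s (fst (?h x))) = (\<Prod>x\<in>pts d. s (pinv (\<sigma> \<circ> \<eta>) x))" by simp
    also have "\<dots> = (\<Prod>x\<in>pts d. s x)"
      using prod.permute[OF permutes_inv[OF permutes_compose[OF p \<sigma>]], of s] by (simp add: o_def)
    also have "\<dots> = flip_sign d eps1 \<eta>"
      unfolding prod_pts flip_sign_def
      by (rule prod.cong) (auto simp: s_def eps1_def hyperoct_fst(2)[OF \<eta>])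
    finally show ?thesis .
  qed
  finally show ?thesis .
qed

end

end

section \<open>The invariants as functions on pairs of matchings\<close>

lemma finite_hyperoct [simp]: "finite (hyperoct d)"
  by (rule finite_subset[OF _ finite_permutations[OF finite_pts[of d]]]) (auto simp: hyperoct_def)

context words
begin

text \<open>Contracts along every matching with the invariant form. Each matching arises from as
  many permutations as \<open>hyperoct d\<close> has elements, which the leading factor
  compensates.\<close>

definition match_tensor :: "((nat \<times> bool \<Rightarrow> nat \<times> bool) \<times> (nat \<times> bool \<Rightarrow> 'c) \<Rightarrow> complex) \<Rightarrow>
    (nat \<times> bool \<Rightarrow> (nat \<times> bool) \<times> 'c) \<Rightarrow> complex" where
  "match_tensor \<psi> h = inverse (of_nat (card (hyperoct d))) * (\<Sum>\<sigma> | \<sigma> permutes pts d.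
     \<psi> (\<sigma>, restrict (\<lambda>x. snd (h x)) (pts d)) * (\<Prod>k<d. beta (h (\<sigma> (k, False))) (h (\<sigma> (k, True)))))"

lemma match_tensor_cong:
  assumes "\<And>x. x \<in> pts d \<Longrightarrow> h x = h' x"
  shows "match_tensor \<psi> h = match_tensor \<psi> h'"
proof -
  have c: "restrict (\<lambda>x. snd (h x)) (pts d) = restrict (\<lambda>x. snd (h' x)) (pts d)"
    by (rule restrict_ext) (simp add: assms)
  have "(\<Prod>k<d. beta (h (\<sigma> (k, False))) (h (\<sigma> (k, True)))) = (\<Prod>k<d. beta (h' (\<sigma> (k, False))) (h' (\<sigma> (k, True))))"
    if "\<sigma> permutes pts d" for \<sigma>
    by (rule prod.cong) (simp_all add: assms permutes_in_image[OF that])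
  then show ?thesis unfolding match_tensor_def c by simp
qed

text \<open>Passing from \<open>J\<close> to \<open>J \<circ> \<sigma>\<close> makes the matching
  standard; the sum then factors over the edges and \<open>beta_invariant\<close> applies to
  each.\<close>

lemma sum_fam_prod_beta:
  assumes \<sigma>: "\<sigma> permutes pts d" and h: "h \<in> pts d \<rightarrow> H" and g: "family g"
  shows "(\<Sum>J\<in>PiE (pts d) (\<lambda>_. H). (\<Prod>x\<in>pts d. fam g (h x) (J x)) *
      (\<Prod>k<d. beta (J (\<sigma> (k, False))) (J (\<sigma> (k, True))))) = (\<Prod>k<d. beta (h (\<sigma> (k, False))) (h (\<sigma> (k, True))))"
proof -
  let ?P = "PiE (pts d) (\<lambda>_. H)"
  define G where "G J = (\<Prod>x\<in>pts d. fam g (h (\<sigma> x)) (J x)) * (\<Prod>k<d. beta (J (k, False)) (J (k, True)))" for J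
  have comp: "J \<circ> \<theta> \<in> ?P" if "J \<in> ?P" "\<theta> permutes pts d" for J \<theta>
  proof -
    have "J \<circ> \<theta> \<in> extensional (pts d)"
      using that by (simp add: extensional_comp_permutes PiE_def)
    moreover have "(J \<circ> \<theta>) x \<in> H" if "x \<in> pts d" for x
      using PiE_mem[OF \<open>J \<in> ?P\<close>] that permutes_in_image[OF \<open>\<theta> permutes pts d\<close>, of x] by simp
    ultimately show ?thesis by (simp add: PiE_iff)
  qed
  have "(\<Sum>J\<in>?P. (\<Prod>x\<in>pts d. fam g (h x) (J x)) * (\<Prod>k<d. beta (J (\<sigma> (k, False))) (J (\<sigma> (k, True))))) = (\<Sum>J\<in>?P. G (J \<circ> \<sigma>))"
  proof (rule sum.cong[OF refl])
    fix J
    show "(\<Prod>x\<in>pts d. fam g (h x) (J x)) * (\<Prod>k<d. beta (J (\<sigma> (k, False))) (J (\<sigma> (k, True)))) = G (J \<circ> \<sigma>)"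
      using prod.permute[OF \<sigma>, of "\<lambda>x. fam g (h x) (J x)"] by (simp add: G_def o_def)
  qed
  also have "\<dots> = (\<Sum>J\<in>?P. G J)"
    by (rule sum.reindex_bij_witness[where i = "\<lambda>J. J \<circ> pinv \<sigma>" and j = "\<lambda>J. J \<circ> \<sigma>"])
      (simp_all add: comp \<sigma> permutes_inv o_assoc[symmetric] permutes_inv_o[OF \<sigma>])
  also have "\<dots> = (\<Sum>J\<in>?P. \<Prod>k<d. fam g (h (\<sigma> (k, False))) (J (k, False)) * fam g (h (\<sigma> (k, True))) (J (k, True)) *
      beta (J (k, False)) (J (k, True)))"
    unfolding G_def prod_pts by (simp only: prod.distrib)
  also have "\<dots> = (\<Prod>k<d. \<Sum>a\<in>H. \<Sum>b\<in>H. fam g (h (\<sigma> (k, False))) a * fam g (h (\<sigma> (k, True))) b * beta a b)"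
    by (rule prod_sum_pairs[OF finite_H, symmetric])
  also have "\<dots> = (\<Prod>k<d. beta (h (\<sigma> (k, False))) (h (\<sigma> (k, True))))"
  proof (rule prod.cong[OF refl])
    fix k assume "k \<in> {..<d}"
    then have "h (\<sigma> (k, s)) \<in> H" for s
      using permutes_in_image[OF \<sigma>, of "(k, s)"] Pi_mem[OF h, of "\<sigma> (k, s)"] by simp
    then show "(\<Sum>a\<in>H. \<Sum>b\<in>H. fam g (h (\<sigma> (k, False))) a * fam g (h (\<sigma> (k, True))) b * beta a b) =
      beta (h (\<sigma> (k, False))) (h (\<sigma> (k, True)))"
      by (intro beta_invariant g)
  qed
  finally show ?thesis .
qed

text \<open>The group preserves colours, so in every nonzero term the weights given by
  \<open>\<psi>\<close> are the same and only the contractions change.\<close>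

lemma match_tensor_invariant:
  assumes g: "family g"
  shows "tensor_invariant d H (fam g) (match_tensor \<psi>)"
  unfolding tensor_invariant_def
proof
  fix h assume h: "h \<in> pts d \<rightarrow> H"
  let ?P = "PiE (pts d) (\<lambda>_. H)"
  define c where "c = restrict (\<lambda>x. snd (h x)) (pts d)"
  define I where "I = inverse (of_nat (card (hyperoct d)) :: complex)"
  define B where "B \<sigma> J = (\<Prod>k<d. beta (J (\<sigma> (k, False))) (J (\<sigma> (k, True))))"
    for \<sigma> and J :: "nat \<times> bool \<Rightarrow> (nat \<times> bool) \<times> 'c"
  define A where "A J = (\<Prod>x\<in>pts d. fam g (h x) (J x))" for J
  have "A J * match_tensor \<psi> J = (\<Sum>\<sigma> | \<sigma> permutes pts d. I * \<psi> (\<sigma>, c) * (A J * B \<sigma> J))" for J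
  proof (cases "A J = 0")
    case False
    have "snd (J x) = snd (h x)" if "x \<in> pts d" for x
    proof (rule ccontr)
      assume "snd (J x) \<noteq> snd (h x)"
      then have "fam g (h x) (J x) = 0" by (auto simp: fam_def)
      then have "A J = 0" unfolding A_def by (intro prod_zero[OF finite_pts] bexI[OF _ that])
      then show False using False by simp
    qed
    then have "restrict (\<lambda>x. snd (J x)) (pts d) = c" unfolding c_def by (intro restrict_ext)
    then have "match_tensor \<psi> J = I * (\<Sum>\<sigma> | \<sigma> permutes pts d. \<psi> (\<sigma>, c) * B \<sigma> J)"
      unfolding match_tensor_def I_def B_def by simp
    then show ?thesis by (simp add: sum_distrib_left mult_ac)
  qed simp
  then have "(\<Sum>J\<in>?P. A J * match_tensor \<psi> J) = (\<Sum>J\<in>?P. \<Sum>\<sigma> | \<sigma> permutes pts d. I * \<psi> (\<sigma>, c) * (A J * B \<sigma> J))"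
    by simp
  also have "\<dots> = (\<Sum>\<sigma> | \<sigma> permutes pts d. \<Sum>J\<in>?P. I * \<psi> (\<sigma>, c) * (A J * B \<sigma> J))"
    by (rule sum.swap)
  also have "\<dots> = (\<Sum>\<sigma> | \<sigma> permutes pts d. I * \<psi> (\<sigma>, c) * B \<sigma> h)"
  proof (rule sum.cong[OF refl])
    fix \<sigma> assume "\<sigma> \<in> {\<sigma>. \<sigma> permutes pts d}"
    then have "(\<Sum>J\<in>?P. A J * B \<sigma> J) = B \<sigma> h"
      unfolding A_def B_def using sum_fam_prod_beta[OF _ h g] by simp
    then show "(\<Sum>J\<in>?P. I * \<psi> (\<sigma>, c) * (A J * B \<sigma> J)) = I * \<psi> (\<sigma>, c) * B \<sigma> h"
      by (simp only: sum_distrib_left[symmetric])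
  qed
  also have "\<dots> = match_tensor \<psi> h"
    unfolding match_tensor_def I_def[symmetric] c_def[symmetric] B_def by (simp only: sum_distrib_left mult.assoc)
  finally show "(\<Sum>J\<in>?P. (\<Prod>x\<in>pts d. fam g (h x) (J x)) * match_tensor \<psi> J) = match_tensor \<psi> h"
    unfolding A_def .
qed

text \<open>Substituting \<open>\<eta> \<circ> \<sigma>\<close> for \<open>\<sigma>\<close> in the
  sum moves \<open>\<eta>\<close> from the word into the first equivariance law of
  \<open>match_space\<close>.\<close>

lemma match_tensor_hyperoct:
  assumes \<psi>: "\<psi> \<in> match_space d R0 \<epsilon>0 R1 \<epsilon>1" and \<eta>: "\<eta> \<in> hyperoct d"
  shows "match_tensor \<psi> (h \<circ> \<eta>) = flip_sign d \<epsilon>0 \<eta> * match_tensor \<psi> h"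
proof -
  have p: "\<eta> permutes pts d" using \<eta> by (simp add: hyperoct_def)
  define c where "c = restrict (\<lambda>x. snd (h x)) (pts d)"
  have c: "c \<in> extensional (pts d)" by (simp add: c_def)
  have c': "restrict (\<lambda>x. snd ((h \<circ> \<eta>) x)) (pts d) = c \<circ> \<eta>"
    using permutes_in_image[OF p] by (auto simp: c_def restrict_def fun_eq_iff permutes_not_in[OF p])
  define B where "B \<sigma> = (\<Prod>k<d. beta (h (\<sigma> (k, False))) (h (\<sigma> (k, True))))" for \<sigma>
  have "(\<Sum>\<sigma> | \<sigma> permutes pts d. \<psi> (\<sigma>, c \<circ> \<eta>) * B (\<eta> \<circ> \<sigma>)) =
    (\<Sum>\<sigma> | \<sigma> permutes pts d. flip_sign d \<epsilon>0 \<eta> * (\<psi> (\<eta> \<circ> \<sigma>, c) * B (\<eta> \<circ> \<sigma>)))"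
  proof (rule sum.cong[OF refl])
    fix \<sigma> assume "\<sigma> \<in> {\<sigma>. \<sigma> permutes pts d}"
    then have "\<eta> \<circ> \<sigma> permutes pts d" using p by (simp add: permutes_compose)
    then have "\<psi> (pinv \<eta> \<circ> (\<eta> \<circ> \<sigma>), c \<circ> pinv (pinv \<eta>)) = flip_sign d \<epsilon>0 (pinv \<eta>) * \<psi> (\<eta> \<circ> \<sigma>, c)"
      using \<psi> c hyperoct_inv[OF \<eta>] unfolding match_space_def by blast
    moreover have "pinv \<eta> \<circ> (\<eta> \<circ> \<sigma>) = \<sigma>" "pinv (pinv \<eta>) = \<eta>"
      using p by (simp_all add: o_assoc permutes_inv_o permutes_inv_inv)
    ultimately have "\<psi> (\<sigma>, c \<circ> \<eta>) = flip_sign d \<epsilon>0 \<eta> * \<psi> (\<eta> \<circ> \<sigma>, c)"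
      by (simp only: flip_sign_inv[OF \<eta>])
    then show "\<psi> (\<sigma>, c \<circ> \<eta>) * B (\<eta> \<circ> \<sigma>) = flip_sign d \<epsilon>0 \<eta> * (\<psi> (\<eta> \<circ> \<sigma>, c) * B (\<eta> \<circ> \<sigma>))" by simp
  qed
  also have "\<dots> = flip_sign d \<epsilon>0 \<eta> * (\<Sum>\<sigma> | \<sigma> permutes pts d. \<psi> (\<sigma>, c) * B \<sigma>)"
    unfolding sum_distrib_left[symmetric]
    using setum_permutations_compose_left[OF p, of "\<lambda>\<sigma>. \<psi> (\<sigma>, c) * B \<sigma>"] by simp
  finally show ?thesis
    unfolding match_tensor_def c' c_def[symmetric] B_def by (simp add: mult.left_commute)
qed

lemma match_tensor_supp:
  assumes \<psi>: "\<psi> \<in> match_space d R0 \<epsilon>0 R1 \<epsilon>1" and k: "k < d" "\<not> R0 (snd (h (k, False))) (snd (h (k, True)))"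
  shows "match_tensor \<psi> h = 0"
proof -
  have "\<not> edge_compat d R0 id (restrict (\<lambda>x. snd (h x)) (pts d))"
    using k by (auto simp: edge_compat_def)
  then have "\<psi> (\<sigma>, restrict (\<lambda>x. snd (h x)) (pts d)) = 0" for \<sigma>
    using \<psi> unfolding match_space_def by blast
  then show ?thesis by (simp add: match_tensor_def)
qed

lemma eps1_sign_square: "flip_sign d eps1 \<eta> * flip_sign d eps1 \<eta> = 1"
  unfolding flip_sign_def prod.distrib[symmetric] by (rule prod.neutral) (simp add: eps1_def)

text \<open>A different matching joins two different numbers of the regular word and is killed by
  the form. The permutations \<open>\<sigma>0 \<circ> \<eta>\<close> with \<open>\<eta>\<close> in
  \<open>hyperoct d\<close> all contribute \<open>\<psi> (\<sigma>0, c)\<close>, since the sign of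
  the contraction cancels that of the second equivariance law.\<close>

lemma match_tensor_regular:
  assumes \<psi>: "\<psi> \<in> match_space d R0 \<epsilon>0 R1 eps1" and \<sigma>0: "\<sigma>0 permutes pts d" and c: "c \<in> extensional (pts d)"
  shows "match_tensor \<psi> (regular_word \<sigma>0 c) = \<psi> (\<sigma>0, c)"
proof -
  let ?h = "regular_word \<sigma>0 c"
  define B where "B \<sigma> = (\<Prod>k<d. beta (?h (\<sigma> (k, False))) (?h (\<sigma> (k, True))))" for \<sigma>
  have c': "restrict (\<lambda>x. snd (?h x)) (pts d) = c"
    using c by (simp add: regular_word_def extensional_restrict)
  have zero: "edge_compat d R1 \<sigma> c" if "\<psi> (\<sigma>, c) \<noteq> 0" for \<sigma>
    using \<psi> that unfolding match_space_def by blast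
  have term_val: "\<psi> (\<sigma>0 \<circ> \<eta>, c) * B (\<sigma>0 \<circ> \<eta>) = (if \<eta> \<in> hyperoct d then \<psi> (\<sigma>0, c) else 0)"
    if p: "\<eta> permutes pts d" for \<eta>
  proof (cases "\<psi> (\<sigma>0 \<circ> \<eta>, c) = 0")
    case True
    have "\<psi> (\<sigma>0, c) = 0" if "\<eta> \<in> hyperoct d"
    proof -
      have "\<psi> (\<sigma>0 \<circ> \<eta>, c) = flip_sign d eps1 \<eta> * \<psi> (\<sigma>0, c)"
        using \<psi> c \<sigma>0 that unfolding match_space_def by blast
      then show ?thesis using True eps1_sign_square[of \<eta>] by auto
    qed
    then show ?thesis using True by simp
  next
    case False
    have comp: "R1 (c (\<sigma>0 (\<eta> (k, False)))) (c (\<sigma>0 (\<eta> (k, True))))" if "k < d" for k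
      using zero[OF False] that by (simp add: edge_compat_def)
    have beta: "beta (?h ((\<sigma>0 \<circ> \<eta>) (k, False))) (?h ((\<sigma>0 \<circ> \<eta>) (k, True))) =
       form ty (label (\<eta> (k, False)) (c (\<sigma>0 (\<eta> (k, False))))) (label (\<eta> (k, True)) (c (\<sigma>0 (\<eta> (k, True)))))"
      if "k < d" for k
      using comp[OF that] unfolding beta_def regular_word_def R1_def by (simp add: permutes_inverses[OF \<sigma>0])
    show ?thesis
    proof (cases "\<eta> \<in> hyperoct d")
      case True
      have "B (\<sigma>0 \<circ> \<eta>) = flip_sign d eps1 \<eta>"
        unfolding B_def flip_sign_def
      proof (rule prod.cong[OF refl])
        fix k assume "k \<in> {..<d}"
        then have k: "k < d" by simp
        have "fst (\<eta> (k, True)) = fst (\<eta> (k, False))" "snd (\<eta> (k, True)) \<longleftrightarrow> \<not> snd (\<eta> (k, False))"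
          using hyperoct_fst[OF True] by blast+
        then show "beta (?h ((\<sigma>0 \<circ> \<eta>) (k, False))) (?h ((\<sigma>0 \<circ> \<eta>) (k, True))) =
          (if snd (\<eta> (k, False)) then eps1 else 1)"
          using comp[OF k] unfolding beta[OF k] form_def label_def R1_def eps1_def form_sign_def
          by (cases ty) auto
      qed
      moreover have "\<psi> (\<sigma>0 \<circ> \<eta>, c) = flip_sign d eps1 \<eta> * \<psi> (\<sigma>0, c)"
        using \<psi> c \<sigma>0 True unfolding match_space_def by blast
      moreover have "flip_sign d eps1 \<eta> * \<psi> (\<sigma>0, c) * flip_sign d eps1 \<eta> = (flip_sign d eps1 \<eta> * flip_sign d eps1 \<eta>) * \<psi> (\<sigma>0, c)"
        by (simp only: mult.assoc mult.commute mult.left_commute)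
      ultimately show ?thesis using True by (simp only: eps1_sign_square if_True mult_1_left)
    next
      case notin: False
      then obtain x where x: "\<eta> (flip x) \<noteq> flip (\<eta> x)" using p by (auto simp: hyperoct_def simp del: split_paired_All)
      have flip_pts: "flip x \<in> pts d \<longleftrightarrow> x \<in> pts d" by (cases x) (simp add: flip_def)
      have xp: "x \<in> pts d"
      proof (rule ccontr)
        assume "x \<notin> pts d"
        then show False using x permutes_not_in[OF p, of x] permutes_not_in[OF p, of "flip x"] flip_pts by simp
      qed
      obtain k s where ks: "x = (k, s)" by (cases x)
      have k: "k < d" using xp ks by simp
      \<comment> \<open>Failure to commute with the flip at either end of edge \<open>k\<close> is
        the same condition, so it can be stated at the end \<open>False\<close>.\<close>
      have "\<eta> (k, True) \<noteq> flip (\<eta> (k, False))"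
      proof (cases s)
        case True
        then have "\<eta> (k, False) \<noteq> flip (\<eta> (k, True))" using x ks by (simp add: flip_def)
        then show ?thesis by (auto simp: flip_def prod_eq_iff)
      next
        case False
        then show ?thesis using x ks by (simp add: flip_def)
      qed
      moreover have "\<eta> (k, True) \<noteq> \<eta> (k, False)" using permutes_inj[OF p] by (auto dest: injD)
      ultimately have "fst (\<eta> (k, True)) \<noteq> fst (\<eta> (k, False))" by (auto simp: flip_def prod_eq_iff)
      then have "beta (?h ((\<sigma>0 \<circ> \<eta>) (k, False))) (?h ((\<sigma>0 \<circ> \<eta>) (k, True))) = 0"
        unfolding beta[OF k] form_def label_def by simp
      then have "B (\<sigma>0 \<circ> \<eta>) = 0" unfolding B_def using k by (intro prod_zero[OF finite_lessThan] bexI[of _ k]) simp_all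
      then show ?thesis using notin by simp
    qed
  qed
  have "(\<Sum>\<sigma> | \<sigma> permutes pts d. \<psi> (\<sigma>, c) * B \<sigma>) = (\<Sum>\<eta> | \<eta> permutes pts d. \<psi> (\<sigma>0 \<circ> \<eta>, c) * B (\<sigma>0 \<circ> \<eta>))"
    by (rule setum_permutations_compose_left[OF \<sigma>0])
  also have "\<dots> = (\<Sum>\<eta> | \<eta> permutes pts d. if \<eta> \<in> hyperoct d then \<psi> (\<sigma>0, c) else 0)"
    by (rule sum.cong[OF refl]) (use term_val in simp)
  also have "\<dots> = (\<Sum>\<eta>\<in>hyperoct d. \<psi> (\<sigma>0, c))"
    by (rule sum.mono_neutral_cong_right[OF finite_permutations[OF finite_pts]]) (auto simp: hyperoct_def)
  also have "\<dots> = of_nat (card (hyperoct d)) * \<psi> (\<sigma>0, c)" by simp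
  finally have *: "(\<Sum>\<sigma> | \<sigma> permutes pts d. \<psi> (\<sigma>, c) * B \<sigma>) = of_nat (card (hyperoct d)) * \<psi> (\<sigma>0, c)" .
  have "card (hyperoct d) \<noteq> 0" using hyperoct_id[of d] by (auto simp: card_eq_0_iff)
  then show ?thesis
    unfolding match_tensor_def c' using * unfolding B_def by simp
qed

end

text \<open>The two assumptions say that \<open>K\<close> and the families of base group elements
  induce the same operators on \<open>V\<close>, so invariance under \<open>K\<close> can be tested
  on families.\<close>

locale pair_model = words d ty N kc sg +
  sym_model d V "words.H ty N kc sg" L eps "\<lambda>a b. R0 (snd a) (snd b)"
  for d :: nat and ty :: gtype and N :: "'k \<Rightarrow> nat" and kc :: "'c::finite \<Rightarrow> 'k" and sg :: "'c \<Rightarrow> bool"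
    and V :: "complex mat set" and L :: "complex mat \<Rightarrow> (nat \<times> bool) \<times> 'c \<Rightarrow> (nat \<times> bool) \<times> 'c \<Rightarrow> complex"
    and eps :: complex and R0 :: "'c \<Rightarrow> 'c \<Rightarrow> bool" +
  fixes K :: "complex mat set"
  assumes K_acts: "\<And>k. k \<in> K \<Longrightarrow> \<exists>g. family g \<and> acts k (fam g)"
    and family_acts: "\<And>g. family g \<Longrightarrow> \<exists>k\<in>K. acts k (fam g)"
begin

lemma sym_inv_iff:
  "f \<in> sym_inv d V K \<longleftrightarrow> f \<in> sym_free d V \<and> (\<forall>g. family g \<longrightarrow> tensor_invariant d H (fam g) (T f))"
proof -
  have "sym_act k f - f \<in> sym_rel d V"
    if f: "f \<in> sym_free d V" and inv: "\<And>g. family g \<Longrightarrow> tensor_invariant d H (fam g) (T f)" and k: "k \<in> K" for k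
  proof -
    obtain g where g: "family g" "acts k (fam g)" using K_acts[OF k] by blast
    show ?thesis unfolding sym_act_diff_iff[OF f g(2)] by (rule inv[OF g(1)])
  qed
  moreover have "tensor_invariant d H (fam g) (T f)"
    if f: "f \<in> sym_free d V" and inv: "\<And>k. k \<in> K \<Longrightarrow> sym_act k f - f \<in> sym_rel d V" and g: "family g" for g
  proof -
    obtain k where k: "k \<in> K" "acts k (fam g)" using family_acts[OF g] by blast
    show ?thesis using inv[OF k(1)] unfolding sym_act_diff_iff[OF f k(2)] .
  qed
  ultimately show ?thesis unfolding sym_inv_def by blast
qed

text \<open>The coefficients of the tensor on regular words. The default 0 is what
  \<open>match_space\<close> demands for incompatible arguments.\<close>

definition \<Psi> :: "(complex mat multiset \<Rightarrow>\<^sub>0 complex) \<Rightarrow> (nat \<times> bool \<Rightarrow> nat \<times> bool) \<times> (nat \<times> bool \<Rightarrow> 'c) \<Rightarrow> complex" where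
  "\<Psi> f x = (if fst x permutes pts d \<and> snd x \<in> extensional (pts d) \<and> edge_compat d R1 (fst x) (snd x)
     then T f (regular_word (fst x) (snd x)) else 0)"

lemma R1_sym: "R1 \<gamma> \<gamma>' \<Longrightarrow> R1 \<gamma>' \<gamma>"
  by (auto simp: R1_def)

lemma edge_compat_hyperoct:
  assumes "\<eta> \<in> hyperoct d" "edge_compat d R1 \<sigma> c"
  shows "edge_compat d R1 (\<sigma> \<circ> \<eta>) c"
  unfolding edge_compat_def
proof (intro allI impI)
  fix k assume k: "k < d"
  define j where "j = fst (\<eta> (k, False))"
  have j: "j < d" using hyperoct_lt[OF assms(1)] k by (simp add: j_def)
  have R: "R1 (c (\<sigma> (j, False))) (c (\<sigma> (j, True)))" using assms(2) j by (simp add: edge_compat_def)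
  show "R1 (c ((\<sigma> \<circ> \<eta>) (k, False))) (c ((\<sigma> \<circ> \<eta>) (k, True)))"
  proof (cases "snd (\<eta> (k, False))")
    case True
    then have "\<eta> (k, False) = (j, True)" "\<eta> (k, True) = (j, False)"
      using hyperoct_fst(1)[OF assms(1), of k True] hyperoct_fst(2)[OF assms(1), of k] by (simp_all add: j_def prod_eq_iff)
    then show ?thesis using R1_sym[OF R] by simp
  next
    case False
    then have "\<eta> (k, False) = (j, False)" "\<eta> (k, True) = (j, True)"
      using hyperoct_fst(1)[OF assms(1), of k True] hyperoct_fst(2)[OF assms(1), of k] by (simp_all add: j_def prod_eq_iff)
    then show ?thesis using R by simp
  qed
qed

lemma edge_compat_hyperoct_iff:
  assumes "\<eta> \<in> hyperoct d"
  shows "edge_compat d R1 (\<sigma> \<circ> \<eta>) c \<longleftrightarrow> edge_compat d R1 \<sigma> c"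
proof
  assume "edge_compat d R1 (\<sigma> \<circ> \<eta>) c"
  from edge_compat_hyperoct[OF hyperoct_inv[OF assms] this]
  show "edge_compat d R1 \<sigma> c"
    using permutes_inv_o(1)[of \<eta> "pts d"] assms by (simp add: hyperoct_def o_assoc[symmetric] del: split_paired_All)
qed (rule edge_compat_hyperoct[OF assms])

text \<open>The first equivariance law is the symmetry of the tensor itself, the second is
  invariance under monomial elements of the group.\<close>

lemma \<Psi>_in_match_space:
  assumes f: "f \<in> sym_inv d V K"
  shows "\<Psi> f \<in> match_space d R0 eps R1 eps1"
proof -
  have free: "f \<in> sym_free d V" and inv: "\<And>g. family g \<Longrightarrow> tensor_invariant d H (fam g) (T f)"
    using f unfolding sym_inv_iff by blast+
  show ?thesis
    unfolding match_space_def
  proof (intro CollectI conjI allI ballI impI)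
    fix \<sigma> :: "nat \<times> bool \<Rightarrow> nat \<times> bool" and c :: "nat \<times> bool \<Rightarrow> 'c"
    assume n: "\<not> (\<sigma> permutes pts d \<and> c \<in> extensional (pts d) \<and> edge_compat d R0 id c \<and> edge_compat d R1 \<sigma> c)"
    show "\<Psi> f (\<sigma>, c) = 0"
    proof (cases "\<sigma> permutes pts d \<and> c \<in> extensional (pts d) \<and> edge_compat d R1 \<sigma> c")
      case True
      then obtain k where k: "k < d" "\<not> R0 (c (k, False)) (c (k, True))"
        using n by (auto simp: edge_compat_def)
      then have "T f (regular_word \<sigma> c) = 0"
        using True by (intro T_supp[OF free regular_word_in_H k(1)]) (simp_all add: regular_word_def)
      then show ?thesis by (simp add: \<Psi>_def)
    next
      case False
      then show ?thesis unfolding \<Psi>_def fst_conv snd_conv by (rule if_not_P)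
    qed
  next
    fix \<sigma> \<eta> :: "nat \<times> bool \<Rightarrow> nat \<times> bool" and c :: "nat \<times> bool \<Rightarrow> 'c"
    assume \<eta>: "\<eta> \<in> hyperoct d" and \<sigma>: "\<sigma> permutes pts d" and c: "c \<in> extensional (pts d)"
    have p: "\<eta> permutes pts d" using \<eta> by (simp add: hyperoct_def)
    have "edge_compat d R1 (\<eta> \<circ> \<sigma>) (c \<circ> pinv \<eta>) \<longleftrightarrow> edge_compat d R1 \<sigma> c"
      by (simp add: edge_compat_def permutes_inverses[OF p])
    moreover have "T f (regular_word (\<eta> \<circ> \<sigma>) (c \<circ> pinv \<eta>)) = flip_sign d eps \<eta> * T f (regular_word \<sigma> c)"
    proof -
      have "regular_word (\<eta> \<circ> \<sigma>) (c \<circ> pinv \<eta>) = regular_word \<sigma> c \<circ> pinv \<eta>"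
        using \<sigma> p by (simp add: fun_eq_iff regular_word_def o_inv_distrib permutes_bij)
      then show ?thesis
        using T_hyperoct[OF free regular_word_in_H[OF \<sigma>] hyperoct_inv[OF \<eta>]] by (simp only: flip_sign_inv[OF \<eta>])
    qed
    ultimately show "\<Psi> f (\<eta> \<circ> \<sigma>, c \<circ> pinv \<eta>) = flip_sign d eps \<eta> * \<Psi> f (\<sigma>, c)"
      using \<sigma> c p by (simp add: \<Psi>_def permutes_compose extensional_comp_permutes permutes_inv)
    have "T f (regular_word (\<sigma> \<circ> \<eta>) c) = flip_sign d eps1 \<eta> * T f (regular_word \<sigma> c)"
      by (rule regular_word_hyperoct[OF inv T_cong[OF free] \<sigma> \<eta>])
    then show "\<Psi> f (\<sigma> \<circ> \<eta>, c) = flip_sign d eps1 \<eta> * \<Psi> f (\<sigma>, c)"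
      using \<sigma> c p edge_compat_hyperoct_iff[OF \<eta>] by (simp add: \<Psi>_def permutes_compose)
  qed
qed

text \<open>Injectivity on the quotient: vanishing on regular words spreads to all words, and an
  element whose tensor vanishes on all words is a relation.\<close>

lemma \<Psi>_eq_zero_iff:
  assumes f: "f \<in> sym_inv d V K"
  shows "f \<in> sym_rel d V \<longleftrightarrow> \<Psi> f = (\<lambda>_. 0)"
proof
  assume "f \<in> sym_rel d V"
  then show "\<Psi> f = (\<lambda>_. 0)"
    using T_sym_rel regular_word_in_H by (auto simp: \<Psi>_def fun_eq_iff simp del: split_paired_All)
next
  have free: "f \<in> sym_free d V" and inv: "\<And>g. family g \<Longrightarrow> tensor_invariant d H (fam g) (T f)"
    using f unfolding sym_inv_iff by blast+
  assume z: "\<Psi> f = (\<lambda>_. 0)"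
  show "f \<in> sym_rel d V"
  proof (rule kernel_T[OF free])
    fix h assume h: "h \<in> pts d \<rightarrow> H"
    show "T f h = 0"
    proof (rule vanishes_if_regular_vanishes[OF inv T_cong[OF free] _ h])
      fix \<sigma> and c :: "nat \<times> bool \<Rightarrow> 'c"
      assume "\<sigma> permutes pts d" "c \<in> extensional (pts d)" "edge_compat d R1 \<sigma> c"
      then show "T f (regular_word \<sigma> c) = 0"
        using fun_cong[OF z, of "(\<sigma>, c)"] by (simp add: \<Psi>_def)
    qed
  qed
qed

text \<open>The section of \<open>match_tensor \<psi>\<close>, divided by d!, is an invariant whose
  values on compatible regular words are those of \<open>\<psi>\<close>.\<close>

lemma match_space_subset_image:
  assumes \<psi>: "\<psi> \<in> match_space d R0 eps R1 eps1"
  shows "\<psi> \<in> \<Psi> ` sym_inv d V K"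
proof -
  define f where "f = scl (inverse (fact d)) (section_map (match_tensor \<psi>))"
  have free: "f \<in> sym_free d V"
    unfolding f_def by (rule scl.subspace_scale[OF sym_free_subspace section_map_sym_free])
  have T: "T f h = match_tensor \<psi> h" if h: "h \<in> pts d \<rightarrow> H" for h
  proof -
    have "T (section_map (match_tensor \<psi>)) h = fact d * match_tensor \<psi> h"
      by (rule T_section_map[OF h match_tensor_hyperoct[OF \<psi>] match_tensor_supp[OF \<psi>] match_tensor_cong])
    then show ?thesis unfolding f_def T_scl by simp
  qed
  have "f \<in> sym_inv d V K"
    unfolding sym_inv_iff
  proof (intro conjI free allI impI)
    fix g assume g: "family g"
    have PJ: "J \<in> pts d \<rightarrow> H" if "J \<in> PiE (pts d) (\<lambda>_. H)" for J using that by (simp add: PiE_def)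
    show "tensor_invariant d H (fam g) (T f)"
      using match_tensor_invariant[OF g, of \<psi>] unfolding tensor_invariant_def by (simp add: T PJ)
  qed
  moreover have "\<Psi> f = \<psi>"
  proof
    fix x :: "(nat \<times> bool \<Rightarrow> nat \<times> bool) \<times> (nat \<times> bool \<Rightarrow> 'c)"
    obtain \<sigma> c where x: "x = (\<sigma>, c)" by (cases x)
    show "\<Psi> f x = \<psi> x"
    proof (cases "\<sigma> permutes pts d \<and> c \<in> extensional (pts d) \<and> edge_compat d R1 \<sigma> c")
      case True
      then show ?thesis
        using T[OF regular_word_in_H, of \<sigma> c] match_tensor_regular[OF \<psi>, of \<sigma> c] by (simp add: \<Psi>_def x)
    next
      case False
      then have "\<psi> (\<sigma>, c) = 0" using \<psi> unfolding match_space_def by blast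
      then show ?thesis using False by (auto simp: \<Psi>_def x)
    qed
  qed
  ultimately show ?thesis by blast
qed

theorem sym_inv_models: "models (sym_inv d V K) (sym_rel d V) (match_space d R0 eps R1 eps1)"
  unfolding models_def
proof (intro conjI exI[of _ \<Psi>] allI ballI)
  show "scl.subspace (sym_inv d V K)"
    by (rule sym_inv_subspace) (use K_acts in blast)
  show "\<Psi> (f + g) = (\<lambda>x. \<Psi> f x + \<Psi> g x)" for f g
    by (simp add: \<Psi>_def fun_eq_iff T_add)
  show "\<Psi> (scl c f) = (\<lambda>x. c * \<Psi> f x)" for c f
    by (simp add: \<Psi>_def fun_eq_iff T_scl)
  show "w \<in> sym_rel d V \<longleftrightarrow> \<Psi> w = (\<lambda>_. 0)" if "w \<in> sym_inv d V K" for w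
    by (rule \<Psi>_eq_zero_iff[OF that])
  show "\<Psi> ` sym_inv d V K = match_space d R0 eps R1 eps1"
    using \<Psi>_in_match_space match_space_subset_image by blast
qed

end

section \<open>Matrix preliminaries\<close>

lemma mult_entry:
  assumes "A \<in> carrier_mat n k" "B \<in> carrier_mat k m" "i < n" "j < m"
  shows "(A * B) $$ (i, j) = (\<Sum>l<k. A $$ (i, l) * B $$ (l, j))"
  using assms by (simp add: times_mat_def scalar_prod_def atLeast0LessThan)

lemma mult_transpose_entry:
  fixes A B C :: "complex mat"
  assumes "A \<in> carrier_mat n k" "B \<in> carrier_mat k l" "C \<in> carrier_mat m l" "i < n" "j < m"
  shows "(A * B * transpose_mat C) $$ (i, j) = (\<Sum>x<k. \<Sum>y<l. A $$ (i, x) * C $$ (j, y) * B $$ (x, y))"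
proof -
  have "(A * B * transpose_mat C) $$ (i, j) = (\<Sum>y<l. (A * B) $$ (i, y) * transpose_mat C $$ (y, j))"
    using assms by (intro mult_entry[of _ n]) auto
  also have "\<dots> = (\<Sum>y<l. (\<Sum>x<k. A $$ (i, x) * B $$ (x, y)) * C $$ (j, y))"
  proof (rule sum.cong[OF refl])
    fix y assume "y \<in> {..<l}"
    then have y: "y < l" by simp
    have "transpose_mat C $$ (y, j) = C $$ (j, y)" using assms y by simp
    then show "(A * B) $$ (i, y) * transpose_mat C $$ (y, j) = (\<Sum>x<k. A $$ (i, x) * B $$ (x, y)) * C $$ (j, y)"
      unfolding mult_entry[OF assms(1,2,4) y] by simp
  qed
  also have "\<dots> = (\<Sum>y<l. \<Sum>x<k. A $$ (i, x) * C $$ (j, y) * B $$ (x, y))"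
    unfolding sum_distrib_right by (intro sum.cong refl) (simp only: mult.assoc mult.commute mult.left_commute)
  also have "\<dots> = (\<Sum>x<k. \<Sum>y<l. A $$ (i, x) * C $$ (j, y) * B $$ (x, y))"
    by (rule sum.swap)
  finally show ?thesis .
qed

lemma GL_grpI:
  assumes "g \<in> carrier_mat N N" "h \<in> carrier_mat N N" "g * h = 1\<^sub>m N"
  shows "g \<in> GL_grp N"
proof -
  have "h * g = 1\<^sub>m N" by (rule mat_mult_left_right_inverse[OF assms])
  then show ?thesis
    using assms unfolding GL_grp_def invertible_mat_def inverts_mat_def by auto
qed

lemma GL_grp_det:
  "g \<in> GL_grp N \<longleftrightarrow> g \<in> carrier_mat N N \<and> Determinant.det g \<noteq> 0"
proof
  assume g: "g \<in> GL_grp N"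
  then have gc: "g \<in> carrier_mat N N" by (simp add: GL_grp_def)
  obtain B where B: "g * B = 1\<^sub>m (dim_row g)" "B * g = 1\<^sub>m (dim_row B)"
    using g unfolding GL_grp_def invertible_mat_def inverts_mat_def by blast
  have "dim_col B = N" using arg_cong[OF B(1), of dim_col] gc by simp
  moreover have "dim_row B = N" using arg_cong[OF B(2), of dim_col] gc by simp
  ultimately have "B \<in> carrier_mat N N" by auto
  then have "Determinant.det g * Determinant.det B = 1"
    using B(1) gc det_mult[of g N B] by simp
  then show "g \<in> carrier_mat N N \<and> Determinant.det g \<noteq> 0" using gc by auto
next
  assume g: "g \<in> carrier_mat N N \<and> Determinant.det g \<noteq> 0"
  have "g * (inverse (Determinant.det g) \<cdot>\<^sub>m adj_mat g) = inverse (Determinant.det g) \<cdot>\<^sub>m (g * adj_mat g)"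
    using g adj_mat(1)[of g N] by (intro mult_smult_distrib) auto
  also have "\<dots> = 1\<^sub>m N"
    unfolding adj_mat(2)[OF conjunct1[OF g]] using g by (intro eq_matI) auto
  finally show "g \<in> GL_grp N"
    using g adj_mat(1)[of g N] by (intro GL_grpI) auto
qed

lemma GL_grp_carrier: "g \<in> GL_grp N \<Longrightarrow> g \<in> carrier_mat N N"
  by (simp add: GL_grp_def)

lemma minv:
  assumes "g \<in> GL_grp N"
  shows "minv g \<in> carrier_mat N N" "g * minv g = 1\<^sub>m N" "minv g * g = 1\<^sub>m N"
proof -
  have g: "g \<in> carrier_mat N N" "Determinant.det g \<noteq> 0" using assms GL_grp_det by blast+
  have "mat_inverse g \<noteq> None"
    using mat_inverse(1)[OF g(1), of "()"] det_non_zero_imp_unit[OF g, of "()"] by blast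
  then obtain B where "mat_inverse g = Some B" by blast
  then show "minv g \<in> carrier_mat N N" "g * minv g = 1\<^sub>m N" "minv g * g = 1\<^sub>m N"
    using mat_inverse(2)[OF g(1), of B] by (simp_all add: minv_def)
qed

lemma minv_eq:
  assumes "g \<in> carrier_mat N N" "h \<in> carrier_mat N N" "g * h = 1\<^sub>m N"
  shows "minv g = h"
proof -
  have m: "minv g \<in> carrier_mat N N" "minv g * g = 1\<^sub>m N"
    using minv[OF GL_grpI[OF assms]] by blast+
  have "minv g = minv g * (g * h)" using m assms by simp
  also have "\<dots> = (minv g * g) * h" using m assms by (intro assoc_mult_mat[symmetric]) auto
  finally show ?thesis using m assms by simp
qed

lemma diag_block_mat_pair:
  "diag_block_mat [a, b] = four_block_mat a (0\<^sub>m (dim_row a) (dim_col b)) (0\<^sub>m (dim_row b) (dim_col a)) b"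
  by (simp only: diag_block_mat.simps(2)[of a "[b]"] Let_def diag_block_mat_singleton)

lemma diag_pair_carrier:
  "a \<in> carrier_mat n n \<Longrightarrow> b \<in> carrier_mat m m \<Longrightarrow> diag_block_mat [a, b] \<in> carrier_mat (n + m) (n + m)"
  unfolding diag_block_mat_pair by auto

lemma diag_pair_entry:
  assumes "a \<in> carrier_mat n n" "b \<in> carrier_mat m m" "i < n + m" "j < n + m"
  shows "diag_block_mat [a, b] $$ (i, j) = (if i < n then if j < n then a $$ (i, j) else 0
     else if j < n then 0 else b $$ (i - n, j - n))"
  unfolding diag_block_mat_pair using assms by (auto simp del: diag_block_mat.simps)

lemma diag_pair_mult:
  assumes "a \<in> carrier_mat n n" "b \<in> carrier_mat m m" "c \<in> carrier_mat n n" "e \<in> carrier_mat m m"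
  shows "diag_block_mat [a, b] * diag_block_mat [c, e] = diag_block_mat [a * c, b * e]"
proof -
  have "diag_block_mat [a, b] = four_block_mat a (0\<^sub>m n m) (0\<^sub>m m n) b"
    "diag_block_mat [c, e] = four_block_mat c (0\<^sub>m n m) (0\<^sub>m m n) e"
    "diag_block_mat [a * c, b * e] = four_block_mat (a * c) (0\<^sub>m n m) (0\<^sub>m m n) (b * e)"
    unfolding diag_block_mat_pair using assms by auto
  then show ?thesis
    using mult_four_block_mat[of a n n "0\<^sub>m n m" m "0\<^sub>m m n" m b c n "0\<^sub>m n m" m "0\<^sub>m m n" e] assms by simp
qed

lemma diag_pair_transpose:
  assumes "a \<in> carrier_mat n n" "b \<in> carrier_mat m m"
  shows "transpose_mat (diag_block_mat [a, b]) = diag_block_mat [transpose_mat a, transpose_mat b]"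
proof (rule eq_matI)
  have c: "diag_block_mat [a, b] \<in> carrier_mat (n + m) (n + m)"
    "diag_block_mat [transpose_mat a, transpose_mat b] \<in> carrier_mat (n + m) (n + m)"
    using assms by (intro diag_pair_carrier; simp)+
  fix i j assume "i < dim_row (diag_block_mat [transpose_mat a, transpose_mat b])"
    "j < dim_col (diag_block_mat [transpose_mat a, transpose_mat b])"
  then have ij: "i < n + m" "j < n + m" using c by auto
  have "transpose_mat (diag_block_mat [a, b]) $$ (i, j) = diag_block_mat [a, b] $$ (j, i)"
    using c(1) ij by (simp del: diag_block_mat.simps)
  then show "transpose_mat (diag_block_mat [a, b]) $$ (i, j) = diag_block_mat [transpose_mat a, transpose_mat b] $$ (i, j)"
    unfolding diag_pair_entry[OF assms ij(2,1)]
    using assms ij by (subst diag_pair_entry[of _ n _ m]) auto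
qed (use assms in \<open>simp_all add: Let_def\<close>)

lemma diag_pair_one: "diag_block_mat [1\<^sub>m n, 1\<^sub>m m] = 1\<^sub>m (n + m)"
  unfolding diag_block_mat_pair by simp

section \<open>Lie algebras\<close>

lemma det_analytic:
  assumes "\<And>z. A z \<in> carrier_mat n n" and "\<And>i j. i < n \<Longrightarrow> j < n \<Longrightarrow> (\<lambda>z. A z $$ (i, j)) analytic_on S"
  shows "(\<lambda>z. Determinant.det (A z) :: complex) analytic_on S"
proof -
  have "(\<lambda>z. Determinant.det (A z)) = (\<lambda>z. \<Sum>p | p permutes {0..<n}. signof p * (\<Prod>i = 0..<n. A z $$ (i, p i)))"
    using det_def'[OF assms(1)] by (rule ext)
  moreover have "(\<lambda>z. \<Sum>p | p permutes {0..<n}. signof p * (\<Prod>i = 0..<n. A z $$ (i, p i))) analytic_on S"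
  proof (intro analytic_on_sum analytic_on_mult analytic_on_const analytic_on_prod)
    fix p i assume "p \<in> {p. p permutes {0..<n}}" "i \<in> {0..<n}"
    then have "p i < n" "i < n" using permutes_in_image[of p "{0..<n}" i] by auto
    then show "(\<lambda>z. A z $$ (i, p i)) analytic_on S" using assms(2) by blast
  qed
  ultimately show ?thesis by simp
qed

lemma cofactor_analytic:
  assumes "\<And>z. A z \<in> carrier_mat n n" and "\<And>i j. i < n \<Longrightarrow> j < n \<Longrightarrow> (\<lambda>z. A z $$ (i, j)) analytic_on S"
    and ij: "i < n" "j < n"
  shows "(\<lambda>z. cofactor (A z) i j :: complex) analytic_on S"
  unfolding cofactor_def
proof (intro analytic_on_mult analytic_on_const det_analytic)
  show "mat_delete (A z) i j \<in> carrier_mat (n - 1) (n - 1)" for z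
    using assms(1)[of z] by (rule mat_delete_carrier)
  have dims: "dim_row (A z) = n" "dim_col (A z) = n" for z using carrier_matD[OF assms(1)] by blast+
  fix k l assume "k < n - 1" "l < n - 1"
  then have "(\<lambda>z. mat_delete (A z) i j $$ (k, l)) = (\<lambda>z. A z $$ (if k < i then k else Suc k, if l < j then l else Suc l))"
    by (simp add: mat_delete_def dims)
  then show "(\<lambda>z. mat_delete (A z) i j $$ (k, l)) analytic_on S"
    using assms(2) \<open>k < n - 1\<close> \<open>l < n - 1\<close> by simp
qed

definition lin_curve :: "nat \<Rightarrow> complex mat \<Rightarrow> complex \<Rightarrow> complex mat" where
  "lin_curve N X z = 1\<^sub>m N + z \<cdot>\<^sub>m X"

lemma lin_curve_entry:
  assumes "X \<in> carrier_mat N N" "i < N" "j < N"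
  shows "lin_curve N X z $$ (i, j) = of_bool (i = j) + z * X $$ (i, j)"
  using assms by (simp add: lin_curve_def)

lemma lin_curve_carrier: "X \<in> carrier_mat N N \<Longrightarrow> lin_curve N X z \<in> carrier_mat N N"
  by (simp add: lin_curve_def)

lemma lin_curve_0: "X \<in> carrier_mat N N \<Longrightarrow> lin_curve N X 0 = 1\<^sub>m N"
  by (intro eq_matI) (auto simp: lin_curve_def)

lemma lin_curve_analytic:
  assumes "X \<in> carrier_mat N N" "i < N" "j < N"
  shows "(\<lambda>z. lin_curve N X (c * z) $$ (i, j)) analytic_on S"
  unfolding lin_curve_entry[OF assms]
  by (intro analytic_on_add analytic_on_mult analytic_on_const analytic_on_ident)

text \<open>The determinant is continuous in \<open>z\<close> and equals 1 at 0.\<close>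

lemma lin_curve_det:
  assumes X: "X \<in> carrier_mat N N"
  shows "\<forall>\<^sub>F z in nhds 0. Determinant.det (lin_curve N X (c * z)) \<noteq> 0"
proof -
  have "(\<lambda>z. Determinant.det (lin_curve N X (c * z))) analytic_on {0}"
    by (rule det_analytic) (use lin_curve_carrier[OF X] lin_curve_analytic[OF X] in auto)
  then have "isCont (\<lambda>z. Determinant.det (lin_curve N X (c * z))) 0"
    by (intro analytic_at_imp_isCont)
  then have "(\<lambda>z. Determinant.det (lin_curve N X (c * z))) \<midarrow>0\<rightarrow> 1"
    using lin_curve_0[OF X] by (simp add: isCont_def)
  then have "\<forall>\<^sub>F z in at 0. Determinant.det (lin_curve N X (c * z)) \<noteq> 0"
    by (rule tendsto_imp_eventually_ne) simp
  then show ?thesis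
    unfolding eventually_nhds_conv_at using lin_curve_0[OF X] by simp
qed

lemma Lie_alg_GL: "Lie_alg N (GL_grp N) = carrier_mat N N"
proof -
  have "X \<in> Lie_alg N (GL_grp N)" if X: "X \<in> carrier_mat N N" for X
    unfolding Lie_alg_def
  proof (intro CollectI conjI X exI[of _ "lin_curve N X"] allI impI)
    show "lin_curve N X 0 = 1\<^sub>m N" by (rule lin_curve_0[OF X])
    show "\<forall>\<^sub>F z in nhds 0. lin_curve N X z \<in> GL_grp N"
      using lin_curve_det[OF X, of 1] lin_curve_carrier[OF X] by (simp add: GL_grp_det)
    fix i j assume ij: "i < N" "j < N"
    show "(\<lambda>z. lin_curve N X z $$ (i, j)) analytic_on {0}" using lin_curve_analytic[OF X ij, of 1] by simp
    show "((\<lambda>z. lin_curve N X z $$ (i, j)) has_field_derivative X $$ (i, j)) (at 0)"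
      unfolding lin_curve_entry[OF X ij] by (auto intro!: derivative_eq_intros)
  qed
  then show ?thesis unfolding Lie_alg_def by blast
qed

text \<open>The Cayley transform, the inverse of 1 - zX/2 times 1 + zX/2: it has velocity
  \<open>X\<close> at the identity and stays in the isometry group when \<open>X\<close> is
  infinitesimally isometric, whereas \<open>lin_curve\<close> in general leaves that group.\<close>

lemma cayley_curve:
  assumes X: "X \<in> carrier_mat N N"
  obtains \<gamma> where "\<gamma> 0 = 1\<^sub>m N" "\<And>z. \<gamma> z \<in> carrier_mat N N"
    "\<And>i j. i < N \<Longrightarrow> j < N \<Longrightarrow> (\<lambda>z. \<gamma> z $$ (i, j)) analytic_on {0} \<and>
        ((\<lambda>z. \<gamma> z $$ (i, j)) has_field_derivative X $$ (i, j)) (at 0)"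
    "\<forall>\<^sub>F z in nhds 0. Determinant.det (lin_curve N X (- 1 / 2 * z)) \<noteq> 0 \<and>
       lin_curve N X (- 1 / 2 * z) * \<gamma> z = lin_curve N X (1 / 2 * z)"
proof -
  define A where "A z = lin_curve N X (- 1 / 2 * z)" for z
  define B where "B z = lin_curve N X (1 / 2 * z)" for z
  \<comment> \<open>The inverse of \<open>A z\<close> is written through the adjugate, so that the
    entries are visibly analytic near 0 and \<open>\<gamma> z\<close> has the right size for every
    \<open>z\<close>.\<close>
  define \<gamma> where "\<gamma> z = inverse (Determinant.det (A z)) \<cdot>\<^sub>m (adj_mat (A z) * B z)" for z
  have Ac: "A z \<in> carrier_mat N N" and Bc: "B z \<in> carrier_mat N N" for z
    unfolding A_def B_def by (rule lin_curve_carrier[OF X])+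
  note adj = adj_mat[OF Ac]
  have ev: "\<forall>\<^sub>F z in nhds 0. Determinant.det (A z) \<noteq> 0"
    unfolding A_def by (rule lin_curve_det[OF X])
  have A0: "A 0 = 1\<^sub>m N" "B 0 = 1\<^sub>m N" unfolding A_def B_def by (simp_all add: lin_curve_0[OF X])
  have "adj_mat (1\<^sub>m N :: complex mat) = 1\<^sub>m N" 
  proof -
    have "adj_mat (1\<^sub>m N :: complex mat) = 1 \<cdot>\<^sub>m 1\<^sub>m N" using adj(2)[of 0] adj(1)[of 0] unfolding A0 by simp
    also have "\<dots> = 1\<^sub>m N" by (rule eq_matI) auto
    finally show ?thesis .
  qed
  then have g0: "\<gamma> 0 = 1\<^sub>m N" unfolding \<gamma>_def A0 by (intro eq_matI) auto
  have gc: "\<gamma> z \<in> carrier_mat N N" for z 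
    unfolding \<gamma>_def by (rule smult_carrier_mat[OF mult_carrier_mat[OF adj(1) Bc]])
  have eq: "A z * \<gamma> z = B z" if "Determinant.det (A z) \<noteq> 0" for z
  proof -
    have "A z * \<gamma> z = inverse (Determinant.det (A z)) \<cdot>\<^sub>m (A z * (adj_mat (A z) * B z))"
      unfolding \<gamma>_def by (rule mult_smult_distrib[OF Ac mult_carrier_mat[OF adj(1) Bc]])
    also have "A z * (adj_mat (A z) * B z) = (A z * adj_mat (A z)) * B z"
      by (rule assoc_mult_mat[OF Ac adj(1) Bc, symmetric])
    also have "inverse (Determinant.det (A z)) \<cdot>\<^sub>m (A z * adj_mat (A z) * B z) = B z"
      unfolding adj(2) mult_smult_assoc_mat[OF one_carrier_mat Bc] left_mult_one_mat[OF Bc]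
      by (rule eq_matI) (simp_all add: that)
    finally show ?thesis .
  qed
  have an: "(\<lambda>z. \<gamma> z $$ (i, j)) analytic_on {0}" if ij: "i < N" "j < N" for i j
  proof -
    have "(\<lambda>z. \<gamma> z $$ (i, j)) = (\<lambda>z. inverse (Determinant.det (A z)) * (\<Sum>l<N. cofactor (A z) l i * B z $$ (l, j)))"
    proof
      fix z
      have "(adj_mat (A z) * B z) $$ (i, j) = (\<Sum>l<N. adj_mat (A z) $$ (i, l) * B z $$ (l, j))"
        by (rule mult_entry[OF adj(1) Bc ij])
      also have "\<dots> = (\<Sum>l<N. cofactor (A z) l i * B z $$ (l, j))"
        using Ac[of z] ij by (intro sum.cong) (auto simp: adj_mat_def)
      finally show "\<gamma> z $$ (i, j) = inverse (Determinant.det (A z)) * (\<Sum>l<N. cofactor (A z) l i * B z $$ (l, j))"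
        unfolding \<gamma>_def using adj(1)[of z] Bc[of z] ij by simp
    qed
    moreover have "(\<lambda>z. inverse (Determinant.det (A z)) * (\<Sum>l<N. cofactor (A z) l i * B z $$ (l, j))) analytic_on {0}"
    proof (intro analytic_on_mult analytic_on_inverse analytic_on_sum)
      have Aan: "(\<lambda>z. A z $$ (k, l)) analytic_on {0}" if "k < N" "l < N" for k l
        unfolding A_def by (rule lin_curve_analytic[OF X that])
      show "(\<lambda>z. Determinant.det (A z)) analytic_on {0}" by (rule det_analytic[OF Ac Aan])
      show "Determinant.det (A z) \<noteq> 0" if "z \<in> {0}" for z using that A0 by simp
      fix l assume "l \<in> {..<N}"
      then have l: "l < N" by simp
      show "(\<lambda>z. cofactor (A z) l i) analytic_on {0}" by (rule cofactor_analytic[OF Ac Aan l ij(1)])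
      show "(\<lambda>z. B z $$ (l, j)) analytic_on {0}" unfolding B_def by (rule lin_curve_analytic[OF X l ij(2)])
    qed
    ultimately show ?thesis by simp
  qed
  have deriv: "((\<lambda>z. \<gamma> z $$ (i, j)) has_field_derivative X $$ (i, j)) (at 0)" if ij: "i < N" "j < N" for i j
  proof -
    \<comment> \<open>From \<open>A z * \<gamma> z = B z\<close> the entry of
      \<open>\<gamma> z\<close> is that of the identity plus \<open>z\<close> times
      \<open>u z / 2\<close>. Differentiability of \<open>u\<close> then gives the derivative at 0
      as \<open>u 0 / 2\<close>, which is the entry of \<open>X\<close>.\<close>
    define u where "u z = (\<Sum>l<N. X $$ (i, l) * \<gamma> z $$ (l, j)) + X $$ (i, j)" for z
    have fd: "(\<lambda>z. \<gamma> z $$ (l, j)) field_differentiable (at 0)" if "l < N" for l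
      using an[OF that ij(2)] by (simp add: analytic_on_imp_differentiable_at)
    have "u field_differentiable (at 0)"
      unfolding u_def by (intro derivative_intros field_differentiable_add field_differentiable_sum field_differentiable_mult fd) auto
    then obtain u' where u': "(u has_field_derivative u') (at 0)" by (auto simp: field_differentiable_def)
    have u0: "u 0 = 2 * X $$ (i, j)"
    proof -
      have "(\<Sum>l<N. X $$ (i, l) * \<gamma> 0 $$ (l, j)) = (X * 1\<^sub>m N) $$ (i, j)"
        unfolding g0 using mult_entry[OF X one_carrier_mat ij] by simp
      then show ?thesis using X ij by (simp add: u_def)
    qed
    have e: "\<gamma> z $$ (i, j) = of_bool (i = j) + z * (1 / 2 * u z)" if "Determinant.det (A z) \<noteq> 0" for z
    proof -
      have "(A z * \<gamma> z) $$ (i, j) = (\<Sum>l<N. A z $$ (i, l) * \<gamma> z $$ (l, j))"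
        by (rule mult_entry[OF Ac gc ij])
      also have "\<dots> = (\<Sum>l<N. of_bool (i = l) * \<gamma> z $$ (l, j) - z / 2 * (X $$ (i, l) * \<gamma> z $$ (l, j)))"
        unfolding A_def using lin_curve_entry[OF X ij(1)] by (intro sum.cong) (auto simp: algebra_simps)
      also have "\<dots> = (\<Sum>l<N. of_bool (i = l) * \<gamma> z $$ (l, j)) - z / 2 * (\<Sum>l<N. X $$ (i, l) * \<gamma> z $$ (l, j))"
        by (simp only: sum_subtractf sum_distrib_left)
      also have "(\<Sum>l<N. of_bool (i = l) * \<gamma> z $$ (l, j)) = \<gamma> z $$ (i, j)"
      proof -
        have "(\<Sum>l<N. of_bool (i = l) * \<gamma> z $$ (l, j)) = (\<Sum>l<N. if l = i then \<gamma> z $$ (l, j) else 0)"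
          by (rule sum.cong) auto
        then show ?thesis using ij by simp
      qed
      finally have "\<gamma> z $$ (i, j) - z / 2 * (\<Sum>l<N. X $$ (i, l) * \<gamma> z $$ (l, j)) = of_bool (i = j) + z / 2 * X $$ (i, j)"
        unfolding eq[OF that] B_def lin_curve_entry[OF X ij] by simp
      then show ?thesis unfolding u_def by (simp add: algebra_simps)
    qed
    have "((\<lambda>z. of_bool (i = j) + z * (1 / 2 * u z)) has_field_derivative X $$ (i, j)) (at 0)"
      using u' u0 by (auto intro!: derivative_eq_intros)
    moreover have ev': "\<forall>\<^sub>F z in nhds 0. \<gamma> z $$ (i, j) = of_bool (i = j) + z * (1 / 2 * u z)"
      using ev by (rule eventually_mono) (rule e)
    ultimately show ?thesis
      using iffD2[OF DERIV_cong_ev[OF refl ev' refl]] by blast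
  qed
  show ?thesis
    by (rule that[of \<gamma>, OF g0 gc]) (use an deriv eventually_mono[OF ev] eq in \<open>auto simp: A_def B_def\<close>)
qed

definition isom_alg :: "nat \<Rightarrow> complex mat \<Rightarrow> complex mat set" where
  "isom_alg N F = {X \<in> carrier_mat N N. \<forall>i<N. \<forall>j<N. (X * F) $$ (i, j) + (F * transpose_mat X) $$ (i, j) = 0}"

text \<open>Differentiate the entries of the invariance equation of the form along the curve at
  0.\<close>

lemma Lie_alg_subset_isom_alg:
  assumes F: "F \<in> carrier_mat N N" and G: "G \<subseteq> isom_grp N F"
  shows "Lie_alg N G \<subseteq> isom_alg N F"
proof
  fix X assume "X \<in> Lie_alg N G"
  then obtain \<gamma> where X: "X \<in> carrier_mat N N" and g0: "\<gamma> 0 = 1\<^sub>m N" and ev: "\<forall>\<^sub>F z in nhds 0. \<gamma> z \<in> G"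
    and d: "\<And>i j. i < N \<Longrightarrow> j < N \<Longrightarrow> ((\<lambda>z. \<gamma> z $$ (i, j)) has_field_derivative X $$ (i, j)) (at 0)"
    unfolding Lie_alg_def by blast
  have "(X * F) $$ (i, j) + (F * transpose_mat X) $$ (i, j) = 0" if ij: "i < N" "j < N" for i j
  proof -
    let ?\<Phi> = "\<lambda>z. \<Sum>x<N. \<Sum>y<N. \<gamma> z $$ (i, x) * \<gamma> z $$ (j, y) * F $$ (x, y)"
    have "\<forall>\<^sub>F z in nhds 0. ?\<Phi> z = F $$ (i, j)"
      using ev
    proof (rule eventually_mono)
      fix z assume "\<gamma> z \<in> G"
      then have "\<gamma> z \<in> carrier_mat N N" "\<gamma> z * F * transpose_mat (\<gamma> z) = F"
        using G by (auto simp: isom_grp_def GL_grp_def)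
      then show "?\<Phi> z = F $$ (i, j)" using mult_transpose_entry[of "\<gamma> z" N N F N "\<gamma> z" N i j] F ij by simp
    qed
    then have "(?\<Phi> has_field_derivative 0) (at 0)"
      using DERIV_cong_ev[OF refl _ refl, of ?\<Phi> "\<lambda>_. F $$ (i, j)" 0 0] by simp
    moreover have "(?\<Phi> has_field_derivative (\<Sum>x<N. \<Sum>y<N.
        (X $$ (i, x) * \<gamma> 0 $$ (j, y) + X $$ (j, y) * \<gamma> 0 $$ (i, x)) * F $$ (x, y))) (at 0)"
      using d ij by (intro DERIV_sum DERIV_cmult_right DERIV_mult) auto
    ultimately have "0 = (\<Sum>x<N. \<Sum>y<N. (X $$ (i, x) * \<gamma> 0 $$ (j, y) + X $$ (j, y) * \<gamma> 0 $$ (i, x)) * F $$ (x, y))"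
      by (rule DERIV_unique)
    also have "\<dots> = (\<Sum>x<N. \<Sum>y<N. X $$ (i, x) * (1\<^sub>m N) $$ (j, y) * F $$ (x, y)) +
        (\<Sum>x<N. \<Sum>y<N. (1\<^sub>m N) $$ (i, x) * X $$ (j, y) * F $$ (x, y))"
      unfolding g0 sum.distrib[symmetric] by (intro sum.cong refl) (simp add: algebra_simps)
    also have "\<dots> = (X * F * transpose_mat (1\<^sub>m N)) $$ (i, j) + (1\<^sub>m N * F * transpose_mat X) $$ (i, j)"
      using X F ij by (simp only: mult_transpose_entry[of _ N N _ N _ N] one_carrier_mat)
    also have "\<dots> = (X * F) $$ (i, j) + (F * transpose_mat X) $$ (i, j)" using X F by simp
    finally show ?thesis ..
  qed
  then show "X \<in> isom_alg N F" unfolding isom_alg_def using X by blast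
qed

section \<open>Isometry groups and the Cayley transform\<close>

lemma lin_curve_mult:
  assumes X: "X \<in> carrier_mat N N" and M: "M \<in> carrier_mat N N"
  shows "lin_curve N X c * M = M + c \<cdot>\<^sub>m (X * M)" "M * transpose_mat (lin_curve N X c) = M + c \<cdot>\<^sub>m (M * transpose_mat X)"
proof -
  have cX: "c \<cdot>\<^sub>m X \<in> carrier_mat N N" using X by simp
  show "lin_curve N X c * M = M + c \<cdot>\<^sub>m (X * M)"
    unfolding lin_curve_def add_mult_distrib_mat[OF one_carrier_mat cX M] mult_smult_assoc_mat[OF X M]
      left_mult_one_mat[OF M] ..
  have Xt: "transpose_mat X \<in> carrier_mat N N" using X by simp
  have t: "transpose_mat (lin_curve N X c) = 1\<^sub>m N + c \<cdot>\<^sub>m transpose_mat X"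
    unfolding lin_curve_def using X by (intro eq_matI) auto
  have cXt: "c \<cdot>\<^sub>m transpose_mat X \<in> carrier_mat N N" using Xt by simp
  show "M * transpose_mat (lin_curve N X c) = M + c \<cdot>\<^sub>m (M * transpose_mat X)"
    unfolding t mult_add_distrib_mat[OF M one_carrier_mat cXt] mult_smult_distrib[OF M Xt] right_mult_one_mat[OF M] ..
qed

lemma lin_curve_commute:
  assumes X: "X \<in> carrier_mat N N"
  shows "lin_curve N X a * lin_curve N X b = lin_curve N X b * lin_curve N X a"
proof -
  have XX: "X * X \<in> carrier_mat N N" using X by simp
  have "X * lin_curve N X c = X + c \<cdot>\<^sub>m (X * X)" for c
  proof -
    have "c \<cdot>\<^sub>m X \<in> carrier_mat N N" using X by simp
    then show ?thesis
      unfolding lin_curve_def using X by (simp add: mult_add_distrib_mat[OF X one_carrier_mat] mult_smult_distrib[OF X X])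
  qed
  then have e: "lin_curve N X a * lin_curve N X b = (1\<^sub>m N + b \<cdot>\<^sub>m X) + a \<cdot>\<^sub>m (X + b \<cdot>\<^sub>m (X * X))" for a b
    unfolding lin_curve_mult(1)[OF X lin_curve_carrier[OF X]] by (simp add: lin_curve_def)
  show ?thesis unfolding e
  proof (rule eq_matI)
    fix i j
    assume "i < dim_row (1\<^sub>m N + a \<cdot>\<^sub>m X + b \<cdot>\<^sub>m (X + a \<cdot>\<^sub>m (X * X)))" "j < dim_col (1\<^sub>m N + a \<cdot>\<^sub>m X + b \<cdot>\<^sub>m (X + a \<cdot>\<^sub>m (X * X)))"
    then have ij: "i < N" "j < N" using X by auto
    have d: "dim_row (X * X) = N" "dim_col (X * X) = N" using XX by (auto simp del: index_mult_mat)
    show "(1\<^sub>m N + b \<cdot>\<^sub>m X + a \<cdot>\<^sub>m (X + b \<cdot>\<^sub>m (X * X))) $$ (i, j) = (1\<^sub>m N + a \<cdot>\<^sub>m X + b \<cdot>\<^sub>m (X + a \<cdot>\<^sub>m (X * X))) $$ (i, j)"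
      using ij X d by (simp add: distrib_left mult.left_commute del: index_mult_mat)
  qed (use X in simp_all)
qed

lemma congruence_cancel:
  assumes A: "A \<in> GL_grp N" and P: "P \<in> carrier_mat N N" "Q \<in> carrier_mat N N"
    and eq: "A * P * transpose_mat A = A * Q * transpose_mat A"
  shows "P = Q"
proof -
  note Ac = GL_grp_carrier[OF A] and Ai = minv[OF A]
  have Act: "transpose_mat A \<in> carrier_mat N N" using Ac by simp
  have Ait: "transpose_mat (minv A) \<in> carrier_mat N N" using Ai by simp
  have tt: "transpose_mat A * transpose_mat (minv A) = 1\<^sub>m N"
    using transpose_mult[OF Ai(1) Ac] Ai(3) by simp
  have "minv A * (A * M * transpose_mat A) * transpose_mat (minv A) = M" if M: "M \<in> carrier_mat N N" for M
  proof -
    have AM: "A * M \<in> carrier_mat N N" using Ac M by simp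
    have "minv A * (A * M * transpose_mat A) * transpose_mat (minv A) = minv A * ((A * M * transpose_mat A) * transpose_mat (minv A))"
      by (rule assoc_mult_mat[OF Ai(1) mult_carrier_mat[OF AM Act] Ait])
    also have "(A * M * transpose_mat A) * transpose_mat (minv A) = A * M"
      unfolding assoc_mult_mat[OF AM Act Ait] tt by (rule right_mult_one_mat[OF AM])
    also have "minv A * (A * M) = M"
      unfolding assoc_mult_mat[OF Ai(1) Ac M, symmetric] Ai(3) using M by simp
    finally show ?thesis .
  qed
  from this[OF P(1)] this[OF P(2)] show ?thesis unfolding eq by simp
qed

text \<open>With A and B for the two linear factors, skewness of X gives A F = F B^t and B F = F
  A^t. Since A and B commute, A (g F g^t) A^t = B F B^t = F A^t B^t = F B^t A^t = A F A^t, and A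
  cancels. The determinants of A F = F B^t show det A = det B, hence det g = 1.\<close>

lemma cayley_isometry:
  assumes F: "F \<in> GL_grp N" and X: "X \<in> isom_alg N F" and g: "g \<in> carrier_mat N N"
    and det: "Determinant.det (lin_curve N X (- c)) \<noteq> 0" and eq: "lin_curve N X (- c) * g = lin_curve N X c"
  shows "g \<in> isom_grp N F" "Determinant.det g = 1"
proof -
  have Xc: "X \<in> carrier_mat N N" using X by (simp add: isom_alg_def)
  have Fc: "F \<in> carrier_mat N N" by (rule GL_grp_carrier[OF F])
  define A where "A = lin_curve N X (- c)"
  define B where "B = lin_curve N X c"
  have Ac: "A \<in> carrier_mat N N" and Bc: "B \<in> carrier_mat N N" unfolding A_def B_def by (rule lin_curve_carrier[OF Xc])+
  have At: "transpose_mat A \<in> carrier_mat N N" and Bt: "transpose_mat B \<in> carrier_mat N N" and gt: "transpose_mat g \<in> carrier_mat N N"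
    using Ac Bc g by simp_all
  have AG: "A \<in> GL_grp N" using det Ac by (simp add: GL_grp_det A_def)
  have Xe: "c' * (F * transpose_mat X) $$ (i, j) = - c' * (X * F) $$ (i, j)" if "i < N" "j < N" for i j c'
  proof -
    have "(X * F) $$ (i, j) + (F * transpose_mat X) $$ (i, j) = 0" using X that unfolding isom_alg_def by blast
    then have "(F * transpose_mat X) $$ (i, j) = - (X * F) $$ (i, j)" by (simp only: add_eq_0_iff)
    then show ?thesis by simp
  qed
  have skew: "lin_curve N X c' * F = F * transpose_mat (lin_curve N X (- c'))" for c'
    unfolding lin_curve_mult[OF Xc Fc]
  proof (rule eq_matI)
    have XF: "X * F \<in> carrier_mat N N" "F * transpose_mat X \<in> carrier_mat N N" using Xc Fc by simp_all
    show "dim_row (F + c' \<cdot>\<^sub>m (X * F)) = dim_row (F + - c' \<cdot>\<^sub>m (F * transpose_mat X))"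
      "dim_col (F + c' \<cdot>\<^sub>m (X * F)) = dim_col (F + - c' \<cdot>\<^sub>m (F * transpose_mat X))" using Xc Fc by simp_all
    fix i j assume "i < dim_row (F + - c' \<cdot>\<^sub>m (F * transpose_mat X))" "j < dim_col (F + - c' \<cdot>\<^sub>m (F * transpose_mat X))"
    then have ij: "i < N" "j < N" using Xc Fc by auto
    have d: "dim_row (X * F) = N" "dim_col (X * F) = N" "dim_row (F * transpose_mat X) = N" "dim_col (F * transpose_mat X) = N"
      using XF by (auto simp del: index_mult_mat)
    show "(F + c' \<cdot>\<^sub>m (X * F)) $$ (i, j) = (F + - c' \<cdot>\<^sub>m (F * transpose_mat X)) $$ (i, j)"
      using ij Fc d Xe[OF ij, of "- c'"] by (simp del: index_mult_mat)
  qed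
  have AF: "A * F = F * transpose_mat B" and BF: "B * F = F * transpose_mat A"
    using skew[of "- c"] skew[of c] by (simp_all add: A_def B_def)
  have BA: "B * A = A * B" unfolding A_def B_def by (rule lin_curve_commute[OF Xc])
  have "A * (g * F * transpose_mat g) * transpose_mat A = A * F * transpose_mat A"
  proof -
    have gF: "g * F \<in> carrier_mat N N" using g Fc by simp
    have "A * (g * F * transpose_mat g) * transpose_mat A = (A * (g * F)) * transpose_mat g * transpose_mat A"
      by (simp only: assoc_mult_mat[OF Ac gF gt])
    also have "\<dots> = (A * (g * F)) * (transpose_mat g * transpose_mat A)"
      by (rule assoc_mult_mat[OF mult_carrier_mat[OF Ac gF] gt At])
    also have "A * (g * F) = B * F"
      unfolding assoc_mult_mat[OF Ac g Fc, symmetric] using eq by (simp add: A_def B_def)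
    also have "transpose_mat g * transpose_mat A = transpose_mat B"
      unfolding transpose_mult[OF Ac g, symmetric] using eq by (simp add: A_def B_def)
    also have "B * F * transpose_mat B = F * (transpose_mat A * transpose_mat B)"
      unfolding BF by (rule assoc_mult_mat[OF Fc At Bt])
    also have "transpose_mat A * transpose_mat B = transpose_mat B * transpose_mat A"
      unfolding transpose_mult[OF Ac Bc, symmetric] transpose_mult[OF Bc Ac, symmetric] BA ..
    also have "F * (transpose_mat B * transpose_mat A) = A * F * transpose_mat A"
      unfolding AF by (rule assoc_mult_mat[OF Fc Bt At, symmetric])
    finally show ?thesis .
  qed
  from congruence_cancel[OF AG _ Fc this] have iso: "g * F * transpose_mat g = F"
    using g Fc gt by simp
  have dA: "Determinant.det A \<noteq> 0" using det by (simp add: A_def)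
  have dF: "Determinant.det F \<noteq> 0" using F by (simp add: GL_grp_det)
  have "Determinant.det A * Determinant.det F = Determinant.det F * Determinant.det B"
    using arg_cong[OF AF, of Determinant.det] det_mult[OF Ac Fc] det_mult[OF Fc Bt] det_transpose[OF Bc] by simp
  then have "Determinant.det B = Determinant.det A" using dF by simp
  moreover have "Determinant.det A * Determinant.det g = Determinant.det B"
    using det_mult[OF Ac g] eq by (simp add: A_def B_def)
  ultimately show dg: "Determinant.det g = 1" using dA by simp
  show "g \<in> isom_grp N F"
    unfolding isom_grp_def using iso g dg by (simp add: GL_grp_det)
qed

text \<open>Cayley curves have determinant 1, so all groups between the special and the full
  isometry group have the same Lie algebra; this covers \<open>SO_D_grp\<close>.\<close>

lemma Lie_alg_isom:
  assumes F: "F \<in> GL_grp N" and G: "{g \<in> isom_grp N F. Determinant.det g = 1} \<subseteq> G" "G \<subseteq> isom_grp N F"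
  shows "Lie_alg N G = isom_alg N F"
proof
  show "Lie_alg N G \<subseteq> isom_alg N F"
    by (rule Lie_alg_subset_isom_alg[OF GL_grp_carrier[OF F] G(2)])
  show "isom_alg N F \<subseteq> Lie_alg N G"
  proof
    fix X assume X: "X \<in> isom_alg N F"
    then have Xc: "X \<in> carrier_mat N N" by (simp add: isom_alg_def)
    obtain \<gamma> where g: "\<gamma> 0 = 1\<^sub>m N" "\<And>z. \<gamma> z \<in> carrier_mat N N"
      "\<And>i j. i < N \<Longrightarrow> j < N \<Longrightarrow> (\<lambda>z. \<gamma> z $$ (i, j)) analytic_on {0} \<and>
          ((\<lambda>z. \<gamma> z $$ (i, j)) has_field_derivative X $$ (i, j)) (at 0)"
      "\<forall>\<^sub>F z in nhds 0. Determinant.det (lin_curve N X (- 1 / 2 * z)) \<noteq> 0 \<and>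
         lin_curve N X (- 1 / 2 * z) * \<gamma> z = lin_curve N X (1 / 2 * z)"
      using cayley_curve[OF Xc] by blast
    have "\<forall>\<^sub>F z in nhds 0. \<gamma> z \<in> G"
      using g(4)
    proof (rule eventually_mono)
      fix z assume "Determinant.det (lin_curve N X (- 1 / 2 * z)) \<noteq> 0 \<and>
         lin_curve N X (- 1 / 2 * z) * \<gamma> z = lin_curve N X (1 / 2 * z)"
      then have "\<gamma> z \<in> isom_grp N F" "Determinant.det (\<gamma> z) = 1"
        using cayley_isometry[OF F X g(2), of "1 / 2 * z" z] by simp_all
      then show "\<gamma> z \<in> G" using G(1) by blast
    qed
    then show "X \<in> Lie_alg N G" unfolding Lie_alg_def using Xc g(1,3) by blast
  qed
qed

lemma Lie_alg_block_prod:
  assumes G: "G1 \<subseteq> carrier_mat n n" "G2 \<subseteq> carrier_mat m m"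
  shows "Lie_alg (n + m) (block_prod G1 G2) = {diag_block_mat [a, b] | a b. a \<in> Lie_alg n G1 \<and> b \<in> Lie_alg m G2}"
proof (intro equalityI subsetI)
  fix X assume "X \<in> Lie_alg (n + m) (block_prod G1 G2)"
  then obtain \<gamma> where X: "X \<in> carrier_mat (n + m) (n + m)" and g0: "\<gamma> 0 = 1\<^sub>m (n + m)"
    and ev: "\<forall>\<^sub>F z in nhds 0. \<gamma> z \<in> block_prod G1 G2"
    and an: "\<And>i j. i < n + m \<Longrightarrow> j < n + m \<Longrightarrow> (\<lambda>z. \<gamma> z $$ (i, j)) analytic_on {0}"
    and d: "\<And>i j. i < n + m \<Longrightarrow> j < n + m \<Longrightarrow> ((\<lambda>z. \<gamma> z $$ (i, j)) has_field_derivative X $$ (i, j)) (at 0)"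
    unfolding Lie_alg_def by blast
  define \<alpha> where "\<alpha> M = Matrix.mat n n (\<lambda>(i, j). M $$ (i, j))" for M :: "complex mat"
  define \<beta> where "\<beta> M = Matrix.mat m m (\<lambda>(i, j). M $$ (i + n, j + n))" for M :: "complex mat"
  have blocks: "\<alpha> M \<in> G1 \<and> \<beta> M \<in> G2 \<and> (\<forall>i j. i < n \<longrightarrow> j < m \<longrightarrow> M $$ (i, j + n) = 0 \<and> M $$ (j + n, i) = 0)"
    if M: "M \<in> block_prod G1 G2" for M
  proof -
    obtain a b where ab: "M = diag_block_mat [a, b]" "a \<in> G1" "b \<in> G2" using M unfolding block_prod_def by blast
    have c: "a \<in> carrier_mat n n" "b \<in> carrier_mat m m" using ab G by auto
    have "\<alpha> M = a" unfolding \<alpha>_def ab(1) using c by (intro eq_matI) (auto simp: diag_pair_entry[OF c] simp del: diag_block_mat.simps)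
    moreover have "\<beta> M = b" unfolding \<beta>_def ab(1) using c by (intro eq_matI) (auto simp: diag_pair_entry[OF c] simp del: diag_block_mat.simps)
    moreover have "M $$ (i, j + n) = 0 \<and> M $$ (j + n, i) = 0" if "i < n" "j < m" for i j
      unfolding ab(1) using that by (simp add: diag_pair_entry[OF c] del: diag_block_mat.simps)
    ultimately show ?thesis using ab by simp
  qed
  have "\<alpha> X \<in> Lie_alg n G1"
    unfolding Lie_alg_def
  proof (intro CollectI conjI exI[of _ "\<lambda>z. \<alpha> (\<gamma> z)"] allI impI)
    show "\<alpha> X \<in> carrier_mat n n" by (simp add: \<alpha>_def)
    show "\<alpha> (\<gamma> 0) = 1\<^sub>m n" unfolding g0 \<alpha>_def by (intro eq_matI) auto
    show "\<forall>\<^sub>F z in nhds 0. \<alpha> (\<gamma> z) \<in> G1" using ev by (rule eventually_mono) (use blocks in blast)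
    fix i j assume ij: "i < n" "j < n"
    show "(\<lambda>z. \<alpha> (\<gamma> z) $$ (i, j)) analytic_on {0}" using an[of i j] ij by (simp add: \<alpha>_def)
    show "((\<lambda>z. \<alpha> (\<gamma> z) $$ (i, j)) has_field_derivative \<alpha> X $$ (i, j)) (at 0)" using d[of i j] ij by (simp add: \<alpha>_def)
  qed
  moreover have "\<beta> X \<in> Lie_alg m G2"
    unfolding Lie_alg_def
  proof (intro CollectI conjI exI[of _ "\<lambda>z. \<beta> (\<gamma> z)"] allI impI)
    show "\<beta> X \<in> carrier_mat m m" by (simp add: \<beta>_def)
    show "\<beta> (\<gamma> 0) = 1\<^sub>m m" unfolding g0 \<beta>_def by (intro eq_matI) auto
    show "\<forall>\<^sub>F z in nhds 0. \<beta> (\<gamma> z) \<in> G2" using ev by (rule eventually_mono) (use blocks in blast)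
    fix i j assume ij: "i < m" "j < m"
    show "(\<lambda>z. \<beta> (\<gamma> z) $$ (i, j)) analytic_on {0}" using an[of "i + n" "j + n"] ij by (simp add: \<beta>_def)
    show "((\<lambda>z. \<beta> (\<gamma> z) $$ (i, j)) has_field_derivative \<beta> X $$ (i, j)) (at 0)"
      using d[of "i + n" "j + n"] ij by (simp add: \<beta>_def)
  qed
  moreover have "X = diag_block_mat [\<alpha> X, \<beta> X]"
  proof (rule eq_matI)
    have c: "\<alpha> X \<in> carrier_mat n n" "\<beta> X \<in> carrier_mat m m" by (simp_all add: \<alpha>_def \<beta>_def)
    note cc = diag_pair_carrier[OF c]
    show "dim_row X = dim_row (diag_block_mat [\<alpha> X, \<beta> X])" "dim_col X = dim_col (diag_block_mat [\<alpha> X, \<beta> X])"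
      using X cc by auto
    fix i j assume "i < dim_row (diag_block_mat [\<alpha> X, \<beta> X])" "j < dim_col (diag_block_mat [\<alpha> X, \<beta> X])"
    then have ij: "i < n + m" "j < n + m" using cc by auto
    \<comment> \<open>The off-diagonal blocks vanish along the curve near 0, hence so do their
      derivatives.\<close>
    have zero: "X $$ (k, l) = 0" if kl: "k < n + m" "l < n + m" "k < n \<longleftrightarrow> \<not> l < n" for k l
    proof -
      have "\<forall>\<^sub>F z in nhds 0. \<gamma> z $$ (k, l) = 0"
        using ev
      proof (rule eventually_mono)
        fix z assume "\<gamma> z \<in> block_prod G1 G2"
        from blocks[OF this] show "\<gamma> z $$ (k, l) = 0"
          using kl by (cases "k < n") (auto dest: spec[of _ k] spec[of _ l] simp: not_less le_iff_add add.commute)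
      qed
      from iffD1[OF DERIV_cong_ev[OF refl this refl] d[OF kl(1,2)]]
      show ?thesis by (rule DERIV_unique) simp
    qed
    show "X $$ (i, j) = diag_block_mat [\<alpha> X, \<beta> X] $$ (i, j)"
      unfolding diag_pair_entry[OF c ij] using ij zero by (auto simp: \<alpha>_def \<beta>_def)
  qed
  ultimately show "X \<in> {diag_block_mat [a, b] | a b. a \<in> Lie_alg n G1 \<and> b \<in> Lie_alg m G2}" by blast
next
  fix X assume "X \<in> {diag_block_mat [a, b] | a b. a \<in> Lie_alg n G1 \<and> b \<in> Lie_alg m G2}"
  then obtain a b where X: "X = diag_block_mat [a, b]" and a: "a \<in> Lie_alg n G1" and b: "b \<in> Lie_alg m G2" by blast
  obtain \<alpha> where ac: "a \<in> carrier_mat n n" and \<alpha>: "\<alpha> 0 = 1\<^sub>m n" "\<forall>\<^sub>F z in nhds 0. \<alpha> z \<in> G1"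
    "\<And>i j. i < n \<Longrightarrow> j < n \<Longrightarrow> (\<lambda>z. \<alpha> z $$ (i, j)) analytic_on {0} \<and>
        ((\<lambda>z. \<alpha> z $$ (i, j)) has_field_derivative a $$ (i, j)) (at 0)"
    using a unfolding Lie_alg_def by blast
  obtain \<beta> where bc: "b \<in> carrier_mat m m" and \<beta>: "\<beta> 0 = 1\<^sub>m m" "\<forall>\<^sub>F z in nhds 0. \<beta> z \<in> G2"
    "\<And>i j. i < m \<Longrightarrow> j < m \<Longrightarrow> (\<lambda>z. \<beta> z $$ (i, j)) analytic_on {0} \<and>
        ((\<lambda>z. \<beta> z $$ (i, j)) has_field_derivative b $$ (i, j)) (at 0)"
    using b unfolding Lie_alg_def by blast
  \<comment> \<open>Defined entrywise because the sizes of \<open>\<alpha> z\<close> and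
    \<open>\<beta> z\<close> are known only near 0.\<close>
  define \<gamma> where "\<gamma> z = Matrix.mat (n + m) (n + m) (\<lambda>(i, j). if i < n then if j < n then \<alpha> z $$ (i, j) else 0
     else if j < n then 0 else \<beta> z $$ (i - n, j - n))" for z
  have eq: "\<gamma> z = diag_block_mat [\<alpha> z, \<beta> z]" if "\<alpha> z \<in> carrier_mat n n" "\<beta> z \<in> carrier_mat m m" for z
  proof (rule eq_matI)
    note cc = diag_pair_carrier[OF that]
    show "dim_row (\<gamma> z) = dim_row (diag_block_mat [\<alpha> z, \<beta> z])" "dim_col (\<gamma> z) = dim_col (diag_block_mat [\<alpha> z, \<beta> z])"
      using cc by (auto simp: \<gamma>_def simp del: diag_block_mat.simps)
    fix i j assume "i < dim_row (diag_block_mat [\<alpha> z, \<beta> z])" "j < dim_col (diag_block_mat [\<alpha> z, \<beta> z])"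
    then have ij: "i < n + m" "j < n + m" using cc by auto
    show "\<gamma> z $$ (i, j) = diag_block_mat [\<alpha> z, \<beta> z] $$ (i, j)"
      unfolding diag_pair_entry[OF that ij] using ij by (simp add: \<gamma>_def)
  qed
  show "X \<in> Lie_alg (n + m) (block_prod G1 G2)"
    unfolding Lie_alg_def
  proof (intro CollectI conjI exI[of _ \<gamma>] allI impI)
    show "X \<in> carrier_mat (n + m) (n + m)" unfolding X by (rule diag_pair_carrier[OF ac bc])
    show "\<gamma> 0 = 1\<^sub>m (n + m)" using eq[of 0] \<alpha>(1) \<beta>(1) by (simp add: diag_pair_one del: diag_block_mat.simps)
    show "\<forall>\<^sub>F z in nhds 0. \<gamma> z \<in> block_prod G1 G2"
      using eventually_conj[OF \<alpha>(2) \<beta>(2)]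
    proof (rule eventually_mono)
      fix z assume z: "\<alpha> z \<in> G1 \<and> \<beta> z \<in> G2"
      then have "\<gamma> z = diag_block_mat [\<alpha> z, \<beta> z]" using G by (intro eq) auto
      then show "\<gamma> z \<in> block_prod G1 G2" unfolding block_prod_def using z by blast
    qed
    fix i j assume ij: "i < n + m" "j < n + m"
    have "(\<lambda>z. \<gamma> z $$ (i, j)) = (\<lambda>z. if i < n then if j < n then \<alpha> z $$ (i, j) else 0
     else if j < n then 0 else \<beta> z $$ (i - n, j - n))" using ij by (simp add: \<gamma>_def)
    then show "(\<lambda>z. \<gamma> z $$ (i, j)) analytic_on {0}"
      "((\<lambda>z. \<gamma> z $$ (i, j)) has_field_derivative X $$ (i, j)) (at 0)"
      unfolding X diag_pair_entry[OF ac bc ij]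
      using \<alpha>(3)[of i j] \<beta>(3)[of "i - n" "j - n"] ij by (cases "i < n"; cases "j < n"; simp)+
  qed
qed

section \<open>Symmetric pairs in coordinates\<close>

text \<open>Pairs in which \<open>G\<close> preserves a bilinear form with matrix \<open>B\<close>: \<open>X \<mapsto> X B\<close> turns the adjoint
  action into \<open>Y \<mapsto> k Y k\<^sup>t\<close> on (anti)symmetric \<open>Y\<close>.\<close>

locale form_pair = words d ty N kc sg
  for d :: nat and ty :: gtype and N :: "'k \<Rightarrow> nat" and kc :: "'c::finite \<Rightarrow> 'k" and sg :: "'c \<Rightarrow> bool" +
  fixes M :: nat and B :: "complex mat" and \<iota> :: "(nat \<times> bool) \<times> 'c \<Rightarrow> nat"
    and eps :: complex and R0 :: "'c \<Rightarrow> 'c \<Rightarrow> bool" and V K :: "complex mat set"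
  assumes eps: "eps * eps = 1" and R0_sym: "\<And>\<gamma> \<gamma>'. R0 \<gamma> \<gamma>' \<Longrightarrow> R0 \<gamma>' \<gamma>"
    and \<iota>: "bij_betw \<iota> H {..<M}" and B: "B \<in> GL_grp M"
    and V: "V = {X \<in> carrier_mat M M. (\<forall>a\<in>H. \<forall>b\<in>H. (X * B) $$ (\<iota> b, \<iota> a) = eps * (X * B) $$ (\<iota> a, \<iota> b)) \<and>
       (\<forall>a\<in>H. \<forall>b\<in>H. \<not> R0 (snd a) (snd b) \<longrightarrow> (X * B) $$ (\<iota> a, \<iota> b) = 0)}"
    and K_isom: "K \<subseteq> isom_grp M B"
    and K_family: "\<And>k. k \<in> K \<Longrightarrow> \<exists>g. family g \<and> (\<forall>a\<in>H. \<forall>b\<in>H. k $$ (\<iota> a, \<iota> b) = fam g a b)"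
    and family_K: "\<And>g. family g \<Longrightarrow> \<exists>k\<in>K. \<forall>a\<in>H. \<forall>b\<in>H. k $$ (\<iota> a, \<iota> b) = fam g a b"
begin

definition L :: "complex mat \<Rightarrow> (nat \<times> bool) \<times> 'c \<Rightarrow> (nat \<times> bool) \<times> 'c \<Rightarrow> complex" where
  "L X a b = (X * B) $$ (\<iota> a, \<iota> b)"

lemma Bc: "B \<in> carrier_mat M M"
  by (rule GL_grp_carrier[OF B])

lemma \<iota>_lt: "a \<in> H \<Longrightarrow> \<iota> a < M"
  using \<iota> by (auto simp: bij_betw_def)

lemma V_carrier: "X \<in> V \<Longrightarrow> X \<in> carrier_mat M M"
  by (simp add: V)

lemma V_iff: "X \<in> V \<longleftrightarrow> X \<in> carrier_mat M M \<and> (\<forall>a\<in>H. \<forall>b\<in>H. L X b a = eps * L X a b) \<and>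
    (\<forall>a\<in>H. \<forall>b\<in>H. \<not> R0 (snd a) (snd b) \<longrightarrow> L X a b = 0)"
  unfolding V L_def by blast

lemma mult_B_entries:
  assumes "X \<in> carrier_mat M M" "Y \<in> carrier_mat M M" "a \<in> H" "b \<in> H"
  shows "L (X + Y) a b = L X a b + L Y a b" "L (c \<cdot>\<^sub>m X) a b = c * L X a b"
proof -
  have XB: "X * B \<in> carrier_mat M M" "Y * B \<in> carrier_mat M M" using assms Bc by simp_all
  then have d: "dim_row (X * B) = M" "dim_col (X * B) = M" "dim_row (Y * B) = M" "dim_col (Y * B) = M"
    by (auto simp del: index_mult_mat)
  show "L (X + Y) a b = L X a b + L Y a b"
    unfolding L_def add_mult_distrib_mat[OF assms(1,2) Bc] using d \<iota>_lt assms by (simp del: index_mult_mat)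
  show "L (c \<cdot>\<^sub>m X) a b = c * L X a b"
    unfolding L_def mult_smult_assoc_mat[OF assms(1) Bc] using d \<iota>_lt assms by (simp del: index_mult_mat)
qed

lemma L_inj:
  assumes "X \<in> carrier_mat M M" "Y \<in> carrier_mat M M" "\<And>a b. a \<in> H \<Longrightarrow> b \<in> H \<Longrightarrow> L X a b = L Y a b"
  shows "X = Y"
proof -
  have "X * B = Y * B"
  proof (rule eq_matI)
    fix i j assume "i < dim_row (Y * B)" "j < dim_col (Y * B)"
    then have "i < M" "j < M" using assms Bc by auto
    then obtain a b where "a \<in> H" "b \<in> H" "i = \<iota> a" "j = \<iota> b" using \<iota> unfolding bij_betw_def by blast
    then show "(X * B) $$ (i, j) = (Y * B) $$ (i, j)" using assms(3) by (simp add: L_def)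
  qed (use assms Bc in simp_all)
  then have "X * (B * minv B) = Y * (B * minv B)"
    using assoc_mult_mat[OF assms(1) Bc minv(1)[OF B]] assoc_mult_mat[OF assms(2) Bc minv(1)[OF B]] by simp
  then show ?thesis using assms(1,2) by (simp add: minv(2)[OF B])
qed

lemma L_surj: "\<exists>X\<in>carrier_mat M M. \<forall>a\<in>H. \<forall>b\<in>H. L X a b = x a b"
proof -
  define Y where "Y = Matrix.mat M M (\<lambda>(i, j). x (inv_into H \<iota> i) (inv_into H \<iota> j))"
  have Y: "Y \<in> carrier_mat M M" by (simp add: Y_def)
  have "(Y * minv B) * B = Y * (minv B * B)" by (rule assoc_mult_mat[OF Y minv(1)[OF B] Bc])
  then have "(Y * minv B) * B = Y" using Y by (simp add: minv(3)[OF B])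
  moreover have "Y $$ (\<iota> a, \<iota> b) = x a b" if "a \<in> H" "b \<in> H" for a b
    using that \<iota>_lt \<iota> by (simp add: Y_def bij_betw_def)
  ultimately have "\<forall>a\<in>H. \<forall>b\<in>H. L (Y * minv B) a b = x a b" by (simp only: L_def) blast
  moreover have "Y * minv B \<in> carrier_mat M M" using Y minv(1)[OF B] by simp
  ultimately show ?thesis by blast
qed

text \<open>An isometry satisfies \<open>minv k * B = B * transpose_mat k\<close>, so conjugating
  \<open>X\<close> by \<open>k\<close> multiplies \<open>X * B\<close> by \<open>k\<close> from the
  left and by its transpose from the right.\<close>

lemma L_Ad:
  assumes k: "k \<in> isom_grp M B" and g: "\<And>a b. a \<in> H \<Longrightarrow> b \<in> H \<Longrightarrow> k $$ (\<iota> a, \<iota> b) = fam g a b"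
    and X: "X \<in> carrier_mat M M" and ab: "a \<in> H" "b \<in> H"
  shows "L (Ad k X) a b = (\<Sum>a'\<in>H. \<Sum>b'\<in>H. fam g a a' * fam g b b' * L X a' b')"
proof -
  have kG: "k \<in> GL_grp M" and iso: "k * B * transpose_mat k = B" using k by (auto simp: isom_grp_def)
  note kc = GL_grp_carrier[OF kG] and ki = minv[OF kG]
  have kt: "transpose_mat k \<in> carrier_mat M M" and XB: "X * B \<in> carrier_mat M M" and kX: "k * X \<in> carrier_mat M M"
    and kB: "k * B \<in> carrier_mat M M" and kiB: "minv k * B \<in> carrier_mat M M"
    using kc X Bc ki by simp_all
  have "minv k * B = minv k * (k * B * transpose_mat k)" unfolding iso ..
  also have "\<dots> = (minv k * (k * B)) * transpose_mat k" by (rule assoc_mult_mat[OF ki(1) kB kt, symmetric])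
  also have "minv k * (k * B) = B"
    unfolding assoc_mult_mat[OF ki(1) kc Bc, symmetric] ki(3) by (rule left_mult_one_mat[OF Bc])
  finally have kiB_eq: "minv k * B = B * transpose_mat k" .
  have "Ad k X * B = (k * X) * (minv k * B)"
    unfolding Ad_def by (rule assoc_mult_mat[OF kX ki(1) Bc])
  also have "\<dots> = (k * X) * B * transpose_mat k"
    unfolding kiB_eq by (rule assoc_mult_mat[OF kX Bc kt, symmetric])
  also have "(k * X) * B = k * (X * B)" by (rule assoc_mult_mat[OF kc X Bc])
  finally have "L (Ad k X) a b = (\<Sum>x<M. \<Sum>y<M. k $$ (\<iota> a, x) * k $$ (\<iota> b, y) * (X * B) $$ (x, y))"
    unfolding L_def using mult_transpose_entry[OF kc XB kc \<iota>_lt[OF ab(1)] \<iota>_lt[OF ab(2)]] by simp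
  also have "\<dots> = (\<Sum>a'\<in>H. \<Sum>b'\<in>H. k $$ (\<iota> a, \<iota> a') * k $$ (\<iota> b, \<iota> b') * (X * B) $$ (\<iota> a', \<iota> b'))"
    by (simp only: sum.reindex_bij_betw[OF \<iota>, symmetric])
  also have "\<dots> = (\<Sum>a'\<in>H. \<Sum>b'\<in>H. fam g a a' * fam g b b' * L X a' b')"
    using g ab by (intro sum.cong refl) (simp add: L_def)
  finally show ?thesis .
qed

text \<open>The operators do not mix colours, so they respect the support; exchanging the two
  summation indices shows that they respect the symmetry.\<close>

lemma Ad_in_V:
  assumes k: "k \<in> isom_grp M B" and g: "\<And>a b. a \<in> H \<Longrightarrow> b \<in> H \<Longrightarrow> k $$ (\<iota> a, \<iota> b) = fam g a b" and X: "X \<in> V"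
  shows "Ad k X \<in> V"
proof -
  have kG: "k \<in> GL_grp M" using k by (simp add: isom_grp_def)
  have Ac: "Ad k X \<in> carrier_mat M M"
    unfolding Ad_def using GL_grp_carrier[OF kG] V_carrier[OF X] minv(1)[OF kG] by simp
  have LA: "L (Ad k X) a b = (\<Sum>a'\<in>H. \<Sum>b'\<in>H. fam g a a' * fam g b b' * L X a' b')" if "a \<in> H" "b \<in> H" for a b
    by (rule L_Ad[OF k _ V_carrier[OF X] that]) (rule g)
  have sym: "L X b a = eps * L X a b" and supp: "\<not> R0 (snd a) (snd b) \<Longrightarrow> L X a b = 0" if "a \<in> H" "b \<in> H" for a b
    using X that unfolding V_iff by blast+
  have "L (Ad k X) b a = eps * L (Ad k X) a b" if ab: "a \<in> H" "b \<in> H" for a b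
  proof -
    have "L (Ad k X) b a = (\<Sum>a'\<in>H. \<Sum>b'\<in>H. fam g b b' * fam g a a' * L X b' a')"
      unfolding LA[OF ab(2,1)] by (rule sum.swap)
    also have "\<dots> = (\<Sum>a'\<in>H. \<Sum>b'\<in>H. eps * (fam g a a' * fam g b b' * L X a' b'))"
    proof (intro sum.cong refl)
      fix a' b' assume "a' \<in> H" "b' \<in> H"
      note s = sym[OF this]
      show "fam g b b' * fam g a a' * L X b' a' = eps * (fam g a a' * fam g b b' * L X a' b')"
        unfolding s by (simp only: mult.assoc mult.commute mult.left_commute)
    qed
    finally show ?thesis unfolding LA[OF ab] by (simp only: sum_distrib_left)
  qed
  moreover have "L (Ad k X) a b = 0" if ab: "a \<in> H" "b \<in> H" "\<not> R0 (snd a) (snd b)" for a b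
    unfolding LA[OF ab(1,2)]
  proof (rule sum.neutral, rule ballI, rule sum.neutral, rule ballI)
    fix a' b' assume ab': "a' \<in> H" "b' \<in> H"
    show "fam g a a' * fam g b b' * L X a' b' = 0"
    proof (cases "snd a = snd a' \<and> snd b = snd b'")
      case True
      then show ?thesis using supp[OF ab'] ab(3) by simp
    qed (auto simp: fam_def)
  qed
  ultimately show ?thesis unfolding V_iff using Ac by blast
qed

lemma coords: "sym_model V H L eps (\<lambda>a b. R0 (snd a) (snd b))"
proof
  show "finite H" by (rule finite_H)
  show "eps * eps = 1" by (rule eps)
  show "R0 (snd b) (snd a)" if "R0 (snd a) (snd b)" for a b :: "(nat \<times> bool) \<times> 'c" using R0_sym[OF that] .
  show "X + Y \<in> V" if X: "X \<in> V" and Y: "Y \<in> V" for X Y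
    unfolding V_iff
  proof (intro conjI ballI impI)
    note e = mult_B_entries(1)[OF V_carrier[OF X] V_carrier[OF Y]]
    show "X + Y \<in> carrier_mat M M" using V_carrier[OF X] V_carrier[OF Y] by simp
    fix a b assume ab: "a \<in> H" "b \<in> H"
    have "L X b a = eps * L X a b" "L Y b a = eps * L Y a b" using X Y ab unfolding V_iff by blast+
    then show "L (X + Y) b a = eps * L (X + Y) a b"
      unfolding e[OF ab] e[OF ab(2,1)] by (simp only: distrib_left)
    assume "\<not> R0 (snd a) (snd b)"
    then have "L X a b = 0" "L Y a b = 0" using X Y ab unfolding V_iff by blast+
    then show "L (X + Y) a b = 0" unfolding e[OF ab] by simp
  qed
  show "c \<cdot>\<^sub>m X \<in> V" if X: "X \<in> V" for c X
    unfolding V_iff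
  proof (intro conjI ballI impI)
    note e = mult_B_entries(2)[OF V_carrier[OF X] V_carrier[OF X]]
    show "c \<cdot>\<^sub>m X \<in> carrier_mat M M" using V_carrier[OF X] by simp
    fix a b assume ab: "a \<in> H" "b \<in> H"
    have "L X b a = eps * L X a b" using X ab unfolding V_iff by blast
    then show "L (c \<cdot>\<^sub>m X) b a = eps * L (c \<cdot>\<^sub>m X) a b"
      unfolding e[OF ab] e[OF ab(2,1)] by (simp only: mult.left_commute)
    assume "\<not> R0 (snd a) (snd b)"
    then have "L X a b = 0" using X ab unfolding V_iff by blast
    then show "L (c \<cdot>\<^sub>m X) a b = 0" unfolding e[OF ab] by simp
  qed
  show "L (X + Y) a b = L X a b + L Y a b" if "X \<in> V" "Y \<in> V" "a \<in> H" "b \<in> H" for X Y a b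
    using that V_carrier by (intro mult_B_entries) auto
  show "L (c \<cdot>\<^sub>m X) a b = c * L X a b" if "X \<in> V" "a \<in> H" "b \<in> H" for c X a b
    using that V_carrier by (intro mult_B_entries[of X X]) auto
  show "L X b a = eps * L X a b" if "X \<in> V" "a \<in> H" "b \<in> H" for X a b using that unfolding V_iff by blast
  show "L X a b = 0" if "X \<in> V" "a \<in> H" "b \<in> H" "\<not> R0 (snd a) (snd b)" for X a b using that unfolding V_iff by blast
  show "X = Y" if "X \<in> V" "Y \<in> V" "\<And>a b. a \<in> H \<Longrightarrow> b \<in> H \<Longrightarrow> L X a b = L Y a b" for X Y
    by (rule L_inj[OF V_carrier[OF that(1)] V_carrier[OF that(2)] that(3)])
  show "\<exists>X\<in>V. \<forall>a\<in>H. \<forall>b\<in>H. L X a b = x a b"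
    if sym: "\<And>a b. a \<in> H \<Longrightarrow> b \<in> H \<Longrightarrow> x b a = eps * x a b"
      and supp: "\<And>a b. a \<in> H \<Longrightarrow> b \<in> H \<Longrightarrow> \<not> R0 (snd a) (snd b) \<Longrightarrow> x a b = 0" for x
  proof -
    obtain X where X: "X \<in> carrier_mat M M" "\<forall>a\<in>H. \<forall>b\<in>H. L X a b = x a b" using L_surj[of x] by blast
    have "X \<in> V" unfolding V_iff
    proof (intro conjI ballI impI)
      show "X \<in> carrier_mat M M" by (rule X(1))
      fix a b assume ab: "a \<in> H" "b \<in> H"
      show "L X b a = eps * L X a b" using X(2) sym[OF ab] ab by metis
      assume "\<not> R0 (snd a) (snd b)"
      then show "L X a b = 0" using X(2) supp[OF ab] ab by metis
    qed
    then show ?thesis using X(2) by blast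
  qed
qed

theorem form_pair_models: "models (sym_inv d V K) (sym_rel d V) (match_space d R0 eps R1 eps1)"
proof -
  interpret sym_model d V H L eps "\<lambda>a b. R0 (snd a) (snd b)" by (rule coords)
  have actsI: "acts k (fam g)" if "k \<in> K" and kg: "\<forall>a\<in>H. \<forall>b\<in>H. k $$ (\<iota> a, \<iota> b) = fam g a b" for k g
    unfolding acts_def
  proof (intro ballI conjI)
    have k: "k \<in> isom_grp M B" using that(1) K_isom by blast
    have g: "k $$ (\<iota> a, \<iota> b) = fam g a b" if "a \<in> H" "b \<in> H" for a b using kg that by blast
    fix X assume X: "X \<in> V"
    show "Ad k X \<in> V" by (rule Ad_in_V[OF k _ X]) (rule g)
    show "L (Ad k X) a b = (\<Sum>a'\<in>H. \<Sum>b'\<in>H. fam g a a' * fam g b b' * L X a' b')" if "a \<in> H" "b \<in> H" for a b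
      by (rule L_Ad[OF k _ V_carrier[OF X] that]) (rule g)
  qed
  interpret pair_model d ty N kc sg V L eps R0 K
  proof
    show "\<exists>g. family g \<and> acts k (fam g)" if "k \<in> K" for k using K_family[OF that] actsI[OF that] by blast
    show "\<exists>k\<in>K. acts k (fam g)" if "family g" for g using family_K[OF that] actsI by blast
  qed
  show ?thesis by (rule sym_inv_models)
qed

end

text \<open>Pairs in which Lie(\<open>G\<close>) consists of all matrices with prescribed vanishing blocks: after multiplication by \<open>B\<close>,
  the rows and columns of \<open>X\<close> transform under dual representations of \<open>K\<close>, and \<open>rc\<close> tells row colours from
  column colours.\<close>

locale gl_pair = words d ty N kc sg
  for d :: nat and ty :: gtype and N :: "'k \<Rightarrow> nat" and kc :: "'c::finite \<Rightarrow> 'k" and sg :: "'c \<Rightarrow> bool" +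
  fixes M :: nat and B :: "complex mat" and \<iota> :: "(nat \<times> bool) \<times> 'c \<Rightarrow> nat" and rc :: "'c \<Rightarrow> bool"
    and R0 :: "'c \<Rightarrow> 'c \<Rightarrow> bool" and V K :: "complex mat set"
  assumes R0_sym: "\<And>\<gamma> \<gamma>'. R0 \<gamma> \<gamma>' \<Longrightarrow> R0 \<gamma>' \<gamma>" and R0_rc: "\<And>\<gamma> \<gamma>'. R0 \<gamma> \<gamma>' \<Longrightarrow> rc \<gamma> \<noteq> rc \<gamma>'"
    and \<iota>: "\<And>s. bij_betw \<iota> {a \<in> H. rc (snd a) = s} {..<M}" and B: "B \<in> GL_grp M"
    and V: "V = {X \<in> carrier_mat M M. \<forall>a\<in>H. \<forall>b\<in>H. \<not> rc (snd a) \<longrightarrow> rc (snd b) \<longrightarrow> \<not> R0 (snd a) (snd b) \<longrightarrow>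
       (X * B) $$ (\<iota> a, \<iota> b) = 0}"
    and K_GL: "K \<subseteq> GL_grp M"
    and K_family: "\<And>k. k \<in> K \<Longrightarrow> \<exists>g. family g \<and> (\<forall>a\<in>H. \<forall>b\<in>H.
       (\<not> rc (snd a) \<longrightarrow> \<not> rc (snd b) \<longrightarrow> k $$ (\<iota> a, \<iota> b) = fam g a b) \<and>
       (rc (snd a) \<longrightarrow> rc (snd b) \<longrightarrow> (minv B * minv k * B) $$ (\<iota> b, \<iota> a) = fam g a b))"
    and family_K: "\<And>g. family g \<Longrightarrow> \<exists>k\<in>K. \<forall>a\<in>H. \<forall>b\<in>H.
       (\<not> rc (snd a) \<longrightarrow> \<not> rc (snd b) \<longrightarrow> k $$ (\<iota> a, \<iota> b) = fam g a b) \<and>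
       (rc (snd a) \<longrightarrow> rc (snd b) \<longrightarrow> (minv B * minv k * B) $$ (\<iota> b, \<iota> a) = fam g a b)"
begin

text \<open>A matrix without symmetry is spread over a doubled index set: each entry is attached to
  a row letter and a column letter in either order. This makes it a symmetric array, so that the
  sign is 1.\<close>

definition L :: "complex mat \<Rightarrow> (nat \<times> bool) \<times> 'c \<Rightarrow> (nat \<times> bool) \<times> 'c \<Rightarrow> complex" where
  "L X a b = (if rc (snd a) = rc (snd b) then 0
     else if rc (snd b) then (X * B) $$ (\<iota> a, \<iota> b) else (X * B) $$ (\<iota> b, \<iota> a))"

lemma Bc: "B \<in> carrier_mat M M"
  by (rule GL_grp_carrier[OF B])

lemma \<iota>_lt: "a \<in> H \<Longrightarrow> \<iota> a < M"
  using \<iota>[of "rc (snd a)"] by (auto simp: bij_betw_def)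

lemma L_sym: "L X b a = L X a b"
  by (auto simp: L_def)

lemma V_carrier: "X \<in> V \<Longrightarrow> X \<in> carrier_mat M M"
  by (simp add: V)

lemma V_iff: "X \<in> V \<longleftrightarrow> X \<in> carrier_mat M M \<and> (\<forall>a\<in>H. \<forall>b\<in>H. \<not> R0 (snd a) (snd b) \<longrightarrow> L X a b = 0)"
proof
  assume X: "X \<in> V"
  show "X \<in> carrier_mat M M \<and> (\<forall>a\<in>H. \<forall>b\<in>H. \<not> R0 (snd a) (snd b) \<longrightarrow> L X a b = 0)"
  proof (intro conjI ballI impI)
    show "X \<in> carrier_mat M M" by (rule V_carrier[OF X])
    fix a b assume ab: "a \<in> H" "b \<in> H" "\<not> R0 (snd a) (snd b)"
    have ba: "\<not> R0 (snd b) (snd a)" using ab(3) R0_sym by blast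
    have zero: "(X * B) $$ (\<iota> u, \<iota> v) = 0" if "u \<in> H" "v \<in> H" "\<not> rc (snd u)" "rc (snd v)" "\<not> R0 (snd u) (snd v)" for u v
      using X that unfolding V by blast
    show "L X a b = 0" unfolding L_def using zero[OF ab(1,2) _ _ ab(3)] zero[OF ab(2,1) _ _ ba] by auto
  qed
next
  assume X: "X \<in> carrier_mat M M \<and> (\<forall>a\<in>H. \<forall>b\<in>H. \<not> R0 (snd a) (snd b) \<longrightarrow> L X a b = 0)"
  show "X \<in> V" unfolding V
  proof (intro CollectI conjI ballI impI)
    show "X \<in> carrier_mat M M" using X by blast
    fix a b assume "a \<in> H" "b \<in> H" "\<not> rc (snd a)" "rc (snd b)" "\<not> R0 (snd a) (snd b)"
    moreover from this X have "L X a b = 0" by blast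
    ultimately show "(X * B) $$ (\<iota> a, \<iota> b) = 0" by (simp add: L_def)
  qed
qed

lemma mult_B_entries:
  assumes "X \<in> carrier_mat M M" "Y \<in> carrier_mat M M" "a \<in> H" "b \<in> H"
  shows "L (X + Y) a b = L X a b + L Y a b" "L (c \<cdot>\<^sub>m X) a b = c * L X a b"
proof -
  have XB: "X * B \<in> carrier_mat M M" "Y * B \<in> carrier_mat M M" using assms Bc by simp_all
  then have d: "dim_row (X * B) = M" "dim_col (X * B) = M" "dim_row (Y * B) = M" "dim_col (Y * B) = M"
    by (auto simp del: index_mult_mat)
  show "L (X + Y) a b = L X a b + L Y a b"
    unfolding L_def add_mult_distrib_mat[OF assms(1,2) Bc] using d \<iota>_lt assms by (simp del: index_mult_mat)
  show "L (c \<cdot>\<^sub>m X) a b = c * L X a b"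
    unfolding L_def mult_smult_assoc_mat[OF assms(1) Bc] using d \<iota>_lt assms by (simp del: index_mult_mat)
qed

lemma \<iota>_obtain:
  assumes "i < M"
  obtains a where "a \<in> H" "rc (snd a) = s" "i = \<iota> a"
  using assms \<iota>[of s] unfolding bij_betw_def by blast

lemma L_inj:
  assumes "X \<in> carrier_mat M M" "Y \<in> carrier_mat M M" "\<And>a b. a \<in> H \<Longrightarrow> b \<in> H \<Longrightarrow> L X a b = L Y a b"
  shows "X = Y"
proof -
  have "X * B = Y * B"
  proof (rule eq_matI)
    fix i j assume "i < dim_row (Y * B)" "j < dim_col (Y * B)"
    then have ij: "i < M" "j < M" using assms Bc by auto
    obtain a where a: "a \<in> H" "rc (snd a) = False" "i = \<iota> a" by (rule \<iota>_obtain[OF ij(1)])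
    obtain b where b: "b \<in> H" "rc (snd b) = True" "j = \<iota> b" by (rule \<iota>_obtain[OF ij(2)])
    show "(X * B) $$ (i, j) = (Y * B) $$ (i, j)" using assms(3)[OF a(1) b(1)] a b by (simp add: L_def)
  qed (use assms Bc in simp_all)
  then have "X * (B * minv B) = Y * (B * minv B)"
    using assoc_mult_mat[OF assms(1) Bc minv(1)[OF B]] assoc_mult_mat[OF assms(2) Bc minv(1)[OF B]] by simp
  then show ?thesis using assms(1,2) by (simp add: minv(2)[OF B])
qed

lemma L_surj:
  assumes sym: "\<And>a b. a \<in> H \<Longrightarrow> b \<in> H \<Longrightarrow> x b a = x a b"
    and supp: "\<And>a b. a \<in> H \<Longrightarrow> b \<in> H \<Longrightarrow> \<not> R0 (snd a) (snd b) \<Longrightarrow> x a b = 0"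
  shows "\<exists>X\<in>carrier_mat M M. \<forall>a\<in>H. \<forall>b\<in>H. L X a b = x a b"
proof -
  define j where "j s = inv_into {a \<in> H. rc (snd a) = s} \<iota>" for s
  have j: "j (rc (snd a)) (\<iota> a) = a" if "a \<in> H" for a
    using that \<iota>[of "rc (snd a)"] by (simp add: j_def bij_betw_def)
  define Y where "Y = Matrix.mat M M (\<lambda>(k, l). x (j False k) (j True l))"
  have Y: "Y \<in> carrier_mat M M" by (simp add: Y_def)
  have "(Y * minv B) * B = Y * (minv B * B)" by (rule assoc_mult_mat[OF Y minv(1)[OF B] Bc])
  then have e: "(Y * minv B) * B = Y" using Y by (simp add: minv(3)[OF B])
  have Yab: "Y $$ (\<iota> a, \<iota> b) = x a b" if "a \<in> H" "b \<in> H" "\<not> rc (snd a)" "rc (snd b)" for a b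
    using that \<iota>_lt j[OF that(1)] j[OF that(2)] by (simp add: Y_def)
  have "L (Y * minv B) a b = x a b" if ab: "a \<in> H" "b \<in> H" for a b
  proof -
    have "x a b = 0" if "rc (snd a) = rc (snd b)" using supp[OF ab] R0_rc that by blast
    then show ?thesis unfolding L_def e using Yab[OF ab] Yab[OF ab(2,1)] sym[OF ab] by auto
  qed
  moreover have "Y * minv B \<in> carrier_mat M M" using Y minv(1)[OF B] by simp
  ultimately show ?thesis by blast
qed

text \<open>\<open>Ad k X * B\<close> is \<open>X * B\<close> multiplied by \<open>k\<close> on the
  left and by \<open>minv B * minv k * B\<close> on the right, the operators on row and column
  letters. The sums extend to all of \<open>H\<close> because letters of different colour do not
  mix.\<close>

lemma L_Ad:
  assumes k: "k \<in> GL_grp M"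
    and g: "\<And>a b. a \<in> H \<Longrightarrow> b \<in> H \<Longrightarrow> \<not> rc (snd a) \<Longrightarrow> \<not> rc (snd b) \<Longrightarrow> k $$ (\<iota> a, \<iota> b) = fam g a b"
    and g': "\<And>a b. a \<in> H \<Longrightarrow> b \<in> H \<Longrightarrow> rc (snd a) \<Longrightarrow> rc (snd b) \<Longrightarrow> (minv B * minv k * B) $$ (\<iota> b, \<iota> a) = fam g a b"
    and X: "X \<in> carrier_mat M M" and ab: "a \<in> H" "b \<in> H"
  shows "L (Ad k X) a b = (\<Sum>a'\<in>H. \<Sum>b'\<in>H. fam g a a' * fam g b b' * L X a' b')"
proof -
  note kc = GL_grp_carrier[OF k] and ki = minv[OF k] and Bi = minv[OF B]
  define k' where "k' = transpose_mat (minv B * minv k * B)"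
  have BB: "minv B * minv k * B \<in> carrier_mat M M" using kc ki Bi Bc by simp
  have k't: "transpose_mat k' = minv B * minv k * B" by (simp add: k'_def)
  have k'c: "k' \<in> carrier_mat M M" unfolding k'_def using BB by simp
  have XB: "X * B \<in> carrier_mat M M" and kX: "k * X \<in> carrier_mat M M" and kiB: "minv k * B \<in> carrier_mat M M"
    using kc X Bc ki by simp_all
  have "B * (minv B * minv k * B) = minv k * B"
  proof -
    have "minv B * minv k * B = minv B * (minv k * B)" by (rule assoc_mult_mat[OF Bi(1) ki(1) Bc])
    then have "B * (minv B * minv k * B) = (B * minv B) * (minv k * B)"
      using assoc_mult_mat[OF Bc Bi(1) kiB] by simp
    then show ?thesis unfolding Bi(2) using left_mult_one_mat[OF kiB] by simp
  qed
  then have "Ad k X * B = (k * X) * (B * transpose_mat k')"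
    unfolding Ad_def k't by (simp only: assoc_mult_mat[OF kX ki(1) Bc])
  also have "\<dots> = (k * X) * B * transpose_mat k'"
    using k'c by (intro assoc_mult_mat[OF kX Bc, symmetric]) simp
  also have "(k * X) * B = k * (X * B)" by (rule assoc_mult_mat[OF kc X Bc])
  finally have AB: "Ad k X * B = k * (X * B) * transpose_mat k'" .
  have row_col: "L (Ad k X) a b = (\<Sum>a'\<in>H. \<Sum>b'\<in>H. fam g a a' * fam g b b' * L X a' b')"
    if ab: "a \<in> H" "b \<in> H" "\<not> rc (snd a)" "rc (snd b)" for a b
  proof -
    let ?R = "{a \<in> H. rc (snd a) = False}" and ?C = "{a \<in> H. rc (snd a) = True}"
    have "L (Ad k X) a b = (\<Sum>x<M. \<Sum>y<M. k $$ (\<iota> a, x) * k' $$ (\<iota> b, y) * (X * B) $$ (x, y))"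
      unfolding L_def AB using that mult_transpose_entry[OF kc XB k'c \<iota>_lt[OF ab(1)] \<iota>_lt[OF ab(2)]] by simp
    also have "\<dots> = (\<Sum>x<M. \<Sum>b'\<in>?C. k $$ (\<iota> a, x) * k' $$ (\<iota> b, \<iota> b') * (X * B) $$ (x, \<iota> b'))"
      by (simp only: sum.reindex_bij_betw[OF \<iota>[of True], symmetric])
    also have "\<dots> = (\<Sum>a'\<in>?R. \<Sum>b'\<in>?C. k $$ (\<iota> a, \<iota> a') * k' $$ (\<iota> b, \<iota> b') * (X * B) $$ (\<iota> a', \<iota> b'))"
      by (rule sum.reindex_bij_betw[OF \<iota>[of False], symmetric])
    also have "\<dots> = (\<Sum>a'\<in>?R. \<Sum>b'\<in>?C. fam g a a' * fam g b b' * L X a' b')"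
    proof (intro sum.cong refl)
      fix a' b' assume a': "a' \<in> ?R" and b': "b' \<in> ?C"
      have "k' $$ (\<iota> b, \<iota> b') = (minv B * minv k * B) $$ (\<iota> b', \<iota> b)"
        unfolding k'_def using BB \<iota>_lt ab b' by (auto simp del: index_mult_mat)
      then show "k $$ (\<iota> a, \<iota> a') * k' $$ (\<iota> b, \<iota> b') * (X * B) $$ (\<iota> a', \<iota> b') = fam g a a' * fam g b b' * L X a' b'"
        using g[of a a'] g'[of b b'] ab a' b' by (simp add: L_def)
    qed
    also have "\<dots> = (\<Sum>a'\<in>?R. \<Sum>b'\<in>H. fam g a a' * fam g b b' * L X a' b')"
    proof (rule sum.cong[OF refl], rule sum.mono_neutral_left[OF finite_H])
      fix a' show "\<forall>b'\<in>H - ?C. fam g a a' * fam g b b' * L X a' b' = 0"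
        using ab by (auto simp: fam_def)
    qed blast
    also have "\<dots> = (\<Sum>a'\<in>H. \<Sum>b'\<in>H. fam g a a' * fam g b b' * L X a' b')"
    proof (rule sum.mono_neutral_left[OF finite_H])
      show "\<forall>a'\<in>H - ?R. (\<Sum>b'\<in>H. fam g a a' * fam g b b' * L X a' b') = 0"
        using ab by (auto simp: fam_def)
    qed blast
    finally show ?thesis .
  qed
  show ?thesis
  proof (cases "rc (snd a) = rc (snd b)")
    case True
    have z: "fam g a a' * fam g b b' * L X a' b' = 0" for a' b'
      using True by (auto simp: fam_def L_def)
    show ?thesis unfolding z sum.neutral_const unfolding L_def using True by simp
  next
    case False
    show ?thesis
    proof (cases "rc (snd b)")
      case True
      then show ?thesis using row_col[OF ab] False by simp
    next
      case b: False
      then have a: "rc (snd a)" using False by simp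
      have "L (Ad k X) a b = (\<Sum>b'\<in>H. \<Sum>a'\<in>H. fam g b b' * fam g a a' * L X b' a')"
        unfolding L_sym[of _ a b] by (rule row_col[OF ab(2,1) b a])
      also have "\<dots> = (\<Sum>a'\<in>H. \<Sum>b'\<in>H. fam g b b' * fam g a a' * L X b' a')" by (rule sum.swap)
      also have "\<dots> = (\<Sum>a'\<in>H. \<Sum>b'\<in>H. fam g a a' * fam g b b' * L X a' b')"
        by (intro sum.cong refl) (simp add: L_sym[of X] mult.commute)
      finally show ?thesis .
    qed
  qed
qed

lemma coords: "sym_model V H L 1 (\<lambda>a b. R0 (snd a) (snd b))"
proof
  show "finite H" by (rule finite_H)
  show "1 * 1 = (1 :: complex)" by simp
  show "R0 (snd b) (snd a)" if "R0 (snd a) (snd b)" for a b :: "(nat \<times> bool) \<times> 'c" using R0_sym[OF that] .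
  show "X + Y \<in> V" if X: "X \<in> V" and Y: "Y \<in> V" for X Y
    using X Y mult_B_entries(1)[OF V_carrier[OF X] V_carrier[OF Y]] unfolding V_iff by simp
  show "c \<cdot>\<^sub>m X \<in> V" if X: "X \<in> V" for c X
    using X mult_B_entries(2)[OF V_carrier[OF X] V_carrier[OF X]] unfolding V_iff by simp
  show "L (X + Y) a b = L X a b + L Y a b" if "X \<in> V" "Y \<in> V" "a \<in> H" "b \<in> H" for X Y a b
    using that V_carrier by (intro mult_B_entries) auto
  show "L (c \<cdot>\<^sub>m X) a b = c * L X a b" if "X \<in> V" "a \<in> H" "b \<in> H" for c X a b
    using that V_carrier by (intro mult_B_entries[of X X]) auto
  show "L X b a = 1 * L X a b" for X a b using L_sym by simp
  show "L X a b = 0" if "X \<in> V" "a \<in> H" "b \<in> H" "\<not> R0 (snd a) (snd b)" for X a b using that unfolding V_iff by blast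
  show "X = Y" if "X \<in> V" "Y \<in> V" "\<And>a b. a \<in> H \<Longrightarrow> b \<in> H \<Longrightarrow> L X a b = L Y a b" for X Y
    by (rule L_inj[OF V_carrier[OF that(1)] V_carrier[OF that(2)] that(3)])
  show "\<exists>X\<in>V. \<forall>a\<in>H. \<forall>b\<in>H. L X a b = x a b"
    if sym: "\<And>a b. a \<in> H \<Longrightarrow> b \<in> H \<Longrightarrow> x b a = 1 * x a b"
      and supp: "\<And>a b. a \<in> H \<Longrightarrow> b \<in> H \<Longrightarrow> \<not> R0 (snd a) (snd b) \<Longrightarrow> x a b = 0" for x
  proof -
    have sym': "x b a = x a b" if "a \<in> H" "b \<in> H" for a b using sym[OF that] by (simp only: mult_1_left)
    have "\<exists>X\<in>carrier_mat M M. \<forall>a\<in>H. \<forall>b\<in>H. L X a b = x a b"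
      by (rule L_surj) (rule sym' supp; assumption)+
    then obtain X where X: "X \<in> carrier_mat M M" "\<forall>a\<in>H. \<forall>b\<in>H. L X a b = x a b" by blast
    then have "X \<in> V" unfolding V_iff using supp by simp
    then show ?thesis using X(2) by blast
  qed
qed

lemma Ad_in_V:
  assumes k: "k \<in> GL_grp M"
    and g: "\<And>a b. a \<in> H \<Longrightarrow> b \<in> H \<Longrightarrow> \<not> rc (snd a) \<Longrightarrow> \<not> rc (snd b) \<Longrightarrow> k $$ (\<iota> a, \<iota> b) = fam g a b"
    and g': "\<And>a b. a \<in> H \<Longrightarrow> b \<in> H \<Longrightarrow> rc (snd a) \<Longrightarrow> rc (snd b) \<Longrightarrow> (minv B * minv k * B) $$ (\<iota> b, \<iota> a) = fam g a b"
    and X: "X \<in> V"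
  shows "Ad k X \<in> V"
proof -
  have Ac: "Ad k X \<in> carrier_mat M M"
    unfolding Ad_def using GL_grp_carrier[OF k] V_carrier[OF X] minv(1)[OF k] by simp
  have supp: "\<not> R0 (snd a) (snd b) \<Longrightarrow> L X a b = 0" if "a \<in> H" "b \<in> H" for a b
    using X that unfolding V_iff by blast
  have LA: "L (Ad k X) a b = (\<Sum>a'\<in>H. \<Sum>b'\<in>H. fam g a a' * fam g b b' * L X a' b')" if "a \<in> H" "b \<in> H" for a b
    by (rule L_Ad[OF k _ _ V_carrier[OF X] that]) (rule g g'; assumption)+
  have "L (Ad k X) a b = 0" if ab: "a \<in> H" "b \<in> H" "\<not> R0 (snd a) (snd b)" for a b
    unfolding LA[OF ab(1,2)]
  proof (rule sum.neutral, rule ballI, rule sum.neutral, rule ballI)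
    fix a' b' assume ab': "a' \<in> H" "b' \<in> H"
    show "fam g a a' * fam g b b' * L X a' b' = 0"
    proof (cases "snd a = snd a' \<and> snd b = snd b'")
      case True
      then show ?thesis using supp[OF ab'] ab(3) by simp
    qed (auto simp: fam_def)
  qed
  then show ?thesis unfolding V_iff using Ac by blast
qed

theorem gl_pair_models: "models (sym_inv d V K) (sym_rel d V) (match_space d R0 1 R1 eps1)"
proof -
  interpret sym_model d V H L 1 "\<lambda>a b. R0 (snd a) (snd b)" by (rule coords)
  have actsI: "acts k (fam g)" if k: "k \<in> K" and g: "\<forall>a\<in>H. \<forall>b\<in>H.
       (\<not> rc (snd a) \<longrightarrow> \<not> rc (snd b) \<longrightarrow> k $$ (\<iota> a, \<iota> b) = fam g a b) \<and>
       (rc (snd a) \<longrightarrow> rc (snd b) \<longrightarrow> (minv B * minv k * B) $$ (\<iota> b, \<iota> a) = fam g a b)" for k g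
  proof -
    have kG: "k \<in> GL_grp M" using k K_GL by blast
    have g1: "k $$ (\<iota> a, \<iota> b) = fam g a b" if "a \<in> H" "b \<in> H" "\<not> rc (snd a)" "\<not> rc (snd b)" for a b
      using g that by blast
    have g2: "(minv B * minv k * B) $$ (\<iota> b, \<iota> a) = fam g a b" if "a \<in> H" "b \<in> H" "rc (snd a)" "rc (snd b)" for a b
      using g that by blast
    show ?thesis unfolding acts_def
    proof (intro ballI conjI)
      fix X assume X: "X \<in> V"
      show "Ad k X \<in> V" by (rule Ad_in_V[OF kG _ _ X]) (rule g1 g2; assumption)+
      show "L (Ad k X) a b = (\<Sum>a'\<in>H. \<Sum>b'\<in>H. fam g a a' * fam g b b' * L X a' b')" if "a \<in> H" "b \<in> H" for a b
        by (rule L_Ad[OF kG _ _ V_carrier[OF X] that]) (rule g1 g2; assumption)+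
    qed
  qed
  interpret pair_model d ty N kc sg V L 1 R0 K
  proof
    show "\<exists>g. family g \<and> acts k (fam g)" if "k \<in> K" for k using K_family[OF that] actsI[OF that] by blast
    show "\<exists>k\<in>K. acts k (fam g)" if "family g" for g using family_K[OF that] actsI by blast
  qed
  show ?thesis by (rule sym_inv_models)
qed

end

section \<open>Coordinates on the classical groups\<close>

definition symm_sign :: "gtype \<Rightarrow> complex" where
  "symm_sign ty = (if ty = Symp then -1 else 1)"

text \<open>\<open>\<iota>\<close> numbers the standard indices so that \<open>F\<close> becomes the
  Gram matrix of the standard form; different layouts of a form are handled by different
  \<open>\<iota>\<close>.\<close>

definition frame :: "gtype \<Rightarrow> nat \<Rightarrow> nat \<Rightarrow> complex mat \<Rightarrow> (nat \<times> bool \<Rightarrow> nat) \<Rightarrow> bool" where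
  "frame ty n M F \<iota> \<longleftrightarrow> bij_betw \<iota> (idx ty n) {..<M} \<and> F \<in> carrier_mat M M \<and>
     (\<forall>a\<in>idx ty n. \<forall>b\<in>idx ty n. F $$ (\<iota> a, \<iota> b) = form ty a b)"

lemma symm_sign_square: "symm_sign ty * symm_sign ty = 1"
  by (simp add: symm_sign_def)

lemma form_commute: "form ty b a = symm_sign ty * form ty a b"
  by (cases ty) (auto simp: form_def form_sign_def symm_sign_def)

lemma frameD:
  assumes "frame ty n M F \<iota>"
  shows "bij_betw \<iota> (idx ty n) {..<M}" "F \<in> carrier_mat M M"
    "a \<in> idx ty n \<Longrightarrow> b \<in> idx ty n \<Longrightarrow> F $$ (\<iota> a, \<iota> b) = form ty a b"
    "a \<in> idx ty n \<Longrightarrow> \<iota> a < M"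
  using assms by (auto simp: frame_def bij_betw_def)

lemma frame_obtain:
  assumes "frame ty n M F \<iota>" "i < M"
  obtains a where "a \<in> idx ty n" "i = \<iota> a"
  using assms unfolding frame_def bij_betw_def by blast

lemma frame_symm:
  assumes fr: "frame ty n M F \<iota>" and "i < M" "j < M"
  shows "F $$ (j, i) = symm_sign ty * F $$ (i, j)"
proof -
  obtain a where a: "a \<in> idx ty n" "i = \<iota> a" by (rule frame_obtain[OF fr assms(2)])
  obtain b where b: "b \<in> idx ty n" "j = \<iota> b" by (rule frame_obtain[OF fr assms(3)])
  show ?thesis unfolding a(2) b(2) frameD(3)[OF fr a(1) b(1)] frameD(3)[OF fr b(1) a(1)] by (rule form_commute)
qed

text \<open>Every index pairs nontrivially with exactly one partner \<open>p\<close>, with value 1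
  or -1, so the rows of the Gram matrix are orthonormal for the product without conjugation.\<close>

lemma form_orthogonal:
  assumes "a \<in> idx ty n" "b \<in> idx ty n"
  shows "(\<Sum>c\<in>idx ty n. form ty a c * form ty b c) = of_bool (a = b)"
proof -
  obtain i s where a: "a = (i, s)" by (cases a)
  obtain j t where b: "b = (j, t)" by (cases b)
  define p where "p = (i, if ty = Orth then s else \<not> s)"
  have p: "p \<in> idx ty n" using assms by (auto simp: p_def a mem_idx)
  have "(\<Sum>c\<in>idx ty n. form ty a c * form ty b c) = (\<Sum>c\<in>idx ty n. if c = p then form ty a c * form ty b c else 0)"
  proof (rule sum.cong[OF refl])
    fix c assume c: "c \<in> idx ty n"
    have "form ty a c = 0" if "c \<noteq> p"
      using that c assms unfolding p_def a by (cases ty; cases c) (auto simp: form_def form_sign_def mem_idx)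
    then show "form ty a c * form ty b c = (if c = p then form ty a c * form ty b c else 0)" by simp
  qed
  also have "\<dots> = form ty a p * form ty b p" using p by simp
  also have "\<dots> = of_bool (a = b)"
    using assms unfolding p_def a b by (cases ty) (auto simp: form_def form_sign_def mem_idx)
  finally show ?thesis .
qed

lemma frame_mult_transpose:
  assumes fr: "frame ty n M F \<iota>"
  shows "F * transpose_mat F = 1\<^sub>m M"
proof (rule eq_matI)
  note Fc = frameD(2)[OF fr]
  have Ft: "transpose_mat F \<in> carrier_mat M M" using Fc by simp
  fix i j assume "i < dim_row (1\<^sub>m M)" "j < dim_col (1\<^sub>m M)"
  then have ij: "i < M" "j < M" by auto
  obtain a where a: "a \<in> idx ty n" "i = \<iota> a" by (rule frame_obtain[OF fr ij(1)])
  obtain b where b: "b \<in> idx ty n" "j = \<iota> b" by (rule frame_obtain[OF fr ij(2)])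
  have "(F * transpose_mat F) $$ (i, j) = (\<Sum>l<M. F $$ (i, l) * transpose_mat F $$ (l, j))"
    by (rule mult_entry[OF Fc Ft ij])
  also have "\<dots> = (\<Sum>l<M. F $$ (i, l) * F $$ (j, l))" using Fc ij by (intro sum.cong) auto
  also have "\<dots> = (\<Sum>c\<in>idx ty n. F $$ (i, \<iota> c) * F $$ (j, \<iota> c))"
    by (rule sum.reindex_bij_betw[OF frameD(1)[OF fr], symmetric])
  also have "\<dots> = (\<Sum>c\<in>idx ty n. form ty a c * form ty b c)"
    unfolding a(2) b(2) by (rule sum.cong) (simp_all add: frameD(3)[OF fr] a b)
  also have "\<dots> = of_bool (a = b)" by (rule form_orthogonal[OF a(1) b(1)])
  also have "a = b \<longleftrightarrow> i = j"
    using a b frameD(1)[OF fr] by (auto simp: bij_betw_def dest: inj_onD)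
  finally show "(F * transpose_mat F) $$ (i, j) = 1\<^sub>m M $$ (i, j)" using ij by simp
qed (use frameD(2)[OF fr] in simp_all)

lemma frame_GL: "frame ty n M F \<iota> \<Longrightarrow> F \<in> GL_grp M"
  by (rule GL_grpI[OF _ _ frame_mult_transpose]) (auto dest: frameD(2))

lemma frame_conj_entry:
  assumes fr: "frame ty n M F \<iota>" and k: "k \<in> carrier_mat M M" and ab: "a \<in> idx ty n" "b \<in> idx ty n"
  shows "(k * F * transpose_mat k) $$ (\<iota> a, \<iota> b) =
    (\<Sum>x\<in>idx ty n. \<Sum>y\<in>idx ty n. k $$ (\<iota> a, \<iota> x) * k $$ (\<iota> b, \<iota> y) * form ty x y)"
proof -
  have "(k * F * transpose_mat k) $$ (\<iota> a, \<iota> b) = (\<Sum>x<M. \<Sum>y<M. k $$ (\<iota> a, x) * k $$ (\<iota> b, y) * F $$ (x, y))"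
    by (rule mult_transpose_entry[OF k frameD(2)[OF fr] k frameD(4)[OF fr ab(1)] frameD(4)[OF fr ab(2)]])
  also have "\<dots> = (\<Sum>x\<in>idx ty n. \<Sum>y\<in>idx ty n. k $$ (\<iota> a, \<iota> x) * k $$ (\<iota> b, \<iota> y) * F $$ (\<iota> x, \<iota> y))"
    by (simp only: sum.reindex_bij_betw[OF frameD(1)[OF fr], symmetric])
  also have "\<dots> = (\<Sum>x\<in>idx ty n. \<Sum>y\<in>idx ty n. k $$ (\<iota> a, \<iota> x) * k $$ (\<iota> b, \<iota> y) * form ty x y)"
    by (intro sum.cong refl) (simp add: frameD(3)[OF fr])
  finally show ?thesis .
qed

text \<open>Invertibility of \<open>k\<close> is automatic:
  \<open>F * (transpose_mat k * minv F)\<close> is a right inverse.\<close>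

lemma isom_grpI:
  assumes F: "F \<in> GL_grp M" and k: "k \<in> carrier_mat M M" "k * F * transpose_mat k = F"
  shows "k \<in> isom_grp M F"
proof -
  have Fc: "F \<in> carrier_mat M M" and kt: "transpose_mat k \<in> carrier_mat M M" using F k by (simp_all add: GL_grp_carrier)
  note Fi = minv[OF F]
  have kF: "transpose_mat k * minv F \<in> carrier_mat M M" "k * F \<in> carrier_mat M M"
    using mult_carrier_mat[OF kt Fi(1)] mult_carrier_mat[OF k(1) Fc] by blast+
  have c: "F * (transpose_mat k * minv F) \<in> carrier_mat M M" by (rule mult_carrier_mat[OF Fc kF(1)])
  have "k * (F * (transpose_mat k * minv F)) = k * F * (transpose_mat k * minv F)"
    by (rule assoc_mult_mat[OF k(1) Fc kF(1), symmetric])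
  also have "\<dots> = k * F * transpose_mat k * minv F"
    by (rule assoc_mult_mat[OF kF(2) kt Fi(1), symmetric])
  also have "\<dots> = 1\<^sub>m M" unfolding k(2) by (rule Fi(2))
  finally have "k \<in> GL_grp M" by (rule GL_grpI[OF k(1) c])
  then show ?thesis using k(2) by (simp add: isom_grp_def)
qed

lemma frame_isom_base_group:
  assumes fr: "frame ty n M F \<iota>" and ty: "ty \<noteq> Lin" and k: "k \<in> isom_grp M F"
  shows "(\<lambda>a b. k $$ (\<iota> a, \<iota> b)) \<in> base_group ty n"
proof -
  have kc: "k \<in> carrier_mat M M" and iso: "k * F * transpose_mat k = F"
    using k by (auto simp: isom_grp_def GL_grp_def)
  show ?thesis unfolding base_group_def
    using frame_conj_entry[OF fr kc] frameD(3)[OF fr] ty unfolding iso by simp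
qed

lemma frame_base_group_isom:
  assumes fr: "frame ty n M F \<iota>" and g: "g \<in> base_group ty n"
  shows "\<exists>k\<in>isom_grp M F. \<forall>a\<in>idx ty n. \<forall>b\<in>idx ty n. k $$ (\<iota> a, \<iota> b) = g a b"
proof -
  define j where "j = inv_into (idx ty n) \<iota>"
  have j: "j (\<iota> a) = a" if "a \<in> idx ty n" for a
    using that frameD(1)[OF fr] by (simp add: j_def bij_betw_def)
  define k where "k = Matrix.mat M M (\<lambda>(x, y). g (j x) (j y))"
  have kc: "k \<in> carrier_mat M M" by (simp add: k_def)
  have ent: "k $$ (\<iota> a, \<iota> b) = g a b" if "a \<in> idx ty n" "b \<in> idx ty n" for a b
    using that frameD(4)[OF fr] by (simp add: k_def j)
  have "k * F * transpose_mat k = F"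
  proof (rule eq_matI)
    note Fc = frameD(2)[OF fr]
    fix x y assume "x < dim_row F" "y < dim_col F"
    then have xy: "x < M" "y < M" using Fc by auto
    obtain a where a: "a \<in> idx ty n" "x = \<iota> a" by (rule frame_obtain[OF fr xy(1)])
    obtain b where b: "b \<in> idx ty n" "y = \<iota> b" by (rule frame_obtain[OF fr xy(2)])
    have "(k * F * transpose_mat k) $$ (x, y) = (\<Sum>x\<in>idx ty n. \<Sum>y\<in>idx ty n. g a x * g b y * form ty x y)"
      unfolding a(2) b(2) frame_conj_entry[OF fr kc a(1) b(1)] by (intro sum.cong refl) (simp add: ent a b)
    also have "\<dots> = form ty a b" using g a(1) b(1) unfolding base_group_def by blast
    finally show "(k * F * transpose_mat k) $$ (x, y) = F $$ (x, y)"
      unfolding a(2) b(2) frameD(3)[OF fr a(1) b(1)] .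
  qed (use frameD(2)[OF fr] kc in auto)
  then have "k \<in> isom_grp M F" by (rule isom_grpI[OF frame_GL[OF fr] kc])
  then show ?thesis using ent by blast
qed

text \<open>As \<open>F\<close> is symmetric up to \<open>s\<close>, multiplying \<open>F\<close> by
  the transpose of \<open>X\<close> gives \<open>s\<close> times the transpose of
  \<open>X * F\<close>. So the condition on \<open>X\<close> is that \<open>X * F\<close> has
  symmetry \<open>- s\<close>, the origin of the sign \<open>- symm_sign ty\<close> below.\<close>

lemma isom_alg_iff:
  assumes F: "F \<in> carrier_mat M M" and s: "s * s = 1" and symm: "\<And>i j. i < M \<Longrightarrow> j < M \<Longrightarrow> F $$ (j, i) = s * F $$ (i, j)"
  shows "X \<in> isom_alg M F \<longleftrightarrow> X \<in> carrier_mat M M \<and> (\<forall>i<M. \<forall>j<M. (X * F) $$ (j, i) = - s * (X * F) $$ (i, j))"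
proof -
  have "(X * F) $$ (i, j) + (F * transpose_mat X) $$ (i, j) = 0 \<longleftrightarrow> (X * F) $$ (j, i) = - s * (X * F) $$ (i, j)"
    if X: "X \<in> carrier_mat M M" and ij: "i < M" "j < M" for i j
  proof -
    have Xt: "transpose_mat X \<in> carrier_mat M M" using X by simp
    have "(F * transpose_mat X) $$ (i, j) = (\<Sum>l<M. F $$ (i, l) * transpose_mat X $$ (l, j))"
      by (rule mult_entry[OF F Xt ij])
    also have "\<dots> = (\<Sum>l<M. s * (X $$ (j, l) * F $$ (l, i)))"
    proof (rule sum.cong[OF refl])
      fix l assume "l \<in> {..<M}"
      then have l: "l < M" by simp
      have "transpose_mat X $$ (l, j) = X $$ (j, l)" using X l ij by simp
      then show "F $$ (i, l) * transpose_mat X $$ (l, j) = s * (X $$ (j, l) * F $$ (l, i))"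
        unfolding symm[OF l ij(1)] by simp
    qed
    also have "\<dots> = s * (X * F) $$ (j, i)"
      unfolding mult_entry[OF X F ij(2,1)] sum_distrib_left ..
    finally have e: "(F * transpose_mat X) $$ (i, j) = s * (X * F) $$ (j, i)" .
    have "p + s * q = 0 \<longleftrightarrow> q = - s * p" for p q
    proof
      assume "p + s * q = 0"
      then have "p = - (s * q)" by (simp only: add_eq_0_iff2)
      then have "- s * p = (s * s) * q" by simp
      then show "q = - s * p" unfolding s by simp
    next
      assume "q = - s * p"
      then have "p + s * q = p - (s * s) * p" by simp
      then show "p + s * q = 0" unfolding s by simp
    qed
    then show ?thesis unfolding e .
  qed
  then show ?thesis unfolding isom_alg_def by blast
qed

section \<open>The standard forms in coordinates\<close>

lemma frame_one: "frame Orth n n (1\<^sub>m n) fst"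
  unfolding frame_def
proof (intro conjI ballI)
  show "bij_betw fst (idx Orth n) {..<n}"
    by (rule bij_betw_byWitness[where f' = "\<lambda>i. (i, False)"]) (auto simp: idx_def)
  fix a b assume "a \<in> idx Orth n" "b \<in> idx Orth n"
  then show "1\<^sub>m n $$ (fst a, fst b) = form Orth a b"
    by (auto simp: idx_def form_def form_sign_def)
qed simp

definition half_index :: "nat \<Rightarrow> nat \<times> bool \<Rightarrow> nat" where
  "half_index m a = fst a + (if snd a then m else 0)"

lemma half_index_bij:
  assumes "ty \<noteq> Orth"
  shows "bij_betw (half_index m) (idx ty m) {..<2 * m}"
  by (rule bij_betw_byWitness[where f' = "\<lambda>i. if i < m then (i, False) else (i - m, True)"])
    (use assms in \<open>auto simp: idx_def half_index_def\<close>)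

lemma frame_J: "frame Symp m (2 * m) (J_mat m) (half_index m)"
  unfolding frame_def
proof (intro conjI ballI)
  show "bij_betw (half_index m) (idx Symp m) {..<2 * m}" by (rule half_index_bij) simp
  show "J_mat m \<in> carrier_mat (2 * m) (2 * m)" by (simp add: J_mat_def mult_2)
  fix a b assume "a \<in> idx Symp m" "b \<in> idx Symp m"
  then show "J_mat m $$ (half_index m a, half_index m b) = form Symp a b"
    by (cases a; cases b) (auto simp: mem_idx half_index_def J_mat_def form_def form_sign_def)
qed

lemma frame_D: "frame Lin m (2 * m) (D_mat m) (half_index m)"
  unfolding frame_def
proof (intro conjI ballI)
  show "bij_betw (half_index m) (idx Lin m) {..<2 * m}" by (rule half_index_bij) simp
  show "D_mat m \<in> carrier_mat (2 * m) (2 * m)" by (simp add: D_mat_def mult_2)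
  fix a b assume "a \<in> idx Lin m" "b \<in> idx Lin m"
  then show "D_mat m $$ (half_index m a, half_index m b) = form Lin a b"
    by (cases a; cases b) (auto simp: mem_idx half_index_def D_mat_def form_def form_sign_def)
qed

definition pair_index :: "nat \<times> bool \<Rightarrow> nat" where
  "pair_index a = 2 * fst a + of_bool (snd a)"

lemma J_mat_1: "J_mat 1 \<in> carrier_mat 2 2"
  using frameD(2)[OF frame_J[of 1]] by simp

lemma C_mat_Suc: "C_mat (Suc r) = diag_block_mat [J_mat 1, C_mat r]"
  unfolding diag_block_mat_pair C_mat_def by (simp add: Let_def)

lemma C_mat_carrier: "C_mat r \<in> carrier_mat (2 * r) (2 * r)"
proof (induction r)
  case 0
  then show ?case by (simp add: C_mat_def)
next
  case (Suc r)
  show ?case unfolding C_mat_Suc using diag_pair_carrier[OF J_mat_1 Suc] by (simp add: algebra_simps del: diag_block_mat.simps)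
qed

text \<open>Induction on the number of blocks: the first \<open>J_mat 1\<close> carries the indices
  with number 0, and the rest is shifted by one number, that is by two matrix indices.\<close>

lemma C_mat_entry: "a \<in> idx Symp r \<Longrightarrow> b \<in> idx Symp r \<Longrightarrow> C_mat r $$ (pair_index a, pair_index b) = form Symp a b"
proof (induction r arbitrary: a b)
  case 0
  then show ?case by (simp add: idx_def)
next
  case (Suc r)
  obtain i s where a: "a = (i, s)" by (cases a)
  obtain j t where b: "b = (j, t)" by (cases b)
  have lt: "pair_index a < 2 + 2 * r" "pair_index b < 2 + 2 * r"
    using Suc.prems by (auto simp: a b mem_idx pair_index_def)
  have J: "J_mat 1 $$ (of_bool u, of_bool v) = form Symp (0, u) (0, v)" for u v
    using frameD(3)[OF frame_J[of 1], of "(0, u)" "(0, v)"] by (cases u; cases v) (simp_all add: half_index_def mem_idx)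
  have e: "C_mat (Suc r) $$ (pair_index a, pair_index b) =
    (if pair_index a < 2 then if pair_index b < 2 then J_mat 1 $$ (pair_index a, pair_index b) else 0
     else if pair_index b < 2 then 0 else C_mat r $$ (pair_index a - 2, pair_index b - 2))"
    unfolding C_mat_Suc by (rule diag_pair_entry[OF J_mat_1 C_mat_carrier lt])
  have small: "pair_index (k, u) < 2 \<longleftrightarrow> k = 0" for k u by (auto simp: pair_index_def)
  show ?case
  proof (cases "i = 0 \<or> j = 0")
    case True
    then show ?thesis
      unfolding e unfolding a b small
      using J[of s t] by (auto simp: pair_index_def form_def)
  next
    case False
    then have "pair_index a - 2 = pair_index (i - 1, s)" "pair_index b - 2 = pair_index (j - 1, t)"
      unfolding a b pair_index_def by auto
    moreover have "C_mat r $$ (pair_index (i - 1, s), pair_index (j - 1, t)) = form Symp (i - 1, s) (j - 1, t)"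
      using Suc.prems False by (intro Suc.IH) (auto simp: a b mem_idx)
    ultimately show ?thesis
      using False unfolding e
      unfolding a b small by (auto simp: form_def)
  qed
qed

lemma frame_C: "frame Symp r (2 * r) (C_mat r) pair_index"
  unfolding frame_def
proof (intro conjI ballI C_mat_carrier C_mat_entry)
  show "bij_betw pair_index (idx Symp r) {..<2 * r}"
    by (rule bij_betw_byWitness[where f' = "\<lambda>i. (i div 2, odd i)"])
      (auto simp: idx_def pair_index_def odd_iff_mod_2_eq_one)
qed

lemma C_mat_add: "C_mat (p + q) = diag_block_mat [C_mat p, C_mat q]"
  unfolding diag_block_mat_pair C_mat_def replicate_add diag_block_mat_append Let_def ..

text \<open>The action of \<open>k\<close> on the sum of the defining representation and its dual;
  the side \<open>True\<close> carries the inverse transpose.\<close>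

definition gl_entries :: "complex mat \<Rightarrow> nat \<times> bool \<Rightarrow> nat \<times> bool \<Rightarrow> complex" where
  "gl_entries k a b = (if snd a = snd b then if snd a then minv k $$ (fst b, fst a) else k $$ (fst a, fst b) else 0)"

lemma sum_idx_Lin: "(\<Sum>x\<in>idx Lin n. F x) = (\<Sum>l<n. F (l, False)) + (\<Sum>l<n. F (l, True))"
proof -
  have "(\<Sum>x\<in>idx Lin n. F x) = (\<Sum>l<n. \<Sum>s\<in>UNIV. F (l, s))"
    unfolding idx_def by (simp add: sum.cartesian_product)
  then show ?thesis by (simp add: sum_UNIV_bool sum.distrib)
qed

lemma Lin_form_sum:
  "(\<Sum>x\<in>idx Lin n. \<Sum>y\<in>idx Lin n. u x * v y * form Lin x y) =
    (\<Sum>l<n. u (l, False) * v (l, True)) + (\<Sum>l<n. u (l, True) * v (l, False))"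
proof -
  have "(\<Sum>y\<in>idx Lin n. u (l, s) * v y * form Lin (l, s) y) = u (l, s) * v (l, \<not> s)" if "l < n" for l s
  proof -
    have "(\<Sum>y\<in>idx Lin n. u (l, s) * v y * form Lin (l, s) y) =
      (\<Sum>y\<in>idx Lin n. if y = (l, \<not> s) then u (l, s) * v y else 0)"
      by (rule sum.cong) (auto simp: form_def form_sign_def)
    then show ?thesis using that by (simp add: mem_idx)
  qed
  then show ?thesis unfolding sum_idx_Lin[of "\<lambda>x. \<Sum>y\<in>idx Lin n. u x * v y * form Lin x y"] by simp
qed

lemma gl_entries_base_group:
  assumes k: "k \<in> GL_grp n"
  shows "gl_entries k \<in> base_group Lin n"
  unfolding base_group_def
proof (intro CollectI conjI ballI impI)
  note kc = GL_grp_carrier[OF k] and ki = minv[OF k]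
  fix a b assume ab: "a \<in> idx Lin n" "b \<in> idx Lin n"
  obtain i s where a: "a = (i, s)" by (cases a)
  obtain j t where b: "b = (j, t)" by (cases b)
  have ij: "i < n" "j < n" using ab by (auto simp: a b mem_idx)
  have inv: "(\<Sum>l<n. k $$ (i, l) * minv k $$ (l, j)) = of_bool (i = j)" if "i < n" "j < n" for i j
  proof -
    have "(\<Sum>l<n. k $$ (i, l) * minv k $$ (l, j)) = (k * minv k) $$ (i, j)"
      by (rule mult_entry[OF kc ki(1) that, symmetric])
    then show ?thesis unfolding ki(2) using that by simp
  qed
  have inv': "(\<Sum>l<n. minv k $$ (l, i) * k $$ (j, l)) = of_bool (i = j)"
  proof -
    have "(\<Sum>l<n. minv k $$ (l, i) * k $$ (j, l)) = (\<Sum>l<n. k $$ (j, l) * minv k $$ (l, i))"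
      by (rule sum.cong) (simp_all only: mult.commute)
    also have "\<dots> = of_bool (j = i)" by (rule inv[OF ij(2,1)])
    finally show ?thesis by (cases "i = j") simp_all
  qed
  show "(\<Sum>x\<in>idx Lin n. \<Sum>y\<in>idx Lin n. gl_entries k a x * gl_entries k b y * form Lin x y) = form Lin a b"
    unfolding Lin_form_sum a b gl_entries_def
    by (cases s; cases t) (simp_all add: form_def form_sign_def inv[OF ij] inv')
qed (simp add: gl_entries_def)

text \<open>Invariance of the duality pairing says that one diagonal block of \<open>g\<close> and
  the transpose of the other are inverse to each other.\<close>

lemma base_group_gl_entries:
  assumes g: "g \<in> base_group Lin n"
  shows "\<exists>k\<in>GL_grp n. \<forall>a\<in>idx Lin n. \<forall>b\<in>idx Lin n. gl_entries k a b = g a b"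
proof -
  define k where "k = Matrix.mat n n (\<lambda>(i, j). g (i, False) (j, False))"
  define h where "h = Matrix.mat n n (\<lambda>(j, i). g (i, True) (j, True))"
  have kc: "k \<in> carrier_mat n n" "h \<in> carrier_mat n n" by (simp_all add: k_def h_def)
  have off: "g (i, s) (j, t) = 0" if "i < n" "j < n" "s \<noteq> t" for i j s t
    using g that unfolding base_group_def by (auto simp: mem_idx)
  have "k * h = 1\<^sub>m n"
  proof (rule eq_matI)
    fix i j assume "i < dim_row (1\<^sub>m n)" "j < dim_col (1\<^sub>m n)"
    then have ij: "i < n" "j < n" by auto
    have "(\<Sum>x\<in>idx Lin n. \<Sum>y\<in>idx Lin n. g (i, False) x * g (j, True) y * form Lin x y) = form Lin (i, False) (j, True)"
      using g ij unfolding base_group_def by (simp add: mem_idx)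
    then have "(\<Sum>l<n. g (i, False) (l, False) * g (j, True) (l, True)) = of_bool (i = j)"
      unfolding Lin_form_sum using off ij by (simp add: form_def form_sign_def)
    then show "(k * h) $$ (i, j) = 1\<^sub>m n $$ (i, j)"
      unfolding mult_entry[OF kc ij] using ij by (simp add: k_def h_def)
  qed (simp_all add: k_def h_def)
  then have "k \<in> GL_grp n" "minv k = h" using GL_grpI[OF kc] minv_eq[OF kc] by blast+
  moreover have "gl_entries k a b = g a b" if ab: "a \<in> idx Lin n" "b \<in> idx Lin n" for a b
    using ab off unfolding gl_entries_def \<open>minv k = h\<close>
    by (cases a; cases b) (auto simp: mem_idx k_def h_def)
  ultimately show ?thesis by blast
qed

section \<open>The symmetric pairs\<close>

lemma ball_bij_betw2:
  assumes "bij_betw f A {..<m}"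
  shows "(\<forall>i<m. \<forall>j<m. P i j) \<longleftrightarrow> (\<forall>a\<in>A. \<forall>b\<in>A. P (f a) (f b))"
proof -
  have "(\<forall>i<m. \<forall>j<m. P i j) \<longleftrightarrow> (\<forall>i\<in>f ` A. \<forall>j\<in>f ` A. P i j)"
    unfolding bij_betw_imp_surj_on[OF assms] Ball_def lessThan_iff ..
  then show ?thesis by simp
qed

definition block_index :: "nat \<Rightarrow> (bool \<Rightarrow> 'a \<Rightarrow> nat) \<Rightarrow> 'a \<times> bool \<Rightarrow> nat" where
  "block_index m \<iota> a = \<iota> (snd a) (fst a) + (if snd a then m else 0)"

lemma bij_betw_block_index:
  assumes "\<And>\<gamma>. bij_betw (\<iota> \<gamma>) (A \<gamma>) {..<M \<gamma>}"
  shows "bij_betw (block_index (M False) \<iota>) {a. fst a \<in> A (snd a)} {..<M False + M True}"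
proof -
  define j where "j \<gamma> = inv_into (A \<gamma>) (\<iota> \<gamma>)" for \<gamma>
  have j: "j \<gamma> (\<iota> \<gamma> a) = a" "\<iota> \<gamma> a < M \<gamma>" if "a \<in> A \<gamma>" for a \<gamma>
    using that assms[of \<gamma>] by (auto simp: j_def bij_betw_def)
  have i: "\<iota> \<gamma> (j \<gamma> x) = x" "j \<gamma> x \<in> A \<gamma>" if "x < M \<gamma>" for x \<gamma>
  proof -
    have "x \<in> \<iota> \<gamma> ` A \<gamma>" using that assms[of \<gamma>] by (simp add: bij_betw_def)
    then show "\<iota> \<gamma> (j \<gamma> x) = x" "j \<gamma> x \<in> A \<gamma>" by (simp_all add: j_def f_inv_into_f inv_into_into)
  qed
  show ?thesis
  proof (rule bij_betw_byWitness[where f' = "\<lambda>x. if x < M False then (j False x, False) else (j True (x - M False), True)"])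
    show "\<forall>a\<in>{a. fst a \<in> A (snd a)}. (if block_index (M False) \<iota> a < M False then (j False (block_index (M False) \<iota> a), False)
        else (j True (block_index (M False) \<iota> a - M False), True)) = a"
    proof
      fix a assume "a \<in> {a. fst a \<in> A (snd a)}"
      then show "(if block_index (M False) \<iota> a < M False then (j False (block_index (M False) \<iota> a), False)
        else (j True (block_index (M False) \<iota> a - M False), True)) = a"
        using j[of "fst a" "snd a"] by (cases "snd a") (auto simp: block_index_def prod_eq_iff)
    qed
    show "\<forall>x\<in>{..<M False + M True}. block_index (M False) \<iota> (if x < M False then (j False x, False) else (j True (x - M False), True)) = x"
      using i by (auto simp: block_index_def)
    show "block_index (M False) \<iota> ` {a. fst a \<in> A (snd a)} \<subseteq> {..<M False + M True}"
    proof
      fix x assume "x \<in> block_index (M False) \<iota> ` {a. fst a \<in> A (snd a)}"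
      then obtain a where "fst a \<in> A (snd a)" "x = block_index (M False) \<iota> a" by blast
      then show "x \<in> {..<M False + M True}" using j(2)[of "fst a" "snd a"] by (cases "snd a") (auto simp: block_index_def)
    qed
    show "(\<lambda>x. if x < M False then (j False x, False) else (j True (x - M False), True)) ` {..<M False + M True} \<subseteq> {a. fst a \<in> A (snd a)}"
      using i by auto
  qed
qed

lemma block_entry:
  assumes k: "\<And>\<gamma>. k \<gamma> \<in> carrier_mat (M \<gamma>) (M \<gamma>)" and "x < M \<gamma>" "y < M \<gamma>'"
  shows "diag_block_mat [k False, k True] $$ (x + (if \<gamma> then M False else 0), y + (if \<gamma>' then M False else 0)) =
    (if \<gamma> = \<gamma>' then k \<gamma> $$ (x, y) else 0)"
proof -
  have "x + (if \<gamma> then M False else 0) < M False + M True" "y + (if \<gamma>' then M False else 0) < M False + M True"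
    using assms(2,3) by (cases \<gamma>; cases \<gamma>'; simp)+
  note e = diag_pair_entry[OF k k this]
  show ?thesis unfolding e using assms(2,3) by (cases \<gamma>; cases \<gamma>'; simp)
qed

lemma diag_pair_GL:
  assumes "k \<in> GL_grp n" "l \<in> GL_grp m"
  shows "diag_block_mat [k, l] \<in> GL_grp (n + m)" "minv (diag_block_mat [k, l]) = diag_block_mat [minv k, minv l]"
proof -
  note k = GL_grp_carrier[OF assms(1)] minv[OF assms(1)] and l = GL_grp_carrier[OF assms(2)] minv[OF assms(2)]
  have "diag_block_mat [k, l] * diag_block_mat [minv k, minv l] = 1\<^sub>m (n + m)"
    unfolding diag_pair_mult[OF k(1) l(1) k(2) l(2)] k(3) l(3) by (rule diag_pair_one)
  note * = diag_pair_carrier[OF k(1) l(1)] diag_pair_carrier[OF k(2) l(2)] this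
  show "diag_block_mat [k, l] \<in> GL_grp (n + m)" by (rule GL_grpI[OF *])
  show "minv (diag_block_mat [k, l]) = diag_block_mat [minv k, minv l]" by (rule minv_eq[OF *])
qed

lemma isom_grpD:
  assumes "k \<in> isom_grp n F"
  shows "k \<in> GL_grp n" "k \<in> carrier_mat n n" "k * F * transpose_mat k = F"
  using assms by (auto simp: isom_grp_def GL_grp_def)

lemma diag_pair_isom:
  assumes k: "k \<in> isom_grp n F" and l: "l \<in> isom_grp m F'" and F: "F \<in> carrier_mat n n" "F' \<in> carrier_mat m m"
  shows "diag_block_mat [k, l] \<in> isom_grp (n + m) (diag_block_mat [F, F'])"
proof -
  note kc = isom_grpD(2)[OF k] and lc = isom_grpD(2)[OF l]
  have t: "transpose_mat k \<in> carrier_mat n n" "transpose_mat l \<in> carrier_mat m m" using kc lc by simp_all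
  have c: "k * F \<in> carrier_mat n n" "l * F' \<in> carrier_mat m m" using kc lc F by simp_all
  have "diag_block_mat [k, l] * diag_block_mat [F, F'] * transpose_mat (diag_block_mat [k, l]) = diag_block_mat [F, F']"
    unfolding diag_pair_transpose[OF kc lc] diag_pair_mult[OF kc lc F] diag_pair_mult[OF c t] isom_grpD(3)[OF k] isom_grpD(3)[OF l] ..
  then show ?thesis
    unfolding isom_grp_def using diag_pair_GL(1)[OF isom_grpD(1)[OF k] isom_grpD(1)[OF l]] by simp
qed

context
  fixes ty :: gtype and n M :: "bool \<Rightarrow> nat" and F :: "bool \<Rightarrow> complex mat" and \<iota> :: "bool \<Rightarrow> nat \<times> bool \<Rightarrow> nat"
  assumes fr: "\<And>\<gamma>. frame ty (n \<gamma>) (M \<gamma>) (F \<gamma>) (\<iota> \<gamma>)" and ty: "ty \<noteq> Lin"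
begin

abbreviation "BB \<equiv> diag_block_mat [F False, F True]"
abbreviation "MM \<equiv> M False + M True"
abbreviation "\<iota>\<iota> \<equiv> block_index (M False) \<iota>"

lemma blocks_bij: "bij_betw \<iota>\<iota> {a. fst a \<in> idx ty (n (snd a))} {..<MM}"
  by (rule bij_betw_block_index) (rule frameD(1)[OF fr])

lemma blocks_GL: "BB \<in> GL_grp MM"
  by (rule diag_pair_GL(1)[OF frame_GL[OF fr] frame_GL[OF fr]])

lemma blocks_entry:
  assumes "\<And>\<gamma>. k \<gamma> \<in> carrier_mat (M \<gamma>) (M \<gamma>)" "fst a \<in> idx ty (n (snd a))" "fst b \<in> idx ty (n (snd b))"
  shows "diag_block_mat [k False, k True] $$ (\<iota>\<iota> a, \<iota>\<iota> b) =
    (if snd a = snd b then k (snd a) $$ (\<iota> (snd a) (fst a), \<iota> (snd a) (fst b)) else 0)"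
  unfolding block_index_def
  using block_entry[of k M, OF assms(1) frameD(4)[OF fr assms(2)] frameD(4)[OF fr assms(3)]] by auto

lemma blocks_symm:
  assumes "i < MM" "j < MM"
  shows "BB $$ (j, i) = symm_sign ty * BB $$ (i, j)"
proof -
  have f: "i < M False \<Longrightarrow> j < M False \<Longrightarrow> F False $$ (j, i) = symm_sign ty * F False $$ (i, j)"
    by (rule frame_symm[OF fr])
  have t: "\<not> i < M False \<Longrightarrow> \<not> j < M False \<Longrightarrow>
      F True $$ (j - M False, i - M False) = symm_sign ty * F True $$ (i - M False, j - M False)"
    by (rule frame_symm[OF fr]) (use assms in linarith)+
  show ?thesis
    unfolding diag_pair_entry[OF frameD(2)[OF fr] frameD(2)[OF fr] assms]
      diag_pair_entry[OF frameD(2)[OF fr] frameD(2)[OF fr] assms(2,1)]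
    by (cases "i < M False"; cases "j < M False"; simp only: f t if_True if_False mult_zero_right not_False_eq_True)
qed

lemma blocks_isom_alg:
  "X \<in> isom_alg MM BB \<longleftrightarrow> X \<in> carrier_mat MM MM \<and>
     (\<forall>a\<in>{a. fst a \<in> idx ty (n (snd a))}. \<forall>b\<in>{a. fst a \<in> idx ty (n (snd a))}.
       (X * BB) $$ (\<iota>\<iota> b, \<iota>\<iota> a) = - symm_sign ty * (X * BB) $$ (\<iota>\<iota> a, \<iota>\<iota> b))"
proof -
  note iff = isom_alg_iff[OF GL_grp_carrier[OF blocks_GL] symm_sign_square[of ty] blocks_symm]
  have e: "(\<forall>i<MM. \<forall>j<MM. (X * BB) $$ (j, i) = - symm_sign ty * (X * BB) $$ (i, j)) \<longleftrightarrow>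
     (\<forall>a\<in>{a. fst a \<in> idx ty (n (snd a))}. \<forall>b\<in>{a. fst a \<in> idx ty (n (snd a))}.
       (X * BB) $$ (\<iota>\<iota> b, \<iota>\<iota> a) = - symm_sign ty * (X * BB) $$ (\<iota>\<iota> a, \<iota>\<iota> b))"
    by (rule ball_bij_betw2[OF blocks_bij])
  show ?thesis unfolding e[symmetric] by (rule iff)
qed

lemma blocks_isom_grp:
  "k \<in> isom_grp (M False) (F False) \<Longrightarrow> l \<in> isom_grp (M True) (F True) \<Longrightarrow> diag_block_mat [k, l] \<in> isom_grp MM BB"
  by (rule diag_pair_isom) (auto intro: frameD(2)[OF fr])

text \<open>For O(p,q) and Sp(p,q) the colour of an index is the factor of \<open>K\<close> that
  acts on it. The Lie algebra of the full isometry group has entries for all pairs of colours, while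
  contractions stay inside one factor.\<close>

lemma models_isom_prod:
  assumes d: "\<And>\<gamma>. d \<le> n \<gamma>"
  defines "V \<equiv> isom_alg MM BB"
    and "K \<equiv> block_prod (isom_grp (M False) (F False)) (isom_grp (M True) (F True))"
  shows "models (sym_inv d V K) (sym_rel d V)
    (match_space d (\<lambda>_ _ :: bool. True) (- symm_sign ty) (\<lambda>\<gamma> \<gamma>'. \<gamma> = \<gamma>') (symm_sign ty))"
proof -
  interpret words d ty n "\<lambda>\<gamma> :: bool. \<gamma>" "\<lambda>_. False" by standard (rule d)
  have H: "H = {a. fst a \<in> idx ty (n (snd a))}" unfolding H_def using ty by simp
  interpret form_pair d ty n "\<lambda>\<gamma> :: bool. \<gamma>" "\<lambda>_. False" MM BB \<iota>\<iota> "- symm_sign ty" "\<lambda>_ _. True" V K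
  proof
    show "- symm_sign ty * - symm_sign ty = 1" using symm_sign_square[of ty] by simp
    show "bij_betw \<iota>\<iota> H {..<MM}" unfolding H by (rule blocks_bij)
    show "BB \<in> GL_grp MM" by (rule blocks_GL)
    show "V = {X \<in> carrier_mat MM MM. (\<forall>a\<in>H. \<forall>b\<in>H. (X * BB) $$ (\<iota>\<iota> b, \<iota>\<iota> a) = - symm_sign ty * (X * BB) $$ (\<iota>\<iota> a, \<iota>\<iota> b)) \<and>
        (\<forall>a\<in>H. \<forall>b\<in>H. \<not> True \<longrightarrow> (X * BB) $$ (\<iota>\<iota> a, \<iota>\<iota> b) = 0)}"
      unfolding V_def H using blocks_isom_alg by blast
    show "K \<subseteq> isom_grp MM BB" unfolding K_def block_prod_def using blocks_isom_grp by blast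
    show "\<exists>g. family g \<and> (\<forall>a\<in>H. \<forall>b\<in>H. k $$ (\<iota>\<iota> a, \<iota>\<iota> b) = fam g a b)" if kK: "k \<in> K" for k
    proof -
      obtain k0 k1 where k: "k = diag_block_mat [k0, k1]" "k0 \<in> isom_grp (M False) (F False)" "k1 \<in> isom_grp (M True) (F True)"
        using kK unfolding K_def block_prod_def by blast
      define kk where "kk \<gamma> = (if \<gamma> then k1 else k0)" for \<gamma>
      have kk: "kk \<gamma> \<in> isom_grp (M \<gamma>) (F \<gamma>)" for \<gamma> using k by (cases \<gamma>) (simp_all add: kk_def)
      have k': "k = diag_block_mat [kk False, kk True]" using k(1) by (simp add: kk_def del: diag_block_mat.simps)
      define g where "g \<gamma> = (\<lambda>a b. kk \<gamma> $$ (\<iota> \<gamma> a, \<iota> \<gamma> b))" for \<gamma>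
      have "family g" unfolding family_def g_def using frame_isom_base_group[OF fr ty kk] by blast
      moreover have "k $$ (\<iota>\<iota> a, \<iota>\<iota> b) = fam g a b" if "a \<in> H" "b \<in> H" for a b
        using blocks_entry[of kk a b] isom_grpD(2)[OF kk] that unfolding H k' fam_def g_def by blast
      ultimately show ?thesis by blast
    qed
    show "\<exists>k\<in>K. \<forall>a\<in>H. \<forall>b\<in>H. k $$ (\<iota>\<iota> a, \<iota>\<iota> b) = fam g a b" if g: "family g" for g
    proof -
      have "\<exists>k\<in>isom_grp (M \<gamma>) (F \<gamma>). \<forall>a\<in>idx ty (n \<gamma>). \<forall>b\<in>idx ty (n \<gamma>). k $$ (\<iota> \<gamma> a, \<iota> \<gamma> b) = g \<gamma> a b" for \<gamma>
        using g unfolding family_def by (intro frame_base_group_isom[OF fr]) blast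
      then have "\<forall>\<gamma>. \<exists>k. k \<in> isom_grp (M \<gamma>) (F \<gamma>) \<and> (\<forall>a\<in>idx ty (n \<gamma>). \<forall>b\<in>idx ty (n \<gamma>). k $$ (\<iota> \<gamma> a, \<iota> \<gamma> b) = g \<gamma> a b)" by blast
      from choice[OF this] obtain k where k: "\<And>\<gamma>. k \<gamma> \<in> isom_grp (M \<gamma>) (F \<gamma>)"
        "\<And>\<gamma> a b. a \<in> idx ty (n \<gamma>) \<Longrightarrow> b \<in> idx ty (n \<gamma>) \<Longrightarrow> k \<gamma> $$ (\<iota> \<gamma> a, \<iota> \<gamma> b) = g \<gamma> a b" by blast
      have "diag_block_mat [k False, k True] \<in> K" unfolding K_def block_prod_def using k(1) by blast
      moreover have "diag_block_mat [k False, k True] $$ (\<iota>\<iota> a, \<iota>\<iota> b) = fam g a b" if "a \<in> H" "b \<in> H" for a b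
        using blocks_entry[of k a b] isom_grpD(2)[OF k(1)] that k(2)[of "fst a" "snd a" "fst b"] unfolding H fam_def by auto
      ultimately show ?thesis by blast
    qed
  qed
  have "R1 = (\<lambda>\<gamma> \<gamma>'. \<gamma> = \<gamma>')" "eps1 = symm_sign ty"
    using ty by (auto simp: R1_def eps1_def symm_sign_def fun_eq_iff)
  then show ?thesis using form_pair_models by simp
qed

end

text \<open>For the complex groups the colour is the factor of G. The Lie algebra is block diagonal,
  so the two indices of a tensor have equal colours, but one group acts on both colours, so any two
  may be contracted.\<close>

lemma models_isom_diag:
  assumes fr: "frame ty n M F \<iota>" and ty: "ty \<noteq> Lin" and d: "d \<le> n"
  defines "V \<equiv> {diag_block_mat [X, Y] | X Y. X \<in> isom_alg M F \<and> Y \<in> isom_alg M F}"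
    and "K \<equiv> block_diagonal (isom_grp M F)"
  shows "models (sym_inv d V K) (sym_rel d V)
    (match_space d (\<lambda>\<gamma> \<gamma>' :: bool. \<gamma> = \<gamma>') (- symm_sign ty) (\<lambda>_ _. True) (symm_sign ty))"
proof -
  let ?B = "diag_block_mat [F, F]" and ?\<iota> = "block_index M (\<lambda>_ :: bool. \<iota>)"
  note bij = blocks_bij[of ty "\<lambda>_. n" "\<lambda>_. M" "\<lambda>_. F" "\<lambda>_. \<iota>", OF fr ty]
    and GL = blocks_GL[of ty "\<lambda>_. n" "\<lambda>_. M" "\<lambda>_. F" "\<lambda>_. \<iota>", OF fr ty]
    and entry = blocks_entry[of ty "\<lambda>_. n" "\<lambda>_. M" "\<lambda>_. F" "\<lambda>_. \<iota>", OF fr ty]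
    and grp = blocks_isom_grp[of ty "\<lambda>_. n" "\<lambda>_. M" "\<lambda>_. F" "\<lambda>_. \<iota>", OF fr ty]
  note Fc = frameD(2)[OF fr] and FG = frame_GL[OF fr]
  note Fi = minv[OF FG]
  interpret words d ty "\<lambda>_ :: unit. n" "\<lambda>_ :: bool. ()" "\<lambda>_. False" by standard (rule d)
  have H: "H = {a. fst a \<in> idx ty n}" unfolding H_def using ty by simp
  note iff = isom_alg_iff[OF Fc symm_sign_square frame_symm[OF fr]]
  have alg: "X \<in> isom_alg M F \<longleftrightarrow> X \<in> carrier_mat M M \<and> (\<forall>a\<in>idx ty n. \<forall>b\<in>idx ty n.
      (X * F) $$ (\<iota> b, \<iota> a) = - symm_sign ty * (X * F) $$ (\<iota> a, \<iota> b))" for X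
  proof -
    have e: "(\<forall>i<M. \<forall>j<M. (X * F) $$ (j, i) = - symm_sign ty * (X * F) $$ (i, j)) \<longleftrightarrow>
      (\<forall>a\<in>idx ty n. \<forall>b\<in>idx ty n. (X * F) $$ (\<iota> b, \<iota> a) = - symm_sign ty * (X * F) $$ (\<iota> a, \<iota> b))"
      by (rule ball_bij_betw2[OF frameD(1)[OF fr]])
    show ?thesis unfolding e[symmetric] by (rule iff)
  qed
  have ent: "diag_block_mat [X, Y] $$ (?\<iota> a, ?\<iota> b) = (if snd a = snd b then (if snd a then Y else X) $$ (\<iota> (fst a), \<iota> (fst b)) else 0)"
    if "X \<in> carrier_mat M M" "Y \<in> carrier_mat M M" "a \<in> H" "b \<in> H" for X Y a b
    using entry[of "\<lambda>\<gamma>. if \<gamma> then Y else X" a b] that unfolding H by (simp del: diag_block_mat.simps)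
  have V: "V = {X \<in> carrier_mat (M + M) (M + M). (\<forall>a\<in>H. \<forall>b\<in>H. (X * ?B) $$ (?\<iota> b, ?\<iota> a) = - symm_sign ty * (X * ?B) $$ (?\<iota> a, ?\<iota> b)) \<and>
        (\<forall>a\<in>H. \<forall>b\<in>H. \<not> snd a = snd b \<longrightarrow> (X * ?B) $$ (?\<iota> a, ?\<iota> b) = 0)}" (is "V = ?V")
  proof (intro equalityI subsetI)
    fix Z assume "Z \<in> V"
    then obtain X Y where Z: "Z = diag_block_mat [X, Y]" and X: "X \<in> isom_alg M F" and Y: "Y \<in> isom_alg M F"
      unfolding V_def by blast
    have c: "X \<in> carrier_mat M M" "Y \<in> carrier_mat M M" using X Y by (auto simp: isom_alg_def)
    have cF: "X * F \<in> carrier_mat M M" "Y * F \<in> carrier_mat M M" using c Fc by simp_all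
    note e = ent[OF cF]
    have ZB: "Z * ?B = diag_block_mat [X * F, Y * F]" unfolding Z by (rule diag_pair_mult[OF c Fc Fc])
    show "Z \<in> ?V"
    proof (intro CollectI conjI ballI impI, unfold ZB)
      show "Z \<in> carrier_mat (M + M) (M + M)" unfolding Z by (rule diag_pair_carrier[OF c])
      fix a b assume ab: "a \<in> H" "b \<in> H"
      have "(X * F) $$ (\<iota> (fst b), \<iota> (fst a)) = - symm_sign ty * (X * F) $$ (\<iota> (fst a), \<iota> (fst b))"
        "(Y * F) $$ (\<iota> (fst b), \<iota> (fst a)) = - symm_sign ty * (Y * F) $$ (\<iota> (fst a), \<iota> (fst b))"
        using X Y ab unfolding alg H by blast+
      then show "diag_block_mat [X * F, Y * F] $$ (?\<iota> b, ?\<iota> a) = - symm_sign ty * diag_block_mat [X * F, Y * F] $$ (?\<iota> a, ?\<iota> b)"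
        unfolding e[OF ab] e[OF ab(2,1)] by (cases "snd a"; cases "snd b") simp_all
      show "diag_block_mat [X * F, Y * F] $$ (?\<iota> a, ?\<iota> b) = 0" if "\<not> snd a = snd b"
        unfolding e[OF ab] using that by simp
    qed
  next
    fix Z assume "Z \<in> ?V"
    then have Zc: "Z \<in> carrier_mat (M + M) (M + M)"
      and skew: "\<And>a b. a \<in> H \<Longrightarrow> b \<in> H \<Longrightarrow> (Z * ?B) $$ (?\<iota> b, ?\<iota> a) = - symm_sign ty * (Z * ?B) $$ (?\<iota> a, ?\<iota> b)"
      and off: "\<And>a b. a \<in> H \<Longrightarrow> b \<in> H \<Longrightarrow> snd a \<noteq> snd b \<Longrightarrow> (Z * ?B) $$ (?\<iota> a, ?\<iota> b) = 0" by blast+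
    note Bc = diag_pair_carrier[OF Fc Fc] and Bi = minv[OF GL]
    define W where "W = Z * ?B"
    have Wc: "W \<in> carrier_mat (M + M) (M + M)" unfolding W_def by (rule mult_carrier_mat[OF Zc Bc])
    \<comment> \<open>The off-diagonal blocks of \<open>Z * ?B\<close> vanish by \<open>off\<close>;
      multiplying the diagonal blocks \<open>P\<close> and \<open>Q\<close> by the inverse of
      \<open>F\<close> recovers those of \<open>Z\<close>.\<close>
    define P where "P = Matrix.mat M M (\<lambda>(i, j). W $$ (i, j))"
    define Q where "Q = Matrix.mat M M (\<lambda>(i, j). W $$ (i + M, j + M))"
    have PQ: "P \<in> carrier_mat M M" "Q \<in> carrier_mat M M" by (simp_all add: P_def Q_def)
    have fl: "?\<iota> a = \<iota> (fst a) + (if snd a then M else 0)" for a by (simp add: block_index_def)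
    have Pe: "P $$ (\<iota> a, \<iota> b) = W $$ (?\<iota> (a, False), ?\<iota> (b, False))" "Q $$ (\<iota> a, \<iota> b) = W $$ (?\<iota> (a, True), ?\<iota> (b, True))"
      if "a \<in> idx ty n" "b \<in> idx ty n" for a b
      using frameD(4)[OF fr] that by (simp_all add: P_def Q_def fl)
    have W: "W = diag_block_mat [P, Q]"
    proof (rule eq_matI)
      note cc = diag_pair_carrier[OF PQ]
      show "dim_row W = dim_row (diag_block_mat [P, Q])" "dim_col W = dim_col (diag_block_mat [P, Q])" using Wc cc by auto
      fix i j assume "i < dim_row (diag_block_mat [P, Q])" "j < dim_col (diag_block_mat [P, Q])"
      then have "i < M + M" "j < M + M" using cc by auto
      then obtain a b where a: "a \<in> H" "i = ?\<iota> a" and b: "b \<in> H" "j = ?\<iota> b"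
        using bij unfolding bij_betw_def H by (metis (no_types, lifting) imageE lessThan_iff)
      have "fst a \<in> idx ty n" "fst b \<in> idx ty n" using a b unfolding H by simp_all
      from Pe[OF this]
      show "W $$ (i, j) = diag_block_mat [P, Q] $$ (i, j)"
        unfolding a(2) b(2) ent[OF PQ a(1) b(1)] using off[OF a(1) b(1)] unfolding W_def[symmetric]
        by (cases a; cases b; cases "snd a"; cases "snd b") (simp_all del: diag_block_mat.simps)
    qed
    have "W * minv ?B = Z * (?B * minv ?B)" unfolding W_def by (rule assoc_mult_mat[OF Zc Bc Bi(1)])
    then have "Z = W * minv ?B" unfolding Bi(2) using Zc by simp
    then have Z: "Z = diag_block_mat [P * minv F, Q * minv F]"
      unfolding W diag_pair_GL(2)[OF FG FG] diag_pair_mult[OF PQ Fi(1) Fi(1)] .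
    have cancelF: "(R * minv F) * F = R" if "R \<in> carrier_mat M M" for R
      unfolding assoc_mult_mat[OF that Fi(1) Fc] Fi(3) by (rule right_mult_one_mat[OF that])
    have "P * minv F \<in> isom_alg M F"
      unfolding alg cancelF[OF PQ(1)]
    proof (intro conjI ballI)
      show "P * minv F \<in> carrier_mat M M" by (rule mult_carrier_mat[OF PQ(1) Fi(1)])
      fix a b assume ab: "a \<in> idx ty n" "b \<in> idx ty n"
      show "P $$ (\<iota> b, \<iota> a) = - symm_sign ty * P $$ (\<iota> a, \<iota> b)"
        unfolding Pe(1)[OF ab] Pe(1)[OF ab(2,1)] W_def by (rule skew) (use ab in \<open>simp_all add: H\<close>)
    qed
    moreover have "Q * minv F \<in> isom_alg M F"
      unfolding alg cancelF[OF PQ(2)]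
    proof (intro conjI ballI)
      show "Q * minv F \<in> carrier_mat M M" by (rule mult_carrier_mat[OF PQ(2) Fi(1)])
      fix a b assume ab: "a \<in> idx ty n" "b \<in> idx ty n"
      show "Q $$ (\<iota> b, \<iota> a) = - symm_sign ty * Q $$ (\<iota> a, \<iota> b)"
        unfolding Pe(2)[OF ab] Pe(2)[OF ab(2,1)] W_def by (rule skew) (use ab in \<open>simp_all add: H\<close>)
    qed
    ultimately show "Z \<in> V" unfolding V_def Z by blast
  qed
  interpret form_pair d ty "\<lambda>_ :: unit. n" "\<lambda>_ :: bool. ()" "\<lambda>_. False" "M + M" ?B ?\<iota> "- symm_sign ty" "\<lambda>\<gamma> \<gamma>'. \<gamma> = \<gamma>'" V K
  proof
    show "- symm_sign ty * - symm_sign ty = 1" using symm_sign_square[of ty] by simp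
    show "\<gamma>' = \<gamma>" if "\<gamma> = \<gamma>'" for \<gamma> \<gamma>' :: bool using that by simp
    show "bij_betw ?\<iota> H {..<M + M}" unfolding H by (rule bij)
    show "?B \<in> GL_grp (M + M)" by (rule GL)
    show "V = {X \<in> carrier_mat (M + M) (M + M). (\<forall>a\<in>H. \<forall>b\<in>H. (X * ?B) $$ (?\<iota> b, ?\<iota> a) = - symm_sign ty * (X * ?B) $$ (?\<iota> a, ?\<iota> b)) \<and>
        (\<forall>a\<in>H. \<forall>b\<in>H. \<not> snd a = snd b \<longrightarrow> (X * ?B) $$ (?\<iota> a, ?\<iota> b) = 0)}" by (rule V)
    show "K \<subseteq> isom_grp (M + M) ?B" unfolding K_def block_diagonal_def using grp by blast
    show "\<exists>g. family g \<and> (\<forall>a\<in>H. \<forall>b\<in>H. k $$ (?\<iota> a, ?\<iota> b) = fam g a b)" if kK: "k \<in> K" for k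
    proof -
      obtain l where k: "k = diag_block_mat [l, l]" and l: "l \<in> isom_grp M F" using kK unfolding K_def block_diagonal_def by blast
      define g where "g = (\<lambda>(_ :: unit) a b. l $$ (\<iota> a, \<iota> b))"
      have "family g" unfolding family_def g_def using frame_isom_base_group[OF fr ty l] by blast
      moreover have "k $$ (?\<iota> a, ?\<iota> b) = fam g a b" if "a \<in> H" "b \<in> H" for a b
        unfolding k ent[OF isom_grpD(2)[OF l] isom_grpD(2)[OF l] that] by (simp add: fam_def g_def)
      ultimately show ?thesis by blast
    qed
    show "\<exists>k\<in>K. \<forall>a\<in>H. \<forall>b\<in>H. k $$ (?\<iota> a, ?\<iota> b) = fam g a b" if g: "family g" for g
    proof -
      have "g () \<in> base_group ty n" using g unfolding family_def by blast
      from frame_base_group_isom[OF fr this] obtain l where l: "l \<in> isom_grp M F"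
        "\<And>a b. a \<in> idx ty n \<Longrightarrow> b \<in> idx ty n \<Longrightarrow> l $$ (\<iota> a, \<iota> b) = g () a b" by blast
      have "diag_block_mat [l, l] \<in> K" unfolding K_def block_diagonal_def using l(1) by blast
      moreover have "diag_block_mat [l, l] $$ (?\<iota> a, ?\<iota> b) = fam g a b" if "a \<in> H" "b \<in> H" for a b
        unfolding ent[OF isom_grpD(2)[OF l(1)] isom_grpD(2)[OF l(1)] that] using l(2) that by (simp add: fam_def H)
      ultimately show ?thesis by blast
    qed
  qed
  have "R1 = (\<lambda>_ _. True)" "eps1 = symm_sign ty"
    using ty by (auto simp: R1_def eps1_def symm_sign_def fun_eq_iff)
  then show ?thesis using form_pair_models by simp
qed

text \<open>GL acts on the defining representation plus its dual, and the colour is the side. All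
  pairs of sides occur in the Lie algebra, but only opposite sides pair invariantly, whichever of
  the two forms defines G.\<close>

lemma models_Levi:
  assumes fr: "frame ty m (2 * m) B (half_index m)" and ty: "ty \<noteq> Orth" and d: "d \<le> m"
  defines "V \<equiv> isom_alg (2 * m) B"
  shows "models (sym_inv d V (GL_Levi m)) (sym_rel d V)
    (match_space d (\<lambda>_ _ :: bool. True) (- symm_sign ty) (\<lambda>\<gamma> \<gamma>'. \<gamma> \<noteq> \<gamma>') 1)"
proof -
  let ?\<iota> = "\<lambda>a :: (nat \<times> bool) \<times> bool. half_index m (fst a)"
  interpret words d Lin "\<lambda>_ :: unit. m" "\<lambda>_ :: bool. ()" "\<lambda>\<gamma>. \<gamma>" by standard (rule d)
  have H: "H = {a. fst a \<in> idx Lin m \<and> snd (fst a) = snd a}" unfolding H_def by simp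
  have idx: "idx ty m = idx Lin m" using ty by (simp add: idx_def)
  have bij0: "bij_betw (half_index m) (idx Lin m) {..<2 * m}" by (rule half_index_bij) simp
  have "bij_betw fst H (idx Lin m)"
    by (rule bij_betw_byWitness[where f' = "\<lambda>a. (a, snd a)"]) (auto simp: H)
  from bij_betw_trans[OF this bij0] have bij: "bij_betw ?\<iota> H {..<2 * m}" by (simp add: o_def)
  have ent: "diag_block_mat [g, transpose_mat (minv g)] $$ (half_index m a, half_index m b) = gl_entries g a b"
    if g: "g \<in> GL_grp m" and ab: "a \<in> idx Lin m" "b \<in> idx Lin m" for g a b
  proof -
    note gc = GL_grp_carrier[OF g] and gi = minv(1)[OF g]
    have gt: "transpose_mat (minv g) \<in> carrier_mat m m" using gi by simp
    have lt: "half_index m a < m + m" "half_index m b < m + m" using ab by (auto simp: half_index_def idx_def)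
    show ?thesis unfolding diag_pair_entry[OF gc gt lt]
      using ab gi by (cases a; cases b) (auto simp: half_index_def gl_entries_def mem_idx)
  qed
  have Levi_carrier: "diag_block_mat [g, transpose_mat (minv g)] \<in> carrier_mat (2 * m) (2 * m)" if g: "g \<in> GL_grp m" for g
    using diag_pair_carrier[OF GL_grp_carrier[OF g], of "transpose_mat (minv g)" m] minv(1)[OF g]
    by (simp add: mult_2 del: diag_block_mat.simps)
  \<comment> \<open>The forms of type \<open>ty\<close> and \<open>Lin\<close> differ by a sign on
    one side; block diagonal matrices commute with that sign, so invariance of one form gives
    invariance of the other.\<close>
  define c where "c s = (if ty = Symp \<and> s then -1 else 1 :: complex)" for s
  have form_ty: "form ty x y = c (snd x) * form Lin x y" for x y
    using ty by (cases ty) (auto simp: form_def form_sign_def c_def)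
  have Levi_isom: "diag_block_mat [g, transpose_mat (minv g)] \<in> isom_grp (2 * m) B" if g: "g \<in> GL_grp m" for g
  proof (rule isom_grpI[OF frame_GL[OF fr] Levi_carrier[OF g]], rule eq_matI)
    let ?k = "diag_block_mat [g, transpose_mat (minv g)]"
    note Bc = frameD(2)[OF fr]
    fix i j assume "i < dim_row B" "j < dim_col B"
    then have ij: "i < 2 * m" "j < 2 * m" using Bc by auto
    obtain a where a: "a \<in> idx ty m" "i = half_index m a" by (rule frame_obtain[OF fr ij(1)])
    obtain b where b: "b \<in> idx ty m" "j = half_index m b" by (rule frame_obtain[OF fr ij(2)])
    have "(?k * B * transpose_mat ?k) $$ (i, j) =
      (\<Sum>x\<in>idx Lin m. \<Sum>y\<in>idx Lin m. c (snd a) * (gl_entries g a x * gl_entries g b y * form Lin x y))"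
      unfolding a(2) b(2) frame_conj_entry[OF fr Levi_carrier[OF g] a(1) b(1)] idx
    proof (intro sum.cong refl)
      fix x y assume xy: "x \<in> idx Lin m" "y \<in> idx Lin m"
      have e: "gl_entries g a x * gl_entries g b y * (c (snd x) * f) = c (snd a) * (gl_entries g a x * gl_entries g b y * f)" for f
        by (cases "snd a = snd x") (simp_all add: gl_entries_def)
      show "?k $$ (half_index m a, half_index m x) * ?k $$ (half_index m b, half_index m y) * form ty x y =
        c (snd a) * (gl_entries g a x * gl_entries g b y * form Lin x y)"
        unfolding ent[OF g a(1)[unfolded idx] xy(1)] ent[OF g b(1)[unfolded idx] xy(2)] form_ty by (rule e)
    qed
    also have "\<dots> = c (snd a) * (\<Sum>x\<in>idx Lin m. \<Sum>y\<in>idx Lin m. gl_entries g a x * gl_entries g b y * form Lin x y)"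
      by (simp only: sum_distrib_left)
    also have "\<dots> = c (snd a) * form Lin a b"
      using gl_entries_base_group[OF g] a(1) b(1) unfolding base_group_def idx by simp
    also have "\<dots> = B $$ (i, j)" unfolding a(2) b(2) frameD(3)[OF fr a(1) b(1)] form_ty ..
    finally show "(?k * B * transpose_mat ?k) $$ (i, j) = B $$ (i, j)" .
  qed (use frameD(2)[OF fr] Levi_carrier[OF g] in auto)
  interpret form_pair d Lin "\<lambda>_ :: unit. m" "\<lambda>_ :: bool. ()" "\<lambda>\<gamma>. \<gamma>" "2 * m" B ?\<iota> "- symm_sign ty" "\<lambda>_ _. True" V "GL_Levi m"
  proof
    show "- symm_sign ty * - symm_sign ty = 1" using symm_sign_square[of ty] by simp
    show "bij_betw ?\<iota> H {..<2 * m}" by (rule bij)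
    show "B \<in> GL_grp (2 * m)" by (rule frame_GL[OF fr])
    show "V = {X \<in> carrier_mat (2 * m) (2 * m). (\<forall>a\<in>H. \<forall>b\<in>H. (X * B) $$ (?\<iota> b, ?\<iota> a) = - symm_sign ty * (X * B) $$ (?\<iota> a, ?\<iota> b)) \<and>
        (\<forall>a\<in>H. \<forall>b\<in>H. \<not> True \<longrightarrow> (X * B) $$ (?\<iota> a, ?\<iota> b) = 0)}"
    proof -
      have e: "(\<forall>i<2 * m. \<forall>j<2 * m. (X * B) $$ (j, i) = - symm_sign ty * (X * B) $$ (i, j)) \<longleftrightarrow>
        (\<forall>a\<in>H. \<forall>b\<in>H. (X * B) $$ (?\<iota> b, ?\<iota> a) = - symm_sign ty * (X * B) $$ (?\<iota> a, ?\<iota> b))" for X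
        by (rule ball_bij_betw2[OF bij])
      have "X \<in> isom_alg (2 * m) B \<longleftrightarrow> X \<in> carrier_mat (2 * m) (2 * m) \<and>
        (\<forall>a\<in>H. \<forall>b\<in>H. (X * B) $$ (?\<iota> b, ?\<iota> a) = - symm_sign ty * (X * B) $$ (?\<iota> a, ?\<iota> b))" for X
        unfolding e[symmetric] by (rule isom_alg_iff[OF frameD(2)[OF fr] symm_sign_square[of ty] frame_symm[OF fr]])
      then show ?thesis unfolding V_def by blast
    qed
    show "GL_Levi m \<subseteq> isom_grp (2 * m) B" unfolding GL_Levi_def using Levi_isom by blast
    show "\<exists>g. family g \<and> (\<forall>a\<in>H. \<forall>b\<in>H. k $$ (?\<iota> a, ?\<iota> b) = fam g a b)" if kK: "k \<in> GL_Levi m" for k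
    proof -
      obtain l where k: "k = diag_block_mat [l, transpose_mat (minv l)]" and l: "l \<in> GL_grp m"
        using kK unfolding GL_Levi_def by blast
      have "family (\<lambda>_ :: unit. gl_entries l)" unfolding family_def using gl_entries_base_group[OF l] by blast
      moreover have "k $$ (?\<iota> a, ?\<iota> b) = fam (\<lambda>_ :: unit. gl_entries l) a b" if "a \<in> H" "b \<in> H" for a b
      proof -
        have ab: "fst a \<in> idx Lin m" "fst b \<in> idx Lin m" "snd (fst a) = snd a" "snd (fst b) = snd b" using that by (auto simp: H)
        show ?thesis unfolding k ent[OF l ab(1,2)] using ab(3,4) by (simp add: fam_def gl_entries_def)
      qed
      ultimately show ?thesis by blast
    qed
    show "\<exists>k\<in>GL_Levi m. \<forall>a\<in>H. \<forall>b\<in>H. k $$ (?\<iota> a, ?\<iota> b) = fam g a b" if g: "family g" for g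
    proof -
      have "g () \<in> base_group Lin m" using g unfolding family_def by blast
      from base_group_gl_entries[OF this] obtain l where l: "l \<in> GL_grp m"
        "\<And>a b. a \<in> idx Lin m \<Longrightarrow> b \<in> idx Lin m \<Longrightarrow> gl_entries l a b = g () a b" by blast
      have "diag_block_mat [l, transpose_mat (minv l)] \<in> GL_Levi m" unfolding GL_Levi_def using l(1) by blast
      moreover have "diag_block_mat [l, transpose_mat (minv l)] $$ (?\<iota> a, ?\<iota> b) = fam g a b" if "a \<in> H" "b \<in> H" for a b
      proof -
        have ab: "fst a \<in> idx Lin m" "fst b \<in> idx Lin m" "snd (fst a) = snd a" "snd (fst b) = snd b" using that by (auto simp: H)
        show ?thesis
        proof (cases "snd a = snd b")
          case True
          then show ?thesis unfolding ent[OF l(1) ab(1,2)] l(2)[OF ab(1,2)] by (simp add: fam_def)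
        next
          case False
          then show ?thesis unfolding ent[OF l(1) ab(1,2)] using ab(3,4) by (simp add: fam_def gl_entries_def)
        qed
      qed
      ultimately show ?thesis by blast
    qed
  qed
  have "R1 = (\<lambda>\<gamma> \<gamma>'. \<gamma> \<noteq> \<gamma>')" "eps1 = 1"
    by (auto simp: R1_def eps1_def fun_eq_iff)
  then show ?thesis using form_pair_models by simp
qed

text \<open>The form identifies the defining representation of K with its dual, so the row and
  column indices of \<open>X * F\<close> transform in the same way; the colour only records which is
  which.\<close>

lemma models_gl_isom:
  assumes fr: "frame ty n M F \<iota>" and ty: "ty \<noteq> Lin" and d: "d \<le> n"
  defines "V \<equiv> carrier_mat M M"
  shows "models (sym_inv d V (isom_grp M F)) (sym_rel d V)
    (match_space d (\<lambda>\<gamma> \<gamma>' :: bool. \<gamma> \<noteq> \<gamma>') 1 (\<lambda>_ _. True) (symm_sign ty))"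
proof -
  let ?\<iota> = "\<lambda>a :: (nat \<times> bool) \<times> bool. \<iota> (fst a)"
  note Fc = frameD(2)[OF fr] and FG = frame_GL[OF fr]
  note Fi = minv[OF FG]
  interpret words d ty "\<lambda>_ :: unit. n" "\<lambda>_ :: bool. ()" "\<lambda>_. False" by standard (rule d)
  have H: "H = {a. fst a \<in> idx ty n}" unfolding H_def using ty by simp
  \<comment> \<open>An isometry satisfies \<open>minv F * minv k * F = transpose_mat k\<close>, so
    column letters transform like row letters.\<close>
  have dual: "(minv F * minv k * F) $$ (\<iota> b, \<iota> a) = k $$ (\<iota> a, \<iota> b)"
    if k: "k \<in> isom_grp M F" and ab: "a \<in> idx ty n" "b \<in> idx ty n" for k a b
  proof -
    note kc = isom_grpD(2)[OF k] and ki = minv[OF isom_grpD(1)[OF k]]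
    have kt: "transpose_mat k \<in> carrier_mat M M" using kc by simp
    have kF: "k * F \<in> carrier_mat M M" using kc Fc by simp
    have "minv k * F = minv k * (k * F * transpose_mat k)" unfolding isom_grpD(3)[OF k] ..
    also have "\<dots> = (minv k * (k * F)) * transpose_mat k" by (rule assoc_mult_mat[OF ki(1) kF kt, symmetric])
    also have "minv k * (k * F) = F"
      unfolding assoc_mult_mat[OF ki(1) kc Fc, symmetric] ki(3) by (rule left_mult_one_mat[OF Fc])
    finally have e: "minv k * F = F * transpose_mat k" .
    have "minv F * minv k * F = minv F * (F * transpose_mat k)"
      unfolding assoc_mult_mat[OF Fi(1) ki(1) Fc] e ..
    also have "\<dots> = transpose_mat k"
      unfolding assoc_mult_mat[OF Fi(1) Fc kt, symmetric] Fi(3) by (rule left_mult_one_mat[OF kt])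
    finally show ?thesis using kc frameD(4)[OF fr] ab by simp
  qed
  interpret gl_pair d ty "\<lambda>_ :: unit. n" "\<lambda>_ :: bool. ()" "\<lambda>_. False" M F ?\<iota> "\<lambda>\<gamma>. \<gamma>" "\<lambda>\<gamma> \<gamma>'. \<gamma> \<noteq> \<gamma>'" V "isom_grp M F"
  proof
    show "\<gamma>' \<noteq> \<gamma>" if "\<gamma> \<noteq> \<gamma>'" for \<gamma> \<gamma>' :: bool using that by simp
    show "\<gamma> \<noteq> \<gamma>'" if "\<gamma> \<noteq> \<gamma>'" for \<gamma> \<gamma>' :: bool using that .
    show "bij_betw ?\<iota> {a \<in> H. snd a = s} {..<M}" for s
    proof -
      have "bij_betw fst {a \<in> H. snd a = s} (idx ty n)"
        by (rule bij_betw_byWitness[where f' = "\<lambda>a. (a, s)"]) (auto simp: H)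
      from bij_betw_trans[OF this frameD(1)[OF fr]] show ?thesis by (simp add: o_def)
    qed
    show "F \<in> GL_grp M" by (rule FG)
    show "V = {X \<in> carrier_mat M M. \<forall>a\<in>H. \<forall>b\<in>H. \<not> snd a \<longrightarrow> snd b \<longrightarrow> \<not> snd a \<noteq> snd b \<longrightarrow> (X * F) $$ (?\<iota> a, ?\<iota> b) = 0}"
      unfolding V_def by blast
    show "isom_grp M F \<subseteq> GL_grp M" by (auto simp: isom_grp_def)
    show "\<exists>g. family g \<and> (\<forall>a\<in>H. \<forall>b\<in>H. (\<not> snd a \<longrightarrow> \<not> snd b \<longrightarrow> k $$ (?\<iota> a, ?\<iota> b) = fam g a b) \<and>
        (snd a \<longrightarrow> snd b \<longrightarrow> (minv F * minv k * F) $$ (?\<iota> b, ?\<iota> a) = fam g a b))" if k: "k \<in> isom_grp M F" for k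
    proof (intro exI[of _ "\<lambda>(_ :: unit) a b. k $$ (\<iota> a, \<iota> b)"] conjI ballI impI)
      show "family (\<lambda>_ a b. k $$ (\<iota> a, \<iota> b))" unfolding family_def using frame_isom_base_group[OF fr ty k] by blast
      fix a b assume ab: "a \<in> H" "b \<in> H"
      show "k $$ (?\<iota> a, ?\<iota> b) = fam (\<lambda>_ a b. k $$ (\<iota> a, \<iota> b)) a b" if "\<not> snd a" "\<not> snd b"
        using that by (simp add: fam_def)
      show "(minv F * minv k * F) $$ (?\<iota> b, ?\<iota> a) = fam (\<lambda>_ a b. k $$ (\<iota> a, \<iota> b)) a b" if "snd a" "snd b"
        using that dual[OF k, of "fst a" "fst b"] ab unfolding H by (simp add: fam_def del: index_mult_mat)
    qed
    show "\<exists>k\<in>isom_grp M F. \<forall>a\<in>H. \<forall>b\<in>H. (\<not> snd a \<longrightarrow> \<not> snd b \<longrightarrow> k $$ (?\<iota> a, ?\<iota> b) = fam g a b) \<and>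
        (snd a \<longrightarrow> snd b \<longrightarrow> (minv F * minv k * F) $$ (?\<iota> b, ?\<iota> a) = fam g a b)" if g: "family g" for g
    proof -
      have "g () \<in> base_group ty n" using g unfolding family_def by blast
      from frame_base_group_isom[OF fr this] obtain k where k: "k \<in> isom_grp M F"
        "\<And>a b. a \<in> idx ty n \<Longrightarrow> b \<in> idx ty n \<Longrightarrow> k $$ (\<iota> a, \<iota> b) = g () a b" by blast
      show ?thesis
      proof (intro bexI[OF _ k(1)] ballI conjI impI)
        fix a b assume ab: "a \<in> H" "b \<in> H"
        then have ab': "fst a \<in> idx ty n" "fst b \<in> idx ty n" by (auto simp: H)
        show "k $$ (?\<iota> a, ?\<iota> b) = fam g a b" if "\<not> snd a" "\<not> snd b" using that k(2)[OF ab'] by (simp add: fam_def)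
        show "(minv F * minv k * F) $$ (?\<iota> b, ?\<iota> a) = fam g a b" if "snd a" "snd b"
          using that dual[OF k(1) ab'] k(2)[OF ab'] by (simp add: fam_def del: index_mult_mat)
      qed
    qed
  qed
  have "R1 = (\<lambda>_ _. True)" "eps1 = symm_sign ty"
    using ty by (auto simp: R1_def eps1_def symm_sign_def fun_eq_iff)
  then show ?thesis using gl_pair_models by simp
qed

text \<open>Common form of GL(n,C) and U(p,q). A colour consists of a row or column tag and a block;
  \<open>\<kappa>\<close> gives the factor of \<open>K\<close> acting on a block and
  \<open>\<rho>\<close> the pairs of blocks in which \<open>X\<close> may be nonzero.\<close>

lemma models_gl_blocks:
  fixes N :: "'k \<Rightarrow> nat" and \<kappa> :: "bool \<Rightarrow> 'k" and \<rho> :: "bool \<Rightarrow> bool \<Rightarrow> bool"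
  assumes d: "\<And>k. d \<le> N k" and \<rho>: "\<And>\<delta> \<delta>'. \<rho> \<delta> \<delta>' \<Longrightarrow> \<rho> \<delta>' \<delta>"
  defines "n \<equiv> \<lambda>\<delta>. N (\<kappa> \<delta>)"
  defines "M \<equiv> n False + n True" and "\<phi> \<equiv> block_index (n False) (\<lambda>_ i :: nat. i)"
  defines "V \<equiv> {X \<in> carrier_mat M M. \<forall>a\<in>{a. fst a < n (snd a)}. \<forall>b\<in>{a. fst a < n (snd a)}.
      \<not> \<rho> (snd a) (snd b) \<longrightarrow> X $$ (\<phi> a, \<phi> b) = 0}"
    and "K \<equiv> {diag_block_mat [h (\<kappa> False), h (\<kappa> True)] | h. \<forall>k. h k \<in> GL_grp (N k)}"
  shows "models (sym_inv d V K) (sym_rel d V)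
    (match_space d (\<lambda>\<gamma> \<gamma>'. fst \<gamma> \<noteq> fst \<gamma>' \<and> \<rho> (snd \<gamma>) (snd \<gamma>')) 1
      (\<lambda>\<gamma> \<gamma>' :: bool \<times> bool. \<kappa> (snd \<gamma>) = \<kappa> (snd \<gamma>') \<and> fst \<gamma> \<noteq> fst \<gamma>') 1)"
proof -
  \<comment> \<open>Forgets the row or column tag, which an element of \<open>H\<close> stores
    twice: as side of the index and as first part of the colour.\<close>
  define f where "f = (\<lambda>a :: (nat \<times> bool) \<times> bool \<times> bool. (fst (fst a), snd (snd a)))"
  interpret words d Lin N "\<lambda>\<gamma> :: bool \<times> bool. \<kappa> (snd \<gamma>)" fst by standard (rule d)
  have H: "a \<in> H \<longleftrightarrow> fst (f a) < n (snd (f a)) \<and> snd (fst a) = fst (snd a)" for a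
    unfolding H_def f_def n_def by (simp add: idx_def mem_Times_iff)
  have bij\<phi>: "bij_betw \<phi> {a. fst a < n (snd a)} {..<M}"
    using bij_betw_block_index[of "\<lambda>_ i. i" "\<lambda>\<delta>. {..<n \<delta>}" n] unfolding \<phi>_def M_def by (simp add: bij_betw_def)
  have \<phi>_one: "X * 1\<^sub>m M = X" if "X \<in> carrier_mat M M" for X :: "complex mat"
    using that by (rule right_mult_one_mat)
  have one: "1\<^sub>m M \<in> GL_grp M" "minv (1\<^sub>m M) = 1\<^sub>m M"
    by (rule GL_grpI[of _ _ "1\<^sub>m M"] minv_eq[of _ M]; simp)+
  have block: "diag_block_mat [k False, k True] $$ (\<phi> a, \<phi> b) = (if snd a = snd b then k (snd a) $$ (fst a, fst b) else 0)"
    if "\<And>\<delta>. k \<delta> \<in> carrier_mat (n \<delta>) (n \<delta>)" "fst a < n (snd a)" "fst b < n (snd b)" for k :: "bool \<Rightarrow> complex mat" and a b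
    unfolding \<phi>_def block_index_def by (rule block_entry[OF that])
  have act: "(\<not> fst (snd a) \<longrightarrow> \<not> fst (snd b) \<longrightarrow>
        diag_block_mat [h (\<kappa> False), h (\<kappa> True)] $$ (\<phi> (f a), \<phi> (f b)) = fam g a b) \<and>
      (fst (snd a) \<longrightarrow> fst (snd b) \<longrightarrow>
        (minv (1\<^sub>m M) * minv (diag_block_mat [h (\<kappa> False), h (\<kappa> True)]) * 1\<^sub>m M) $$ (\<phi> (f b), \<phi> (f a)) = fam g a b)"
    if h: "\<And>k. h k \<in> GL_grp (N k)"
      and g: "\<And>k a b. a \<in> idx Lin (N k) \<Longrightarrow> b \<in> idx Lin (N k) \<Longrightarrow> gl_entries (h k) a b = g k a b"
      and a: "a \<in> H" and b: "b \<in> H" for h g a b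
  proof -
    have hn: "h (\<kappa> \<delta>) \<in> GL_grp (n \<delta>)" for \<delta> unfolding n_def by (rule h)
    note hc = GL_grp_carrier[OF hn] and hi = minv(1)[OF hn]
    have ab: "fst (f a) < n (snd (f a))" "fst (f b) < n (snd (f b))" using a b H by blast+
    have ent: "gl_entries (h (\<kappa> (snd (snd a)))) (fst a) (fst b) = g (\<kappa> (snd (snd a))) (fst a) (fst b)"
      if "snd a = snd b"
      using a b that unfolding H_def by (intro g) simp_all
    have sides: "snd (fst a) = fst (snd a)" "snd (fst b) = fst (snd b)" using a b H by blast+
    have i: "minv (1\<^sub>m M) * minv (diag_block_mat [h (\<kappa> False), h (\<kappa> True)]) * 1\<^sub>m M
        = diag_block_mat [minv (h (\<kappa> False)), minv (h (\<kappa> True))]"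
      unfolding diag_pair_GL(2)[OF hn hn] one(2)
      using diag_pair_carrier[OF hi hi, of False True, folded M_def]
      by (simp del: diag_block_mat.simps)
    note blocks = i block[of "\<lambda>\<delta>. h (\<kappa> \<delta>)", OF hc ab] block[of "\<lambda>\<delta>. minv (h (\<kappa> \<delta>))", OF hi ab(2,1)]
    show ?thesis
    proof (cases "snd a = snd b")
      case True
      note e = ent[OF True, unfolded True gl_entries_def]
      show ?thesis using e sides unfolding blocks by (cases "fst (snd b)") (simp_all add: True f_def fam_def)
    next
      case False
      then have "snd (f a) \<noteq> snd (f b)" if "fst (snd a) = fst (snd b)" using that by (simp add: f_def prod_eq_iff)
      then show ?thesis using False unfolding blocks by (auto simp: fam_def)
    qed
  qed
  interpret gl_pair d Lin N "\<lambda>\<gamma> :: bool \<times> bool. \<kappa> (snd \<gamma>)" fst M "1\<^sub>m M" "\<lambda>a. \<phi> (f a)" fst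
    "\<lambda>\<gamma> \<gamma>'. fst \<gamma> \<noteq> fst \<gamma>' \<and> \<rho> (snd \<gamma>) (snd \<gamma>')" V K
  proof
    show "fst \<gamma>' \<noteq> fst \<gamma> \<and> \<rho> (snd \<gamma>') (snd \<gamma>)" if "fst \<gamma> \<noteq> fst \<gamma>' \<and> \<rho> (snd \<gamma>) (snd \<gamma>')" for \<gamma> \<gamma>' :: "bool \<times> bool"
      using that \<rho> by metis
    show "fst \<gamma> \<noteq> fst \<gamma>'" if "fst \<gamma> \<noteq> fst \<gamma>' \<and> \<rho> (snd \<gamma>) (snd \<gamma>')" for \<gamma> \<gamma>' :: "bool \<times> bool" using that by blast
    have bijf: "bij_betw f {a \<in> H. fst (snd a) = s} {a. fst a < n (snd a)}" for s
      by (rule bij_betw_byWitness[where f' = "\<lambda>x. ((fst x, s), (s, snd x))"]) (auto simp: H f_def)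
    show "bij_betw (\<lambda>a. \<phi> (f a)) {a \<in> H. fst (snd a) = s} {..<M}" for s
      using bij_betw_trans[OF bijf bij\<phi>] by (simp add: o_def)
    have f_H: "\<exists>a\<in>H. fst (snd a) = s \<and> f a = x" if "fst x < n (snd x)" for s x
      by (rule bexI[of _ "((fst x, s), (s, snd x))"]) (use that in \<open>simp_all add: H f_def\<close>)
    show "V = {X \<in> carrier_mat M M. \<forall>a\<in>H. \<forall>b\<in>H. \<not> fst (snd a) \<longrightarrow> fst (snd b) \<longrightarrow>
       \<not> (fst (snd a) \<noteq> fst (snd b) \<and> \<rho> (snd (snd a)) (snd (snd b))) \<longrightarrow> (X * 1\<^sub>m M) $$ (\<phi> (f a), \<phi> (f b)) = 0}"
    proof (intro equalityI subsetI CollectI conjI ballI impI)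
      fix X :: "complex mat" assume X: "X \<in> V"
      then show "X \<in> carrier_mat M M" by (simp add: V_def)
      then have X1: "X * 1\<^sub>m M = X" by (rule \<phi>_one)
      fix a b assume "a \<in> H" "b \<in> H" and s: "\<not> fst (snd a)" "fst (snd b)" "\<not> (fst (snd a) \<noteq> fst (snd b) \<and> \<rho> (snd (snd a)) (snd (snd b)))"
      then have "fst (f a) < n (snd (f a))" "fst (f b) < n (snd (f b))" using H by blast+
      moreover have "\<not> \<rho> (snd (f a)) (snd (f b))" using s by (auto simp: f_def)
      ultimately show "(X * 1\<^sub>m M) $$ (\<phi> (f a), \<phi> (f b)) = 0" unfolding X1 using X unfolding V_def by blast
    next
      fix X :: "complex mat" assume X: "X \<in> {X \<in> carrier_mat M M. \<forall>a\<in>H. \<forall>b\<in>H. \<not> fst (snd a) \<longrightarrow> fst (snd b) \<longrightarrow>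
       \<not> (fst (snd a) \<noteq> fst (snd b) \<and> \<rho> (snd (snd a)) (snd (snd b))) \<longrightarrow> (X * 1\<^sub>m M) $$ (\<phi> (f a), \<phi> (f b)) = 0}"
      then have Xc: "X \<in> carrier_mat M M" by blast
      note X1 = \<phi>_one[OF Xc]
      show "X \<in> V" unfolding V_def
      proof (intro CollectI conjI ballI impI Xc)
        fix x y assume xy: "x \<in> {a. fst a < n (snd a)}" "y \<in> {a. fst a < n (snd a)}" "\<not> \<rho> (snd x) (snd y)"
        obtain a where a: "a \<in> H" "\<not> fst (snd a)" "f a = x" using f_H[of x False] xy(1) by blast
        obtain b where b: "b \<in> H" "fst (snd b)" "f b = y" using f_H[of y True] xy(2) by blast
        have "\<not> \<rho> (snd (snd a)) (snd (snd b))" using xy(3) unfolding a(3)[symmetric] b(3)[symmetric] by (simp add: f_def)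
        then have "(X * 1\<^sub>m M) $$ (\<phi> (f a), \<phi> (f b)) = 0" using X a(1,2) b(1,2) by blast
        then show "X $$ (\<phi> x, \<phi> y) = 0" unfolding X1 a(3) b(3) .
      qed
    qed
    have hGL: "diag_block_mat [h (\<kappa> False), h (\<kappa> True)] \<in> GL_grp M" if "\<And>k. h k \<in> GL_grp (N k)" for h
      unfolding M_def n_def by (rule diag_pair_GL(1)[OF that that])
    show "1\<^sub>m M \<in> GL_grp M" by (rule one(1))
    show "K \<subseteq> GL_grp M" unfolding K_def using hGL by blast
    show "\<exists>g. family g \<and> (\<forall>a\<in>H. \<forall>b\<in>H. (\<not> fst (snd a) \<longrightarrow> \<not> fst (snd b) \<longrightarrow> k $$ (\<phi> (f a), \<phi> (f b)) = fam g a b) \<and>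
        (fst (snd a) \<longrightarrow> fst (snd b) \<longrightarrow> (minv (1\<^sub>m M) * minv k * 1\<^sub>m M) $$ (\<phi> (f b), \<phi> (f a)) = fam g a b))" if kK: "k \<in> K" for k
    proof -
      obtain h where k: "k = diag_block_mat [h (\<kappa> False), h (\<kappa> True)]" and h: "\<And>k. h k \<in> GL_grp (N k)"
        using kK unfolding K_def by blast
      have "family (\<lambda>k. gl_entries (h k))" unfolding family_def using gl_entries_base_group[OF h] by blast
      moreover note act[of h "\<lambda>k. gl_entries (h k)", OF h refl, folded k]
      ultimately show ?thesis by blast
    qed
    show "\<exists>k\<in>K. \<forall>a\<in>H. \<forall>b\<in>H. (\<not> fst (snd a) \<longrightarrow> \<not> fst (snd b) \<longrightarrow> k $$ (\<phi> (f a), \<phi> (f b)) = fam g a b) \<and>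
        (fst (snd a) \<longrightarrow> fst (snd b) \<longrightarrow> (minv (1\<^sub>m M) * minv k * 1\<^sub>m M) $$ (\<phi> (f b), \<phi> (f a)) = fam g a b)" if g: "family g" for g
    proof -
      have "\<forall>k. \<exists>l. l \<in> GL_grp (N k) \<and> (\<forall>a\<in>idx Lin (N k). \<forall>b\<in>idx Lin (N k). gl_entries l a b = g k a b)"
        using base_group_gl_entries g unfolding family_def by blast
      from choice[OF this] obtain h where h: "\<And>k. h k \<in> GL_grp (N k)"
        "\<And>k a b. a \<in> idx Lin (N k) \<Longrightarrow> b \<in> idx Lin (N k) \<Longrightarrow> gl_entries (h k) a b = g k a b" by blast
      have "diag_block_mat [h (\<kappa> False), h (\<kappa> True)] \<in> K" unfolding K_def using h(1) by blast
      then show ?thesis using act[of h g, OF h] by blast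
    qed
  qed
  have p: "R1 = (\<lambda>\<gamma> \<gamma>'. \<kappa> (snd \<gamma>) = \<kappa> (snd \<gamma>') \<and> fst \<gamma> \<noteq> fst \<gamma>')" "eps1 = 1"
    by (auto simp: R1_def eps1_def fun_eq_iff)
  show ?thesis using gl_pair_models unfolding p .
qed

text \<open>The instance with two diagonal blocks (\<open>\<rho>\<close> is equality) acted on by
  the same group (\<open>\<kappa>\<close> is constant).\<close>

lemma models_GL_C:
  assumes d: "d \<le> n"
  defines "V \<equiv> {diag_block_mat [X, Y] | X Y. X \<in> carrier_mat n n \<and> Y \<in> carrier_mat n n}"
  shows "models (sym_inv d V (block_diagonal (GL_grp n))) (sym_rel d V)
    (match_space d (\<lambda>\<gamma> \<gamma>'. fst \<gamma> \<noteq> fst \<gamma>' \<and> snd \<gamma> = snd \<gamma>') 1 (\<lambda>\<gamma> \<gamma>' :: bool \<times> bool. fst \<gamma> \<noteq> fst \<gamma>') 1)"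
proof -
  let ?\<phi> = "block_index n (\<lambda>(_ :: bool) i :: nat. i)"
  have K: "block_diagonal (GL_grp n) = {diag_block_mat [h (), h ()] | h. \<forall>k. h k \<in> GL_grp n}"
  proof (intro equalityI subsetI)
    fix x assume "x \<in> block_diagonal (GL_grp n)"
    then obtain a where "x = diag_block_mat [a, a]" "a \<in> GL_grp n" unfolding block_diagonal_def by blast
    then show "x \<in> {diag_block_mat [h (), h ()] | h. \<forall>k. h k \<in> GL_grp n}"
      by (intro CollectI exI[of _ "\<lambda>_. a"]) (simp del: diag_block_mat.simps)
  qed (unfold block_diagonal_def, blast)
  have V: "V = {X \<in> carrier_mat (n + n) (n + n). \<forall>a\<in>{a. fst a < n}. \<forall>b\<in>{a. fst a < n}.
      \<not> snd a = snd b \<longrightarrow> X $$ (?\<phi> a, ?\<phi> b) = 0}" (is "V = ?V")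
  proof (intro equalityI subsetI)
    fix Z assume "Z \<in> V"
    then obtain X Y where Z: "Z = diag_block_mat [X, Y]" and XY: "X \<in> carrier_mat n n" "Y \<in> carrier_mat n n"
      unfolding V_def by blast
    have zero: "Z $$ (?\<phi> a, ?\<phi> b) = 0" if "fst a < n" "fst b < n" "snd a \<noteq> snd b" for a b
    proof -
      have lt: "?\<phi> a < n + n" "?\<phi> b < n + n" using that by (auto simp: block_index_def)
      show ?thesis unfolding Z diag_pair_entry[OF XY lt] using that by (auto simp: block_index_def)
    qed
    show "Z \<in> ?V"
    proof (intro CollectI conjI ballI impI)
      show "Z \<in> carrier_mat (n + n) (n + n)" unfolding Z by (rule diag_pair_carrier[OF XY])
    qed (rule zero; simp)
  next
    fix Z assume "Z \<in> ?V"
    then have Zc: "Z \<in> carrier_mat (n + n) (n + n)"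
      and off: "\<And>a b. fst a < n \<Longrightarrow> fst b < n \<Longrightarrow> snd a \<noteq> snd b \<Longrightarrow> Z $$ (?\<phi> a, ?\<phi> b) = 0" by blast+
    define X where "X = Matrix.mat n n (\<lambda>(i, j). Z $$ (i, j))"
    define Y where "Y = Matrix.mat n n (\<lambda>(i, j). Z $$ (i + n, j + n))"
    have XY: "X \<in> carrier_mat n n" "Y \<in> carrier_mat n n" by (simp_all add: X_def Y_def)
    have "Z = diag_block_mat [X, Y]"
    proof (rule eq_matI)
      note cc = diag_pair_carrier[OF XY]
      show "dim_row Z = dim_row (diag_block_mat [X, Y])" "dim_col Z = dim_col (diag_block_mat [X, Y])" using Zc cc by auto
      fix i j assume "i < dim_row (diag_block_mat [X, Y])" "j < dim_col (diag_block_mat [X, Y])"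
      then have ij: "i < n + n" "j < n + n" using cc by auto
      have 1: "Z $$ (i, j) = 0" if "i < n" "\<not> j < n"
        using off[of "(i, False)" "(j - n, True)"] that ij by (simp add: block_index_def)
      have 2: "Z $$ (i, j) = 0" if "\<not> i < n" "j < n"
        using off[of "(i - n, True)" "(j, False)"] that ij by (simp add: block_index_def)
      show "Z $$ (i, j) = diag_block_mat [X, Y] $$ (i, j)"
        unfolding diag_pair_entry[OF XY ij] using ij 1 2 by (auto simp: X_def Y_def)
    qed
    then show "Z \<in> V" unfolding V_def using XY by blast
  qed
  show ?thesis
    using models_gl_blocks[of d "\<lambda>_ :: unit. n" "(=)" "\<lambda>_. ()", OF d sym] by (simp only: K V simp_thms)
qed

text \<open>The instance with no vanishing blocks and a separate group for each block.\<close>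

lemma models_U:
  assumes d: "d \<le> p" "d \<le> q"
  defines "V \<equiv> carrier_mat (p + q) (p + q)"
  shows "models (sym_inv d V (block_prod (GL_grp p) (GL_grp q))) (sym_rel d V)
    (match_space d (\<lambda>\<gamma> \<gamma>' :: bool \<times> bool. fst \<gamma> \<noteq> fst \<gamma>') 1 (\<lambda>\<gamma> \<gamma>'. fst \<gamma> \<noteq> fst \<gamma>' \<and> snd \<gamma> = snd \<gamma>') 1)"
proof -
  define N where "N k = (if k then q else p)" for k
  have dN: "d \<le> N k" for k using d by (simp add: N_def)
  have N: "N False = p" "N True = q" by (simp_all add: N_def)
  have K: "block_prod (GL_grp p) (GL_grp q) = {diag_block_mat [h False, h True] | h. \<forall>k. h k \<in> GL_grp (N k)}"
  proof (intro equalityI subsetI)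
    fix x assume "x \<in> block_prod (GL_grp p) (GL_grp q)"
    then obtain a b where "x = diag_block_mat [a, b]" "a \<in> GL_grp p" "b \<in> GL_grp q" unfolding block_prod_def by blast
    then show "x \<in> {diag_block_mat [h False, h True] | h. \<forall>k. h k \<in> GL_grp (N k)}"
      by (intro CollectI exI[of _ "\<lambda>k. if k then b else a"]) (simp add: N_def del: diag_block_mat.simps)
  next
    fix x assume "x \<in> {diag_block_mat [h False, h True] | h. \<forall>k. h k \<in> GL_grp (N k)}"
    then obtain h where x: "x = diag_block_mat [h False, h True]" and h: "\<And>k. h k \<in> GL_grp (N k)" by blast
    have "h False \<in> GL_grp p" "h True \<in> GL_grp q" using h[of False] h[of True] by (simp_all add: N)
    then show "x \<in> block_prod (GL_grp p) (GL_grp q)" unfolding block_prod_def x by blast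
  qed
  have R: "(\<lambda>\<gamma> \<gamma>' :: bool \<times> bool. snd \<gamma> = snd \<gamma>' \<and> fst \<gamma> \<noteq> fst \<gamma>') = (\<lambda>\<gamma> \<gamma>'. fst \<gamma> \<noteq> fst \<gamma>' \<and> snd \<gamma> = snd \<gamma>')"
    by (intro ext) blast
  have V: "V = {X \<in> carrier_mat (p + q) (p + q). \<forall>a\<in>{a. fst a < N (snd a)}. \<forall>b\<in>{a. fst a < N (snd a)}.
      \<not> True \<longrightarrow> X $$ (block_index p (\<lambda>_ i. i) a, block_index p (\<lambda>_ i. i) b) = 0}"
    unfolding V_def by blast
  show ?thesis
    using models_gl_blocks[of d N "\<lambda>_ _. True" "\<lambda>\<gamma>. \<gamma>", OF dN TrueI] unfolding R unfolding N K V simp_thms .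
qed

section \<open>The individual real forms and the five equalities\<close>

lemma symm_sign_simps: "symm_sign Orth = 1" "symm_sign Symp = -1" "symm_sign Lin = 1"
  by (simp_all add: symm_sign_def)

lemma gtype_neq: "Orth \<noteq> Lin" "Symp \<noteq> Lin" "Symp \<noteq> Orth" "Lin \<noteq> Orth"
  by simp_all

lemma GL_minv_transpose: "{g \<in> GL_grp n. minv g = transpose_mat g} = isom_grp n (1\<^sub>m n)"
proof (intro equalityI subsetI)
  fix g assume "g \<in> {g \<in> GL_grp n. minv g = transpose_mat g}"
  then have g: "g \<in> GL_grp n" "minv g = transpose_mat g" by blast+
  have "g * 1\<^sub>m n * transpose_mat g = g * minv g" using GL_grp_carrier[OF g(1)] g(2) by simp
  then show "g \<in> isom_grp n (1\<^sub>m n)" using g(1) minv(2)[OF g(1)] by (simp add: isom_grp_def)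
next
  fix g assume g: "g \<in> isom_grp n (1\<^sub>m n)"
  note gc = isom_grpD(2)[OF g]
  have "g * transpose_mat g = 1\<^sub>m n" using isom_grpD(3)[OF g] gc by simp
  then have "minv g = transpose_mat g" using gc by (intro minv_eq[of _ n]) simp_all
  then show "g \<in> {g \<in> GL_grp n. minv g = transpose_mat g}" using isom_grpD(1)[OF g] by simp
qed

lemma J_mat_carrier: "J_mat n \<in> carrier_mat (2 * n) (2 * n)"
  by (rule frameD(2)[OF frame_J])

text \<open>The transpose of \<open>J_mat n\<close> is both its inverse and its negative.\<close>

lemma J_mat_square: "J_mat n * J_mat n = - 1\<^sub>m (2 * n)"
proof -
  note J = J_mat_carrier[of n]
  have t: "transpose_mat (J_mat n) = - J_mat n"
  proof (rule eq_matI)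
    fix i j assume "i < dim_row (- J_mat n)" "j < dim_col (- J_mat n)"
    then have ij: "i < 2 * n" "j < 2 * n" using J by auto
    then show "transpose_mat (J_mat n) $$ (i, j) = (- J_mat n) $$ (i, j)"
      using frame_symm[OF frame_J ij] J by (simp add: symm_sign_simps)
  qed (use J in simp_all)
  have "J_mat n * transpose_mat (J_mat n) = 1\<^sub>m (2 * n)"
    by (rule frame_mult_transpose[OF frame_J])
  then have "- (J_mat n * J_mat n) = 1\<^sub>m (2 * n)" unfolding t using J by simp
  then show ?thesis by (metis uminus_uminus_mat)
qed

text \<open>Both conditions amount to \<open>g * J_mat n = J_mat n * transpose_mat (minv g)\<close>:
  for one use that J squares to -1, for the other multiply by the transpose of \<open>g\<close> or
  of its inverse.\<close>

lemma GL_H_isom_grp: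
  "{g \<in> GL_grp (2 * n). g = - (J_mat n * transpose_mat (minv g) * J_mat n)} = isom_grp (2 * n) (J_mat n)"
proof -
  have "g = - (J_mat n * transpose_mat (minv g) * J_mat n) \<longleftrightarrow> g * J_mat n * transpose_mat g = J_mat n"
    if g: "g \<in> GL_grp (2 * n)" for g
  proof -
    let ?N = "2 * n" and ?J = "J_mat n"
    note gc = GL_grp_carrier[OF g] and gi = minv[OF g] and J = J_mat_carrier[of n]
    have gt: "transpose_mat g \<in> carrier_mat ?N ?N" "transpose_mat (minv g) \<in> carrier_mat ?N ?N" using gc gi(1) by simp_all
    have tt: "transpose_mat (minv g) * transpose_mat g = 1\<^sub>m ?N" "transpose_mat g * transpose_mat (minv g) = 1\<^sub>m ?N"
      unfolding transpose_mult[OF gc gi(1), symmetric] transpose_mult[OF gi(1) gc, symmetric] gi(2,3) by simp_all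
    have JJ: "A * ?J * ?J = - A" if "A \<in> carrier_mat ?N ?N" for A
      unfolding assoc_mult_mat[OF that J J] J_mat_square using that by simp
    have JT: "?J * transpose_mat (minv g) \<in> carrier_mat ?N ?N" and gJ: "g * ?J \<in> carrier_mat ?N ?N"
      by (rule mult_carrier_mat[OF J gt(2)], rule mult_carrier_mat[OF gc J])
    show ?thesis
    proof
      assume e: "g = - (?J * transpose_mat (minv g) * ?J)"
      have "g * ?J = - (?J * transpose_mat (minv g) * ?J) * ?J" using e by (rule arg_cong)
      also have "\<dots> = - (?J * transpose_mat (minv g) * ?J * ?J)"
        using mult_carrier_mat[OF JT J] J by simp
      also have "\<dots> = ?J * transpose_mat (minv g)" unfolding JJ[OF JT] using JT by simp
      finally have "g * ?J * transpose_mat g = ?J * (transpose_mat (minv g) * transpose_mat g)"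
        using assoc_mult_mat[OF J gt(2,1)] by simp
      then show "g * ?J * transpose_mat g = ?J" unfolding tt using J by simp
    next
      assume e: "g * ?J * transpose_mat g = ?J"
      have "?J * transpose_mat (minv g) = g * ?J * transpose_mat g * transpose_mat (minv g)" unfolding e ..
      also have "\<dots> = g * ?J" unfolding assoc_mult_mat[OF gJ gt] tt by (rule right_mult_one_mat[OF gJ])
      finally have "?J * transpose_mat (minv g) * ?J = - g" using JJ[OF gc] by simp
      then show "g = - (?J * transpose_mat (minv g) * ?J)" using gc by simp
    qed
  qed
  then show ?thesis unfolding isom_grp_def by blast
qed

lemma Lie_alg_isom_grp: "F \<in> GL_grp N \<Longrightarrow> Lie_alg N (isom_grp N F) = isom_alg N F"
  by (rule Lie_alg_isom) auto

lemma Lie_alg_isom_block_prod: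
  assumes "F \<in> GL_grp M"
  shows "Lie_alg (M + M) (block_prod (isom_grp M F) (isom_grp M F)) =
    {diag_block_mat [X, Y] | X Y. X \<in> isom_alg M F \<and> Y \<in> isom_alg M F}"
  unfolding Lie_alg_isom_grp[OF assms, symmetric] by (rule Lie_alg_block_prod) (auto dest: isom_grpD(2))

text \<open>For GL(n,R) the first matching joins different colours and the second any; for Sp(m,R)
  it is the reverse. All signs are 1, because \<open>X * B\<close> is symmetric for a symplectic
  form.\<close>

lemma GL_R_eq_Sp_R:
  assumes d: "d \<le> n" "d \<le> m"
  shows "h_GL_R d n = h_Sp_R d m"
proof -
  note 1 = models_gl_isom[OF frame_one gtype_neq(1) d(1)] and 2 = models_Levi[OF frame_J gtype_neq(3) d(2)]
  show ?thesis
    unfolding h_GL_R_def h_Sp_R_def inv_dim_def Lie_alg_GL GL_minv_transpose Sp_grp_def Lie_alg_isom_grp[OF frame_GL[OF frame_J]]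
    by (rule quot_dim_eq_by_swap[OF 1[unfolded symm_sign_simps] 2[unfolded symm_sign_simps minus_minus]])
qed

text \<open>As for the previous pair, but the matching without colour condition has sign -1: from
  the symplectic form of K on one side, from skewness of \<open>X * B\<close> for the symmetric form
  on the other.\<close>

lemma GL_H_eq_SO_star:
  assumes d: "d \<le> n" "d \<le> m"
  shows "h_GL_H d n = h_SO_star d m"
proof -
  note 1 = models_gl_isom[OF frame_J gtype_neq(2) d(1)] and 2 = models_Levi[OF frame_D gtype_neq(4) d(2)]
  have "Lie_alg (2 * m) (SO_D_grp m) = isom_alg (2 * m) (D_mat m)"
    unfolding SO_D_grp_def by (rule Lie_alg_isom[OF frame_GL[OF frame_D]]) auto
  then show ?thesis
    unfolding h_GL_H_def h_SO_star_def inv_dim_def Lie_alg_GL GL_H_isom_grp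
    using quot_dim_eq_by_swap[OF 1[unfolded symm_sign_simps] 2[unfolded symm_sign_simps]] by simp
qed

lemma models_O_pq:
  assumes "d \<le> p" "d \<le> q"
  shows "models (sym_inv d (Lie_alg (p + q) (O_grp (p + q))) (block_prod (O_grp p) (O_grp q)))
    (sym_rel d (Lie_alg (p + q) (O_grp (p + q)))) (match_space d (\<lambda>_ _ :: bool. True) (-1) (\<lambda>\<gamma> \<gamma>'. \<gamma> = \<gamma>') 1)"
proof -
  define N where "N \<gamma> = (if \<gamma> then q else p)" for \<gamma>
  have N: "N False = p" "N True = q" by (simp_all add: N_def)
  have fr: "frame Orth (N \<gamma>) (N \<gamma>) (1\<^sub>m (N \<gamma>)) fst" for \<gamma> by (rule frame_one)
  have "d \<le> N \<gamma>" for \<gamma> using assms by (simp add: N_def)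
  from models_isom_prod[of Orth N N "\<lambda>\<gamma>. 1\<^sub>m (N \<gamma>)" "\<lambda>_. fst", OF fr gtype_neq(1) this] show ?thesis
    unfolding O_grp_def Lie_alg_isom_grp[OF frame_GL[OF frame_one]] N diag_pair_one symm_sign_simps .
qed

lemma models_Sp_pq:
  assumes "d \<le> p" "d \<le> q"
  shows "models (sym_inv d (Lie_alg (2 * (p + q)) (Sp_C_grp (p + q))) (block_prod (Sp_C_grp p) (Sp_C_grp q)))
    (sym_rel d (Lie_alg (2 * (p + q)) (Sp_C_grp (p + q)))) (match_space d (\<lambda>_ _ :: bool. True) 1 (\<lambda>\<gamma> \<gamma>'. \<gamma> = \<gamma>') (-1))"
proof -
  define N where "N \<gamma> = (if \<gamma> then q else p)" for \<gamma>
  have N: "N False = p" "N True = q" by (simp_all add: N_def)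
  have fr: "frame Symp (N \<gamma>) (2 * N \<gamma>) (C_mat (N \<gamma>)) pair_index" for \<gamma> by (rule frame_C)
  have "d \<le> N \<gamma>" for \<gamma> using assms by (simp add: N_def)
  from models_isom_prod[of Symp N "\<lambda>\<gamma>. 2 * N \<gamma>" "\<lambda>\<gamma>. C_mat (N \<gamma>)" "\<lambda>_. pair_index", OF fr gtype_neq(2) this] show ?thesis
    unfolding Sp_C_grp_def Lie_alg_isom_grp[OF frame_GL[OF frame_C]] N C_mat_add[symmetric] distrib_left[symmetric]
      symm_sign_simps minus_minus .
qed

text \<open>The matching between equal colours has sign -1, from the skew Lie algebra of O(n,C) and
  from the symplectic form of K in Sp(p,q); the unrestricted one has sign 1.\<close>

lemma O_C_eq_Sp_pq:
  assumes d: "d \<le> n" "d \<le> p" "d \<le> q"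
  shows "h_O_C d n = h_Sp_pq d p q"
proof -
  note 1 = models_isom_diag[OF frame_one gtype_neq(1) d(1)] and 2 = models_Sp_pq[OF d(2,3)]
  show ?thesis
    unfolding h_O_C_def h_Sp_pq_def inv_dim_def O_grp_def mult_2 Lie_alg_isom_block_prod[OF frame_GL[OF frame_one]]
    by (rule quot_dim_eq_by_swap[OF 1[unfolded symm_sign_simps] 2[unfolded mult_2]])
qed

text \<open>The same colour conditions as in the preceding case with the two signs
  interchanged.\<close>

lemma Sp_C_eq_O_pq:
  assumes d: "d \<le> m" "d \<le> p" "d \<le> q"
  shows "h_Sp_C d m = h_O_pq d p q"
proof -
  note 1 = models_isom_diag[OF frame_J gtype_neq(2) d(1)] and 2 = models_O_pq[OF d(2,3)]
  have four: "4 * m = 2 * m + 2 * m" by simp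
  show ?thesis
    unfolding h_Sp_C_def h_O_pq_def inv_dim_def Sp_grp_def four Lie_alg_isom_block_prod[OF frame_GL[OF frame_J]]
    by (rule quot_dim_eq_by_swap[OF 1[unfolded symm_sign_simps minus_minus] 2])
qed

text \<open>All signs are 1. Both matchings join row colours to column colours, and one of them also
  requires equal blocks: the first for GL(n,C), the second for U(p,q).\<close>

lemma GL_C_eq_U:
  assumes d: "d \<le> n" "d \<le> p" "d \<le> q"
  shows "h_GL_C d n = h_U d p q"
proof -
  have "Lie_alg (n + n) (block_prod (GL_grp n) (GL_grp n)) =
      {diag_block_mat [X, Y] | X Y. X \<in> carrier_mat n n \<and> Y \<in> carrier_mat n n}"
    unfolding Lie_alg_GL[symmetric] by (rule Lie_alg_block_prod) (auto dest: GL_grp_carrier)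
  then show ?thesis
    unfolding h_GL_C_def h_U_def inv_dim_def mult_2 Lie_alg_GL
    using quot_dim_eq_by_swap[OF models_GL_C[OF d(1)] models_U[OF d(2,3)]] by (simp only:)
qed

theorem mainTheorem2:
  fixes d n m p q :: nat
  assumes "n > 0" and "m > 0" and "p > 0" and "q > 0"
  shows "(d \<le> min n m \<longrightarrow> h_GL_R d n = h_Sp_R d m) \<and>
    (d \<le> min n m \<longrightarrow> h_GL_H d n = h_SO_star d m) \<and>
    (real d \<le> min (real n / 2) (min (real p) (real q)) \<longrightarrow> h_O_C d n = h_Sp_pq d p q) \<and>
    (real d \<le> min (real m) (min (real p / 2) (real q / 2)) \<longrightarrow> h_Sp_C d m = h_O_pq d p q) \<and>
    (d \<le> min n (min p q) \<longrightarrow> h_GL_C d n = h_U d p q)"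
proof (intro conjI impI)
  assume "d \<le> min n m"
  then have d: "d \<le> n" "d \<le> m" by simp_all
  show "h_GL_R d n = h_Sp_R d m" by (rule GL_R_eq_Sp_R[OF d])
  show "h_GL_H d n = h_SO_star d m" by (rule GL_H_eq_SO_star[OF d])
next
  assume "real d \<le> min (real n / 2) (min (real p) (real q))"
  then show "h_O_C d n = h_Sp_pq d p q" by (intro O_C_eq_Sp_pq) (simp_all add: min_def split: if_splits)
next
  assume "real d \<le> min (real m) (min (real p / 2) (real q / 2))"
  then show "h_Sp_C d m = h_O_pq d p q" by (intro Sp_C_eq_O_pq) (simp_all add: min_def split: if_splits)
next
  assume "d \<le> min n (min p q)"
  then show "h_GL_C d n = h_U d p q" by (intro GL_C_eq_U) simp_all
qed

end
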